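(* Let $L|K$ be a finite field extension, $\omega$ a valuation on $L$ and $\nu$ its restriction to $K$. Let $D$ be the integral closure of $\mathcal{O}_\nu$ in $L$. Assume that we are in one of the following cases: (i) $\omega$ is the only extension of $\nu$ to $L$; (ii) $L|K$ is a normal extension. Then $D$ is a finite $\mathcal{O}_\nu$-module if and only if $d(\omega|\nu)=1$ and $\epsilon(\omega|\nu)=e(\omega|\nu)$.
   Context: For a finite field extension $L|K$ and a valuation $\omega$ on $L$ with restriction $\nu$ to $K$: $\mathcal{O}_\omega,\mathcal{O}_\nu$ are the valuation rings, $\Gamma_\omega\supseteq\Gamma_\nu$ the value groups (totally ordered abelian groups), $L\omega\supseteq K\nu$ the residue fields. Put $e(\omega|\nu)=(\Gamma_\omega:\Gamma_\nu)$ and $f(\omega|\nu)=[L\omega:K\nu]$. Initial index: for an extension $\Delta\subseteq\Gamma$ of ordered abelian groups, $\epsilon(\Gamma\mid\Delta)=|\{\gamma\in\Gamma\mid \gamma\ge 0 \text{ and } \gamma<\delta\text{ for all }\delta\in\Delta\text{ with }\delta>0\}|$; and $\epsilon(\omega|\nu)=\epsilon(\Gamma_\omega\mid\Gamma_\nu)$. Defect: fix an extension $\overline\nu$ of $\omega$ to an algebraic closure $\overline K$ of $L$. The henselization $K^h$ of $(K,\nu)$ is the smallest field with $K\subseteq K^h\subseteq\overline K$ such that $\overline\nu$ is the only extension of $\overline\nu|_{K^h}$ to $\overline K$; $L^h$ is defined likewise for $(L,\omega)$. The defect is $d(\omega|\nu)=\dfrac{[L^h:K^h]}{e(\omega|\nu)f(\omega|\nu)}$,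 a positive integer. *)

theory Defs
  imports "HOL-Algebra.Algebra"
begin

section \<open>Ordered abelian groups and valuations\<close>

text \<open>
  Value groups are written multiplicatively, because they are groups in the sense of HOL-Algebra,
  but the order keeps the direction of the additive notation: the group unit plays the role
  of 0, and elements of the valuation ring have values above the unit.
\<close>

record 'g ordered_group = "'g monoid" +
  gle :: "'g \<Rightarrow> 'g \<Rightarrow> bool" (infixl \<open>\<preceq>\<index>\<close> 50)

definition gless :: "('g, 'm) ordered_group_scheme \<Rightarrow> 'g \<Rightarrow> 'g \<Rightarrow> bool" (infixl \<open>\<prec>\<index>\<close> 50)
  where "a \<prec>\<^bsub>G\<^esub> b \<longleftrightarrow> a \<preceq>\<^bsub>G\<^esub> b \<and> a \<noteq> b"

locale ordered_comm_group = comm_group G for G :: "('g, 'm) ordered_group_scheme" (structure) +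
  assumes gle_refl: "a \<in> carrier G \<Longrightarrow> a \<preceq> a"
    and gle_antisym: "\<lbrakk> a \<in> carrier G; b \<in> carrier G; a \<preceq> b; b \<preceq> a \<rbrakk> \<Longrightarrow> a = b"
    and gle_trans:
      "\<lbrakk> a \<in> carrier G; b \<in> carrier G; c \<in> carrier G; a \<preceq> b; b \<preceq> c \<rbrakk> \<Longrightarrow> a \<preceq> c"
    and gle_total: "\<lbrakk> a \<in> carrier G; b \<in> carrier G \<rbrakk> \<Longrightarrow> a \<preceq> b \<or> b \<preceq> a"
    and gle_mult:
      "\<lbrakk> a \<in> carrier G; b \<in> carrier G; c \<in> carrier G; a \<preceq> b \<rbrakk> \<Longrightarrow> a \<otimes> c \<preceq> b \<otimes> c"

text \<open>
  The value of zero (infinity) is left out: only \<open>v x\<close> for nonzero \<open>x\<close> is meaningful.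
  By surjectivity, \<open>G\<close> is the value group of \<open>v\<close>. The last assumption is
  \<open>v (x + y) \<ge> min (v x) (v y)\<close>.
\<close>

locale valuation = F: field F + G: ordered_comm_group G
  for F :: "('a, 'b) ring_scheme" and G :: "('g, 'm) ordered_group_scheme" and v :: "'a \<Rightarrow> 'g" +
  assumes v_surj: "v ` (carrier F - {\<zero>\<^bsub>F\<^esub>}) = carrier G"
    and v_mult:
      "\<lbrakk> x \<in> carrier F - {\<zero>\<^bsub>F\<^esub>}; y \<in> carrier F - {\<zero>\<^bsub>F\<^esub>} \<rbrakk> \<Longrightarrow> v (x \<otimes>\<^bsub>F\<^esub> y) = v x \<otimes>\<^bsub>G\<^esub> v y"
    and v_add:
      "\<lbrakk> x \<in> carrier F - {\<zero>\<^bsub>F\<^esub>}; y \<in> carrier F - {\<zero>\<^bsub>F\<^esub>}; x \<oplus>\<^bsub>F\<^esub> y \<noteq> \<zero>\<^bsub>F\<^esub> \<rbrakk>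
        \<Longrightarrow> v x \<preceq>\<^bsub>G\<^esub> v (x \<oplus>\<^bsub>F\<^esub> y) \<or> v y \<preceq>\<^bsub>G\<^esub> v (x \<oplus>\<^bsub>F\<^esub> y)"

definition valuation_ring ::
    "('a, 'b) ring_scheme \<Rightarrow> ('g, 'm) ordered_group_scheme \<Rightarrow> ('a \<Rightarrow> 'g) \<Rightarrow> 'a set"
  where "valuation_ring F G v = {x \<in> carrier F. x = \<zero>\<^bsub>F\<^esub> \<or> \<one>\<^bsub>G\<^esub> \<preceq>\<^bsub>G\<^esub> v x}"

definition valuation_ideal ::
    "('a, 'b) ring_scheme \<Rightarrow> ('g, 'm) ordered_group_scheme \<Rightarrow> ('a \<Rightarrow> 'g) \<Rightarrow> 'a set"
  where "valuation_ideal F G v = {x \<in> carrier F. x = \<zero>\<^bsub>F\<^esub> \<or> \<one>\<^bsub>G\<^esub> \<prec>\<^bsub>G\<^esub> v x}"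

definition residue_field ::
    "('a, 'b) ring_scheme \<Rightarrow> ('g, 'm) ordered_group_scheme \<Rightarrow> ('a \<Rightarrow> 'g) \<Rightarrow> 'a set ring"
  where "residue_field F G v = (F\<lparr>carrier := valuation_ring F G v\<rparr>) Quot (valuation_ideal F G v)"


section \<open>Restriction and extension of valuations\<close>

text \<open>
  Throughout, \<open>K\<close> and \<open>L\<close> are subfields (sets) of an ambient field \<open>C\<close>; the field \<open>L\<close> itself is
  \<open>C\<lparr>carrier := L\<rparr>\<close>. The restriction to \<open>K\<close> of a valuation \<open>v\<close> is the same function \<open>v\<close>,
  with the smaller value group \<open>value_subgroup F G v K\<close>.
\<close>

definition value_subgroup ::
    "('a, 'b) ring_scheme \<Rightarrow> ('g, 'm) ordered_group_scheme \<Rightarrow> ('a \<Rightarrow> 'g) \<Rightarrow> 'a set \<Rightarrow> 'g set"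
  where "value_subgroup F G v K = v ` (K - {\<zero>\<^bsub>F\<^esub>})"

abbreviation restricted_ring ::
    "('a, 'b) ring_scheme \<Rightarrow> ('g, 'm) ordered_group_scheme \<Rightarrow> ('a \<Rightarrow> 'g) \<Rightarrow> 'a set \<Rightarrow> 'a set"
  where "restricted_ring F G v K \<equiv>
    valuation_ring (F\<lparr>carrier := K\<rparr>) (G\<lparr>carrier := value_subgroup F G v K\<rparr>) v"

text \<open>
  Valuations are considered up to equivalence, i.e. up to having the same valuation ring, so
  that \<open>v'\<close> extends \<open>v\<close> if the valuation ring of \<open>v'\<close> intersects the smaller field in that
  of \<open>v\<close>.
\<close>

definition extends_valuation ::
    "('a, 'b) ring_scheme \<Rightarrow> ('h, 'n) ordered_group_scheme \<Rightarrow> ('a \<Rightarrow> 'h) \<Rightarrow>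
     ('a, 'c) ring_scheme \<Rightarrow> ('g, 'm) ordered_group_scheme \<Rightarrow> ('a \<Rightarrow> 'g) \<Rightarrow> bool"
  where "extends_valuation F' G' v' F G v \<longleftrightarrow>
    valuation F' G' v' \<and> valuation_ring F' G' v' \<inter> carrier F = valuation_ring F G v"

text \<open>
  \<open>v\<close> is the only extension, up to equivalence, of its restriction to \<open>K\<close>. A bound variable
  needs a fixed type of values; \<open>'a set\<close> is large enough, as shown by the lemma
  \<open>equivalent_valuation_on_sets\<close> below.
\<close>

definition only_extension ::
    "('a, 'b) ring_scheme \<Rightarrow> 'a set \<Rightarrow> ('g, 'm) ordered_group_scheme \<Rightarrow> ('a \<Rightarrow> 'g) \<Rightarrow> bool"
  where "only_extension F K G v \<longleftrightarrow>
    (\<forall>(G' :: 'a set ordered_group) v'.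
       extends_valuation F G' v' (F\<lparr>carrier := K\<rparr>) (G\<lparr>carrier := value_subgroup F G v K\<rparr>) v
       \<longrightarrow> valuation_ring F G' v' = valuation_ring F G v)"

lemma (in valuation) equivalent_valuation_on_sets:
  "\<exists>(G' :: 'a set ordered_group) v'.
     valuation F G' v' \<and> valuation_ring F G' v' = valuation_ring F G v"
proof -
  let ?U = "carrier F - {\<zero>\<^bsub>F\<^esub>}"
  define \<phi> where "\<phi> g = {x \<in> ?U. v x = g}" for g
  define \<psi> where "\<psi> = inv_into (carrier G) \<phi>"
  define G' :: "'a set ordered_group" where
    "G' = \<lparr>carrier = \<phi> ` carrier G, monoid.mult = (\<lambda>A B. \<phi> (\<psi> A \<otimes>\<^bsub>G\<^esub> \<psi> B)), one = \<phi> \<one>\<^bsub>G\<^esub>,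
           gle = (\<lambda>A B. \<psi> A \<preceq>\<^bsub>G\<^esub> \<psi> B)\<rparr>"
  have "inj_on \<phi> (carrier G)"
  proof (rule inj_onI)
    fix g h assume g: "g \<in> carrier G" and "h \<in> carrier G" and eq: "\<phi> g = \<phi> h"
    from g have "g \<in> v ` ?U" by (simp only: v_surj)
    then obtain x where "x \<in> ?U" "v x = g" by blast
    then have "x \<in> \<phi> g" by (simp add: \<phi>_def)
    then have "x \<in> \<phi> h" by (simp only: eq)
    then show "g = h" using \<open>v x = g\<close> by (simp add: \<phi>_def)
  qed
  then have \<psi>\<phi>: "\<psi> (\<phi> g) = g" if "g \<in> carrier G" for g
    using that by (simp add: \<psi>_def)
  have v_closed: "v x \<in> carrier G" if "x \<in> carrier F" "x \<noteq> \<zero>\<^bsub>F\<^esub>" for x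
    using that imageI[of x ?U v] by (simp add: v_surj)
  have carrier': "carrier G' = \<phi> ` carrier G"
    and one': "\<one>\<^bsub>G'\<^esub> = \<phi> \<one>\<^bsub>G\<^esub>"
    by (simp_all add: G'_def)
  have mult': "\<phi> g \<otimes>\<^bsub>G'\<^esub> \<phi> h = \<phi> (g \<otimes>\<^bsub>G\<^esub> h)"
    and gle': "(\<phi> g \<preceq>\<^bsub>G'\<^esub> \<phi> h) = (g \<preceq>\<^bsub>G\<^esub> h)"
    if "g \<in> carrier G" "h \<in> carrier G" for g h
    using that by (simp_all add: G'_def \<psi>\<phi>)
  have "comm_group G'"
  proof (rule comm_groupI)
    fix A assume "A \<in> carrier G'"
    then obtain g where g: "g \<in> carrier G" "A = \<phi> g" by (auto simp: carrier')
    then show "\<exists>B\<in>carrier G'. B \<otimes>\<^bsub>G'\<^esub> A = \<one>\<^bsub>G'\<^esub>"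
      by (intro bexI[of _ "\<phi> (inv\<^bsub>G\<^esub> g)"]) (simp_all add: mult' one' carrier')
    show "\<one>\<^bsub>G'\<^esub> \<otimes>\<^bsub>G'\<^esub> A = A"
      using g by (simp add: mult' one')
    fix B assume "B \<in> carrier G'"
    then obtain h where h: "h \<in> carrier G" "B = \<phi> h" by (auto simp: carrier')
    show "A \<otimes>\<^bsub>G'\<^esub> B \<in> carrier G'"
      using g h by (simp add: mult' carrier')
    show "A \<otimes>\<^bsub>G'\<^esub> B = B \<otimes>\<^bsub>G'\<^esub> A"
      using g h by (simp add: mult' G.m_comm)
    fix C assume "C \<in> carrier G'"
    then obtain k where k: "k \<in> carrier G" "C = \<phi> k" by (auto simp: carrier')
    show "A \<otimes>\<^bsub>G'\<^esub> B \<otimes>\<^bsub>G'\<^esub> C = A \<otimes>\<^bsub>G'\<^esub> (B \<otimes>\<^bsub>G'\<^esub> C)"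
      using g h k by (simp add: mult' G.m_assoc)
  next
    show "\<one>\<^bsub>G'\<^esub> \<in> carrier G'"
      by (simp add: one' carrier')
  qed
  moreover have "ordered_comm_group_axioms G'"
  proof
    fix A assume "A \<in> carrier G'"
    then obtain g where g: "g \<in> carrier G" "A = \<phi> g" by (auto simp: carrier')
    show "A \<preceq>\<^bsub>G'\<^esub> A"
      using g by (simp add: gle' G.gle_refl)
    fix B assume "B \<in> carrier G'"
    then obtain h where h: "h \<in> carrier G" "B = \<phi> h" by (auto simp: carrier')
    show "A \<preceq>\<^bsub>G'\<^esub> B \<or> B \<preceq>\<^bsub>G'\<^esub> A"
      using g h G.gle_total by (simp add: gle')
    show "A = B" if "A \<preceq>\<^bsub>G'\<^esub> B" "B \<preceq>\<^bsub>G'\<^esub> A"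
      using g h that G.gle_antisym[of g h] by (simp add: gle')
    fix C assume "C \<in> carrier G'"
    then obtain k where k: "k \<in> carrier G" "C = \<phi> k" by (auto simp: carrier')
    show "A \<preceq>\<^bsub>G'\<^esub> C" if "A \<preceq>\<^bsub>G'\<^esub> B" "B \<preceq>\<^bsub>G'\<^esub> C"
      using g h k that G.gle_trans[of g h k] by (simp add: gle')
    show "A \<otimes>\<^bsub>G'\<^esub> C \<preceq>\<^bsub>G'\<^esub> B \<otimes>\<^bsub>G'\<^esub> C" if "A \<preceq>\<^bsub>G'\<^esub> B"
      using g h k that G.gle_mult[of g h k] by (simp add: gle' mult')
  qed
  ultimately have ordered: "ordered_comm_group G'"
    by (simp add: ordered_comm_group_def)
  have "valuation_axioms F G' (\<phi> \<circ> v)"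
  proof
    show "(\<phi> \<circ> v) ` ?U = carrier G'"
      by (simp only: image_comp[symmetric] v_surj carrier')
  next
    fix x y assume xy: "x \<in> ?U" "y \<in> ?U"
    show "(\<phi> \<circ> v) (x \<otimes>\<^bsub>F\<^esub> y) = (\<phi> \<circ> v) x \<otimes>\<^bsub>G'\<^esub> (\<phi> \<circ> v) y"
      using xy by (simp add: v_mult mult' v_closed)
    assume "x \<oplus>\<^bsub>F\<^esub> y \<noteq> \<zero>\<^bsub>F\<^esub>"
    then show "(\<phi> \<circ> v) x \<preceq>\<^bsub>G'\<^esub> (\<phi> \<circ> v) (x \<oplus>\<^bsub>F\<^esub> y)
      \<or> (\<phi> \<circ> v) y \<preceq>\<^bsub>G'\<^esub> (\<phi> \<circ> v) (x \<oplus>\<^bsub>F\<^esub> y)"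
      using xy v_add[of x y] by (simp add: gle' v_closed)
  qed
  then have "valuation F G' (\<phi> \<circ> v)"
    by (simp add: valuation_def F.field_axioms ordered)
  moreover have "\<one>\<^bsub>G'\<^esub> \<preceq>\<^bsub>G'\<^esub> (\<phi> \<circ> v) x \<longleftrightarrow> \<one>\<^bsub>G\<^esub> \<preceq>\<^bsub>G\<^esub> v x" if "x \<in> carrier F" "x \<noteq> \<zero>\<^bsub>F\<^esub>" for x
    using that by (simp add: gle' one' v_closed)
  then have "valuation_ring F G' (\<phi> \<circ> v) = valuation_ring F G v"
    unfolding valuation_ring_def by blast
  ultimately show ?thesis by blast
qed


section \<open>Ramification index, residue degree, initial index, defect\<close>

definition ramification_index ::
    "('a, 'b) ring_scheme \<Rightarrow> ('g, 'm) ordered_group_scheme \<Rightarrow> ('a \<Rightarrow> 'g) \<Rightarrow> 'a set \<Rightarrow> nat"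
  where "ramification_index F G v K = card (rcosets\<^bsub>G\<^esub> (value_subgroup F G v K))"

text \<open>The residue field of \<open>K\<close> is identified with its image in the residue field of \<open>F\<close>.\<close>

definition residue_subfield ::
    "('a, 'b) ring_scheme \<Rightarrow> ('g, 'm) ordered_group_scheme \<Rightarrow> ('a \<Rightarrow> 'g) \<Rightarrow> 'a set \<Rightarrow> 'a set set"
  where "residue_subfield F G v K =
    (\<lambda>x. valuation_ideal F G v +>\<^bsub>F\<lparr>carrier := valuation_ring F G v\<rparr>\<^esub> x) ` restricted_ring F G v K"

definition residue_degree ::
    "('a, 'b) ring_scheme \<Rightarrow> ('g, 'm) ordered_group_scheme \<Rightarrow> ('a \<Rightarrow> 'g) \<Rightarrow> 'a set \<Rightarrow> nat"
  where "residue_degree F G v K =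
    ring.dim (residue_field F G v) (residue_subfield F G v K) (carrier (residue_field F G v))"

definition initial_index :: "('g, 'm) ordered_group_scheme \<Rightarrow> 'g set \<Rightarrow> nat"
  where "initial_index G \<Delta> =
    card {\<gamma> \<in> carrier G. \<one>\<^bsub>G\<^esub> \<preceq>\<^bsub>G\<^esub> \<gamma> \<and> (\<forall>\<delta>\<in>\<Delta>. \<one>\<^bsub>G\<^esub> \<prec>\<^bsub>G\<^esub> \<delta> \<longrightarrow> \<gamma> \<prec>\<^bsub>G\<^esub> \<delta>)}"

text \<open>\<open>C\<close> is an algebraic closure with valuation \<open>V\<close>; \<open>LEAST\<close> is with respect to inclusion.\<close>

definition henselization ::
    "('a, 'b) ring_scheme \<Rightarrow> ('h, 'n) ordered_group_scheme \<Rightarrow> ('a \<Rightarrow> 'h) \<Rightarrow> 'a set \<Rightarrow> 'a set"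
  where "henselization C H V K = (LEAST E. subfield E C \<and> K \<subseteq> E \<and> only_extension C E H V)"

definition defect ::
    "('a, 'b) ring_scheme \<Rightarrow> ('h, 'n) ordered_group_scheme \<Rightarrow> ('a \<Rightarrow> 'h) \<Rightarrow>
     'a set \<Rightarrow> ('g, 'm) ordered_group_scheme \<Rightarrow> ('a \<Rightarrow> 'g) \<Rightarrow> 'a set \<Rightarrow> rat"
  where "defect C H V L G v K =
    of_nat (ring.dim C (henselization C H V K) (henselization C H V L)) /
    of_nat (ramification_index (C\<lparr>carrier := L\<rparr>) G v K * residue_degree (C\<lparr>carrier := L\<rparr>) G v K)"


section \<open>Integral closure, finite modules, normal extensions\<close>

definition integral_closure :: "('a, 'b) ring_scheme \<Rightarrow> 'a set \<Rightarrow> 'a set \<Rightarrow> 'a set"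
  where "integral_closure C A L =
    {x \<in> L. \<exists>p. polynomial\<^bsub>C\<^esub> A p \<and> p \<noteq> [] \<and> lead_coeff p = \<one>\<^bsub>C\<^esub> \<and> ring.eval C p x = \<zero>\<^bsub>C\<^esub>}"

definition finite_submodule :: "('a, 'b) ring_scheme \<Rightarrow> 'a set \<Rightarrow> 'a set \<Rightarrow> bool"
  where "finite_submodule C A D \<longleftrightarrow> (\<exists>us. set us \<subseteq> D \<and> D = ring.Span C A us)"

text \<open>
  For an algebraic extension \<open>L\<close> of \<open>K\<close> inside \<open>C\<close>. Splitting over \<open>L\<close> must count roots with
  multiplicity, which \<^const>\<open>ring.splitted\<close> over the field \<open>L\<close> does and \<open>splitted_on\<close> does not.
\<close>

definition normal_extension :: "('a, 'b) ring_scheme \<Rightarrow> 'a set \<Rightarrow> 'a set \<Rightarrow> bool"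
  where "normal_extension C K L \<longleftrightarrow>
    (\<forall>p \<in> carrier (univ_poly C K). pirreducible\<^bsub>C\<^esub> K p \<and> (\<exists>x\<in>L. ring.eval C p x = \<zero>\<^bsub>C\<^esub>)
       \<longrightarrow> ring.splitted (C\<lparr>carrier := L\<rparr>) p)"

end

theory Submission
 imports Defs
begin

text \<open>
 Let \<open>g\<close> be the number of extensions of \<open>\<nu>\<close> to \<open>L\<close>, and let \<open>e\<close>, \<open>f\<close>, \<open>\<epsilon>\<close> be the three indices. In both
 cases the extensions are conjugate under automorphisms that map \<open>L\<close> to itself, and a Galois argument
 gives \<open>[L : K] = g [L\<^sup>h : K\<^sup>h]\<close>. Products of an element separating the extensions with elements
 of inequivalent values and with lifts of a residue basis, moved around by the automorphisms, form
 \<open>g e f\<close> independent elements, so \<open>g e f \<le> [L : K]\<close>. If only the \<open>\<epsilon>\<close> values below all positive values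
 of \<open>K\<close> are used, the \<open>g \<epsilon> f\<close> elements are integral and remain independent modulo the maximal ideal of
 the valuation ring of \<open>K\<close>; they form a basis of \<open>D\<close> as soon as \<open>g \<epsilon> f = [L : K]\<close>. Conversely, such
 elements generate every extension of the valuation ring modulo that maximal ideal, so a finite \<open>D\<close>,
 which is free of rank \<open>[L : K]\<close>, forces \<open>[L : K] \<le> g \<epsilon> f\<close>. As \<open>\<epsilon> \<le> e\<close>, this means \<open>\<epsilon> = e\<close> and
 \<open>[L\<^sup>h : K\<^sup>h] = e f\<close>.
\<close>

section \<open>Polynomials as coefficient lists\<close>

text \<open>The extension may be inseparable, so being fixed by automorphisms over a field
  \<open>E\<close> does not put an element into \<open>E\<close>; it only puts a power
  \<open>x [^] N\<close> there, with an exponent for which powering is additive. Such powering is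
  injective, so nothing is lost about automorphisms or about units and nonunits. The separability of
  the henselization enters in one place: families whose vectors of conjugates are independent over
  \<open>K\<close> remain so over the henselization, which bounds [L : K] from above even for
  inseparable L|K. No topology on the automorphism group is used. Extensions of a valuation are
  shown to be conjugate on finite sets only, and the decomposition field is defined so that each of
  its elements depends on finitely many tests. All elements with prescribed behaviour at several
  places come from one source, the inverse of 1 + y + ... + y^k. For suitable \<open>k\<close> it is
  a unit at every place where \<open>y\<close> is integral and lies in the maximal ideal at every
  other place; one \<open>k\<close> can serve finitely many pairs of a place and an element.\<close>

lemma set_map2_subset:
 assumes "\<And>a b. a \<in> A \<Longrightarrow> b \<in> B \<Longrightarrow> f a b \<in> D" "set p \<subseteq> A" "set q \<subseteq> B"
 shows "set (map2 f p q) \<subseteq> D"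
proof
 fix x assume "x \<in> set (map2 f p q)"
 then obtain a b where ab: "(a, b) \<in> set (zip p q)" "x = f a b" by auto
 thus "x \<in> D" using assms set_zip_leftD[OF ab(1)] set_zip_rightD[OF ab(1)] by blast
qed

abbreviation (in ring) (input) C where "C \<equiv> carrier R"

context cring
begin

lemma eval_Cons: "eval (a # p) x = a \<otimes> x [^] length p \<oplus> eval p x"
 by simp

lemma eval_map2_add:
 assumes "length p = length q" "set p \<subseteq> C" "set q \<subseteq> C" "x \<in> C"
 shows "eval (map2 (\<oplus>) p q) x = eval p x \<oplus> eval q x"
 using assms(1-3)
proof (induction p q rule: list_induct2)
 case (Cons a p b q)
 thus ?case
  using assms(4) eval_in_carrier[of p x] eval_in_carrier[of q x]
  by (simp add: l_distr a_ac)
qed simp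

lemma eval_map_scale:
 assumes "a \<in> C" "set p \<subseteq> C" "x \<in> C"
 shows "eval (map (\<lambda>c. a \<otimes> c) p) x = a \<otimes> eval p x"
 using assms(2)
proof (induction p)
 case (Cons b p)
 thus ?case
  using assms(1,3) eval_in_carrier[of p x] by (simp add: r_distr m_assoc)
qed (simp add: assms)

lemma eval_map2_diff:
 assumes "length p = length q" "set p \<subseteq> C" "set q \<subseteq> C" "x \<in> C" "a \<in> C"
 shows "eval (map2 (\<lambda>b c. b \<ominus> a \<otimes> c) p q) x = eval p x \<ominus> a \<otimes> eval q x"
 using assms(1-3)
proof (induction p q rule: list_induct2)
 case (Cons b p c q)
 define e1 e2 y where "e1 = eval p x" and "e2 = eval q x" and "y = x [^] length q"
 have c: "e1 \<in> C" "e2 \<in> C" "y \<in> C" "b \<in> C" "c \<in> C"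
  using Cons.prems assms(4) eval_in_carrier by (auto simp: e1_def e2_def y_def)
 have "eval (map2 (\<lambda>b c. b \<ominus> a \<otimes> c) (b # p) (c # q)) x
   = (b \<ominus> a \<otimes> c) \<otimes> y \<oplus> (e1 \<ominus> a \<otimes> e2)"
  using Cons by (simp add: e1_def e2_def y_def)
 also have "\<dots> = (b \<otimes> y \<oplus> e1) \<ominus> a \<otimes> (c \<otimes> y \<oplus> e2)"
  using c assms(5) by algebra
 finally show ?case using Cons.hyps by (simp add: e1_def e2_def y_def)
qed (simp add: assms minus_eq)

lemma eval_zeros: "set p \<subseteq> {\<zero>} \<Longrightarrow> x \<in> C \<Longrightarrow> eval p x = \<zero>"
 by (induction p) auto

text \<open>The quotient is dropped: at an element killed by the monic \<open>p\<close> only the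
  remainder matters, and its values at the roots of \<open>p\<close> are all that is needed. Zero
  divisors are permitted because the lemma is also applied in the product ring
  \<open>RDirProd R R\<close>.\<close>

lemma monic_division:
 assumes T: "subring T R" and p: "set p \<subseteq> T" "p \<noteq> []" "hd p = \<one>"
  and q: "set q \<subseteq> T"
 shows "\<exists>q'. set q' \<subseteq> T \<and> length q' < length p \<and>
  (\<forall>y\<in>C. eval p y = \<zero> \<longrightarrow> eval q' y = eval q y)"
 using q
proof (induction "length q" arbitrary: q rule: less_induct)
 case less
 have TR: "T \<subseteq> C" using subringE(1)[OF T] .
 show ?case
 proof (cases "length q < length p")
  case True
  thus ?thesis using less.prems by blast
 next
  case False
  then obtain a q1 where q: "q = a # q1" using p(2) by (cases q) auto
  obtain p1 where p1: "p = \<one> # p1" using p by (cases p) auto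
  \<comment> \<open>\<open>q2\<close> is \<open>q\<close> minus \<open>a\<close> times
    \<open>p\<close> shifted by \<open>k\<close> degrees. The leading terms cancel, so only the
    tails \<open>q1\<close> and \<open>p1\<close> occur, with \<open>k\<close> zeros appended for
    the shift.\<close>
  define k where "k = length q1 - length p1"
  define q2 where "q2 = map2 (\<lambda>b c. b \<ominus> a \<otimes> c) q1 (p1 @ replicate k \<zero>)"
  have len: "length q1 = length (p1 @ replicate k \<zero>)" using False by (simp add: k_def q p1)
  have aT: "a \<in> T" and q1T: "set q1 \<subseteq> T" using less.prems q by auto
  have p1T: "set p1 \<subseteq> T" using p p1 by auto
  have "set q2 \<subseteq> T"
  proof
   fix z assume "z \<in> set q2"
   then obtain b c where bc: "(b, c) \<in> set (zip q1 (p1 @ replicate k \<zero>))" "z = b \<ominus> a \<otimes> c"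
    by (auto simp: q2_def)
   hence "b \<in> T" "c \<in> T \<or> c = \<zero>"
    using q1T p1T set_zip_leftD[OF bc(1)] set_zip_rightD[OF bc(1)] by auto
   hence "b \<in> T" "c \<in> T" using subringE(2)[OF T] by auto
   thus "z \<in> T" using aT bc(2) subringE(5,6,7)[OF T] by (simp add: minus_eq)
  qed
  moreover have "length q2 < length q" using len by (simp add: q2_def q)
  ultimately obtain q' where q': "set q' \<subseteq> T" "length q' < length p"
   "\<And>y. y \<in> C \<Longrightarrow> eval p y = \<zero> \<Longrightarrow> eval q' y = eval q2 y"
   using less.hyps[of q2] by blast
  have "eval q2 y = eval q y" if y: "y \<in> C" "eval p y = \<zero>" for y
  proof -
   define u v w where "u = eval p1 y" and "v = y [^] length p1" and "w = y [^] k"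
   have c: "u \<in> C" "v \<in> C" "w \<in> C" "a \<in> C" "eval q1 y \<in> C"
    using y p1T TR q1T aT eval_in_carrier[of p1 y] eval_in_carrier[of q1 y]
    by (auto simp: u_def v_def w_def)
   have "eval q2 y = eval q1 y \<ominus> a \<otimes> eval (p1 @ replicate k \<zero>) y"
    unfolding q2_def using len q1T p1T TR y aT by (intro eval_map2_diff) auto
   also have "eval (p1 @ replicate k \<zero>) y = u \<otimes> w"
   proof -
    have "eval (replicate k \<zero>) y = \<zero>" using y by (intro eval_zeros) auto
    moreover have "set p1 \<subseteq> C" "set (replicate k \<zero>) \<subseteq> C" using p1T TR by auto
    ultimately show ?thesis
     using eval_append[of p1 "replicate k \<zero>" y] c y by (simp add: u_def w_def)
   qed
   finally have 1: "eval q2 y = eval q1 y \<ominus> a \<otimes> (u \<otimes> w)" .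
   have "v \<oplus> u = \<zero>" using y c by (simp add: p1 u_def v_def)
   hence "v = \<ominus> u" using c by (metis minus_equality a_comm)
   moreover have "y [^] length q1 = v \<otimes> w"
    using len y by (simp add: v_def w_def nat_pow_mult)
   ultimately have "eval q y = a \<otimes> (\<ominus> u \<otimes> w) \<oplus> eval q1 y"
    by (simp add: q)
   also have "\<dots> = eval q1 y \<ominus> a \<otimes> (u \<otimes> w)" using c by algebra
   finally show ?thesis using 1 by simp
  qed
  thus ?thesis using q' by (intro exI[of _ q']) auto
 qed
qed

text \<open>Coefficients of the product (X - r) q: appending a zero multiplies by X, and the zero in
  front only aligns the lengths.\<close>

definition lmul :: "'a \<Rightarrow> 'a list \<Rightarrow> 'a list"
 where "lmul r q = map2 (\<lambda>a b. a \<ominus> r \<otimes> b) (q @ [\<zero>]) (\<zero> # q)"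

definition linprod :: "'a list \<Rightarrow> 'a list"
 where "linprod rs = foldr lmul rs [\<one>]"

lemma length_lmul [simp]: "length (lmul r q) = Suc (length q)"
 by (simp add: lmul_def)

lemma nth_lmul:
 "i \<le> length q \<Longrightarrow> lmul r q ! i = (if i < length q then q ! i else \<zero>) \<ominus> r \<otimes> (if i = 0 then \<zero> else q ! (i - 1))"
 by (cases i) (auto simp: lmul_def nth_append)

lemma lmul_in:
 assumes "subring T R" "r \<in> T" "set q \<subseteq> T"
 shows "set (lmul r q) \<subseteq> T"
proof
 fix x assume "x \<in> set (lmul r q)"
 then obtain a b where ab: "(a, b) \<in> set (zip (q @ [\<zero>]) (\<zero> # q))" "x = a \<ominus> r \<otimes> b"
  by (auto simp: lmul_def)
 have "a \<in> T" "b \<in> T"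
  using set_zip_leftD[OF ab(1)] set_zip_rightD[OF ab(1)] assms subringE(2)[OF assms(1)] by auto
 thus "x \<in> T" using ab(2) assms subringE(5,6,7)[OF assms(1)] by (simp add: minus_eq)
qed

lemma eval_lmul:
 assumes "r \<in> C" "set q \<subseteq> C" "y \<in> C"
 shows "eval (lmul r q) y = (y \<ominus> r) \<otimes> eval q y"
proof -
 have e: "eval q y \<in> C" using assms eval_in_carrier by auto
 have "eval (lmul r q) y = eval (q @ [\<zero>]) y \<ominus> r \<otimes> eval (\<zero> # q) y"
  unfolding lmul_def by (rule eval_map2_diff) (use assms in auto)
 also have "eval (q @ [\<zero>]) y = eval q y \<otimes> y"
  using eval_append_aux[of q \<zero> y] assms e by simp
 also have "eval (\<zero> # q) y = eval q y" using assms e by simp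
 finally show ?thesis using e assms by (simp, algebra)
qed

lemma hd_lmul: "q \<noteq> [] \<Longrightarrow> set q \<subseteq> C \<Longrightarrow> r \<in> C \<Longrightarrow> hd (lmul r q) = hd q"
 by (cases q) (simp_all add: lmul_def minus_eq)

lemma linprod_simps [simp]: "linprod [] = [\<one>]" "linprod (r # rs) = lmul r (linprod rs)"
 by (simp_all add: linprod_def)

lemma length_linprod [simp]: "length (linprod rs) = Suc (length rs)"
 by (induction rs) auto

lemma linprod_in:
 assumes "subring T R" "set rs \<subseteq> T" shows "set (linprod rs) \<subseteq> T"
 using assms(2) by (induction rs) (auto simp: subringE(3)[OF assms(1)] dest: lmul_in[OF assms(1)])

lemma linprod_closed: "set rs \<subseteq> C \<Longrightarrow> set (linprod rs) \<subseteq> C"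
 by (rule linprod_in[OF carrier_is_subring])

lemma hd_linprod: "set rs \<subseteq> C \<Longrightarrow> hd (linprod rs) = \<one>"
proof (induction rs)
 case (Cons r rs)
 have "linprod rs \<noteq> []" using length_linprod[of rs] by (metis list.size(3) nat.distinct(1))
 thus ?case using Cons linprod_closed[of rs] by (simp add: hd_lmul)
qed simp

lemma eval_linprod_Cons:
 assumes "set (r # rs) \<subseteq> C" "y \<in> C"
 shows "eval (linprod (r # rs)) y = (y \<ominus> r) \<otimes> eval (linprod rs) y"
 using assms by (simp add: eval_lmul linprod_closed)

lemma eval_linprod_root:
 assumes "set rs \<subseteq> C" "y \<in> set rs"
 shows "eval (linprod rs) y = \<zero>"
 using assms
proof (induction rs)
 case (Cons r rs)
 have y: "y \<in> C" using Cons.prems by auto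
 have e: "eval (linprod rs) y \<in> C"
  using eval_in_carrier linprod_closed Cons.prems y by auto
 show ?case
 proof (cases "y = r")
  case True
  thus ?thesis using eval_linprod_Cons[OF Cons.prems(1) y] e y
   by (simp add: minus_eq r_neg)
 next
  case False
  hence "eval (linprod rs) y = \<zero>" using Cons by auto
  thus ?thesis using eval_linprod_Cons[OF Cons.prems(1) y] y Cons.prems by simp
 qed
qed simp

text \<open>Up to sign, the coefficients below the leading one are elementary symmetric functions of
  the roots, and each of their terms has a factor in the ideal. Applied to an element all of whose
  conjugates are nonunits.\<close>

lemma linprod_tl_in_ideal:
 assumes A: "subring A R" and I: "\<And>x y. x \<in> I \<Longrightarrow> y \<in> I \<Longrightarrow> x \<oplus> y \<in> I" "\<And>x a. x \<in> I \<Longrightarrow> a \<in> A \<Longrightarrow> x \<otimes> a \<in> I"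
  "\<zero> \<in> I" "I \<subseteq> A" and rs: "set rs \<subseteq> I"
 shows "set (tl (linprod rs)) \<subseteq> I"
 using rs
proof (induction rs)
 case (Cons r rs)
 have AR: "A \<subseteq> C" using subringE(1)[OF A] .
 have rs: "set rs \<subseteq> C" using Cons.prems I(4) AR by auto
 then obtain q where q: "linprod rs = \<one> # q"
  using hd_linprod[of rs] length_linprod[of rs] by (cases "linprod rs") auto
 hence qI: "set q \<subseteq> I" using Cons by simp
 have mI: "\<ominus> x \<in> I" if "x \<in> I" for x
 proof -
  have "x \<otimes> (\<ominus> \<one>) \<in> I" using I(2)[OF that] subringE(3,5)[OF A] by auto
  thus ?thesis using that I(4) AR by (metis minus_closed one_closed r_minus r_one subsetD)
 qed
 show ?case
 proof
  fix x assume "x \<in> set (tl (linprod (r # rs)))"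
  hence "x \<in> set (map2 (\<lambda>a b. a \<ominus> r \<otimes> b) (q @ [\<zero>]) (\<one> # q))"
   by (simp add: lmul_def q)
  then obtain a b where ab: "(a, b) \<in> set (zip (q @ [\<zero>]) (\<one> # q))" "x = a \<ominus> r \<otimes> b"
   by auto
  have "a \<in> I" "b \<in> A"
   using set_zip_leftD[OF ab(1)] set_zip_rightD[OF ab(1)] qI I(3,4) subringE(3)[OF A] by auto
  thus "x \<in> I" using ab(2) I(1,2) mI Cons.prems by (simp add: minus_eq)
 qed
qed simp

text \<open>Horner's scheme: the coefficients of the quotient by X - r are the intermediate results,
  that is, the values at \<open>r\<close> of the initial segments of \<open>p\<close>. The last
  result is the remainder, which vanishes.\<close>

lemma synthetic_division:
 assumes p: "set p \<subseteq> C" "p \<noteq> []" and r: "r \<in> C" and root: "eval p r = \<zero>"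
 shows "\<exists>q. set q \<subseteq> C \<and> p = lmul r q"
proof -
 define n where "n = length p - 1"
 define q where "q = map (\<lambda>i. eval (take (Suc i) p) r) [0..<n]"
 have len: "length p = Suc n" using p by (cases p) (auto simp: n_def)
 have tk: "eval (take i p) r \<in> C" for i
  using eval_in_carrier[of "take i p" r] p r set_take_subset[of i p] by auto
 have step: "eval (take (Suc i) p) r = eval (take i p) r \<otimes> r \<oplus> p ! i" if "i < length p" for i
 proof -
  have "set (take i p) \<subseteq> C" using p set_take_subset[of i p] by auto
  moreover have "p ! i \<in> C" using p that by auto
  ultimately show ?thesis using eval_append_aux[of "take i p" "p ! i" r] r
   by (simp add: take_Suc_conv_app_nth[OF that])
 qed
 have nth: "p ! i \<in> C" if "i < length p" for i using p that by auto
 have "p = lmul r q"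
 proof (rule nth_equalityI)
  show "length p = length (lmul r q)" by (simp add: q_def len)
  fix i assume i: "i < length p"
  show "p ! i = lmul r q ! i"
  proof (cases "i = n")
   case True
   define e where "e = eval (take n p) r"
   have e: "e \<in> C" using tk by (simp add: e_def)
   have "e \<otimes> r \<oplus> p ! n = \<zero>" using step[of n] root len by (simp add: e_def)
   hence "p ! n = \<ominus> (e \<otimes> r)" using e r nth[of n] len
    by (metis a_comm lessI local.minus_equality m_closed)
   moreover have "n = 0 \<Longrightarrow> e = \<zero>" by (simp add: e_def)
   ultimately show ?thesis using True e r
    by (cases n) (auto simp: nth_lmul q_def e_def minus_eq m_comm nth_append)
  next
   case False
   hence "i < n" using i len by auto
   moreover have "(a \<otimes> r \<oplus> b) \<ominus> r \<otimes> a = b" if "a \<in> C" "b \<in> C" for a b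
    using that r by algebra
   moreover have "lmul r q ! i = eval (take (Suc i) p) r \<ominus> r \<otimes> eval (take i p) r"
    using \<open>i < n\<close> r by (cases i) (auto simp: nth_lmul q_def)
   ultimately show ?thesis using step[OF i] tk nth[OF i] by simp
  qed
 qed
 moreover have "set q \<subseteq> C" using tk by (auto simp: q_def)
 ultimately show ?thesis by blast
qed

end

section \<open>Counting roots over a domain\<close>

context domain
begin

lemma eval_linprod_zero_iff:
 assumes "set rs \<subseteq> C" "y \<in> C"
 shows "eval (linprod rs) y = \<zero> \<longleftrightarrow> y \<in> set rs"
 using assms(1)
proof (induction rs)
 case (Cons r rs)
 have e: "eval (linprod rs) y \<in> C"
  using eval_in_carrier linprod_closed Cons.prems assms(2) by auto
 have "y \<ominus> r = \<zero> \<longleftrightarrow> y = r" using Cons.prems assms(2) by simp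
 thus ?case
  using Cons eval_linprod_Cons[OF Cons.prems assms(2)] e assms(2) by (auto simp: integral_iff)
qed simp

text \<open>Leading zeros are permitted, so the bound concerns the length and triviality means that
  every entry vanishes. Roots are split off as linear factors until the list is empty.\<close>

lemma list_with_many_roots_zero:
 assumes "finite S" "S \<subseteq> C" "length q \<le> card S" "set q \<subseteq> C"
  and "\<And>y. y \<in> S \<Longrightarrow> eval q y = \<zero>"
 shows "set q \<subseteq> {\<zero>}"
 using assms
proof (induction "length q" arbitrary: q S)
 case (Suc n)
 then obtain r where r: "r \<in> S" by fastforce
 obtain q1 where q1: "set q1 \<subseteq> C" "q = lmul r q1"
  using synthetic_division[of q r] Suc r by force
 have "set q1 \<subseteq> {\<zero>}"
 proof (rule Suc.hyps(1))
  show "n = length q1" using Suc.hyps(2) q1 by simp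
  show "finite (S - {r})" "S - {r} \<subseteq> C" using Suc by auto
  show "length q1 \<le> card (S - {r})" using q1 r Suc by simp
  fix y assume y: "y \<in> S - {r}"
  hence yc: "y \<in> C" "r \<in> C" using Suc r by auto
  have "(y \<ominus> r) \<otimes> eval q1 y = \<zero>"
   using eval_lmul[OF yc(2) q1(1) yc(1)] Suc.prems(5)[of y] y q1 by simp
  moreover have "y \<ominus> r \<noteq> \<zero>" using y yc by simp
  ultimately show "eval q1 y = \<zero>" using yc q1 eval_in_carrier by (simp add: integral_iff)
 qed (use q1 in auto)
 moreover have "set (lmul r q1) \<subseteq> {\<zero>}" if "set q1 \<subseteq> {\<zero>}"
 proof
  fix x assume "x \<in> set (lmul r q1)"
  then obtain a b where ab: "(a, b) \<in> set (zip (q1 @ [\<zero>]) (\<zero> # q1))" "x = a \<ominus> r \<otimes> b"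
   by (auto simp: lmul_def)
  have "a = \<zero>" "b = \<zero>" using set_zip_leftD[OF ab(1)] set_zip_rightD[OF ab(1)] that by auto
  thus "x \<in> {\<zero>}" using ab r Suc.prems by (auto simp: minus_eq)
 qed
 ultimately show ?case using q1 by simp
qed simp

text \<open>The leading ones cancel. The difference of the tails has only \<open>card S\<close>
  coefficients, one too few for a nonzero polynomial with \<open>card S\<close> roots.\<close>

lemma monic_eq_of_roots:
 assumes "finite S" "S \<subseteq> C" "length p = Suc (card S)" "length q = Suc (card S)"
  and "set p \<subseteq> C" "set q \<subseteq> C" "hd p = \<one>" "hd q = \<one>"
  and "\<And>y. y \<in> S \<Longrightarrow> eval p y = \<zero>" "\<And>y. y \<in> S \<Longrightarrow> eval q y = \<zero>"
 shows "p = q"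
proof -
 obtain p' q' where pq: "p = \<one> # p'" "q = \<one> # q'" using assms by (cases p; cases q) auto
 define d where "d = map2 (\<lambda>b c. b \<ominus> \<one> \<otimes> c) p' q'"
 have len: "length p' = length q'" using assms pq by simp
 have p': "set p' \<subseteq> C" "set q' \<subseteq> C" using assms pq by auto
 have "set d \<subseteq> {\<zero>}"
 proof (rule list_with_many_roots_zero[OF assms(1,2)])
  show "length d \<le> card S" using assms pq by (simp add: d_def)
  show "set d \<subseteq> C"
   unfolding d_def by (rule set_map2_subset[OF _ p']) simp
  fix y assume y: "y \<in> S"
  hence yc: "y \<in> C" using assms by auto
  have e: "eval p' y \<in> C" "eval q' y \<in> C"
   using eval_in_carrier p' yc by auto
  have "y [^] length q' \<oplus> eval p' y = y [^] length q' \<oplus> eval q' y"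
   using assms(9,10)[OF y] pq len yc by simp
  hence "eval p' y = eval q' y" using e yc by simp
  thus "eval d y = \<zero>"
   unfolding d_def using eval_map2_diff[OF len p' yc one_closed] e by (simp add: minus_eq r_neg)
 qed
 hence "p' ! i = q' ! i" if "i < length p'" for i
 proof -
  have "d ! i = p' ! i \<ominus> \<one> \<otimes> q' ! i" "d ! i \<in> set d"
   using that len nth_mem[of i d] by (simp_all add: d_def del: nth_mem)
  hence "p' ! i \<ominus> \<one> \<otimes> q' ! i = \<zero>" using \<open>set d \<subseteq> {\<zero>}\<close> by auto
  moreover have "p' ! i \<in> C" "q' ! i \<in> C" using p' that len by (auto simp: subset_iff)
  ultimately show ?thesis by simp
 qed
 thus ?thesis using pq len by (auto intro: nth_equalityI)
qed

end


section \<open>Algebraic closures and minimal polynomials\<close>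

text \<open>Lists may carry leading zeros, so a shorter relation counts as trivial when all its
  entries are zero, not only when it is empty.\<close>

definition (in ring) min_poly :: "'a set \<Rightarrow> 'a \<Rightarrow> 'a list \<Rightarrow> bool"
 where "min_poly E x p \<longleftrightarrow> set p \<subseteq> E \<and> p \<noteq> [] \<and> hd p = \<one> \<and> eval p x = \<zero> \<and>
  (\<forall>q. set q \<subseteq> E \<longrightarrow> length q < length p \<longrightarrow> eval q x = \<zero> \<longrightarrow> set q \<subseteq> {\<zero>})"

text \<open>Stands for the powers of the characteristic exponent, for which \<open>x [^] m\<close>
  is an iterated Frobenius map; this avoids distinguishing characteristics.\<close>

definition (in ring) additive_exponent :: "nat \<Rightarrow> bool"
 where "additive_exponent m \<longleftrightarrow> m > 0 \<and>
  (\<forall>y\<in>C. \<forall>z\<in>C. (y \<oplus> z) [^] m = y [^] m \<oplus> z [^] m)"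

text \<open>Together the axioms make \<open>R\<close> an algebraic closure of \<open>K\<close>. They
  are phrased with monic coefficient lists, the only ones whose roots are ever taken.\<close>

locale algebraically_closed_over = field R for R (structure) +
 fixes K :: "'a set"
 assumes subfield_K: "subfield K R"
  and algebraic_K: "x \<in> carrier R \<Longrightarrow> \<exists>p. set p \<subseteq> K \<and> p \<noteq> [] \<and> hd p = \<one> \<and> eval p x = \<zero>"
  and root_exists: "set p \<subseteq> carrier R \<Longrightarrow> 2 \<le> length p \<Longrightarrow> hd p = \<one> \<Longrightarrow> \<exists>x\<in>carrier R. eval p x = \<zero>"

context field
begin

lemma subfield_inv_closed: "subfield E R \<Longrightarrow> x \<in> E \<Longrightarrow> x \<noteq> \<zero> \<Longrightarrow> inv x \<in> E"
 using subfield_m_inv(1)[of E x] by auto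

text \<open>A shortest nontrivial relation has a nonzero leading coefficient, since otherwise its
  tail would be a shorter one; so it can be made monic.\<close>

lemma min_poly_exists:
 assumes E: "subfield E R" and x: "x \<in> C"
  and alg: "set q \<subseteq> E" "\<not> set q \<subseteq> {\<zero>}" "eval q x = \<zero>"
 shows "\<exists>p. min_poly E x p \<and> length p \<le> length q"
proof -
 define P where "P q \<longleftrightarrow> set q \<subseteq> E \<and> \<not> set q \<subseteq> {\<zero>} \<and> eval q x = \<zero>" for q
 have ER: "E \<subseteq> C" using subfieldE(3)[OF E] .
 define r where "r = arg_min length P"
 have r: "P r" "\<And>s. P s \<Longrightarrow> length r \<le> length s"
  using arg_min_natI[of P q length] arg_min_nat_le[of P _ length] alg by (auto simp: r_def P_def)
 then obtain a r' where r': "r = a # r'" by (cases r) (auto simp: P_def)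
 have c: "a \<in> C" "set r' \<subseteq> C" using r r' ER by (auto simp: P_def)
 have a: "a \<noteq> \<zero>"
 proof
  assume "a = \<zero>"
  hence "P r'" using r r' x c eval_in_carrier[of r' x] by (auto simp: P_def)
  thus False using r(2)[of r'] r' by simp
 qed
 have ia: "inv a \<in> E" using a r r' subfield_inv_closed[OF E] by (auto simp: P_def)
 define p where "p = map (\<lambda>c. inv a \<otimes> c) r"
 have "min_poly E x p" unfolding min_poly_def
 proof (intro conjI allI impI)
  show "set p \<subseteq> E" using r(1) ia subringE(6)[OF subfieldE(1)[OF E]] by (auto simp: p_def P_def)
  show "p \<noteq> []" by (simp add: p_def r')
  show "hd p = \<one>" using a c by (simp add: p_def r' field_Units)
  show "eval p x = \<zero>"
   using eval_map_scale[of "inv a" r x] r(1) ia ER x by (auto simp: p_def P_def)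
  fix s assume s: "set s \<subseteq> E" "length s < length p" "eval s x = \<zero>"
  thus "set s \<subseteq> {\<zero>}" using r(2)[of s] by (auto simp: p_def P_def)
 qed
 thus ?thesis using r(2)[of q] alg by (auto simp: p_def P_def)
qed

lemma min_poly_length:
 assumes E: "subfield E R" and x: "x \<in> C" and p: "min_poly E x p"
 shows "2 \<le> length p"
proof (rule ccontr)
 assume "\<not> 2 \<le> length p"
 hence "p = [\<one>]" using p by (cases p; cases "tl p") (auto simp: min_poly_def)
 thus False using p x by (simp add: min_poly_def)
qed

text \<open>The remainder of \<open>h\<close> modulo \<open>p\<close> is a relation for
  \<open>x\<close> shorter than \<open>p\<close>, hence trivial.\<close>

lemma min_poly_conjugate:
 assumes E: "subfield E R" and p: "min_poly E x p" and x: "x \<in> C"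
  and r: "r \<in> C" "eval p r = \<zero>" and h: "set h \<subseteq> E" "eval h x = \<zero>"
 shows "eval h r = \<zero>"
proof -
 obtain q' where q': "set q' \<subseteq> E" "length q' < length p"
  "\<And>y. y \<in> C \<Longrightarrow> eval p y = \<zero> \<Longrightarrow> eval q' y = eval h y"
  using monic_division[of E p h] subfieldE(1)[OF E] p h by (auto simp: min_poly_def)
 hence "set q' \<subseteq> {\<zero>}" using p x h by (auto simp: min_poly_def)
 thus ?thesis using q'(3)[OF r] eval_zeros r by simp
qed

lemma nth_linprod_replicate:
 assumes x: "x \<in> C" and i: "i \<le> m"
 shows "linprod (replicate m x) ! i = add_pow R (m choose i) \<one> \<otimes> (\<ominus> x) [^] i"
 using i
proof (induction m arbitrary: i)
 case (Suc m)
 have len: "length (linprod (replicate m x)) = Suc m" by simp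
 have c: "add_pow R k \<one> \<in> C" "(\<ominus> x) [^] k \<in> C" for k :: nat using x by auto
 show ?case
 proof (cases i)
  case 0
  thus ?thesis using Suc.IH[of 0] x c by (simp add: nth_lmul minus_eq)
 next
  case (Suc j)
  have j: "j \<le> m" using Suc Suc.prems by simp
  define u where "u = (\<ominus> x) [^] j"
  have u: "u \<in> C" using x by (simp add: u_def)
  have "linprod (replicate (Suc m) x) ! i
   = (if i \<le> m then linprod (replicate m x) ! i else \<zero>) \<ominus> x \<otimes> linprod (replicate m x) ! j"
   using Suc.prems Suc by (simp add: nth_lmul less_Suc_eq_le)
  also have "(if i \<le> m then linprod (replicate m x) ! i else \<zero>) = add_pow R (m choose i) \<one> \<otimes> (u \<otimes> \<ominus> x)"
   using Suc.IH[of i] Suc x c by (auto simp: u_def binomial_eq_0)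
  also have "linprod (replicate m x) ! j = add_pow R (m choose j) \<one> \<otimes> u"
   using Suc.IH[OF j] by (simp add: u_def)
  also have "add_pow R (m choose i) \<one> \<otimes> (u \<otimes> \<ominus> x) \<ominus> x \<otimes> (add_pow R (m choose j) \<one> \<otimes> u)
    = (add_pow R (m choose j) \<one> \<oplus> add_pow R (m choose i) \<one>) \<otimes> (u \<otimes> \<ominus> x)"
   using c[of "m choose i"] c[of "m choose j"] u x by algebra
  also have "add_pow R (m choose j) \<one> \<oplus> add_pow R (m choose i) \<one> = add_pow R (Suc m choose i) \<one>"
   by (simp add: Suc add.nat_pow_mult)
  finally show ?thesis using x by (simp add: Suc u_def nat_pow_Suc)
 qed
qed simp

lemma pow_eq_zero_imp: "x \<in> C \<Longrightarrow> x [^] (n::nat) = \<zero> \<Longrightarrow> x = \<zero>"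
 by (induction n) (auto simp: integral_iff)

lemma additive_exponent_one: "additive_exponent 1"
 by (simp add: additive_exponent_def)

lemma additive_exponent_mult:
 assumes "additive_exponent m" "additive_exponent n"
 shows "additive_exponent (m * n)"
 using assms by (simp add: additive_exponent_def flip: nat_pow_pow)

text \<open>Additivity for \<open>z\<close> and \<open>\<ominus> z\<close> identifies the power of
  \<open>\<ominus> z\<close> without regard to the parity of \<open>m\<close>. So the power of the
  difference of \<open>y\<close> and \<open>z\<close> vanishes, and a field has no nilpotent
  elements.\<close>

lemma additive_exponent_inj:
 assumes m: "additive_exponent m" and yz: "y \<in> C" "z \<in> C" "y [^] m = z [^] m"
 shows "y = z"
proof -
 have m0: "m > 0" using m by (simp add: additive_exponent_def)
 have add: "(a \<oplus> b) [^] m = a [^] m \<oplus> b [^] m" if "a \<in> C" "b \<in> C" for a b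
  using m that by (simp add: additive_exponent_def)
 have "\<zero> [^] m = z [^] m \<oplus> (\<ominus> z) [^] m" using add[of z "\<ominus> z"] yz by (simp add: r_neg)
 hence "z [^] m \<oplus> (\<ominus> z) [^] m = \<zero>" using m0 by (simp add: nat_pow_zero)
 hence "(y \<oplus> \<ominus> z) [^] m = \<zero>" using add[of y "\<ominus> z"] yz by simp
 hence "y \<oplus> \<ominus> z = \<zero>" using yz pow_eq_zero_imp[of "y \<oplus> \<ominus> z" m] by simp
 thus ?thesis using yz by (metis minus_eq r_right_minus_eq)
qed

text \<open>
 All intermediate binomial coefficients of \<open>(X - x)\<^sup>m\<close> vanish: otherwise a power of \<open>x\<close> with
 exponent less than \<open>m\<close> would lie in the ground field. Hence \<open>m\<close> is a power of the
 characteristic exponent, although the characteristic never has to be mentioned.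
\<close>

lemma min_poly_single_root:
 assumes E: "subfield E R" and x: "x \<in> C" and p: "min_poly E x (linprod (replicate m x))"
 shows "x [^] m \<in> E" and "additive_exponent m"
proof -
 have Er: "subring E R" using subfieldE(1)[OF E] .
 have ER: "E \<subseteq> C" using subfieldE(3)[OF E] .
 have m0: "m > 0" using min_poly_length[OF E x p] by simp
 let ?b = "\<lambda>i. add_pow R (m choose i) \<one>"
 have nE: "add_pow R n \<one> \<in> E" for n :: nat
  by (induction n) (auto simp: subringE(2,3,7)[OF Er])
 have pE: "z [^] n \<in> E" if "z \<in> E" for z and n :: nat
  using that ER by (induction n) (auto simp: subringE(3,6)[OF Er])
 have coeffE: "?b i \<otimes> (\<ominus> x) [^] i \<in> E" if "i \<le> m" for i
 proof -
  have "linprod (replicate m x) ! i \<in> set (linprod (replicate m x))" using that by (intro nth_mem) simp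
  thus ?thesis using p nth_linprod_replicate[OF x that] by (auto simp: min_poly_def)
 qed
 have power_in: "x [^] i \<in> E" if "i \<le> m" "?b i \<noteq> \<zero>" for i
 proof -
  have "inv (?b i) \<otimes> (?b i \<otimes> (\<ominus> x) [^] i) \<in> E"
   using subringE(6)[OF Er] coeffE[OF that(1)] subfield_inv_closed[OF E nE that(2)] by blast
  moreover have "?b i \<in> Units R" using that by (simp add: field_Units)
  ultimately have "(\<ominus> x) [^] i \<in> E" using x by (simp flip: m_assoc)
  moreover have "x [^] i = (\<ominus> x) [^] i \<otimes> (\<ominus> \<one>) [^] i"
   using x by (simp flip: nat_pow_distrib add: r_minus)
  ultimately show ?thesis using subringE(3,5,6)[OF Er] pE by auto
 qed
 have vanish: "?b i = \<zero>" if "0 < i" "i < m" for i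
 proof (rule ccontr)
  assume "?b i \<noteq> \<zero>"
  hence xi: "x [^] i \<in> E" using power_in that by simp
  \<comment> \<open>The polynomial X^i - x^i: once \<open>x [^] i\<close> lies in \<open>E\<close>,
    it is a monic relation shorter than the minimal polynomial.\<close>
  define q where "q = \<one> # replicate (i - 1) \<zero> @ [\<ominus> (x [^] i)]"
  have "eval (replicate (i - 1) \<zero> @ [\<ominus> (x [^] i)]) x = \<ominus> (x [^] i)"
   using eval_replicate[of "[\<ominus> (x [^] i)]" x "i - 1"] x by simp
  hence "eval q x = \<one> \<otimes> x [^] i \<oplus> \<ominus> (x [^] i)"
   using that by (simp add: q_def)
  hence "eval q x = \<zero>" using x by (simp add: r_neg)
  moreover have "\<ominus> (x [^] i) \<in> E" "\<one> \<in> E" "\<zero> \<in> E" using xi subringE(2,3,5)[OF Er] by blast+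
  hence "set q \<subseteq> E" by (auto simp: q_def)
  moreover have "length q < length (linprod (replicate m x))" using that by (simp add: q_def)
  ultimately have "set q \<subseteq> {\<zero>}" using p by (auto simp: min_poly_def)
  thus False by (simp add: q_def)
 qed
 have b0: "?b 0 = \<one>" "?b m = \<one>" by simp_all
 show "x [^] m \<in> E" using power_in[of m] b0 by simp
 \<comment> \<open>The vanishing binomial coefficients are elements of the ring that do not involve
   \<open>x\<close>. Hence the middle terms of the expansion disappear for all \<open>y\<close> and
   \<open>z\<close>.\<close>
 have key: "(y \<ominus> z) [^] m = y [^] m \<oplus> (\<ominus> z) [^] m" if yz: "y \<in> C" "z \<in> C" for y z
 proof -
  have "eval (linprod (replicate n z)) y = (y \<ominus> z) [^] n" for n
  proof (induction n)
   case (Suc n)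
   have "set (replicate (Suc n) z) \<subseteq> C" using yz by auto
   thus ?case using eval_linprod_Cons[of z "replicate n z" y] Suc yz
    by (simp add: nat_pow_Suc m_comm)
  qed (use yz in simp)
  moreover have "linprod (replicate m z) = \<one> # replicate (m - 1) \<zero> @ [(\<ominus> z) [^] m]"
  proof (rule nth_equalityI)
   show "length (linprod (replicate m z)) = length (\<one> # replicate (m - 1) \<zero> @ [(\<ominus> z) [^] m])"
    using m0 by simp
   fix i assume "i < length (linprod (replicate m z))"
   hence i: "i \<le> m" by simp
   have e: "linprod (replicate m z) ! i = ?b i \<otimes> (\<ominus> z) [^] i"
    by (rule nth_linprod_replicate[OF yz(2) i])
   consider "i = 0" | "i = m" "0 < i" | "0 < i" "i < m" using i by linarith
   thus "linprod (replicate m z) ! i = (\<one> # replicate (m - 1) \<zero> @ [(\<ominus> z) [^] m]) ! i"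
   proof cases
    case 1
    show ?thesis unfolding e using 1 by simp
   next
    case 2
    have "(\<one> # replicate (m - 1) \<zero> @ [(\<ominus> z) [^] m]) ! i = (\<ominus> z) [^] m"
     using 2 by (cases i) (simp_all add: nth_append)
    thus ?thesis unfolding e using 2 b0 yz by simp
   next
    case 3
    have "(\<one> # replicate (m - 1) \<zero> @ [(\<ominus> z) [^] m]) ! i = \<zero>"
    proof -
     obtain j where j: "i = Suc j" using 3 by (cases i) auto
     hence "j < length (replicate (m - 1) \<zero>)" using 3 by simp
     thus ?thesis unfolding j nth_Cons_Suc nth_append by simp
    qed
    thus ?thesis unfolding e using vanish[OF 3] yz by simp
   qed
  qed
  moreover have "eval (\<one> # replicate (m - 1) \<zero> @ [(\<ominus> z) [^] m]) y = y [^] m \<oplus> (\<ominus> z) [^] m"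
   using eval_replicate[of "[(\<ominus> z) [^] m]" y "m - 1"] yz m0 by simp
  ultimately show ?thesis by metis
 qed
 show "additive_exponent m"
  unfolding additive_exponent_def
 proof (intro conjI ballI m0)
  fix y z assume "y \<in> C" "z \<in> C"
  thus "(y \<oplus> z) [^] m = y [^] m \<oplus> z [^] m" using key[of y "\<ominus> z"] by (simp add: minus_eq)
 qed
qed

end

context algebraically_closed_over
begin

definition overfield :: "'a set \<Rightarrow> bool"
 where "overfield E \<longleftrightarrow> subfield E R \<and> K \<subseteq> E"

lemma overfield_K: "overfield K" using subfield_K by (simp add: overfield_def)

lemma overfieldD:
 assumes "overfield E"
 shows "subfield E R" "K \<subseteq> E" "subring E R" "E \<subseteq> C"
 using assms subfieldE(1,3)[of E R] by (auto simp: overfield_def)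

lemma monic_splits:
 assumes "set p \<subseteq> C" "p \<noteq> []" "hd p = \<one>"
 shows "\<exists>rs. set rs \<subseteq> C \<and> p = linprod rs"
 using assms
proof (induction "length p" arbitrary: p rule: less_induct)
 case less
 show ?case
 proof (cases "2 \<le> length p")
  case True
  then obtain r where r: "r \<in> C" "eval p r = \<zero>" using root_exists less.prems by blast
  then obtain q where q: "set q \<subseteq> C" "p = lmul r q"
   using synthetic_division less.prems by blast
  hence "q \<noteq> []" using True by auto
  hence "hd q = \<one>" using hd_lmul[OF _ q(1) r(1)] q less.prems by simp
  then obtain rs where "set rs \<subseteq> C" "q = linprod rs"
   using less.hyps[of q] q \<open>q \<noteq> []\<close> by auto
  thus ?thesis using q r by (intro exI[of _ "r # rs"]) simp
 next
  case False
  hence "p = linprod []" using less.prems by (cases p; cases "tl p") auto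
  thus ?thesis by (metis empty_set empty_subsetI)
 qed
qed

lemma min_poly_exists_over:
 assumes E: "overfield E" and x: "x \<in> C"
 shows "\<exists>p. min_poly E x p"
proof -
 obtain p where p: "set p \<subseteq> K" "p \<noteq> []" "hd p = \<one>" "eval p x = \<zero>" using algebraic_K[OF x] by blast
 have "\<one> \<in> set p" using p by (metis hd_in_set)
 hence "\<not> set p \<subseteq> {\<zero>}" by auto
 thus ?thesis using min_poly_exists[of E x p] overfieldD[OF E] x p by blast
qed

end

section \<open>Extending embeddings into an algebraic closure\<close>

context cring
begin

text \<open>Proved for commutative rings with zero divisors, as it will be used for a subring of the
  product of \<open>R\<close> with itself.\<close>

lemma simple_extension_closed:
 assumes T: "subring T R" and x: "x \<in> C"
 shows "subring (simple_extension T x) R"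
proof -
 let ?S = "simple_extension T x"
 have TR: "T \<subseteq> C" using subringE(1)[OF T] .
 have SR: "?S \<subseteq> C" using simple_extension_in_carrier[OF TR x] .
 note c = subsetD[OF TR] subsetD[OF SR]
 have TS: "T \<subseteq> ?S" using simple_extension_incl[OF TR x] .
 have add: "u \<oplus> v \<in> ?S" if "u \<in> ?S" "v \<in> ?S" for u v
  using that
 proof (induction u arbitrary: v)
  case zero
  thus ?case using c by simp
 next
  case (lin u k)
  from lin.prems show ?case
  proof cases
   case zero
   thus ?thesis using lin.hyps c simple_extension.lin[OF lin.hyps] x by simp
  next
   case (lin v' k')
   have "(u \<oplus> v') \<otimes> x \<oplus> (k \<oplus> k') \<in> ?S"
    using \<open>\<And>v. v \<in> ?S \<Longrightarrow> u \<oplus> v \<in> ?S\<close> lin(2) lin(3) \<open>k \<in> T\<close> subringE(7)[OF T]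
    by (intro simple_extension.lin) auto
   moreover have "(u \<oplus> v') \<otimes> x \<oplus> (k \<oplus> k') = u \<otimes> x \<oplus> k \<oplus> v"
    using c(2)[OF \<open>u \<in> ?S\<close>] c(2)[OF lin(2)] c(1)[OF lin(3)] c(1)[OF \<open>k \<in> T\<close>] x
    unfolding lin(1) by algebra
   ultimately show ?thesis by simp
  qed
 qed
 have scal: "k \<otimes> u \<in> ?S" if "k \<in> T" "u \<in> ?S" for k u
  using that(2)
 proof induction
  case zero
  thus ?case using c that by simp
 next
  case (lin u k')
  have "(k \<otimes> u) \<otimes> x \<oplus> k \<otimes> k' \<in> ?S"
   using lin that subringE(6)[OF T] by (intro simple_extension.lin) auto
  moreover have "(k \<otimes> u) \<otimes> x \<oplus> k \<otimes> k' = k \<otimes> (u \<otimes> x \<oplus> k')"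
   using c(2)[OF lin(1)] c(1)[OF lin(2)] c(1)[OF that(1)] x by algebra
  ultimately show ?case by simp
 qed
 have mult: "u \<otimes> v \<in> ?S" if "u \<in> ?S" "v \<in> ?S" for u v
  using that(1)
 proof induction
  case zero
  thus ?case using c that by simp
 next
  case (lin u k)
  have "(u \<otimes> v) \<otimes> x \<oplus> \<zero> \<in> ?S"
   using lin subringE(2)[OF T] by (intro simple_extension.lin) auto
  hence "((u \<otimes> v) \<otimes> x \<oplus> \<zero>) \<oplus> k \<otimes> v \<in> ?S" using add scal[OF lin(2) that(2)] by blast
  moreover have "((u \<otimes> v) \<otimes> x \<oplus> \<zero>) \<oplus> k \<otimes> v = (u \<otimes> x \<oplus> k) \<otimes> v"
   using c(2)[OF lin(1)] c(1)[OF lin(2)] c(2)[OF that(2)] x by algebra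
  ultimately show ?case by simp
 qed
 show ?thesis
 proof (rule subringI[OF SR])
  show "\<one> \<in> ?S" using TS subringE(3)[OF T] by blast
  fix u v assume uv: "u \<in> ?S" "v \<in> ?S"
  show "u \<oplus> v \<in> ?S" "u \<otimes> v \<in> ?S" using add mult uv by auto
  have "(\<ominus> \<one>) \<otimes> u \<in> ?S" using scal uv subringE(3,5)[OF T] by blast
  thus "\<ominus> u \<in> ?S" using c(2)[OF uv(1)] by (simp add: l_minus)
 qed
qed

lemma simple_extension_eval:
 assumes T: "T \<subseteq> C" and x: "x \<in> C" and u: "u \<in> simple_extension T x"
 shows "\<exists>q. set q \<subseteq> T \<and> u = eval q x"
 using u
proof induction
 case zero
 show ?case by (intro exI[of _ "[]"]) simp
next
 case (lin u k)
 then obtain q where q: "set q \<subseteq> T" "u = eval q x" by blast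
 have "eval (q @ [k]) x = eval q x \<otimes> x \<oplus> k"
  using lin T x q by (intro eval_append_aux) auto
 thus ?case using lin q by (intro exI[of _ "q @ [k]"]) auto
qed

end

context algebraically_closed_over
begin

abbreviation PP where "PP \<equiv> RDirProd R R"

lemma PP_simps [simp]:
 "carrier PP = C \<times> C"
 "(a, b) \<otimes>\<^bsub>PP\<^esub> (c, d) = (a \<otimes> c, b \<otimes> d)"
 "(a, b) \<oplus>\<^bsub>PP\<^esub> (c, d) = (a \<oplus> c, b \<oplus> d)"
 "\<one>\<^bsub>PP\<^esub> = (\<one>, \<one>)" "\<zero>\<^bsub>PP\<^esub> = (\<zero>, \<zero>)"
 by (simp_all add: RDirProd_def DirProd_def monoid.defs)

lemma fst_PP_mult: "fst (p \<otimes>\<^bsub>PP\<^esub> q) = fst p \<otimes> fst q"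
 by (cases p; cases q) simp

lemma PP_cring: "cring PP"
proof -
 interpret P: ring PP using RDirProd_ring ring_axioms by blast
 show ?thesis
 proof
  fix x y assume "x \<in> carrier PP" "y \<in> carrier PP"
  thus "x \<otimes>\<^bsub>PP\<^esub> y = y \<otimes>\<^bsub>PP\<^esub> x" by (cases x; cases y) (simp add: m_comm)
 qed
qed

interpretation PP: cring PP by (rule PP_cring)

lemma PP_minus:
 assumes "a \<in> C" "b \<in> C"
 shows "\<ominus>\<^bsub>PP\<^esub> (a, b) = (\<ominus> a, \<ominus> b)"
 using assms PP.minus_equality[of "(\<ominus> a, \<ominus> b)" "(a, b)"] by (simp add: l_neg)

lemma PP_pow: "a \<in> C \<Longrightarrow> b \<in> C \<Longrightarrow> (a, b) [^]\<^bsub>PP\<^esub> (n::nat) = (a [^] n, b [^] n)"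
 by (induction n) simp_all

lemma PP_eval:
 assumes "set q \<subseteq> C \<times> C" "a \<in> C" "b \<in> C"
 shows "PP.eval q (a, b) = (eval (map fst q) a, eval (map snd q) b)"
 using assms(1)
proof (induction q)
 case (Cons x q)
 thus ?case using assms(2,3) by (cases x) (simp add: PP_pow)
qed simp

text \<open>The graph of a ring homomorphism over \<open>K\<close> defined on the first projection
  of \<open>T\<close>; for a subring the last condition amounts to single-valuedness. With graphs,
  extending a homomorphism becomes inclusion of sets, and extending it by one element becomes a
  simple extension in the product ring.\<close>

definition graph_hom :: "('a \<times> 'a) set \<Rightarrow> bool"
 where "graph_hom T \<longleftrightarrow> subring T PP \<and> (\<forall>x\<in>K. (x, x) \<in> T) \<and> (\<forall>y. (\<zero>, y) \<in> T \<longrightarrow> y = \<zero>)"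

lemma algebraic_over: "x \<in> C \<Longrightarrow> overfield E \<Longrightarrow> (algebraic over E) x"
proof -
 assume x: "x \<in> C" and E: "overfield E"
 obtain p where p: "set p \<subseteq> K" "p \<noteq> []" "hd p = \<one>" "eval p x = \<zero>" using algebraic_K[OF x] by blast
 hence "polynomial E p" using overfieldD[OF E] by (auto simp: polynomial_def)
 thus "(algebraic over E) x"
  using algebraicI[of p E x] p by (simp add: univ_poly_carrier)
qed

text \<open>The inverse of an algebraic element \<open>x\<close> lies in the simple extension of
  \<open>K\<close> by \<open>x\<close>, which the ring contains.\<close>

lemma subring_overfield:
 assumes D: "subring D R" "K \<subseteq> D"
 shows "overfield D"
proof -
 have "inv x \<in> D" if x: "x \<in> D - {\<zero>}" for x
 proof -
  have xc: "x \<in> C" using x subringE(1)[OF D(1)] by auto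
  hence "subfield (simple_extension K x) R"
   using simple_extension_is_subfield[OF subfield_K xc] algebraic_over[OF xc overfield_K] by simp
  moreover have "x \<in> simple_extension K x"
   using simple_extension_mem[OF overfieldD(3)[OF overfield_K] xc] .
  ultimately have "inv x \<in> simple_extension K x" using subfield_inv_closed x by blast
  thus ?thesis using simple_extension_subring_incl[of D K x] D x by blast
 qed
 thus ?thesis using subfieldI'[OF D(1)] D(2) by (simp add: overfield_def)
qed

lemma graph_hom_single_valued:
 assumes T: "graph_hom T" and xy: "(x, y) \<in> T" "(x, z) \<in> T"
 shows "y = z"
proof -
 have T1: "subring T PP" using T by (simp add: graph_hom_def)
 have c: "x \<in> C" "y \<in> C" "z \<in> C" using xy subringE(1)[OF T1] by auto
 have "\<ominus>\<^bsub>PP\<^esub> (x, z) \<in> T" using subringE(5)[OF T1] xy(2) by blast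
 hence "(x, y) \<oplus>\<^bsub>PP\<^esub> (\<ominus>\<^bsub>PP\<^esub> (x, z)) \<in> T" using subringE(7)[OF T1] xy(1) by blast
 hence "(\<zero>, y \<ominus> z) \<in> T" using c by (simp add: PP_minus r_neg minus_eq)
 hence "y \<ominus> z = \<zero>" using T by (simp add: graph_hom_def)
 thus ?thesis using c by simp
qed

lemma graph_hom_domain:
 assumes T: "graph_hom T"
 shows "overfield (fst ` T)"
proof (rule subring_overfield)
 have T1: "subring T PP" using T by (simp add: graph_hom_def)
 note S = subringE[OF T1]
 show "K \<subseteq> fst ` T" using T by (force simp: graph_hom_def)
 show "subring (fst ` T) R"
 proof (rule subringI)
  show "fst ` T \<subseteq> C" using S(1) by auto
  show "\<one> \<in> fst ` T" using S(3) by (force simp: image_iff)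
  fix a b assume "a \<in> fst ` T" "b \<in> fst ` T"
  then obtain a' b' where ab: "(a, a') \<in> T" "(b, b') \<in> T" by auto
  hence c: "a \<in> C" "a' \<in> C" using S(1) by auto
  show "\<ominus> a \<in> fst ` T" using S(5)[OF ab(1)] c by (force simp: PP_minus)
  show "a \<oplus> b \<in> fst ` T" using S(7)[OF ab] by force
  show "a \<otimes> b \<in> fst ` T" using S(6)[OF ab] by force
 qed
qed

text \<open>The classical extension step inside the product ring. A list over \<open>T\<close> is a
  polynomial together with its image; \<open>p\<close> is a shortest monic one whose first component
  kills \<open>c\<close>, and \<open>d\<close> is a root of its image. The new graph arises by
  adjoining the pair \<open>(c, d)\<close>.\<close>

lemma graph_hom_extend:
 assumes T: "graph_hom T" and c: "c \<in> C"
 shows "\<exists>T' d. graph_hom T' \<and> T \<subseteq> T' \<and> (c, d) \<in> T'"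
proof -
 have T1: "subring T PP" using T by (simp add: graph_hom_def)
 note S = subringE[OF T1]
 have TC: "set q \<subseteq> T \<Longrightarrow> set q \<subseteq> C \<times> C" for q using S(1) by auto
 define P where "P p \<longleftrightarrow> set p \<subseteq> T \<and> p \<noteq> [] \<and> hd p = (\<one>, \<one>) \<and> eval (map fst p) c = \<zero>" for p
 obtain p0 where p0: "set p0 \<subseteq> K" "p0 \<noteq> []" "hd p0 = \<one>" "eval p0 c = \<zero>" using algebraic_K[OF c] by blast
 have "P (map (\<lambda>x. (x, x)) p0)"
  using p0 T by (auto simp: P_def graph_hom_def hd_map comp_def)
 define p where "p = arg_min length P"
 have p: "P p" "\<And>s. P s \<Longrightarrow> length p \<le> length s"
  using arg_min_natI[of P _ length] arg_min_nat_le[of P _ length] \<open>P (map (\<lambda>x. (x, x)) p0)\<close>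
  by (auto simp: p_def)
 \<comment> \<open>At the first nonzero entry the list is multiplied by a pair lying over the
   inverse of that entry. Single-valuedness forces the second component of the new leading pair to
   be one as well, so the minimality of \<open>p\<close> applies.\<close>
 have short: "set (map fst s) \<subseteq> {\<zero>}" if "set s \<subseteq> T" "length s < length p" "eval (map fst s) c = \<zero>" for s
  using that
 proof (induction s)
  case (Cons x s)
  obtain a b where x: "x = (a, b)" by (cases x)
  have ab: "(a, b) \<in> T" "a \<in> C" "b \<in> C" using Cons.prems(1) x S(1) by auto
  have sc: "set s \<subseteq> T" "set (map fst s) \<subseteq> C" using Cons.prems(1) TC[of s] by auto
  show ?case
  proof (cases "a = \<zero>")
   case True
   hence "eval (map fst s) c = \<zero>" using Cons.prems(3) c sc eval_in_carrier[OF sc(2) c] by (simp add: x)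
   thus ?thesis using Cons True x by simp
  next
   case False
   have "a \<in> fst ` T" using ab by force
   hence "inv a \<in> fst ` T" using subfield_inv_closed[OF overfieldD(1)[OF graph_hom_domain[OF T]]] False by blast
   then obtain b' where b': "(inv a, b') \<in> T" by auto
   have ic: "inv a \<in> C" "b' \<in> C" using b' S(1) by auto
   define r where "r = map (\<lambda>y. (inv a, b') \<otimes>\<^bsub>PP\<^esub> y) (x # s)"
   have fr: "map fst r = map (\<lambda>y. inv a \<otimes> y) (map fst (x # s))"
    using ic by (auto simp: r_def fst_PP_mult)
   have rT: "set r \<subseteq> T" using Cons.prems(1) b' S(6) by (auto simp: r_def)
   have "(\<one>, b' \<otimes> b) \<in> T" using S(6)[OF b' ab(1)] ab False by (simp add: field_Units)
   moreover have "(\<one>, \<one>) \<in> T" using S(3) by simp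
   ultimately have "b' \<otimes> b = \<one>" using graph_hom_single_valued[OF T] by blast
   hence "hd r = (\<one>, \<one>)" using ab False by (simp add: r_def x field_Units)
   moreover have "eval (map fst r) c = inv a \<otimes> eval (map fst (x # s)) c"
    unfolding fr by (rule eval_map_scale) (use ic c sc ab x in auto)
   hence "eval (map fst r) c = \<zero>" using Cons.prems(3) ic by simp
   ultimately have "P r" using rT by (auto simp: P_def r_def)
   hence "length p \<le> length r" by (rule p(2))
   thus ?thesis using Cons.prems(2) by (simp add: r_def)
  qed
 qed simp
 have pT: "set p \<subseteq> T" "p \<noteq> []" "hd p = (\<one>, \<one>)" "eval (map fst p) c = \<zero>" using p by (auto simp: P_def)
 have "2 \<le> length p"
 proof (rule ccontr)
  assume "\<not> 2 \<le> length p"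
  hence "p = [(\<one>, \<one>)]" using pT by (cases p; cases "tl p") auto
  thus False using pT(4) c by simp
 qed
 moreover have "hd (map snd p) = \<one>" using pT by (simp add: hd_map)
 moreover have "set (map snd p) \<subseteq> C" using TC[OF pT(1)] by auto
 ultimately obtain d where d: "d \<in> C" "eval (map snd p) d = \<zero>"
  using root_exists[of "map snd p"] by auto
 define T' where "T' = PP.simple_extension T (c, d)"
 have cd: "(c, d) \<in> carrier PP" using c d by simp
 have "subring T' PP" unfolding T'_def by (rule PP.simple_extension_closed[OF T1 cd])
 moreover have TT': "T \<subseteq> T'" unfolding T'_def using PP.simple_extension_incl[OF S(1) cd] .
 moreover have "y = \<zero>" if y: "(\<zero>, y) \<in> T'" for y
 proof -
  obtain q where q: "set q \<subseteq> T" "(\<zero>, y) = PP.eval q (c, d)"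
   using PP.simple_extension_eval[OF S(1) cd] y unfolding T'_def by blast
  \<comment> \<open>Reduction modulo \<open>p\<close> acts on both components at once. Minimality
    kills the first component of the remainder, and then the graph property kills the
    second.\<close>
  obtain q' where q': "set q' \<subseteq> T" "length q' < length p"
   "\<And>z. z \<in> carrier PP \<Longrightarrow> PP.eval p z = \<zero>\<^bsub>PP\<^esub> \<Longrightarrow> PP.eval q' z = PP.eval q z"
   using PP.monic_division[OF T1 pT(1,2) _ q(1)] pT by auto
  have "PP.eval p (c, d) = \<zero>\<^bsub>PP\<^esub>" using PP_eval[OF TC[OF pT(1)]] c d pT by simp
  hence e: "(\<zero>, y) = (eval (map fst q') c, eval (map snd q') d)"
   using q'(3)[OF cd] q(2) PP_eval[OF TC[OF q'(1)]] c d by simp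
  hence "set (map fst q') \<subseteq> {\<zero>}" using short[OF q'(1,2)] by simp
  hence "set (map snd q') \<subseteq> {\<zero>}" using q'(1) T by (fastforce simp: graph_hom_def)
  thus ?thesis using e eval_zeros d by simp
 qed
 moreover have "(c, d) \<in> T'" unfolding T'_def using PP.simple_extension_mem[OF T1 cd] .
 ultimately have "graph_hom T'" using T by (auto simp: graph_hom_def)
 thus ?thesis using TT' \<open>(c, d) \<in> T'\<close> by blast
qed

lemma graph_hom_Union:
 assumes ne: "\<C> \<noteq> {}" and gh: "\<And>T. T \<in> \<C> \<Longrightarrow> graph_hom T"
  and chain: "\<And>S T. S \<in> \<C> \<Longrightarrow> T \<in> \<C> \<Longrightarrow> S \<subseteq> T \<or> T \<subseteq> S"
 shows "graph_hom (\<Union>\<C>)"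
 unfolding graph_hom_def
proof (intro conjI ballI allI impI)
 have s: "T \<in> \<C> \<Longrightarrow> subring T PP" for T using gh by (simp add: graph_hom_def)
 show "subring (\<Union>\<C>) PP"
 proof (rule PP.subringI)
  show "\<Union>\<C> \<subseteq> carrier PP" using s subringE(1) by blast
  show "\<one>\<^bsub>PP\<^esub> \<in> \<Union>\<C>" using s subringE(3) ne by blast
  fix a b assume "a \<in> \<Union>\<C>" "b \<in> \<Union>\<C>"
  then obtain S T where "S \<in> \<C>" "T \<in> \<C>" "a \<in> S" "b \<in> T" by blast
  then obtain U where U: "U \<in> \<C>" "a \<in> U" "b \<in> U" using chain by blast
  show "\<ominus>\<^bsub>PP\<^esub> a \<in> \<Union>\<C>" using subringE(5)[OF s[OF U(1)] U(2)] U(1) by blast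
  show "a \<otimes>\<^bsub>PP\<^esub> b \<in> \<Union>\<C>" using subringE(6)[OF s[OF U(1)] U(2,3)] U(1) by blast
  show "a \<oplus>\<^bsub>PP\<^esub> b \<in> \<Union>\<C>" using subringE(7)[OF s[OF U(1)] U(2,3)] U(1) by blast
 qed
 fix x assume "x \<in> K"
 thus "(x, x) \<in> \<Union>\<C>" using ne gh by (auto simp: graph_hom_def)
next
 fix y assume "(\<zero>, y) \<in> \<Union>\<C>"
 thus "y = \<zero>" using gh by (auto simp: graph_hom_def)
qed

text \<open>Outside the carrier the functions are arbitrary, so different members may be the same
  automorphism of the field. Inverses are therefore characterised on the carrier only.\<close>

definition auts :: "'a set \<Rightarrow> ('a \<Rightarrow> 'a) set"
 where "auts E = {\<tau>. \<tau> \<in> ring_hom R R \<and> bij_betw \<tau> C C \<and> (\<forall>x\<in>E. \<tau> x = x)}"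

lemma finite_roots:
 assumes "set p \<subseteq> C" "p \<noteq> []" "hd p = \<one>"
 shows "finite {x \<in> C. eval p x = \<zero>}"
proof -
 obtain rs where "set rs \<subseteq> C" "p = linprod rs" using monic_splits[OF assms] by blast
 hence "{x \<in> C. eval p x = \<zero>} \<subseteq> set rs" using eval_linprod_zero_iff by auto
 thus ?thesis using finite_subset by blast
qed

lemma hom_eval:
 assumes "\<tau> \<in> ring_hom R R" "set p \<subseteq> C" "x \<in> C"
 shows "\<tau> (eval p x) = eval (map \<tau> p) (\<tau> x)"
proof -
 interpret h: ring_hom_ring R R \<tau>
  using assms(1) ring_axioms by (simp add: ring_hom_ringI2)
 have pow: "\<tau> (x [^] n) = \<tau> x [^] n" for n :: nat using assms(3) by (induction n) auto
 show ?thesis using assms(2)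
 proof (induction p)
  case (Cons a p)
  thus ?case using assms(3) eval_in_carrier[of p x] by (simp add: pow)
 qed simp
qed

text \<open>Surjectivity comes from algebraicity: every element is a root of some polynomial over
  \<open>K\<close>, and the homomorphism maps the finite set of its roots injectively into
  itself.\<close>

lemma hom_fixing_K_bij:
 assumes s: "\<tau> \<in> ring_hom R R" and fx: "\<And>x. x \<in> K \<Longrightarrow> \<tau> x = x"
 shows "bij_betw \<tau> C C"
proof -
 interpret h: ring_hom_ring R R \<tau>
  using s ring_axioms by (simp add: ring_hom_ringI2)
 have inj: "inj_on \<tau> C"
 proof (rule inj_onI)
  fix x y assume xy: "x \<in> C" "y \<in> C" "\<tau> x = \<tau> y"
  show "x = y"
  proof (rule ccontr)
   assume "x \<noteq> y"
   hence n: "x \<ominus> y \<noteq> \<zero>" "x \<ominus> y \<in> C" using xy by auto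
   have "\<tau> (x \<ominus> y) = \<tau> x \<ominus> \<tau> y" using xy by (simp add: minus_eq)
   hence "\<tau> (x \<ominus> y) = \<zero>" using xy by (simp add: minus_eq r_neg)
   moreover have "(x \<ominus> y) \<otimes> inv (x \<ominus> y) = \<one>" using n by (simp add: field_Units)
   moreover have "inv (x \<ominus> y) \<in> C" using n by (simp add: field_Units)
   ultimately have "\<tau> \<one> = \<zero>"
    using n h.hom_mult[of "x \<ominus> y" "inv (x \<ominus> y)"] by (metis h.hom_closed l_null)
   thus False by simp
  qed
 qed
 have "C \<subseteq> \<tau> ` C"
 proof
  fix y assume y: "y \<in> C"
  obtain p where p: "set p \<subseteq> K" "p \<noteq> []" "hd p = \<one>" "eval p y = \<zero>" using algebraic_K[OF y] by blast
  have pc: "set p \<subseteq> C" using p overfieldD(4)[OF overfield_K] by blast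
  define S where "S = {x \<in> C. eval p x = \<zero>}"
  have fin: "finite S" unfolding S_def by (rule finite_roots[OF pc p(2,3)])
  have mp: "map \<tau> p = p" using p fx by (simp add: map_idI subset_iff)
  have "\<tau> ` S \<subseteq> S"
   using hom_eval[OF s pc] mp by (auto simp: S_def) (metis h.hom_zero)
  hence "\<tau> ` S = S"
   using inj fin by (metis (no_types, lifting) S_def endo_inj_surj inj_on_subset mem_Collect_eq subsetI)
  thus "y \<in> \<tau> ` C" using y p by (auto simp: S_def)
 qed
 thus ?thesis using inj by (auto simp: bij_betw_def)
qed

text \<open>A maximal graph, which exists by Zorn's lemma, is defined everywhere, since otherwise
  one more element could be added to its domain.\<close>

lemma graph_hom_total:
 assumes T0: "graph_hom T0"
 shows "\<exists>\<tau>. \<tau> \<in> ring_hom R R \<and> (\<forall>x y. (x, y) \<in> T0 \<longrightarrow> \<tau> x = y)"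
proof -
 define A where "A = {T. graph_hom T \<and> T0 \<subseteq> T}"
 have "\<exists>M\<in>A. \<forall>Y\<in>A. M \<subseteq> Y \<longrightarrow> Y = M"
 proof (rule subset_Zorn_nonempty)
  show "A \<noteq> {}" using T0 by (auto simp: A_def)
  fix \<C> assume C: "\<C> \<noteq> {}" "subset.chain A \<C>"
  hence CA: "\<C> \<subseteq> A" "\<And>S T. S \<in> \<C> \<Longrightarrow> T \<in> \<C> \<Longrightarrow> S \<subseteq> T \<or> T \<subseteq> S"
   by (auto simp: subset_chain_def)
  have "graph_hom (\<Union>\<C>)"
  proof (rule graph_hom_Union[OF C(1)])
   show "graph_hom T" if "T \<in> \<C>" for T using CA(1) that by (auto simp: A_def)
  qed (use CA(2) in blast)
  moreover have "T0 \<subseteq> \<Union>\<C>" using C(1) CA(1) by (auto simp: A_def)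
  ultimately show "\<Union>\<C> \<in> A" by (simp add: A_def)
 qed
 then obtain M where M: "M \<in> A" "\<And>Y. Y \<in> A \<Longrightarrow> M \<subseteq> Y \<Longrightarrow> Y = M" by blast
 hence g: "graph_hom M" and T0M: "T0 \<subseteq> M" by (auto simp: A_def)
 have M1: "subring M PP" using g by (simp add: graph_hom_def)
 have total: "\<exists>d. (c, d) \<in> M" if c: "c \<in> C" for c
 proof -
  obtain T' d where T': "graph_hom T'" "M \<subseteq> T'" "(c, d) \<in> T'" using graph_hom_extend[OF g c] by blast
  hence "T' = M" using M(2)[of T'] T0M by (auto simp: A_def)
  thus ?thesis using T'(3) by (intro exI[of _ d]) simp
 qed
 define \<tau> where "\<tau> x = (THE y. (x, y) \<in> M)" for x
 have sig: "\<tau> x = y" if "(x, y) \<in> M" for x y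
  unfolding \<tau>_def 
  using graph_hom_single_valued[OF g _ that] that by (intro the_equality)
 have sigM: "(x, \<tau> x) \<in> M" if "x \<in> C" for x
 proof -
  have "\<exists>d. (x, d) \<in> M" by (rule total[OF that])
  then obtain d where d: "(x, d) \<in> M" by (rule exE)
  thus ?thesis using sig[OF d] by simp
 qed
 have "\<tau> \<in> ring_hom R R"
 proof (rule ring_hom_memI)
  fix x y assume xy: "x \<in> C" "y \<in> C"
  show "\<tau> x \<in> C" using sigM[OF xy(1)] subringE(1)[OF M1] by auto
  show "\<tau> (x \<otimes> y) = \<tau> x \<otimes> \<tau> y" using subringE(6)[OF M1 sigM[OF xy(1)] sigM[OF xy(2)]] sig by simp
  show "\<tau> (x \<oplus> y) = \<tau> x \<oplus> \<tau> y" using subringE(7)[OF M1 sigM[OF xy(1)] sigM[OF xy(2)]] sig by simp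
 next
  show "\<tau> \<one> = \<one>" using subringE(3)[OF M1] sig by simp
 qed
 moreover have "\<tau> x = y" if "(x, y) \<in> T0" for x y using that T0M sig by auto
 ultimately show ?thesis by (intro exI[of _ \<tau>]) simp
qed

text \<open>Evaluating polynomials over \<open>E\<close> at the pair \<open>(a, b)\<close> gives a
  subring of the product ring. The assumption says that it is a graph, and a total extension of it
  is the automorphism.\<close>

theorem conjugation_exists:
 assumes E: "overfield E" and ab: "a \<in> C" "b \<in> C"
  and vanish: "\<And>h. set h \<subseteq> E \<Longrightarrow> eval h a = \<zero> \<Longrightarrow> eval h b = \<zero>"
 shows "\<exists>\<tau>\<in>auts E. \<tau> a = b"
proof -
 note EE = overfieldD[OF E]
 define D where "D = (\<lambda>x. (x, x)) ` E"
 have D: "subring D PP"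
 proof (rule PP.subringI)
  show "D \<subseteq> carrier PP" using EE(4) unfolding D_def PP_simps by blast
  show "\<one>\<^bsub>PP\<^esub> \<in> D" using subringE(3)[OF EE(3)] by (simp add: D_def)
  fix x y assume "x \<in> D" "y \<in> D"
  then obtain x' y' where xy: "x = (x', x')" "y = (y', y')" "x' \<in> E" "y' \<in> E" by (auto simp: D_def)
  hence c: "x' \<in> C" using EE by blast
  show "\<ominus>\<^bsub>PP\<^esub> x \<in> D" using xy c subringE(5)[OF EE(3)] by (simp add: D_def PP_minus image_iff)
  show "x \<otimes>\<^bsub>PP\<^esub> y \<in> D" "x \<oplus>\<^bsub>PP\<^esub> y \<in> D"
   using xy subringE(6,7)[OF EE(3)] by (simp_all add: D_def image_iff)
 qed
 have DC: "D \<subseteq> carrier PP" using subringE(1)[OF D] .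
 have abc: "(a, b) \<in> carrier PP" using ab by simp
 define T where "T = PP.simple_extension D (a, b)"
 have DT: "D \<subseteq> T" unfolding T_def using PP.simple_extension_incl[OF DC abc] .
 have "y = \<zero>" if t: "(\<zero>, y) \<in> T" for y
 proof -
  obtain q where q: "set q \<subseteq> D" "(\<zero>, y) = PP.eval q (a, b)"
   using PP.simple_extension_eval[OF DC abc t[unfolded T_def]] by (elim exE conjE)
  have m: "map snd q = map fst q" using q(1) by (auto simp: D_def)
  have f: "set (map fst q) \<subseteq> E" using q(1) by (auto simp: D_def)
  have "set q \<subseteq> C \<times> C" using q(1) DC by auto
  hence e: "eval (map fst q) a = \<zero>" "y = eval (map fst q) b"
   using PP_eval[of q a b] q(2) ab unfolding m by auto
  show ?thesis unfolding e(2) by (rule vanish[OF f e(1)])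
 qed
 moreover have "subring T PP" unfolding T_def by (rule PP.simple_extension_closed[OF D abc])
 moreover have "(x, x) \<in> T" if "x \<in> K" for x using that DT EE(2) by (auto simp: D_def)
 ultimately have "graph_hom T" by (simp add: graph_hom_def)
 then obtain \<tau> where s: "\<tau> \<in> ring_hom R R" "\<And>x y. (x, y) \<in> T \<Longrightarrow> \<tau> x = y"
  by (metis graph_hom_total)
 have fx: "\<tau> x = x" if "x \<in> E" for x
 proof (rule s(2))
  show "(x, x) \<in> T" using DT that by (auto simp: D_def)
 qed
 have "(a, b) \<in> T" unfolding T_def by (rule PP.simple_extension_mem[OF D abc])
 hence "\<tau> a = b" by (rule s(2))
 moreover have "bij_betw \<tau> C C"
 proof (rule hom_fixing_K_bij[OF s(1)])
  show "\<tau> x = x" if "x \<in> K" for x using fx[of x] that EE(2) by auto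
 qed
 hence "\<tau> \<in> auts E" unfolding auts_def using s(1) fx by simp
 ultimately show ?thesis by (intro bexI[of _ \<tau>])
qed

end

section \<open>Valuation rings\<close>

text \<open>
 A valuation is handled through its valuation ring \<open>A\<close> only: \<open>vle A x y\<close> stands for
 \<open>v x \<le> v y\<close>, with \<open>v 0 = \<infinity>\<close>.
\<close>

context field
begin

definition valring :: "'a set \<Rightarrow> bool"
 where "valring A \<longleftrightarrow> subring A R \<and> (\<forall>x\<in>C. x \<noteq> \<zero> \<longrightarrow> x \<in> A \<or> inv x \<in> A)"

definition vle :: "'a set \<Rightarrow> 'a \<Rightarrow> 'a \<Rightarrow> bool"
 where "vle A x y \<longleftrightarrow> (\<exists>z\<in>A. y = x \<otimes> z)"

definition veq :: "'a set \<Rightarrow> 'a \<Rightarrow> 'a \<Rightarrow> bool"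
 where "veq A x y \<longleftrightarrow> vle A x y \<and> vle A y x"

text \<open>By totality the negation is the strict inequality of values. In particular
  \<open>vlt A \<one> x\<close> says that \<open>x\<close> is in the maximal ideal of
  \<open>A\<close>, and this includes \<open>x = \<zero>\<close>.\<close>

definition vlt :: "'a set \<Rightarrow> 'a \<Rightarrow> 'a \<Rightarrow> bool"
 where "vlt A x y \<longleftrightarrow> \<not> vle A y x"

lemma inv_simps [simp]:
 assumes "x \<in> C" "x \<noteq> \<zero>"
 shows "inv x \<in> C" "x \<otimes> inv x = \<one>" "inv x \<otimes> x = \<one>" "inv x \<noteq> \<zero>"
proof -
 have u: "x \<in> Units R" using assms by (simp add: field_Units)
 show "inv x \<in> C" "x \<otimes> inv x = \<one>" "inv x \<otimes> x = \<one>" using u by auto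
 thus "inv x \<noteq> \<zero>" using assms by (metis r_null zero_not_one)
qed

lemma mult_inv_cancel [simp]:
 assumes "x \<in> C" "x \<noteq> \<zero>" "y \<in> C"
 shows "x \<otimes> (inv x \<otimes> y) = y" "inv x \<otimes> (x \<otimes> y) = y" "y \<otimes> inv x \<otimes> x = y" "y \<otimes> x \<otimes> inv x = y"
 using assms by (simp_all add: m_assoc flip: m_assoc[of x] m_assoc[of "inv x"])

lemma pow_nonzero [simp]: "x \<in> C \<Longrightarrow> x \<noteq> \<zero> \<Longrightarrow> x [^] (n::nat) \<noteq> \<zero>"
 using pow_eq_zero_imp by blast

context
 fixes A assumes A: "valring A"
begin

lemma valring_subring: "subring A R"
 and valring_total: "x \<in> C \<Longrightarrow> x \<noteq> \<zero> \<Longrightarrow> x \<in> A \<or> inv x \<in> A"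
 using A by (auto simp: valring_def)

lemma valring_carrier: "x \<in> A \<Longrightarrow> x \<in> C"
 using subringE(1)[OF valring_subring] by blast

lemma valring_closed:
 "\<zero> \<in> A" "\<one> \<in> A" "x \<in> A \<Longrightarrow> \<ominus> x \<in> A" "x \<in> A \<Longrightarrow> y \<in> A \<Longrightarrow> x \<oplus> y \<in> A" "x \<in> A \<Longrightarrow> y \<in> A \<Longrightarrow> x \<otimes> y \<in> A"
 using subringE[OF valring_subring] by auto

lemma vle_iff_div:
 assumes "x \<in> C" "y \<in> C" "x \<noteq> \<zero>"
 shows "vle A x y \<longleftrightarrow> inv x \<otimes> y \<in> A"
proof
 assume "vle A x y"
 then obtain z where "z \<in> A" "y = x \<otimes> z" by (auto simp: vle_def)
 thus "inv x \<otimes> y \<in> A" using assms valring_carrier by simp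
next
 assume "inv x \<otimes> y \<in> A"
 moreover have "y = x \<otimes> (inv x \<otimes> y)" using assms by simp
 ultimately show "vle A x y" unfolding vle_def by blast
qed

lemma vle_one_iff: "x \<in> C \<Longrightarrow> vle A \<one> x \<longleftrightarrow> x \<in> A"
 by (auto simp: vle_def valring_carrier intro!: bexI[of _ x])

lemma vle_zero: "x \<in> C \<Longrightarrow> vle A x \<zero>"
 by (auto simp: vle_def valring_closed intro!: bexI[of _ \<zero>])

lemma zero_vle_iff: "y \<in> C \<Longrightarrow> vle A \<zero> y \<longleftrightarrow> y = \<zero>"
 using valring_closed(1) valring_carrier by (auto simp: vle_def)

lemma vle_refl: "x \<in> C \<Longrightarrow> vle A x x"
 by (auto simp: vle_def valring_closed intro!: bexI[of _ \<one>])

lemma vle_trans: "vle A x y \<Longrightarrow> vle A y z \<Longrightarrow> x \<in> C \<Longrightarrow> vle A x z"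
 unfolding vle_def by (metis m_assoc valring_carrier valring_closed(5))

lemma vle_total:
 assumes "x \<in> C" "y \<in> C"
 shows "vle A x y \<or> vle A y x"
proof (cases "x = \<zero> \<or> y = \<zero>")
 case True
 thus ?thesis using vle_zero assms by blast
next
 case False
 define w where "w = inv x \<otimes> y"
 have w: "w \<in> C" "w \<noteq> \<zero>" "y = x \<otimes> w"
  using False assms by (auto simp: w_def integral_iff)
 have "x = y \<otimes> inv w" using w assms by (simp add: m_assoc)
 thus ?thesis using valring_total[OF w(1,2)] w(3) by (auto simp: vle_def)
qed

lemma vle_mult:
 assumes "vle A x y" "x \<in> C" "z \<in> C"
 shows "vle A (z \<otimes> x) (z \<otimes> y)"
 using assms valring_carrier unfolding vle_def by (metis m_assoc)

lemma vle_mult2: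
 assumes "vle A x y" "vle A x' y'" "x \<in> C" "x' \<in> C" "y \<in> C"
 shows "vle A (x \<otimes> x') (y \<otimes> y')"
proof -
 have "vle A (x' \<otimes> x) (x' \<otimes> y)" "vle A (y \<otimes> x') (y \<otimes> y')"
  using assms vle_mult by auto
 thus ?thesis using vle_trans[of "x \<otimes> x'" "y \<otimes> x'"] assms by (simp add: m_comm)
qed

lemma vle_cancel:
 assumes "vle A (z \<otimes> x) (z \<otimes> y)" "x \<in> C" "y \<in> C" "z \<in> C" "z \<noteq> \<zero>"
 shows "vle A x y"
 using vle_mult[OF assms(1), of "inv z"] assms by simp

lemma vle_add:
 assumes "vle A x y" "vle A x z" "x \<in> C"
 shows "vle A x (y \<oplus> z)"
proof -
 obtain u v where "u \<in> A" "v \<in> A" "y = x \<otimes> u" "z = x \<otimes> v" using assms by (auto simp: vle_def)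
 hence "y \<oplus> z = x \<otimes> (u \<oplus> v)" "u \<oplus> v \<in> A"
  using assms valring_carrier valring_closed(4) by (auto simp: r_distr)
 thus ?thesis by (auto simp: vle_def)
qed

lemma vle_minus:
 assumes "vle A x y" "x \<in> C"
 shows "vle A x (\<ominus> y)"
proof -
 obtain u where "u \<in> A" "y = x \<otimes> u" using assms by (auto simp: vle_def)
 hence "\<ominus> y = x \<otimes> (\<ominus> u)" "\<ominus> u \<in> A"
  using assms valring_carrier valring_closed(3) by (auto simp: r_minus)
 thus ?thesis by (auto simp: vle_def)
qed

lemma vle_nat_pow:
 assumes "vle A x y" "x \<in> C" "y \<in> C"
 shows "vle A (x [^] (n::nat)) (y [^] n)"
 using assms by (induction n) (auto simp: vle_refl intro!: vle_mult2)

lemma vlt_imp_vle: "vlt A x y \<Longrightarrow> x \<in> C \<Longrightarrow> y \<in> C \<Longrightarrow> vle A x y"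
 using vle_total by (auto simp: vlt_def)

lemma vlt_vle_trans: "vlt A x y \<Longrightarrow> vle A y z \<Longrightarrow> z \<in> C \<Longrightarrow> y \<in> C \<Longrightarrow> vlt A x z"
 unfolding vlt_def using vle_trans by blast

lemma vle_vlt_trans: "vle A x y \<Longrightarrow> vlt A y z \<Longrightarrow> z \<in> C \<Longrightarrow> vlt A x z"
 unfolding vlt_def using vle_trans by blast

lemma vlt_trans: "vlt A x y \<Longrightarrow> vlt A y z \<Longrightarrow> x \<in> C \<Longrightarrow> y \<in> C \<Longrightarrow> z \<in> C \<Longrightarrow> vlt A x z"
 using vlt_vle_trans vlt_imp_vle by blast

lemma vlt_irrefl: "x \<in> C \<Longrightarrow> \<not> vlt A x x"
 by (simp add: vlt_def vle_refl)

lemma vlt_zero: "x \<in> C \<Longrightarrow> vlt A x \<zero> \<longleftrightarrow> x \<noteq> \<zero>"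
 by (simp add: vlt_def zero_vle_iff)

lemma vlt_add:
 assumes "vlt A x y" "vlt A x z" "x \<in> C" "y \<in> C" "z \<in> C"
 shows "vlt A x (y \<oplus> z)"
proof -
 have "vle A y (y \<oplus> z) \<or> vle A z (y \<oplus> z)"
  using vle_total[OF assms(4,5)] vle_add vle_refl assms by blast
 thus ?thesis using vlt_vle_trans assms by auto
qed

lemma vlt_minus:
 assumes "vlt A x y" "x \<in> C" "y \<in> C"
 shows "vlt A x (\<ominus> y)"
proof -
 have "vle A y (\<ominus> y)" using vle_minus vle_refl assms by blast
 thus ?thesis using vlt_vle_trans assms by auto
qed

lemma vlt_mult_iff:
 assumes "x \<in> C" "y \<in> C" "z \<in> C" "z \<noteq> \<zero>"
 shows "vlt A (z \<otimes> x) (z \<otimes> y) \<longleftrightarrow> vlt A x y"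
 unfolding vlt_def using vle_mult vle_cancel assms by blast

lemma veq_refl: "x \<in> C \<Longrightarrow> veq A x x"
 by (simp add: veq_def vle_refl)

lemma veq_sym: "veq A x y \<Longrightarrow> veq A y x"
 by (simp add: veq_def)

lemma veq_trans: "veq A x y \<Longrightarrow> veq A y z \<Longrightarrow> x \<in> C \<Longrightarrow> z \<in> C \<Longrightarrow> veq A x z"
 unfolding veq_def using vle_trans by blast

lemma veq_mult: "veq A x y \<Longrightarrow> x \<in> C \<Longrightarrow> y \<in> C \<Longrightarrow> z \<in> C \<Longrightarrow> veq A (z \<otimes> x) (z \<otimes> y)"
 unfolding veq_def using vle_mult by blast

lemma veq_mult2:
 "veq A x y \<Longrightarrow> veq A x' y' \<Longrightarrow> x \<in> C \<Longrightarrow> x' \<in> C \<Longrightarrow> y \<in> C \<Longrightarrow> y' \<in> C \<Longrightarrow>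
  veq A (x \<otimes> x') (y \<otimes> y')"
 unfolding veq_def using vle_mult2 by blast

lemma veq_nat_pow: "veq A x y \<Longrightarrow> x \<in> C \<Longrightarrow> y \<in> C \<Longrightarrow> veq A (x [^] (n::nat)) (y [^] n)"
 unfolding veq_def using vle_nat_pow by blast

lemma veq_nonzero: "veq A x y \<Longrightarrow> x \<in> C \<Longrightarrow> y \<in> C \<Longrightarrow> x = \<zero> \<longleftrightarrow> y = \<zero>"
 using zero_vle_iff by (auto simp: veq_def)

lemma veq_or_vlt: "x \<in> C \<Longrightarrow> y \<in> C \<Longrightarrow> veq A x y \<or> vlt A x y \<or> vlt A y x"
 by (auto simp: veq_def vlt_def)

lemma veq_add:
 assumes "vlt A x y" "x \<in> C" "y \<in> C"
 shows "veq A x (x \<oplus> y)"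
proof -
 have 1: "vle A x (x \<oplus> y)" using vle_add vle_refl vlt_imp_vle assms by blast
 have "\<not> vlt A x (x \<oplus> y)"
 proof
  assume "vlt A x (x \<oplus> y)"
  hence "vlt A x ((x \<oplus> y) \<oplus> \<ominus> y)" using vlt_add vlt_minus assms by simp
  moreover have "(x \<oplus> y) \<oplus> \<ominus> y = x" using assms by algebra
  ultimately show False using vlt_irrefl assms by simp
 qed
 thus ?thesis using 1 by (simp add: veq_def vlt_def)
qed

lemma veq_inv:
 assumes "veq A x y" "x \<in> C" "y \<in> C" "x \<noteq> \<zero>"
 shows "veq A (inv x) (inv y)"
proof -
 have y: "y \<noteq> \<zero>" using veq_nonzero assms by blast
 have "veq A ((inv x \<otimes> inv y) \<otimes> y) ((inv x \<otimes> inv y) \<otimes> x)"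
  using assms y veq_sym by (intro veq_mult) auto
 moreover have "(inv x \<otimes> inv y) \<otimes> x = inv y" using assms y by (simp add: m_comm[of "inv x"] m_assoc)
 ultimately show ?thesis using assms y by simp
qed

lemma unit_in: "veq A \<one> x \<Longrightarrow> x \<in> C \<Longrightarrow> x \<in> A \<and> inv x \<in> A \<and> x \<noteq> \<zero>"
 using veq_inv[of \<one> x] veq_nonzero[of \<one> x] by (auto simp: veq_def vle_one_iff)

lemma vlt_one_mult:
 assumes "vlt A \<one> x" "y \<in> A" "x \<in> C"
 shows "vlt A \<one> (x \<otimes> y)"
proof -
 have "vle A x (x \<otimes> y)" using assms by (auto simp: vle_def)
 thus ?thesis using vlt_vle_trans assms valring_carrier by auto
qed

lemma vlt_one_in: "vlt A \<one> x \<Longrightarrow> x \<in> C \<Longrightarrow> x \<in> A"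
 using vlt_imp_vle[of \<one> x] vle_one_iff by auto

lemma not_in_iff: "x \<in> C \<Longrightarrow> x \<notin> A \<longleftrightarrow> vlt A x \<one>"
 by (simp add: vlt_def vle_one_iff)

lemma in_cases: "x \<in> A \<Longrightarrow> veq A \<one> x \<or> vlt A \<one> x"
 using vle_one_iff valring_carrier by (auto simp: veq_def vlt_def)

lemma vlt_finsum:
 assumes "finite I" "f \<in> I \<rightarrow> C" "x \<in> C" "x \<noteq> \<zero>" "\<And>i. i \<in> I \<Longrightarrow> vlt A x (f i)"
 shows "vlt A x (finsum R f I)"
 using assms
proof (induction rule: finite_induct)
 case (insert i I)
 have "f \<in> I \<rightarrow> C" using insert by (auto simp: Pi_def)
 thus ?case using insert by (auto intro!: vlt_add finsum_closed)
qed (auto simp: vlt_zero)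

text \<open>By \<open>indep\<close> the nonzero monomials have pairwise different values, so the
  value of the polynomial is that of one of them and the polynomial cannot vanish at
  \<open>x\<close>. This is the source of the torsion of value groups in algebraic
  extensions.\<close>

lemma vle_algebraic:
 assumes E: "subring E R" and x: "x \<in> C" "x \<noteq> \<zero>"
  and indep: "\<And>a b (k::nat). a \<in> E \<Longrightarrow> b \<in> E \<Longrightarrow> a \<noteq> \<zero> \<Longrightarrow> b \<noteq> \<zero> \<Longrightarrow> 0 < k \<Longrightarrow> \<not> veq A (a \<otimes> x [^] k) b"
  and p: "set p \<subseteq> E" "\<not> set p \<subseteq> {\<zero>}"
 shows "\<exists>c\<in>E. \<exists>j<length p. c \<noteq> \<zero> \<and> veq A (eval p x) (c \<otimes> x [^] j)"
 using p
proof (induction p)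
 case (Cons a p)
 have ER: "E \<subseteq> C" using subringE(1)[OF E] .
 have a: "a \<in> E" "a \<in> C" using Cons.prems ER by auto
 have pc: "set p \<subseteq> C" "set p \<subseteq> E" using Cons.prems ER by auto
 have e: "eval p x \<in> C" using eval_in_carrier pc x by simp
 have xc: "x [^] n \<in> C" "x [^] n \<noteq> \<zero>" for n :: nat using x by auto
 have ev: "eval (a # p) x = a \<otimes> x [^] length p \<oplus> eval p x" by simp
 show ?case
 proof (cases "set p \<subseteq> {\<zero>}")
  case True
  hence "eval p x = \<zero>" using eval_zeros x by simp
  hence "eval (a # p) x = a \<otimes> x [^] length p" using ev a xc by simp
  moreover have "a \<noteq> \<zero>" using Cons.prems True by auto
  ultimately show ?thesis using a xc veq_refl[of "a \<otimes> x [^] length p"]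
   by (intro bexI[of _ a] exI[of _ "length p"]) auto
 next
  case False
  then obtain c j where cj: "c \<in> E" "j < length p" "c \<noteq> \<zero>" "veq A (eval p x) (c \<otimes> x [^] j)"
   using Cons.IH pc by blast
  have c: "c \<in> C" using cj ER by auto
  show ?thesis
  proof (cases "a = \<zero>")
   case True
   hence "eval (a # p) x = eval p x" using ev e xc by simp
   thus ?thesis using cj by (intro bexI[of _ c] exI[of _ j]) auto
  next
   case a0: False
   define t where "t = a \<otimes> x [^] length p"
   have t: "t \<in> C" using a xc by (simp add: t_def)
   \<comment> \<open>Otherwise two monomials of different degrees would have equal value, and
     dividing by the lower power of \<open>x\<close> would contradict \<open>indep\<close>.\<close>
   have "\<not> veq A t (eval p x)"
   proof
    assume "veq A t (eval p x)"
    hence "veq A t (c \<otimes> x [^] j)" using veq_trans cj(4) t c xc by blast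
    moreover have "t = x [^] j \<otimes> (a \<otimes> x [^] (length p - j))"
     using x a cj(2) nat_pow_mult[OF x(1), of j "length p - j"] by (simp add: t_def m_lcomm)
    moreover have "c \<otimes> x [^] j = x [^] j \<otimes> c" using c xc by (simp add: m_comm)
    ultimately have "veq A (x [^] j \<otimes> (a \<otimes> x [^] (length p - j))) (x [^] j \<otimes> c)" by simp
    hence "veq A (a \<otimes> x [^] (length p - j)) c"
     using vle_cancel[of "x [^] j"] c a xc unfolding veq_def by auto
    thus False using indep[OF a(1) cj(1) a0 cj(3), of "length p - j"] cj(2) by simp
   qed
   then consider "vlt A t (eval p x)" | "vlt A (eval p x) t" using veq_or_vlt t e by blast
   thus ?thesis
   proof cases
    case 1
    hence "veq A (eval (a # p) x) t" using veq_add[OF 1 t e] ev veq_sym by (simp add: t_def)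
    thus ?thesis using a a0 unfolding t_def by (intro bexI[of _ a] exI[of _ "length p"]) auto
   next
    case 2
    hence "veq A (eval (a # p) x) (eval p x)"
     using veq_add[OF 2 e t] ev veq_sym e t by (simp add: t_def a_comm)
    hence "veq A (eval (a # p) x) (c \<otimes> x [^] j)"
     using veq_trans cj(4) c xc t e ev by (metis a_closed m_closed t_def)
    thus ?thesis using cj by (intro bexI[of _ c] exI[of _ j]) auto
   qed
  qed
 qed
qed simp

end

text \<open>\<open>geo y k\<close> is 1 + y + ... + y^(k-1), so \<open>geo y (Suc k)\<close> has
  degree \<open>k\<close> in \<open>y\<close>. What is really wanted is its inverse, which is
  integral everywhere and detects where \<open>y\<close> is not.\<close>

primrec geo :: "'a \<Rightarrow> nat \<Rightarrow> 'a"
 where "geo y 0 = \<zero>"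
 | "geo y (Suc k) = \<one> \<oplus> y \<otimes> geo y k"

lemma geo_closed [simp]: "y \<in> C \<Longrightarrow> geo y k \<in> C"
 by (induction k) auto

lemma geo_in_subring: "subring A R \<Longrightarrow> y \<in> A \<Longrightarrow> geo y k \<in> A"
 by (induction k) (auto simp: subringE)

lemma geo_add: "y \<in> C \<Longrightarrow> geo y (a + b) = geo y a \<oplus> y [^] a \<otimes> geo y b"
proof (induction a)
 case (Suc a)
 define u v w where "u = geo y a" and "v = geo y b" and "w = y [^] a"
 have c: "u \<in> C" "v \<in> C" "w \<in> C" using Suc by (auto simp: u_def v_def w_def)
 have "geo y (Suc a + b) = \<one> \<oplus> y \<otimes> (u \<oplus> w \<otimes> v)" using Suc by (simp add: u_def v_def w_def)
 also have "\<dots> = (\<one> \<oplus> y \<otimes> u) \<oplus> (w \<otimes> y) \<otimes> v" using c Suc.prems by algebra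
 finally show ?case by (simp add: u_def v_def w_def)
qed simp

lemma geo_multiple:
 assumes A: "valring A" and y: "y \<in> A" and a: "vlt A \<one> (geo y a)"
 shows "vlt A \<one> (geo y (q * a))"
proof (induction q)
 case 0
 thus ?case by (simp add: vlt_zero[OF A])
next
 case (Suc q)
 have yc: "y \<in> C" using valring_carrier[OF A y] .
 have "y [^] a \<in> A" using y valring_closed[OF A] by (induction a) auto
 hence "vlt A \<one> (geo y (q * a) \<otimes> y [^] a)" using vlt_one_mult[OF A Suc] yc by simp
 hence "vlt A \<one> (y [^] a \<otimes> geo y (q * a))" using yc by (simp add: m_comm)
 hence "vlt A \<one> (geo y (a + q * a))"
  unfolding geo_add[OF yc] using vlt_add[OF A a] yc by simp
 thus ?case by simp
qed

text \<open>
 The exponents \<open>a\<close> for which \<open>1 + y + \<dots> + y\<^sup>a\<^sup>-\<^sup>1\<close> is a nonunit are closed under multiples, so one more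
 than a common multiple of such exponents works for all pairs simultaneously.
\<close>

lemma common_geo_exponent:
 assumes fin: "finite P" and P: "\<And>A y. (A, y) \<in> P \<Longrightarrow> valring A \<and> y \<in> C"
 shows "\<exists>k\<ge>l. \<forall>(A, y)\<in>P. y \<in> A \<longrightarrow> veq A \<one> (geo y (Suc k))"
proof -
 define bad where "bad A y b \<longleftrightarrow> b > 0 \<and> vlt A \<one> (geo y b)" for A y b
 \<comment> \<open>One exponent with a nonunit sum for each pair; where there is none, the default 1
   leaves the product unchanged.\<close>
 define c where "c p = (if \<exists>b. bad (fst p) (snd p) b then SOME b. bad (fst p) (snd p) b else 1)" for p
 have c0: "c p > 0" for p using someI_ex[of "bad (fst p) (snd p)"] by (auto simp: c_def bad_def)
 \<comment> \<open>The factor \<open>Suc l\<close> only makes \<open>k\<close> large enough.\<close>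
 define k where "k = Suc l * (\<Prod>p\<in>P. c p)"
 have "k \<ge> l"
 proof -
  have "(\<Prod>p\<in>P. c p) \<ge> 1" using c0 by (simp add: Suc_leI prod_pos)
  hence "Suc l * 1 \<le> k" unfolding k_def by (intro mult_le_mono) auto
  thus ?thesis by simp
 qed
 moreover have "veq A \<one> (geo y (Suc k))" if Ay: "(A, y) \<in> P" "y \<in> A" for A y
 proof -
  have A: "valring A" and yc: "y \<in> C" using P Ay by auto
  have gA: "geo y (Suc k) \<in> A" using geo_in_subring[OF valring_subring[OF A] Ay(2)] .
  show ?thesis
  proof (cases "\<exists>b. bad A y b")
   case True
   hence "bad A y (c (A, y))" using someI_ex[OF True] by (auto simp: c_def)
   moreover have "c (A, y) dvd k" unfolding k_def using fin Ay(1) by (simp add: dvd_prodI)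
   then obtain q where "k = q * c (A, y)" by (metis dvd_def mult.commute)
   ultimately have "vlt A \<one> (geo y k)" using geo_multiple[OF A Ay(2)] by (auto simp: bad_def)
   \<comment> \<open>\<open>geo y (Suc k)\<close> is 1 plus this nonunit, hence a unit.\<close>
   hence "vlt A \<one> (geo y k \<otimes> y)" using vlt_one_mult[OF A _ Ay(2)] yc by simp
   thus ?thesis using veq_add[OF A, of \<one> "y \<otimes> geo y k"] yc by (simp add: m_comm)
  next
   case False
   hence "\<not> vlt A \<one> (geo y (Suc k))" by (auto simp: bad_def)
   thus ?thesis using in_cases[OF A gA] by blast
  qed
 qed
 ultimately show ?thesis by (intro exI[of _ k]) auto
qed

text \<open>The powers of an element outside the ring have strictly decreasing values, so the top
  term determines the value of the sum.\<close>

lemma geo_outside: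
 assumes A: "valring A" and y: "y \<in> C" "y \<notin> A"
 shows "veq A (y [^] k) (geo y (Suc k))"
proof (induction k)
 case 0
 thus ?case using y by (simp add: veq_refl[OF A])
next
 case (Suc k)
 have "vlt A y \<one>" using not_in_iff[OF A] y by simp
 have "vle A y \<one>" using vlt_imp_vle[OF A] \<open>vlt A y \<one>\<close> y by simp
 have vk: "vle A (y [^] n) \<one>" for n :: nat
  using vle_nat_pow[OF A \<open>vle A y \<one>\<close> y(1), of n] by simp
 have "vlt A (y [^] k \<otimes> y) (y [^] k \<otimes> \<one>)"
  using vlt_mult_iff[OF A y(1) one_closed, of "y [^] k"] \<open>vlt A y \<one>\<close> y valring_closed(1)[OF A]
   by (metis nat_pow_closed pow_nonzero)
 hence "vlt A (y [^] Suc k) \<one>" using vlt_vle_trans[OF A _ vk[of k]] y by simp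
 moreover have g: "veq A (y [^] Suc k) (y \<otimes> geo y (Suc k))"
  using veq_mult[OF A Suc, of y] y by (simp add: m_comm)
 ultimately have "vlt A (y \<otimes> geo y (Suc k)) \<one>"
  using vle_vlt_trans[OF A] y by (auto simp: veq_def)
 hence "veq A (y \<otimes> geo y (Suc k)) (\<one> \<oplus> y \<otimes> geo y (Suc k))"
  using veq_add[OF A, of "y \<otimes> geo y (Suc k)" \<one>] y by (simp add: a_comm del: geo.simps)
 hence "veq A (y [^] Suc k) (\<one> \<oplus> y \<otimes> geo y (Suc k))"
  using veq_trans[OF A g] y by (auto simp del: geo.simps nat_pow_Suc)
 thus ?case by (simp only: geo.simps)
qed

text \<open>Where \<open>y\<close> is integral, the inverse is a unit by assumption; elsewhere its
  value is that of the inverse of \<open>y [^] k\<close>. A factor \<open>y [^] j\<close> is thus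
  absorbed up to \<open>j = k\<close>, with room to spare for \<open>j < k\<close>. The applications
  take \<open>j\<close> to be 0 or 1 and therefore ask for \<open>k \<ge> 1\<close>.\<close>

lemma geo_inverse_in:
 assumes A: "valring A" and y: "y \<in> C" and u: "y \<in> A \<Longrightarrow> veq A \<one> (geo y (Suc k))"
 shows "geo y (Suc k) \<noteq> \<zero>"
  and "j \<le> k \<Longrightarrow> y [^] j \<otimes> inv (geo y (Suc k)) \<in> A"
  and "y \<in> A \<Longrightarrow> veq A \<one> (inv (geo y (Suc k)))"
  and "y \<notin> A \<Longrightarrow> j < k \<Longrightarrow> vlt A \<one> (y [^] j \<otimes> inv (geo y (Suc k)))"
proof -
 define g where "g = geo y (Suc k)"
 have gc: "g \<in> C" using y by (simp add: g_def del: geo.simps)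
 have yp: "y [^] j \<in> A" if "y \<in> A" for j :: nat using that valring_closed[OF A] by (induction j) auto
 have out: "veq A (y [^] k) g" if "y \<notin> A" using geo_outside[OF A y that] by (simp add: g_def)
 have y0: "y \<noteq> \<zero>" if "y \<notin> A" using that valring_closed(1)[OF A] by auto
 show g0: "geo y (Suc k) \<noteq> \<zero>"
  unfolding g_def[symmetric]
 proof (cases "y \<in> A")
  case True
  thus "g \<noteq> \<zero>" using unit_in[OF A u] y by (simp add: g_def del: geo.simps)
 next
  case False
  thus "g \<noteq> \<zero>" using veq_nonzero[OF A out] y y0 gc by auto
 qed
 show ui: "y \<in> A \<Longrightarrow> veq A \<one> (inv (geo y (Suc k)))"
  using veq_inv[OF A u] y by (auto simp del: geo.simps)
 have key: "veq A (inv (y [^] (k - j))) (y [^] j \<otimes> inv g)" if "y \<notin> A" "j \<le> k" for j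
 proof -
  have "veq A (inv (y [^] k)) (inv g)" using veq_inv[OF A out[OF that(1)]] y y0 that gc by auto
  hence "veq A (y [^] j \<otimes> inv (y [^] k)) (y [^] j \<otimes> inv g)"
   using veq_mult[OF A] y y0 that gc g0 by (auto simp: g_def simp del: geo.simps)
  moreover have "y [^] j \<otimes> inv (y [^] k) = inv (y [^] (k - j))"
  proof -
   have "y [^] k = y [^] j \<otimes> y [^] (k - j)" using that y by (simp add: nat_pow_mult)
   hence "(y [^] j \<otimes> inv (y [^] k)) \<otimes> y [^] (k - j) = \<one>"
    using y y0 that(1) by (metis inv_simps(2) m_assoc m_comm nat_pow_closed pow_nonzero inv_simps(1))
   thus ?thesis using y y0 that
    by (metis comm_inv_char inv_simps(1) m_closed m_comm nat_pow_closed pow_nonzero)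
  qed
  ultimately show ?thesis by simp
 qed
 have yin: "vle A \<one> (inv (y [^] n))" if "y \<notin> A" for n :: nat
 proof -
  have "vle A y \<one>" using vlt_imp_vle[OF A] not_in_iff[OF A y] that y by simp
  hence "vle A (y [^] n) \<one>" using vle_nat_pow[OF A _ y one_closed, of n] by simp
  hence "vle A (inv (y [^] n) \<otimes> y [^] n) (inv (y [^] n) \<otimes> \<one>)"
   by (rule vle_mult[OF A]) (use y y0[OF that] in auto)
  thus ?thesis using y y0[OF that] by simp
 qed
 show "y [^] j \<otimes> inv (geo y (Suc k)) \<in> A" if "j \<le> k"
 proof (cases "y \<in> A")
  case True
  thus ?thesis using yp unit_in[OF A ui] valring_closed(5)[OF A] y g0
   by (auto simp del: geo.simps)
 next
  case False
  have "vle A \<one> (y [^] j \<otimes> inv g)"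
   using vle_trans[OF A yin[OF False, of "k - j"]] key[OF False that] by (simp add: veq_def)
  thus ?thesis using vle_one_iff[OF A] y g0 gc by (simp add: g_def del: geo.simps)
 qed
 show "vlt A \<one> (y [^] j \<otimes> inv (geo y (Suc k)))" if yA: "y \<notin> A" and jk: "j < k"
 proof -
  have "vlt A (y [^] (k - j)) \<one>"
  proof -
   obtain n where n: "k - j = Suc n" using jk by (metis Suc_diff_Suc)
   have "vle A (y [^] n) \<one>" using vle_nat_pow[OF A _ y one_closed, of n]
    vlt_imp_vle[OF A] not_in_iff[OF A y] yA y by simp
   moreover have "vlt A (y [^] n \<otimes> y) (y [^] n \<otimes> \<one>)"
    using vlt_mult_iff[OF A y one_closed, of "y [^] n"] not_in_iff[OF A y] yA y y0 by auto
   ultimately show ?thesis using vlt_vle_trans[OF A] y by (simp add: n)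
  qed
  hence "vlt A (inv (y [^] (k - j)) \<otimes> y [^] (k - j)) (inv (y [^] (k - j)) \<otimes> \<one>)"
   using vlt_mult_iff[OF A, of "y [^] (k - j)" \<one> "inv (y [^] (k - j))"] y y0[OF yA] by simp
  hence "vlt A \<one> (inv (y [^] (k - j)))" using y y0[OF yA] by simp
  hence "vlt A \<one> (y [^] j \<otimes> inv g)"
   using vlt_vle_trans[OF A] key[OF yA] jk y y0[OF yA] g0 gc by (auto simp: veq_def g_def simp del: geo.simps)
  thus ?thesis by (simp add: g_def)
 qed
qed

end

section \<open>Automorphisms and valuation rings\<close>

declare (in field) geo.simps(2) [simp del]

context algebraically_closed_over
begin

lemma auts_ring_hom: "\<tau> \<in> auts E \<Longrightarrow> ring_hom_ring R R \<tau>"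
 using ring_axioms by (auto simp: auts_def intro: ring_hom_ringI2)

lemma auts_unary:
 assumes t: "\<tau> \<in> auts E" and x: "x \<in> C"
 shows "\<tau> x \<in> C" "\<tau> (\<ominus> x) = \<ominus> (\<tau> x)" "\<tau> (x [^] (n::nat)) = \<tau> x [^] n"
proof -
 interpret h: ring_hom_ring R R \<tau> using auts_ring_hom[OF t] .
 show "\<tau> x \<in> C" "\<tau> (\<ominus> x) = \<ominus> (\<tau> x)" using x h.hom_closed h.hom_a_inv by simp_all
 show "\<tau> (x [^] (n::nat)) = \<tau> x [^] n" using x by (induction n) simp_all
qed

lemma auts_binary:
 assumes t: "\<tau> \<in> auts E" and xy: "x \<in> C" "y \<in> C"
 shows "\<tau> (x \<oplus> y) = \<tau> x \<oplus> \<tau> y" "\<tau> (x \<otimes> y) = \<tau> x \<otimes> \<tau> y" "\<tau> x = \<tau> y \<longleftrightarrow> x = y"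
proof -
 interpret h: ring_hom_ring R R \<tau> using auts_ring_hom[OF t] .
 show "\<tau> (x \<oplus> y) = \<tau> x \<oplus> \<tau> y" "\<tau> (x \<otimes> y) = \<tau> x \<otimes> \<tau> y"
  using xy h.hom_add h.hom_mult by simp_all
 have "inj_on \<tau> C" using t by (simp add: auts_def bij_betw_def)
 thus "\<tau> x = \<tau> y \<longleftrightarrow> x = y" using xy by (rule inj_on_eq_iff)
qed

lemmas auts_closed = auts_unary(1)

lemmas auts_simps = auts_unary(1) auts_binary(1,2) auts_unary(2,3) auts_binary(3)

lemma auts_const:
 assumes t: "\<tau> \<in> auts E"
 shows "\<tau> \<zero> = \<zero>" "\<tau> \<one> = \<one>"
proof -
 interpret h: ring_hom_ring R R \<tau> using auts_ring_hom[OF t] .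
 show "\<tau> \<zero> = \<zero>" "\<tau> \<one> = \<one>" by auto
qed

lemma auts_fix: "\<tau> \<in> auts E \<Longrightarrow> x \<in> E \<Longrightarrow> \<tau> x = x"
 by (simp add: auts_def)

lemma auts_zero_iff: "\<tau> \<in> auts E \<Longrightarrow> x \<in> C \<Longrightarrow> \<tau> x = \<zero> \<longleftrightarrow> x = \<zero>"
 using auts_simps(6)[of \<tau> E x \<zero>] auts_const(1)[of \<tau> E] by simp

lemma auts_inv:
 assumes "\<tau> \<in> auts E" "x \<in> C" "x \<noteq> \<zero>"
 shows "\<tau> (inv x) = inv (\<tau> x)"
proof -
 have "\<tau> x \<otimes> \<tau> (inv x) = \<one>"
  using assms auts_simps(3)[of \<tau> E x "inv x"] auts_const[OF assms(1)] by simp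
 thus ?thesis using assms(2,3) auts_closed[OF assms(1)] by (metis comm_inv_char inv_simps(1))
qed

lemma auts_geo: "\<tau> \<in> auts E \<Longrightarrow> x \<in> C \<Longrightarrow> \<tau> (geo x k) = geo (\<tau> x) k"
 by (induction k) (simp_all add: auts_const auts_simps geo.simps(2))

lemmas auts_rules = auts_simps auts_const auts_zero_iff auts_inv auts_geo

lemma auts_eval: "\<tau> \<in> auts E \<Longrightarrow> set p \<subseteq> C \<Longrightarrow> x \<in> C \<Longrightarrow> \<tau> (eval p x) = eval (map \<tau> p) (\<tau> x)"
 using hom_eval by (simp add: auts_def)

lemma auts_finsum:
 assumes "\<tau> \<in> auts E" "finite I" "f \<in> I \<rightarrow> C"
 shows "\<tau> (finsum R f I) = finsum R (\<lambda>i. \<tau> (f i)) I"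
 using assms(2,3)
proof (induction rule: finite_induct)
 case (insert i I)
 hence f: "f \<in> I \<rightarrow> C" "f i \<in> C" by auto
 hence "(\<lambda>i. \<tau> (f i)) \<in> I \<rightarrow> C" "\<tau> (f i) \<in> C"
  using auts_closed[OF assms(1)] by (auto simp: Pi_def)
 thus ?case using insert f auts_rules[OF assms(1)] by simp
qed (simp add: auts_const[OF assms(1)])

lemma auts_finprod:
 assumes "\<tau> \<in> auts E" "finite I" "f \<in> I \<rightarrow> C"
 shows "\<tau> (finprod R f I) = finprod R (\<lambda>i. \<tau> (f i)) I"
 using assms(2,3)
proof (induction rule: finite_induct)
 case (insert i I)
 hence f: "f \<in> I \<rightarrow> C" "f i \<in> C" by auto
 hence "(\<lambda>i. \<tau> (f i)) \<in> I \<rightarrow> C" "\<tau> (f i) \<in> C"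
  using auts_closed[OF assms(1)] by (auto simp: Pi_def)
 thus ?case using insert f auts_rules[OF assms(1)] by simp
qed (simp add: auts_const[OF assms(1)])

lemma auts_mono: "E \<subseteq> F \<Longrightarrow> auts F \<subseteq> auts E"
 by (auto simp: auts_def)

lemma auts_id: "id \<in> auts E"
 by (auto simp: auts_def ring_hom_def)

lemma auts_comp:
 assumes s: "\<tau> \<in> auts E" and t: "\<rho> \<in> auts E"
 shows "\<tau> \<circ> \<rho> \<in> auts E"
proof -
 have "\<tau> \<circ> \<rho> \<in> ring_hom R R" using auts_rules[OF s] auts_rules[OF t] by (auto intro!: ring_hom_memI)
 moreover have "bij_betw (\<tau> \<circ> \<rho>) C C"
  using s t bij_betw_trans[of \<rho> "C" "C" \<tau>] by (simp add: auts_def)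
 ultimately show ?thesis using s t by (simp add: auts_def)
qed

lemma auts_inverse:
 assumes E: "E \<subseteq> C" and t: "\<tau> \<in> auts E"
 shows "\<exists>\<rho>\<in>auts E. \<forall>x\<in>C. \<rho> (\<tau> x) = x \<and> \<tau> (\<rho> x) = x"
proof -
 define \<rho> where "\<rho> = inv_into C \<tau>"
 have b: "bij_betw \<tau> C C" using t by (simp add: auts_def)
 have b': "bij_betw \<rho> C C" unfolding \<rho>_def by (rule bij_betw_inv_into[OF b])
 have l: "\<rho> (\<tau> x) = x" if "x \<in> C" for x
  unfolding \<rho>_def by (rule bij_betw_inv_into_left[OF b that])
 have r: "\<tau> (\<rho> x) = x" if "x \<in> C" for x
  unfolding \<rho>_def by (rule bij_betw_inv_into_right[OF b that])
 have c: "\<rho> x \<in> C" if "x \<in> C" for x using b' that by (auto simp: bij_betw_def)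
 have "\<rho> \<in> ring_hom R R"
 proof (rule ring_hom_memI)
  fix x y assume xy: "x \<in> C" "y \<in> C"
  show "\<rho> x \<in> C" using c xy by blast
  have "\<tau> (\<rho> x \<otimes> \<rho> y) = x \<otimes> y" using auts_simps(3)[OF t] c r xy by simp
  thus "\<rho> (x \<otimes> y) = \<rho> x \<otimes> \<rho> y" using l[of "\<rho> x \<otimes> \<rho> y"] c xy by simp
  have "\<tau> (\<rho> x \<oplus> \<rho> y) = x \<oplus> y" using auts_simps(2)[OF t] c r xy by simp
  thus "\<rho> (x \<oplus> y) = \<rho> x \<oplus> \<rho> y" using l[of "\<rho> x \<oplus> \<rho> y"] c xy by simp
 next
  show "\<rho> \<one> = \<one>" using l[of \<one>] auts_const[OF t] by simp
 qed
 moreover have "\<rho> x = x" if "x \<in> E" for x using l[of x] that E auts_fix[OF t that] by auto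
 ultimately have "\<rho> \<in> auts E" using b' by (simp add: auts_def)
 thus ?thesis using l r by blast
qed

text \<open>The valuation ring of the valuation composed with \<open>\<tau>\<close>.\<close>

definition pullback :: "('a \<Rightarrow> 'a) \<Rightarrow> 'a set \<Rightarrow> 'a set"
 where "pullback \<tau> A = {x \<in> C. \<tau> x \<in> A}"

lemma pullback_valring:
 assumes A: "valring A" and t: "\<tau> \<in> auts E"
 shows "valring (pullback \<tau> A)"
 unfolding valring_def
proof (intro conjI ballI impI)
 note cl = valring_closed[OF A]
 show "subring (pullback \<tau> A) R"
  by (rule subringI) (use cl in \<open>auto simp: pullback_def auts_rules[OF t]\<close>)
 fix x assume "x \<in> C" "x \<noteq> \<zero>"
 thus "x \<in> pullback \<tau> A \<or> inv x \<in> pullback \<tau> A"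
  using valring_total[OF A, of "\<tau> x"] by (simp add: pullback_def auts_rules[OF t])
qed

text \<open>Every root is reached from \<open>x\<close> by \<open>conjugation_exists\<close>. In the
  inseparable case the list \<open>rs\<close> repeats the conjugates, which is why only its set is
  described.\<close>

lemma conjugates:
 assumes E: "overfield E" and x: "x \<in> C"
 shows "\<exists>rs. set rs = {\<tau> x | \<tau>. \<tau> \<in> auts E} \<and> min_poly E x (linprod rs)"
proof -
 obtain p where p: "min_poly E x p" using min_poly_exists_over[OF E x] by blast
 have pE: "set p \<subseteq> E" "p \<noteq> []" "hd p = \<one>" "eval p x = \<zero>" using p by (auto simp: min_poly_def)
 have pc: "set p \<subseteq> C" using pE overfieldD(4)[OF E] by blast
 obtain rs where rs: "set rs \<subseteq> C" "p = linprod rs" using monic_splits[OF pc pE(2,3)] by blast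
 have "\<exists>\<tau>\<in>auts E. \<tau> x = r" if "r \<in> set rs" for r
 proof (rule conjugation_exists[OF E x])
  show r: "r \<in> C" using that rs by blast
  have "eval p r = \<zero>" using eval_linprod_root[OF rs(1) that] rs(2) by simp
  thus "eval h r = \<zero>" if "set h \<subseteq> E" "eval h x = \<zero>" for h
   using min_poly_conjugate[OF overfieldD(1)[OF E] p x r] that by blast
 qed
 moreover have "\<tau> x \<in> set rs" if t: "\<tau> \<in> auts E" for \<tau>
 proof -
  have "map \<tau> p = p" using pE auts_fix[OF t] by (intro map_idI) auto
  hence "eval p (\<tau> x) = \<zero>" using auts_eval[OF t pc x] pE auts_const[OF t] by simp
  thus ?thesis using eval_linprod_zero_iff[OF rs(1)] rs(2) auts_closed[OF t] x by simp
 qed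
 ultimately have "set rs = {\<tau> x | \<tau>. \<tau> \<in> auts E}" by auto
 thus ?thesis using p rs(2) by blast
qed

lemma finite_conjugates:
 assumes "overfield E" "x \<in> C"
 shows "finite {\<tau> x | \<tau>. \<tau> \<in> auts E}"
 using conjugates[OF assms] by (metis List.finite_set)

text \<open>If no power of \<open>x\<close> had a value from \<open>E\<close>, the minimal
  polynomial would take the value of a nonzero monomial at \<open>x\<close>, although it vanishes
  there.\<close>

lemma valuation_torsion:
 assumes E: "overfield E" and A: "valring A" and x: "x \<in> C" "x \<noteq> \<zero>"
 shows "\<exists>n>0. \<exists>c\<in>E. c \<noteq> \<zero> \<and> veq A (x [^] (n::nat)) c"
proof (rule ccontr)
 assume neg: "\<not> ?thesis"
 note EE = overfieldD[OF E]
 obtain p where p: "min_poly E x p" using min_poly_exists_over[OF E x(1)] by blast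
 have "\<one> \<in> set p" using p by (metis hd_in_set min_poly_def)
 hence nz: "\<not> set p \<subseteq> {\<zero>}" by auto
 have indep: "\<not> veq A (a \<otimes> x [^] k) b" if ab: "a \<in> E" "b \<in> E" "a \<noteq> \<zero>" "b \<noteq> \<zero>" "0 < k" for a b and k :: nat
 proof
  assume v: "veq A (a \<otimes> x [^] k) b"
  have c: "a \<in> C" "b \<in> C" using ab subsetD[OF EE(4)] by auto
  have "veq A (inv a \<otimes> (a \<otimes> x [^] k)) (inv a \<otimes> b)"
   by (rule veq_mult[OF A v]) (use c ab x in auto)
  hence "veq A (x [^] k) (inv a \<otimes> b)" using c ab x by simp
  moreover have "inv a \<otimes> b \<in> E" using subfield_inv_closed[OF EE(1)] ab subringE(6)[OF EE(3)] by blast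
  moreover have "inv a \<otimes> b \<noteq> \<zero>" using c ab by (simp add: integral_iff)
  ultimately show False using neg ab(5) by blast
 qed
 obtain c and j :: nat where cj: "c \<in> E" "c \<noteq> \<zero>" "veq A (eval p x) (c \<otimes> x [^] j)"
 proof -
  have "set p \<subseteq> E" using p by (simp add: min_poly_def)
  hence "\<exists>c\<in>E. \<exists>j<length p. c \<noteq> \<zero> \<and> veq A (eval p x) (c \<otimes> x [^] j)"
   by (intro vle_algebraic[OF A EE(3) x] indep nz)
  thus thesis using that by blast
 qed
 have "c \<in> C" using cj subsetD[OF EE(4)] by auto
 hence "c \<otimes> x [^] j \<noteq> \<zero>" "c \<otimes> x [^] j \<in> C" using cj x by (auto simp: integral_iff)
 moreover have "eval p x = \<zero>" using p by (simp add: min_poly_def)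
 ultimately show False using cj veq_nonzero[OF A cj(3)] by simp
qed

text \<open>A nonzero nonunit is recognised by its inverse lying outside the ring; so the trace of
  the ring on \<open>E\<close> also determines the trace of its maximal ideal.\<close>

lemma vlt_one_trace:
 assumes E: "overfield E" and A: "valring A" and B: "valring B" and AB: "A \<inter> E = B \<inter> E"
  and c: "c \<in> E" "vlt B \<one> c"
 shows "vlt A \<one> c"
proof (cases "c = \<zero>")
 case True
 thus ?thesis using vlt_zero[OF A] by simp
next
 case False
 note EE = overfieldD[OF E]
 have cc: "c \<in> C" using c subsetD[OF EE(4)] by auto
 have *: "vlt D \<one> c \<longleftrightarrow> inv c \<notin> D" if D: "valring D" for D
  using vle_iff_div[OF D cc one_closed False] False cc by (simp add: vlt_def)
 have "inv c \<in> E" using subfield_inv_closed[OF EE(1) c(1) False] .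
 thus ?thesis using * c(2) A B AB by blast
qed

lemma eval_vlt_one:
 assumes A: "valring A" and q: "set q \<subseteq> {c \<in> C. vlt A \<one> c}" and t: "t \<in> A"
 shows "vlt A \<one> (eval q t)"
 using q
proof (induction q)
 case (Cons a q)
 have tc: "t \<in> C" using valring_carrier[OF A t] .
 have "t [^] n \<in> A" for n :: nat using t valring_closed[OF A] by (induction n) auto
 hence "vlt A \<one> (a \<otimes> t [^] length q)" using vlt_one_mult[OF A] Cons.prems by auto
 moreover have "eval q t \<in> C" using eval_in_carrier[of q t] Cons.prems tc by auto
 ultimately show ?case using vlt_add[OF A] Cons tc by simp
qed (simp add: vlt_zero[OF A])

lemma finprod_in_valring:
 assumes A: "valring A" and "finite I" "\<And>i. i \<in> I \<Longrightarrow> f i \<in> A"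
 shows "finprod R f I \<in> A"
 using assms(2,3)
proof (induction I rule: finite_induct)
 case (insert i I)
 hence "f \<in> insert i I \<rightarrow> C" using valring_carrier[OF A] by auto
 thus ?case using insert valring_closed[OF A] by (simp add: Pi_def)
qed (simp add: valring_closed[OF A])

lemma finprod_unit:
 assumes A: "valring A" and "finite I" "\<And>i. i \<in> I \<Longrightarrow> f i \<in> C \<and> veq A \<one> (f i)"
 shows "finprod R f I \<in> C \<and> veq A \<one> (finprod R f I)"
 using assms(2,3)
proof (induction I rule: finite_induct)
 case (insert i I)
 hence f: "f \<in> insert i I \<rightarrow> C" by auto
 hence "veq A (\<one> \<otimes> \<one>) (f i \<otimes> finprod R f I)"
  using veq_mult2[OF A] insert by blast
 thus ?case using f insert by (simp add: Pi_def)
qed (simp add: veq_refl[OF A])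

lemma finprod_vlt_one:
 assumes A: "valring A" and "finite I" "\<And>i. i \<in> I \<Longrightarrow> f i \<in> A" "i \<in> I" "vlt A \<one> (f i)"
 shows "vlt A \<one> (finprod R f I)"
proof -
 have f: "f \<in> I \<rightarrow> C" using assms valring_carrier[OF A] by auto
 have "insert i (I - {i}) = I" using assms by auto
 hence "finprod R f I = f i \<otimes> finprod R f (I - {i})"
  using finprod_insert[of "I - {i}" i f] assms(2) f assms(4) by (auto simp: Pi_def)
 moreover have "finprod R f (I - {i}) \<in> A" 
  by (rule finprod_in_valring[OF A]) (use assms in auto)
 ultimately show ?thesis using vlt_one_mult[OF A assms(5)] f assms(4) by auto
qed

text \<open>If all automorphisms fail, each one moves some element of \<open>S\<close> in
  \<open>A\<close> out of \<open>B\<close>. The product \<open>t\<close> of the inverted geometric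
  sums of these elements is a unit for \<open>A\<close>, while all its conjugates are nonunits for
  \<open>B\<close>. So the lower coefficients of its minimal polynomial are nonunits for
  \<open>B\<close>, hence for \<open>A\<close>, and a power of \<open>t\<close> becomes a nonunit
  for \<open>A\<close>. A finite \<open>S\<close> is what makes the product available.\<close>

lemma valuation_conjugate_one_sided:
 assumes E: "overfield E" and A: "valring A" and B: "valring B" and AB: "A \<inter> E = B \<inter> E"
  and S: "finite S" "S \<subseteq> C"
 shows "\<exists>\<eta>\<in>auts E. \<forall>x\<in>S. x \<in> A \<longrightarrow> \<eta> x \<in> B"
proof (rule ccontr)
 assume "\<not> ?thesis"
 hence neg: "\<And>\<eta>. \<eta> \<in> auts E \<Longrightarrow> \<exists>x\<in>S \<inter> A. \<eta> x \<notin> B" by blast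
 define Y where "Y = S \<inter> A"
 have Y: "finite Y" "Y \<subseteq> C" "Y \<subseteq> A" using S by (auto simp: Y_def)
 \<comment> \<open>The pairs for which one exponent must serve: the elements themselves at
   \<open>A\<close>, and all their conjugates at \<open>B\<close>.\<close>
 define P where "P = Pair A ` Y \<union> Pair B ` (\<Union>x\<in>Y. {\<tau> x | \<tau>. \<tau> \<in> auts E})"
 have "finite P" unfolding P_def
  using Y finite_conjugates[OF E] by (intro finite_UnI finite_imageI finite_UN_I) auto
 moreover have "valring D \<and> y \<in> C" if "(D, y) \<in> P" for D y
 proof -
  have "y \<in> C" if "x \<in> Y" "y = \<tau> x" "\<tau> \<in> auts E" for x \<tau>
   using that Y auts_closed[OF that(3)] by auto
  thus ?thesis using that A B Y by (auto simp: P_def)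
 qed
 ultimately obtain k where k: "k \<ge> 1" "\<forall>(D, y)\<in>P. y \<in> D \<longrightarrow> veq D \<one> (geo y (Suc k))"
  using common_geo_exponent[of P 1] by blast
 have kA: "veq A \<one> (geo y (Suc k))" if "y \<in> Y" for y
 proof -
  have "(A, y) \<in> P" "y \<in> A" using that Y by (auto simp: P_def)
  thus ?thesis using k(2) by auto
 qed
 have kB: "veq B \<one> (geo (\<tau> y) (Suc k))" if "y \<in> Y" "\<tau> \<in> auts E" "\<tau> y \<in> B" for y \<tau>
 proof -
  have "\<tau> y \<in> {\<tau> y | \<tau>. \<tau> \<in> auts E}" using that(2) by auto
  hence "(B, \<tau> y) \<in> P" unfolding P_def using that(1) by (intro UnI2 imageI UN_I)
  thus ?thesis using k(2) that(3) by auto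
 qed
 define f where "f y = inv (geo y (Suc k))" for y
 have fA: "veq A \<one> (f y)" "geo y (Suc k) \<noteq> \<zero>" "f y \<in> C" if "y \<in> Y" for y
 proof -
  have yc: "y \<in> C" "y \<in> A" using that Y by auto
  show "veq A \<one> (f y)" unfolding f_def using geo_inverse_in(3)[OF A yc(1) kA[OF that]] yc by blast
  show "geo y (Suc k) \<noteq> \<zero>" using geo_inverse_in(1)[OF A yc(1) kA[OF that]] .
  thus "f y \<in> C" using yc by (simp add: f_def del: geo.simps)
 qed
 define t where "t = finprod R f Y"
 have t: "t \<in> C" "veq A \<one> t" using finprod_unit[OF A Y(1), of f] fA by (auto simp: t_def)
 \<comment> \<open>By the assumption of failure at least one factor has its argument moved out of
   \<open>B\<close>. That factor becomes a nonunit, and the remaining ones stay integral.\<close>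
 have tB: "vlt B \<one> (\<tau> t)" if tau: "\<tau> \<in> auts E" for \<tau>
 proof -
  have ft: "\<tau> (f y) = inv (geo (\<tau> y) (Suc k))" if "y \<in> Y" for y
   unfolding f_def using that Y fA(2)[OF that] by (simp add: auts_rules[OF tau] subset_iff del: geo.simps)
  have tc: "\<tau> y \<in> C" if "y \<in> Y" for y using auts_closed[OF tau] that Y by auto
  have "\<tau> (f y) \<in> B" if "y \<in> Y" for y
   using geo_inverse_in(2)[OF B tc[OF that] kB[OF that tau], of 0] ft[OF that] tc[OF that]
    geo_inverse_in(1)[OF B tc[OF that] kB[OF that tau]] by (simp del: geo.simps)
  moreover obtain x where x: "x \<in> Y" "\<tau> x \<notin> B" using neg[OF tau] by (auto simp: Y_def)
  moreover have "vlt B \<one> (\<tau> (f x))"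
   using geo_inverse_in(4)[OF B tc[OF x(1)] kB[OF x(1) tau] x(2), of 0] ft[OF x(1)] tc[OF x(1)] k(1)
    geo_inverse_in(1)[OF B tc[OF x(1)] kB[OF x(1) tau]] by (simp del: geo.simps)
  ultimately have "vlt B \<one> (finprod R (\<lambda>y. \<tau> (f y)) Y)"
   using finprod_vlt_one[OF B Y(1), of "\<lambda>y. \<tau> (f y)" x] by blast
  thus ?thesis using auts_finprod[OF tau Y(1), of f] fA by (auto simp: t_def Pi_def)
 qed
 obtain rs where rs: "set rs = {\<tau> t | \<tau>. \<tau> \<in> auts E}" "min_poly E t (linprod rs)"
  using conjugates[OF E t(1)] by blast
 define I where "I = {c \<in> C. vlt B \<one> c}"
 have rsI: "set rs \<subseteq> I"
 proof
  fix r assume "r \<in> set rs"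
  then obtain \<tau> where tau: "r = \<tau> t" "\<tau> \<in> auts E" unfolding rs(1) by blast
  show "r \<in> I" unfolding tau(1) I_def using tB[OF tau(2)] auts_closed[OF tau(2) t(1)] by simp
 qed
 have tlI: "set (tl (linprod rs)) \<subseteq> I"
 proof (rule linprod_tl_in_ideal[OF valring_subring[OF B]])
  show "x \<oplus> y \<in> I" if "x \<in> I" "y \<in> I" for x y using that vlt_add[OF B] by (auto simp: I_def)
  show "x \<otimes> a \<in> I" if "x \<in> I" "a \<in> B" for x a
   using that vlt_one_mult[OF B] valring_carrier[OF B] by (auto simp: I_def)
  show "\<zero> \<in> I" by (simp add: I_def vlt_zero[OF B])
  show "I \<subseteq> B" using vlt_one_in[OF B] by (auto simp: I_def)
 qed (rule rsI)
 have lin: "set (linprod rs) \<subseteq> E" "linprod rs \<noteq> []" "hd (linprod rs) = \<one>" "eval (linprod rs) t = \<zero>"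
  using rs(2) by (auto simp: min_poly_def)
 then obtain q where q: "linprod rs = \<one> # q" by (cases "linprod rs") auto
 have "set q \<subseteq> {c \<in> C. vlt A \<one> c}"
  using tlI lin(1) q vlt_one_trace[OF E A B AB] by (auto simp: I_def)
 moreover have "t \<in> A" using unit_in[OF A t(2,1)] by blast
 ultimately have 1: "vlt A \<one> (eval q t)" and qc: "set q \<subseteq> C" using eval_vlt_one[OF A] by auto
 have ec: "eval q t \<in> C" using eval_in_carrier qc t by blast
 \<comment> \<open>The minimal equation expresses a power of the unit \<open>t\<close> by a
   nonunit.\<close>
 have "t [^] length q \<oplus> eval q t = \<zero>" using lin(4) q t by simp
 hence "t [^] length q = \<ominus> eval q t" using ec t by (metis minus_equality nat_pow_closed)
 hence "vlt A \<one> (t [^] length q)" using vlt_minus[OF A 1] ec by simp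
 moreover have "veq A (\<one> [^] length q) (t [^] length q)" using veq_nat_pow[OF A t(2)] t by blast
 ultimately show False by (simp add: veq_def vlt_def)
qed

text \<open>One inclusion becomes an equivalence by testing more elements. If \<open>x [^] n\<close>
  has the value of \<open>c\<close> in \<open>E\<close>, then \<open>w x\<close>, the quotient of
  \<open>c\<close> by \<open>x [^] n\<close>, is tested too. When \<open>\<eta> x\<close> lies in
  \<open>B\<close>, so does \<open>c\<close>, which is fixed by \<open>\<eta>\<close>; then
  \<open>c\<close> lies in \<open>A\<close>, and this forces \<open>x\<close> into
  \<open>A\<close>.\<close>

theorem valuation_conjugate:
 assumes E: "overfield E" and A: "valring A" and B: "valring B" and AB: "A \<inter> E = B \<inter> E"
  and S: "finite S" "S \<subseteq> C"
 shows "\<exists>\<eta>\<in>auts E. \<forall>x\<in>S. x \<in> A \<longleftrightarrow> \<eta> x \<in> B"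
proof -
 note EE = overfieldD[OF E]
 define Q where "Q x nc \<longleftrightarrow> fst nc > (0::nat) \<and> snd nc \<in> E \<and> snd nc \<noteq> \<zero> \<and> veq A (x [^] fst nc) (snd nc)"
  for x nc
 define h where "h x = (SOME nc. Q x nc)" for x
 have h: "fst (h x) > (0::nat) \<and> snd (h x) \<in> E \<and> snd (h x) \<noteq> \<zero> \<and> veq A (x [^] fst (h x)) (snd (h x))"
  if x: "x \<in> C" "x \<noteq> \<zero>" for x
 proof -
  obtain n c where "0 < (n::nat)" "c \<in> E" "c \<noteq> \<zero>" "veq A (x [^] n) c"
   using valuation_torsion[OF E A x] by blast
  hence "Q x (n, c)" by (simp add: Q_def)
  hence "Q x (h x)" unfolding h_def by (rule someI)
  thus ?thesis by (simp add: Q_def)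
 qed
 define w where "w x = snd (h x) \<otimes> inv (x [^] fst (h x))" for x
 have hc: "snd (h x) \<in> C" if "x \<in> C" "x \<noteq> \<zero>" for x using h[OF that] subsetD[OF EE(4)] by auto
 have wA: "w x \<in> A" "w x \<in> C" if x: "x \<in> C" "x \<noteq> \<zero>" for x
 proof -
  have "vle A (x [^] fst (h x)) (snd (h x))" using h[OF x] by (simp add: veq_def)
  hence "inv (x [^] fst (h x)) \<otimes> snd (h x) \<in> A" using vle_iff_div[OF A] x hc by simp
  thus "w x \<in> A" using x hc by (simp add: w_def m_comm)
  thus "w x \<in> C" using valring_carrier[OF A] by blast
 qed
 define S' where "S' = S \<union> w ` (S - {\<zero>})"
 have "finite S'" "S' \<subseteq> C" using S wA by (auto simp: S'_def)
 then obtain \<eta> where e: "\<eta> \<in> auts E" "\<And>x. x \<in> S' \<Longrightarrow> x \<in> A \<Longrightarrow> \<eta> x \<in> B"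
  using valuation_conjugate_one_sided[OF E A B AB, of S'] by blast
 have "x \<in> A" if x: "x \<in> S" "\<eta> x \<in> B" for x
 proof (rule ccontr)
  assume xA: "x \<notin> A"
  have xc: "x \<in> C" "x \<noteq> \<zero>" using x S xA valring_closed(1)[OF A] by auto
  obtain n c where nc: "n = fst (h x)" "c = snd (h x)" by blast
  have n: "n > 0" "c \<in> E" "c \<noteq> \<zero>" "veq A (x [^] n) c" "c \<in> C" using h[OF xc] hc[OF xc] nc by auto
  have "c \<notin> A"
  proof
   assume "c \<in> A"
   hence "vle A \<one> (x [^] n)"
    using vle_trans[OF A, of \<one> c "x [^] n"] n vle_one_iff[OF A] by (auto simp: veq_def)
   moreover have "vlt A x \<one>" using not_in_iff[OF A] xA xc by blast
   hence "vle A x \<one>" using vlt_imp_vle[OF A] xc by simp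
   hence vk: "vle A (x [^] k) \<one>" for k :: nat using vle_nat_pow[OF A _ xc(1) one_closed, of k] by simp
   obtain m where m: "n = Suc m" using n by (cases n) auto
   have "vlt A (x [^] m \<otimes> x) (x [^] m \<otimes> \<one>)"
    using vlt_mult_iff[OF A xc(1) one_closed, of "x [^] m"] \<open>vlt A x \<one>\<close> xc by simp
   hence "vlt A (x [^] n) \<one>" using vlt_vle_trans[OF A _ vk[of m]] xc by (simp add: m)
   ultimately show False by (simp add: vlt_def)
  qed
  hence "c \<notin> B" using AB n(2) by blast
  moreover have "\<eta> (w x) \<in> B" using e(2)[of "w x"] wA[OF xc] x xc by (auto simp: S'_def)
  moreover have "\<eta> x [^] n \<in> B" using x(2) valring_closed[OF B] by (induction n) auto
  moreover have "c = w x \<otimes> x [^] n" using xc n by (simp add: w_def flip: nc)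
  hence "\<eta> c = \<eta> (w x) \<otimes> \<eta> x [^] n" using auts_simps[OF e(1)] xc wA[OF xc] by simp
  moreover have "\<eta> c = c" using auts_fix[OF e(1) n(2)] .
  ultimately show False using valring_closed(5)[OF B] by metis
 qed
 moreover have "\<eta> x \<in> B" if "x \<in> S" "x \<in> A" for x using e(2)[of x] that by (simp add: S'_def)
 ultimately have "\<forall>x\<in>S. x \<in> A \<longleftrightarrow> \<eta> x \<in> B" by blast
 thus ?thesis using e(1) by (rule bexI)
qed

end

section \<open>The henselization\<close>

context algebraically_closed_over
begin

text \<open>For \<open>S\<close> the whole carrier this is the decomposition group of
  \<open>A\<close>; finite \<open>S\<close> approximate it from above.\<close>

definition dec_on :: "'a set \<Rightarrow> 'a set \<Rightarrow> ('a \<Rightarrow> 'a) set"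
 where "dec_on A S = {\<tau> \<in> auts K. \<forall>x\<in>S. \<tau> x \<in> A \<longleftrightarrow> x \<in> A}"

definition henselian :: "'a set \<Rightarrow> 'a set \<Rightarrow> bool"
 where "henselian A E \<longleftrightarrow> overfield E \<and> (\<forall>B. valring B \<longrightarrow> B \<inter> E = A \<inter> E \<longrightarrow> B = A)"

text \<open>As an intersection it is contained in every henselian field by construction; that it is
  henselian itself is the part that needs proof.\<close>

definition hensel :: "'a set \<Rightarrow> 'a set"
 where "hensel A = \<Inter> {E. henselian A E}"

text \<open>The fixed field of the decomposition group, purely inseparable over the henselization.
  Requiring invariance under an approximation with finite \<open>S\<close> builds in what would
  otherwise be a compactness argument, and it fits the finite sets of
  \<open>valuation_conjugate\<close>.\<close>

definition dec_fixed :: "'a set \<Rightarrow> 'a set"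
 where "dec_fixed A = {x \<in> C. \<exists>S. finite S \<and> S \<subseteq> C \<and> (\<forall>\<tau>\<in>dec_on A S. \<tau> x = x)}"

lemma auts_K_mono: "overfield E \<Longrightarrow> auts E \<subseteq> auts K"
 using auts_mono overfieldD(2) by blast

lemma dec_on_mono: "S \<subseteq> S' \<Longrightarrow> dec_on A S' \<subseteq> dec_on A S"
 by (auto simp: dec_on_def)

text \<open>An automorphism over \<open>E\<close> pulls \<open>A\<close> back to a ring with the
  same trace on \<open>E\<close>. Conversely any ring with this trace is conjugate to
  \<open>A\<close> on each single element, so it equals \<open>A\<close> when all automorphisms over
  \<open>E\<close> preserve \<open>A\<close>.\<close>

lemma henselian_iff:
 assumes A: "valring A" and E: "overfield E"
 shows "henselian A E \<longleftrightarrow> auts E \<subseteq> dec_on A C"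
proof
 assume h: "henselian A E"
 show "auts E \<subseteq> dec_on A C"
 proof
  fix \<tau> assume t: "\<tau> \<in> auts E"
  have "pullback \<tau> A \<inter> E = A \<inter> E"
  proof -
   have "x \<in> pullback \<tau> A \<longleftrightarrow> x \<in> A" if x: "x \<in> E" for x
    using x overfieldD(4)[OF E] by (auto simp: pullback_def auts_fix[OF t x])
   thus ?thesis by blast
  qed
  hence "pullback \<tau> A = A"
   using h pullback_valring[OF A t] by (simp add: henselian_def)
  hence "\<tau> x \<in> A \<longleftrightarrow> x \<in> A" if "x \<in> C" for x
   using that unfolding pullback_def by blast
  moreover have "\<tau> \<in> auts K" using t auts_K_mono[OF E] by blast
  ultimately show "\<tau> \<in> dec_on A C" by (simp add: dec_on_def)
 qed
next
 assume d: "auts E \<subseteq> dec_on A C"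
 have "B = A" if B: "valring B" "B \<inter> E = A \<inter> E" for B
 proof -
  have "x \<in> B \<longleftrightarrow> x \<in> A" if x: "x \<in> C" for x
  proof -
   have "\<exists>\<eta>\<in>auts E. \<forall>y\<in>{x}. y \<in> B \<longleftrightarrow> \<eta> y \<in> A"
    using valuation_conjugate[OF E B(1) A B(2), of "{x}"] x by simp
   then obtain \<eta> where e: "\<eta> \<in> auts E" "x \<in> B \<longleftrightarrow> \<eta> x \<in> A" by auto
   hence "\<eta> \<in> dec_on A C" using d by blast
   thus ?thesis using e(2) x by (simp add: dec_on_def)
  qed
  thus ?thesis using valring_carrier[OF A] valring_carrier[OF B(1)] by blast
 qed
 thus "henselian A E" using E by (simp add: henselian_def)
qed

lemma dec_fixed_overfield:
 assumes A: "valring A"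
 shows "overfield (dec_fixed A)"
proof (rule subring_overfield)
 show KZ: "K \<subseteq> dec_fixed A"
 proof
  fix x assume x: "x \<in> K"
  hence "\<forall>\<tau>\<in>dec_on A {}. \<tau> x = x" using auts_fix by (auto simp: dec_on_def)
  thus "x \<in> dec_fixed A" using x overfieldD(4)[OF overfield_K] unfolding dec_fixed_def by blast
 qed
 show "subring (dec_fixed A) R"
 proof (rule subringI)
  show "dec_fixed A \<subseteq> C" by (auto simp: dec_fixed_def)
  show "\<one> \<in> dec_fixed A" using KZ subringE(3)[OF overfieldD(3)[OF overfield_K]] by blast
  fix x y assume "x \<in> dec_fixed A" "y \<in> dec_fixed A"
  then obtain S T where ST: "x \<in> C" "y \<in> C" "finite S" "finite T" "S \<subseteq> C" "T \<subseteq> C"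
   "\<forall>\<tau>\<in>dec_on A S. \<tau> x = x" "\<forall>\<tau>\<in>dec_on A T. \<tau> y = y"
   unfolding dec_fixed_def by blast
  have fxy: "\<tau> x = x" "\<tau> y = y" "\<tau> \<in> auts K" if "\<tau> \<in> dec_on A (S \<union> T)" for \<tau>
   using that ST(7,8) by (auto simp: dec_on_def)
  have mem: "z \<in> dec_fixed A" if "z \<in> C" "\<And>\<tau>. \<tau> \<in> dec_on A (S \<union> T) \<Longrightarrow> \<tau> z = z" for z
   unfolding dec_fixed_def using that ST by (intro CollectI conjI exI[of _ "S \<union> T"] ballI) auto
  show "\<ominus> x \<in> dec_fixed A"
  proof (rule mem)
   show "\<tau> (\<ominus> x) = \<ominus> x" if t: "\<tau> \<in> dec_on A (S \<union> T)" for \<tau>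
    using fxy[OF t] auts_unary(2)[of \<tau> K x] ST by simp
  qed (use ST in simp)
  show "x \<otimes> y \<in> dec_fixed A"
  proof (rule mem)
   show "\<tau> (x \<otimes> y) = x \<otimes> y" if t: "\<tau> \<in> dec_on A (S \<union> T)" for \<tau>
    using fxy[OF t] auts_binary(2)[of \<tau> K x y] ST by simp
  qed (use ST in simp)
  show "x \<oplus> y \<in> dec_fixed A"
  proof (rule mem)
   show "\<tau> (x \<oplus> y) = x \<oplus> y" if t: "\<tau> \<in> dec_on A (S \<union> T)" for \<tau>
    using fxy[OF t] auts_binary(1)[of \<tau> K x y] ST by simp
  qed (use ST in simp)
 qed
qed

lemma stable_set_image:
 assumes S: "finite S" "S \<subseteq> C" and t: "\<tau> \<in> auts E" and sub: "\<tau> ` S \<subseteq> S"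
 shows "\<tau> ` S = S"
proof -
 have "inj_on \<tau> S" using S auts_binary(3)[OF t] by (auto simp: inj_on_def subset_iff)
 thus ?thesis using endo_inj_surj[OF S(1) sub] by blast
qed

text \<open>The image polynomial is monic of the same degree with the same simple roots, so it is
  the same polynomial.\<close>

lemma linprod_fixed:
 assumes S: "finite S" "S \<subseteq> C" and rs: "set rs = S" "distinct rs"
  and t: "\<tau> \<in> auts E" and sub: "\<tau> ` S \<subseteq> S" and c: "c \<in> set (linprod rs)"
 shows "\<tau> c = c"
proof -
 have rc: "set rs \<subseteq> C" using S rs by simp
 have lc: "set (linprod rs) \<subseteq> C" using linprod_closed[OF rc] .
 have ne: "linprod rs \<noteq> []" using length_linprod[of rs] by (metis list.size(3) nat.distinct(1))
 have "map \<tau> (linprod rs) = linprod rs"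
 proof (rule monic_eq_of_roots[OF S])
  have len: "length rs = card S" using rs by (metis distinct_card)
  show "length (map \<tau> (linprod rs)) = Suc (card S)" "length (linprod rs) = Suc (card S)"
   using len by simp_all
  show "set (map \<tau> (linprod rs)) \<subseteq> C" using lc auts_closed[OF t] by auto
  show "set (linprod rs) \<subseteq> C" by (rule lc)
  show "hd (linprod rs) = \<one>" by (rule hd_linprod[OF rc])
  thus "hd (map \<tau> (linprod rs)) = \<one>" using ne auts_const[OF t] by (simp add: hd_map)
  fix y assume y: "y \<in> S"
  thus "eval (linprod rs) y = \<zero>" using eval_linprod_root[OF rc] rs by simp
  have "y \<in> \<tau> ` S" using stable_set_image[OF S t sub] y by simp
  then obtain z where z: "z \<in> S" "y = \<tau> z" by blast
  hence "eval (map \<tau> (linprod rs)) y = \<tau> (eval (linprod rs) z)"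
   using auts_eval[OF t lc, of z] S by auto
  also have "\<dots> = \<zero>" using eval_linprod_root[OF rc, of z] z rs auts_const[OF t] by simp
  finally show "eval (map \<tau> (linprod rs)) y = \<zero>" .
 qed
 thus ?thesis using c by (metis in_set_conv_nth length_map nth_map)
qed

lemma dec_on_stable_comp:
 assumes S: "\<And>\<tau> x. \<tau> \<in> auts K \<Longrightarrow> x \<in> S \<Longrightarrow> \<tau> x \<in> S"
  and st: "\<tau> \<in> dec_on A S" "\<rho> \<in> dec_on A S"
 shows "\<tau> \<circ> \<rho> \<in> dec_on A S"
 using st S auts_comp[of \<tau> K \<rho>] unfolding dec_on_def by auto

text \<open>Let \<open>S\<close> be the orbit of \<open>x\<close>, and \<open>T\<close> its orbit
  under the automorphisms that respect \<open>A\<close> on \<open>S\<close>. These permute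
  \<open>T\<close>, so the polynomial with roots \<open>T\<close> has coefficients in
  \<open>dec_fixed A\<close>, with \<open>S\<close> as witness. An automorphism over
  \<open>dec_fixed A\<close> therefore sends \<open>x\<close> into \<open>T\<close>, that is, it
  agrees at \<open>x\<close> with one that respects \<open>A\<close> on \<open>S\<close>.\<close>

lemma dec_fixed_henselian:
 assumes A: "valring A"
 shows "auts (dec_fixed A) \<subseteq> dec_on A C"
proof
 let ?Z = "dec_fixed A"
 fix \<tau> assume t: "\<tau> \<in> auts ?Z"
 have "\<tau> x \<in> A \<longleftrightarrow> x \<in> A" if x: "x \<in> C" for x
 proof -
  define S where "S = {\<tau> x | \<tau>. \<tau> \<in> auts K}"
  define D where "D = dec_on A S"
  define T where "T = {\<tau> x | \<tau>. \<tau> \<in> D}"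
  have DK: "D \<subseteq> auts K" by (auto simp: D_def dec_on_def)
  have S: "finite S" "S \<subseteq> C"
   using finite_conjugates[OF overfield_K x] auts_closed[OF _ x] by (auto simp: S_def)
  have stab: "\<tau> y \<in> S" if ta: "\<tau> \<in> auts K" and ty: "y \<in> S" for \<tau> y
  proof -
   obtain \<rho> where r: "\<rho> \<in> auts K" "y = \<rho> x" using ty by (auto simp: S_def)
   hence "\<tau> y = (\<tau> \<circ> \<rho>) x" by simp
   thus ?thesis using auts_comp[OF ta r(1)] unfolding S_def by blast
  qed
  have TS: "T \<subseteq> S" using DK by (auto simp: T_def S_def)
  hence T: "finite T" "T \<subseteq> C" using S finite_subset by auto
  obtain rs where rs: "set rs = T" "distinct rs" using finite_distinct_list[OF T(1)] by blast
  have fixed: "\<delta> c = c" if d: "\<delta> \<in> D" and c: "c \<in> set (linprod rs)" for \<delta> c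
  proof (rule linprod_fixed[OF T rs _ _ c])
   show "\<delta> \<in> auts K" using d DK by blast
   show "\<delta> ` T \<subseteq> T"
   proof
    fix z assume "z \<in> \<delta> ` T"
    then obtain \<rho> where r: "\<rho> \<in> D" "z = (\<delta> \<circ> \<rho>) x" by (auto simp: T_def)
    moreover have "\<delta> \<circ> \<rho> \<in> D" unfolding D_def
    proof (rule dec_on_stable_comp)
     show "\<tau> y \<in> S" if "\<tau> \<in> auts K" "y \<in> S" for \<tau> y using stab that by blast
    qed (use d r(1) in \<open>simp_all add: D_def\<close>)
    ultimately show "z \<in> T" unfolding T_def by blast
   qed
  qed
  have lc: "set (linprod rs) \<subseteq> C" using linprod_closed[of rs] rs T by simp
  have "set (linprod rs) \<subseteq> ?Z"
  proof
   fix c assume c: "c \<in> set (linprod rs)"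
   show "c \<in> ?Z" unfolding dec_fixed_def
    using c lc fixed S by (intro CollectI conjI exI[of _ S] ballI) (auto simp: D_def)
  qed
  hence mp: "map \<tau> (linprod rs) = linprod rs" using auts_fix[OF t] by (intro map_idI) auto
  have xT: "x \<in> T"
  proof -
   have "id \<in> D" using auts_id by (simp add: D_def dec_on_def)
   moreover have "x = id x" by simp
   ultimately show ?thesis unfolding T_def by blast
  qed
  have "eval (linprod rs) (\<tau> x) = \<tau> (eval (linprod rs) x)" using auts_eval[OF t lc x] mp by simp
  also have "\<dots> = \<zero>" using eval_linprod_root[of rs x] rs T xT auts_const[OF t] by simp
  finally have "\<tau> x \<in> T"
   using eval_linprod_zero_iff[of rs "\<tau> x"] rs T auts_closed[OF t x] by simp
  then obtain \<delta> where d: "\<delta> \<in> D" "\<tau> x = \<delta> x" by (auto simp: T_def)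
  have "x \<in> S" using xT TS by blast
  thus ?thesis using d by (simp add: D_def dec_on_def)
 qed
 moreover have "\<tau> \<in> auts K" using t auts_K_mono[OF dec_fixed_overfield[OF A]] by blast
 ultimately show "\<tau> \<in> dec_on A C" by (simp add: dec_on_def)
qed

text \<open>An element that is its only conjugate has a minimal polynomial with a single root. The
  explicit bound on \<open>m\<close> is what makes a uniform exponent possible.\<close>

lemma fixed_power_in:
 assumes E: "overfield E" and x: "x \<in> C" and fixed: "\<And>\<tau>. \<tau> \<in> auts E \<Longrightarrow> \<tau> x = x"
  and q: "set q \<subseteq> E" "\<not> set q \<subseteq> {\<zero>}" "eval q x = \<zero>"
 shows "\<exists>m<length q. additive_exponent m \<and> x [^] m \<in> E"
proof -
 obtain rs where rs: "set rs = {\<tau> x | \<tau>. \<tau> \<in> auts E}" "min_poly E x (linprod rs)"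
  using conjugates[OF E x] by blast
 have "set rs \<subseteq> {x}"
 proof
  fix r assume "r \<in> set rs"
  then obtain \<tau> where "\<tau> \<in> auts E" "r = \<tau> x" unfolding rs(1) by blast
  thus "r \<in> {x}" using fixed by simp
 qed
 hence r: "rs = replicate (length rs) x" by (intro replicate_eqI) auto
 have "length (linprod rs) \<le> length q"
  using rs(2) q by (meson min_poly_def not_le)
 hence "length rs < length q" by simp
 thus ?thesis
  using min_poly_single_root[OF overfieldD(1)[OF E] x, of "length rs"] rs(2) r by metis
qed

lemma additive_exponent_prod:
 "finite I \<Longrightarrow> (\<And>i. i \<in> I \<Longrightarrow> additive_exponent (f i)) \<Longrightarrow> additive_exponent (\<Prod>i\<in>I. f i)"
 by (induction I rule: finite_induct) (auto intro: additive_exponent_mult simp: additive_exponent_one[simplified])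

lemma pow_in_subring: "subring E R \<Longrightarrow> x \<in> E \<Longrightarrow> x [^] (n::nat) \<in> E"
 by (induction n) (auto simp: subringE)

text \<open>The exponent must not depend on \<open>E\<close>, because the power will have to lie in
  an intersection of fields. The multiplicity of \<open>x\<close> is bounded by the length of one
  relation over \<open>K\<close>, and the product of all additive exponents below this bound serves
  every \<open>E\<close>.\<close>

lemma uniform_fixed_power:
 assumes x: "x \<in> C"
 shows "\<exists>N. additive_exponent N \<and> (\<forall>E. overfield E \<longrightarrow> (\<forall>\<tau>\<in>auts E. \<tau> x = x) \<longrightarrow> x [^] N \<in> E)"
proof -
 obtain q where q: "set q \<subseteq> K" "q \<noteq> []" "hd q = \<one>" "eval q x = \<zero>" using algebraic_K[OF x] by blast
 have "\<one> \<in> set q" using q by (metis hd_in_set)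
 hence nz: "\<not> set q \<subseteq> {\<zero>}" by auto
 define I where "I = {m. m < length q \<and> additive_exponent m}"
 define N where "N = \<Prod>I"
 have fin: "finite I" by (simp add: I_def)
 have "additive_exponent N" unfolding N_def by (rule additive_exponent_prod[OF fin]) (simp add: I_def)
 moreover have "x [^] N \<in> E" if E: "overfield E" "\<forall>\<tau>\<in>auts E. \<tau> x = x" for E
 proof -
  obtain m where m: "m \<in> I" "x [^] m \<in> E"
   using fixed_power_in[OF E(1) x _ _ nz q(4)] E q(1) overfieldD(2)[OF E(1)] by (auto simp: I_def)
  hence "m dvd N" unfolding N_def using dvd_prodI[OF fin m(1), of "\<lambda>x. x"] by simp
  then obtain k where "N = m * k" by (rule dvdE)
  hence "x [^] N = (x [^] m) [^] k" using x by (simp add: nat_pow_pow)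
  thus ?thesis using pow_in_subring[OF overfieldD(3)[OF E(1)] m(2)] by simp
 qed
 ultimately show ?thesis by blast
qed

lemma overfield_Inter:
 assumes ne: "\<E> \<noteq> {}" and E: "\<And>E. E \<in> \<E> \<Longrightarrow> overfield E"
 shows "overfield (\<Inter>\<E>)"
proof (rule subring_overfield)
 show "K \<subseteq> \<Inter>\<E>" using overfieldD(2)[OF E] by blast
 have s: "subring E R" if "E \<in> \<E>" for E using overfieldD(3)[OF E[OF that]] .
 show "subring (\<Inter>\<E>) R"
 proof (rule subringI)
  show "\<Inter>\<E> \<subseteq> C" using ne subringE(1)[OF s] by blast
  show "\<one> \<in> \<Inter>\<E>" using subringE(3)[OF s] by blast
  fix x y assume xy: "x \<in> \<Inter>\<E>" "y \<in> \<Inter>\<E>"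
  show "\<ominus> x \<in> \<Inter>\<E>" using xy subringE(5)[OF s] by blast
  show "x \<otimes> y \<in> \<Inter>\<E>" using xy subringE(6)[OF s] by blast
  show "x \<oplus> y \<in> \<Inter>\<E>" using xy subringE(7)[OF s] by blast
 qed
qed

context
 fixes A assumes A: "valring A"
begin

lemma hensel_subset_dec_fixed: "hensel A \<subseteq> dec_fixed A"
proof -
 have "henselian A (dec_fixed A)"
  using henselian_iff[OF A dec_fixed_overfield[OF A]] dec_fixed_henselian[OF A] by simp
 thus ?thesis by (auto simp: hensel_def)
qed

lemma hensel_overfield: "overfield (hensel A)"
 unfolding hensel_def
proof (rule overfield_Inter)
 show "{E. henselian A E} \<noteq> {}"
  using henselian_iff[OF A dec_fixed_overfield[OF A]] dec_fixed_henselian[OF A] by blast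
 show "overfield E" if "E \<in> {E. henselian A E}" for E using that by (simp add: henselian_def)
qed

lemma dec_fixed_by_dec:
 assumes x: "x \<in> dec_fixed A" and t: "\<tau> \<in> dec_on A C"
 shows "\<tau> x = x"
proof -
 obtain S where S: "S \<subseteq> C" "\<forall>\<tau>\<in>dec_on A S. \<tau> x = x" using x by (auto simp: dec_fixed_def)
 have "\<tau> \<in> dec_on A S" using dec_on_mono[OF S(1)] t by blast
 thus ?thesis using S(2) by blast
qed

text \<open>Additive powering is injective, so an automorphism that fixes \<open>x [^] N\<close>
  fixes \<open>x\<close>.\<close>

lemma auts_fixing_powers:
 assumes E: "overfield E"
  and pow: "\<And>x. x \<in> F \<Longrightarrow> x \<in> C \<and> (\<exists>N. additive_exponent N \<and> x [^] N \<in> E)"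
 shows "auts E \<subseteq> auts F"
proof
 fix \<tau> assume t: "\<tau> \<in> auts E"
 have "\<tau> x = x" if x: "x \<in> F" for x
 proof -
  obtain N where N: "x \<in> C" "additive_exponent N" "x [^] N \<in> E" using pow[OF x] by blast
  have "\<tau> x [^] N = x [^] N" using auts_fix[OF t N(3)] auts_unary(3)[OF t N(1)] by simp
  thus ?thesis using additive_exponent_inj[OF N(2)] N(1) auts_closed[OF t N(1)] by blast
 qed
 thus "\<tau> \<in> auts F" using t by (simp add: auts_def)
qed

text \<open>It is not automatic that an intersection of henselian fields is henselian. For
  \<open>x\<close> in \<open>dec_fixed A\<close>, one and the same power lies in all henselian
  fields, hence in their intersection, and automorphisms fixing that power fix
  \<open>x\<close>.\<close>

lemma hensel_henselian: "auts (hensel A) \<subseteq> dec_on A C"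
proof -
 have "auts (hensel A) \<subseteq> auts (dec_fixed A)"
 proof (rule auts_fixing_powers[OF hensel_overfield])
  fix x assume x: "x \<in> dec_fixed A"
  hence xc: "x \<in> C" by (simp add: dec_fixed_def)
  obtain N where N: "additive_exponent N"
   "\<And>E. overfield E \<Longrightarrow> (\<forall>\<tau>\<in>auts E. \<tau> x = x) \<Longrightarrow> x [^] N \<in> E"
   using uniform_fixed_power[OF xc] by blast
  have "x [^] N \<in> E" if h: "henselian A E" for E
  proof (rule N(2))
   show E: "overfield E" using h by (simp add: henselian_def)
   have "auts E \<subseteq> dec_on A C" using henselian_iff[OF A E] h by simp
   thus "\<forall>\<tau>\<in>auts E. \<tau> x = x" using dec_fixed_by_dec[OF x] by blast
  qed
  hence "x [^] N \<in> hensel A" by (simp add: hensel_def)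
  thus "x \<in> C \<and> (\<exists>N. additive_exponent N \<and> x [^] N \<in> hensel A)"
   using xc N(1) by blast
 qed
 thus ?thesis using dec_fixed_henselian[OF A] by blast
qed

lemma hensel_least: "overfield E \<Longrightarrow> auts E \<subseteq> dec_on A C \<Longrightarrow> hensel A \<subseteq> E"
 using henselian_iff[OF A] by (auto simp: hensel_def)

lemma fixed_by_dec_power:
 assumes x: "x \<in> C" and f: "\<And>\<tau>. \<tau> \<in> dec_on A C \<Longrightarrow> \<tau> x = x"
 shows "\<exists>N. additive_exponent N \<and> x [^] N \<in> hensel A"
 using uniform_fixed_power[OF x] hensel_overfield hensel_henselian f by blast

end

lemma additive_pow_eval:
 assumes q: "additive_exponent q" and h: "set h \<subseteq> C" and x: "x \<in> C"
 shows "(eval h x) [^] q = eval (map (\<lambda>c. c [^] q) h) (x [^] q)"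
 using h
proof (induction h)
 case Nil
 have "q > 0" using q by (simp add: additive_exponent_def)
 thus ?case by (simp add: nat_pow_zero)
next
 case (Cons a h)
 have c: "a \<in> C" "set h \<subseteq> C" using Cons.prems by auto
 have e: "eval h x \<in> C" using eval_in_carrier c x by blast
 have "(a \<otimes> x [^] length h \<oplus> eval h x) [^] q = (a \<otimes> x [^] length h) [^] q \<oplus> (eval h x) [^] q"
  using q c e x by (simp add: additive_exponent_def)
 also have "(a \<otimes> x [^] length h) [^] q = a [^] q \<otimes> (x [^] q) [^] length h"
  using c x by (simp add: nat_pow_distrib nat_pow_pow mult.commute)
 finally show ?case using Cons c by simp
qed

text \<open>
 \<open>N\<close> makes the power \<open>x\<^sup>N\<close> separable: the coefficients of the polynomial whose simple roots are the
 conjugates of \<open>x\<close> are purely inseparable over \<open>E\<close>.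
\<close>

lemma separable_power:
 assumes E: "overfield E" and x: "x \<in> C"
 shows "\<exists>N p. additive_exponent N \<and> set p \<subseteq> E \<and> p \<noteq> [] \<and> hd p = \<one> \<and> eval p (x [^] N) = \<zero> \<and>
  length p = Suc (card {\<tau> (x [^] N) | \<tau>. \<tau> \<in> auts E})"
proof -
 note EE = overfieldD[OF E]
 define S where "S = {\<tau> x | \<tau>. \<tau> \<in> auts E}"
 have S: "finite S" "S \<subseteq> C"
  using finite_conjugates[OF E x] auts_closed[OF _ x] by (auto simp: S_def)
 obtain rs where rs: "set rs = S" "distinct rs" using finite_distinct_list[OF S(1)] by blast
 have rc: "set rs \<subseteq> C" using rs S by simp
 have lc: "set (linprod rs) \<subseteq> C" by (rule linprod_closed[OF rc])
 have stab: "\<tau> ` S \<subseteq> S" if t: "\<tau> \<in> auts E" for \<tau>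
 proof
  fix z assume "z \<in> \<tau> ` S"
  then obtain \<rho> where "\<rho> \<in> auts E" "z = (\<tau> \<circ> \<rho>) x" by (auto simp: S_def)
  thus "z \<in> S" using auts_comp[OF t] unfolding S_def by blast
 qed
 have "\<exists>N. additive_exponent N \<and> c [^] N \<in> E" if c: "c \<in> set (linprod rs)" for c
 proof -
  have cc: "c \<in> C" using c lc by blast
  have "\<forall>\<tau>\<in>auts E. \<tau> c = c" using linprod_fixed[OF S rs _ stab c] by blast
  thus ?thesis using uniform_fixed_power[OF cc] E by blast
 qed
 then obtain f where f: "\<And>c. c \<in> set (linprod rs) \<Longrightarrow> additive_exponent (f c) \<and> c [^] f c \<in> E" by metis
 define N where "N = (\<Prod>c\<in>set (linprod rs). f c)"
 have N: "additive_exponent N" unfolding N_def using f by (intro additive_exponent_prod) auto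
 have cN: "c [^] N \<in> E" if c: "c \<in> set (linprod rs)" for c
 proof -
  have "f c dvd N" unfolding N_def by (rule dvd_prodI[OF _ c]) simp
  then obtain k where "N = f c * k" by (rule dvdE)
  hence "c [^] N = (c [^] f c) [^] k" using c lc by (simp add: nat_pow_pow subset_iff)
  thus ?thesis using pow_in_subring[OF EE(3)] f[OF c] by simp
 qed
 \<comment> \<open>Raising the coefficients to the power \<open>N\<close> gives a polynomial
   vanishing at \<open>x [^] N\<close>, by additivity; injectivity of powering keeps the number of
   conjugates.\<close>
 define p where "p = map (\<lambda>c. c [^] N) (linprod rs)"
 have ne: "linprod rs \<noteq> []" using length_linprod[of rs] by (metis list.size(3) nat.distinct(1))
 have "x \<in> S" unfolding S_def using auts_id by (intro CollectI exI[of _ id]) simp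
 hence "eval (linprod rs) x = \<zero>" using eval_linprod_root[OF rc] rs by simp
 moreover have "N > 0" using N by (simp add: additive_exponent_def)
 ultimately have "eval p (x [^] N) = \<zero>"
  using additive_pow_eval[OF N lc x] by (simp add: p_def nat_pow_zero)
 moreover have "set p \<subseteq> E" "p \<noteq> []" "hd p = \<one>"
  using cN ne hd_linprod[OF rc] by (auto simp: p_def hd_map)
 moreover have "length p = Suc (card {\<tau> (x [^] N) | \<tau>. \<tau> \<in> auts E})"
 proof -
  have "{\<tau> (x [^] N) | \<tau>. \<tau> \<in> auts E} = (\<lambda>y. y [^] N) ` S"
   using auts_unary(3)[OF _ x] by (auto simp: S_def image_iff)
  moreover have "inj_on (\<lambda>y. y [^] N) S"
   using additive_exponent_inj[OF N] S by (auto simp: inj_on_def)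
  ultimately have "card {\<tau> (x [^] N) | \<tau>. \<tau> \<in> auts E} = card S" by (simp add: card_image)
  also have "\<dots> = length rs" using rs by (metis distinct_card)
  finally show ?thesis by (simp add: p_def)
 qed
 ultimately show ?thesis using N by blast
qed

section \<open>Relations between conjugates over growing fields\<close>

lemma eval_finsum_coefficients:
 assumes J: "finite J" and h: "\<And>j. j \<in> J \<Longrightarrow> length (h j) = s \<and> set (h j) \<subseteq> C"
  and w: "\<And>j. j \<in> J \<Longrightarrow> w j \<in> C" and z: "z \<in> C"
 shows "eval (map (\<lambda>i. \<Oplus>j\<in>J. h j ! i \<otimes> w j) [0..<s]) z = (\<Oplus>j\<in>J. eval (h j) z \<otimes> w j)"
 using J h w
proof (induction rule: finite_induct)
 case empty
 have "set (map (\<lambda>i. \<Oplus>j\<in>{}. h j ! i \<otimes> w j) [0..<s]) \<subseteq> {\<zero>}" by auto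
 thus ?case using eval_zeros z by simp
next
 case (insert j J)
 let ?G = "\<lambda>J. map (\<lambda>i. \<Oplus>j\<in>J. h j ! i \<otimes> w j) [0..<s]"
 have hc: "h j' ! i \<in> C" if "j' \<in> insert j J" "i < s" for j' i
  using insert.prems(1)[OF that(1)] that(2) by (metis nth_mem subsetD)
 have hj: "length (h j) = s" "set (h j) \<subseteq> C" "w j \<in> C" using insert.prems by auto
 have fc: "(\<lambda>j. h j ! i \<otimes> w j) \<in> J \<rightarrow> C" if "i < s" for i using insert.prems hc that by auto
 have "?G (insert j J) = map2 (\<oplus>) (map (\<lambda>c. w j \<otimes> c) (h j)) (?G J)"
 proof (rule nth_equalityI)
  fix i assume "i < length (?G (insert j J))"
  hence i: "i < s" by simp
  thus "?G (insert j J) ! i = map2 (\<oplus>) (map (\<lambda>c. w j \<otimes> c) (h j)) (?G J) ! i"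
   using insert.hyps fc[OF i] hc[of j i] hj by (simp add: m_comm)
 qed (simp add: hj)
 moreover have "eval (map2 (\<oplus>) (map (\<lambda>c. w j \<otimes> c) (h j)) (?G J)) z
   = eval (map (\<lambda>c. w j \<otimes> c) (h j)) z \<oplus> eval (?G J) z"
  by (rule eval_map2_add) (use hj z fc in auto)
 moreover have "eval (map (\<lambda>c. w j \<otimes> c) (h j)) z = w j \<otimes> eval (h j) z"
  by (rule eval_map_scale) (use hj z in auto)
 moreover have "eval (?G J) z = (\<Oplus>j\<in>J. eval (h j) z \<otimes> w j)" using insert by simp
 moreover have "(\<lambda>j. eval (h j) z \<otimes> w j) \<in> J \<rightarrow> C" "eval (h j) z \<in> C"
  using insert.prems z eval_in_carrier by auto
 ultimately show ?case using insert.hyps hj by (simp add: m_comm)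
qed

text \<open>Linear independence over \<open>E\<close> of the vectors formed by all conjugates of the
  \<open>b j\<close>, indexed by the automorphisms. Unlike independence of the \<open>b j\<close>
  themselves, it can persist when \<open>E\<close> meets the field they generate.\<close>

definition galois_independent :: "'i set \<Rightarrow> ('i \<Rightarrow> 'a) \<Rightarrow> 'a set \<Rightarrow> bool"
 where "galois_independent J b E \<longleftrightarrow> (\<forall>c. (\<forall>j\<in>J. c j \<in> E) \<longrightarrow>
  (\<forall>\<tau>\<in>auts K. (\<Oplus>j\<in>J. c j \<otimes> \<tau> (b j)) = \<zero>) \<longrightarrow> (\<forall>j\<in>J. c j = \<zero>))"

text \<open>Coefficients in the extension are polynomials in \<open>x\<close> of degree below the
  number of conjugates. Automorphisms over \<open>E\<close> turn the relation into one at every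
  conjugate of \<open>x\<close>; so the relation, read as a polynomial, has too many roots and
  vanishes coefficientwise, which leaves relations over \<open>E\<close>. The length assumption on
  \<open>p\<close> is the separability of \<open>x\<close> and supplies enough conjugates.\<close>

lemma galois_independent_simple_extension:
 assumes E: "overfield E" and J: "finite J" "b \<in> J \<rightarrow> C" and ind: "galois_independent J b E"
  and x: "x \<in> C"
  and p: "set p \<subseteq> E" "p \<noteq> []" "hd p = \<one>" "eval p x = \<zero>" "length p = Suc (card {\<tau> x | \<tau>. \<tau> \<in> auts E})"
 shows "galois_independent J b (simple_extension E x)"
 unfolding galois_independent_def
proof (intro allI impI)
 note EE = overfieldD[OF E]
 define S where "S = {\<tau> x | \<tau>. \<tau> \<in> auts E}"
 define s where "s = card S"
 have S: "finite S" "S \<subseteq> C"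
  using finite_conjugates[OF E x] auts_closed[OF _ x] by (auto simp: S_def)
 fix c assume c: "\<forall>j\<in>J. c j \<in> simple_extension E x"
  and rel: "\<forall>\<tau>\<in>auts K. (\<Oplus>j\<in>J. c j \<otimes> \<tau> (b j)) = \<zero>"
 \<comment> \<open>Padding with leading zeros gives all coefficient lists the same length
   \<open>s\<close>.\<close>
 have "\<exists>h. length h = s \<and> set h \<subseteq> E \<and> c j = eval h x" if j: "j \<in> J" for j
 proof -
  obtain h0 where h0: "set h0 \<subseteq> E" "c j = eval h0 x"
   using simple_extension_eval[OF EE(4) x] c j by blast
  obtain h where h: "set h \<subseteq> E" "length h < length p" "eval h x = c j"
   using monic_division[OF EE(3) p(1,2,3) h0(1)] p(4) h0(2) x by auto
  have "eval (replicate (s - length h) \<zero> @ h) x = c j"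
   using eval_replicate[of h x "s - length h"] h EE(4) x by auto
  moreover have "set (replicate (s - length h) \<zero> @ h) \<subseteq> E" using h(1) subringE(2)[OF EE(3)] by auto
  moreover have "length (replicate (s - length h) \<zero> @ h) = s" using h(2) p(5) by (simp add: s_def S_def)
  ultimately show ?thesis by metis
 qed
 then obtain h where h: "\<And>j. j \<in> J \<Longrightarrow> length (h j) = s \<and> set (h j) \<subseteq> E \<and> c j = eval (h j) x" by metis
 have hc: "length (h j) = s \<and> set (h j) \<subseteq> C" if "j \<in> J" for j using h[OF that] EE(4) by blast
 have hE: "h j ! i \<in> E" if "j \<in> J" "i < s" for j i using h[OF that(1)] that(2) by (metis nth_mem subsetD)
 have zero: "(\<Oplus>j\<in>J. h j ! i \<otimes> \<sigma>' (b j)) = \<zero>" if s: "\<sigma>' \<in> auts K" and i: "i < s" for \<sigma>' i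
 proof -
  define G where "G = map (\<lambda>i. \<Oplus>j\<in>J. h j ! i \<otimes> \<sigma>' (b j)) [0..<s]"
  have sb: "\<sigma>' (b j) \<in> C" if "j \<in> J" for j 
  proof -
   have "b j \<in> C" using J(2) that by blast
   thus ?thesis by (rule auts_closed[OF s])
  qed
  have Gc: "set G \<subseteq> C"
  proof -
   have "(\<lambda>j. h j ! i \<otimes> \<sigma>' (b j)) \<in> J \<rightarrow> C" if "i < s" for i
   proof
    fix j assume j: "j \<in> J"
    show "h j ! i \<otimes> \<sigma>' (b j) \<in> C" using subsetD[OF EE(4) hE[OF j that]] sb[OF j] by simp
   qed
   hence "(\<Oplus>j\<in>J. h j ! i \<otimes> \<sigma>' (b j)) \<in> C" if "i < s" for i using that by (intro finsum_closed)
   thus ?thesis unfolding G_def by (auto simp only: set_map set_upt image_subset_iff atLeastLessThan_iff)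
  qed
  have "set G \<subseteq> {\<zero>}"
  proof (rule list_with_many_roots_zero[OF S _ Gc])
   show "length G \<le> card S" by (simp add: G_def s_def)
   fix y assume "y \<in> S"
   then obtain \<rho> where r: "\<rho> \<in> auts E" "y = \<rho> x" by (auto simp: S_def)
   obtain \<rho>' where r': "\<rho>' \<in> auts E" "\<And>z. z \<in> C \<Longrightarrow> \<rho> (\<rho>' z) = z"
    using auts_inverse[OF EE(4) r(1)] by blast
   \<comment> \<open>The relation is taken at \<open>\<rho>' \<circ> \<sigma>'\<close>, so that
     applying \<open>\<rho>\<close> restores \<open>\<sigma>'\<close> on the \<open>b j\<close> and
     moves only the coefficients.\<close>
   have "\<rho>' \<circ> \<sigma>' \<in> auts K" using auts_comp[of \<rho>' K \<sigma>'] r'(1) auts_K_mono[OF E] s by blast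
   hence "(\<Oplus>j\<in>J. c j \<otimes> \<rho>' (\<sigma>' (b j))) = \<zero>" using rel by auto
   hence z: "\<rho> (\<Oplus>j\<in>J. c j \<otimes> \<rho>' (\<sigma>' (b j))) = \<zero>" using auts_const[OF r(1)] by simp
   have cc: "c j \<in> C" if "j \<in> J" for j using h[OF that] hc[OF that] eval_in_carrier x by simp
   have "\<rho> (c j \<otimes> \<rho>' (\<sigma>' (b j))) = eval (h j) y \<otimes> \<sigma>' (b j)" if j: "j \<in> J" for j
   proof -
    have "map \<rho> (h j) = h j" using h[OF j] auts_fix[OF r(1)] by (intro map_idI) auto
    hence "\<rho> (c j) = eval (h j) y" using auts_eval[OF r(1), of "h j" x] hc[OF j] h[OF j] x r(2) by simp
    thus ?thesis using auts_binary(2)[OF r(1) cc[OF j] auts_closed[OF r'(1) sb[OF j]]] r'(2)[OF sb[OF j]] by simp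
   qed
   moreover have "\<rho> (\<Oplus>j\<in>J. c j \<otimes> \<rho>' (\<sigma>' (b j))) = (\<Oplus>j\<in>J. \<rho> (c j \<otimes> \<rho>' (\<sigma>' (b j))))"
   proof (rule auts_finsum[OF r(1) J(1)])
    show "(\<lambda>j. c j \<otimes> \<rho>' (\<sigma>' (b j))) \<in> J \<rightarrow> C"
    proof
     fix j assume j: "j \<in> J"
     show "c j \<otimes> \<rho>' (\<sigma>' (b j)) \<in> C" using cc[OF j] auts_closed[OF r'(1) sb[OF j]] by simp
    qed
   qed
   ultimately have "(\<Oplus>j\<in>J. eval (h j) y \<otimes> \<sigma>' (b j)) = \<zero>"
   proof -
    have yc: "y \<in> C" using auts_closed[OF r(1) x] r(2) by simp
    have "(\<Oplus>j\<in>J. \<rho> (c j \<otimes> \<rho>' (\<sigma>' (b j)))) = (\<Oplus>j\<in>J. eval (h j) y \<otimes> \<sigma>' (b j))"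
    proof (rule finsum_cong')
     show "(\<lambda>j. eval (h j) y \<otimes> \<sigma>' (b j)) \<in> J \<rightarrow> C"
     proof
      fix j assume j: "j \<in> J"
      show "eval (h j) y \<otimes> \<sigma>' (b j) \<in> C"
       using eval_in_carrier[of "h j" y] hc[OF j] yc sb[OF j] by simp
     qed
    qed (use \<open>\<And>j. j \<in> J \<Longrightarrow> \<rho> (c j \<otimes> \<rho>' (\<sigma>' (b j))) = eval (h j) y \<otimes> \<sigma>' (b j)\<close> in auto)
    thus ?thesis using z \<open>\<rho> (\<Oplus>j\<in>J. c j \<otimes> \<rho>' (\<sigma>' (b j))) = (\<Oplus>j\<in>J. \<rho> (c j \<otimes> \<rho>' (\<sigma>' (b j))))\<close>
     by metis
   qed
   moreover have "eval G y = (\<Oplus>j\<in>J. eval (h j) y \<otimes> \<sigma>' (b j))"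
    unfolding G_def
   proof (rule eval_finsum_coefficients[OF J(1)])
    show "y \<in> C" using auts_closed[OF r(1) x] r(2) by simp
   qed (use hc sb in auto)
   ultimately show "eval G y = \<zero>" by simp
  qed
  moreover have "(\<Oplus>j\<in>J. h j ! i \<otimes> \<sigma>' (b j)) \<in> set G" using i by (auto simp: G_def)
  ultimately show ?thesis by blast
 qed
 show "\<forall>j\<in>J. c j = \<zero>"
 proof
  fix j assume j: "j \<in> J"
  have "h j ! i = \<zero>" if i: "i < s" for i
  proof -
   have "\<forall>j\<in>J. h j ! i \<in> E" using hE i by blast
   moreover have "\<forall>\<tau>\<in>auts K. (\<Oplus>j\<in>J. h j ! i \<otimes> \<tau> (b j)) = \<zero>" using zero[OF _ i] by blast
   ultimately have "\<forall>j\<in>J. h j ! i = \<zero>"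
    using ind[unfolded galois_independent_def, THEN spec, of "\<lambda>j. h j ! i"] by simp
   thus ?thesis using j by blast
  qed
  hence "set (h j) \<subseteq> {\<zero>}" using h[OF j] by (auto simp: in_set_conv_nth)
  thus "c j = \<zero>" using h[OF j] eval_zeros x by simp
 qed
qed

context
 fixes A assumes A: "valring A"
begin

text \<open>
 A maximal field between \<open>K\<close> and its henselization over which the family is still independent is
 henselian, since it contains a suitable power of every element of the henselization.
\<close>

theorem hensel_galois_independent:
 assumes J: "finite J" "b \<in> J \<rightarrow> C" and ind: "galois_independent J b K"
 shows "galois_independent J b (hensel A)"
proof -
 note HH = overfieldD[OF hensel_overfield[OF A]]
 define \<E> where "\<E> = {E. overfield E \<and> E \<subseteq> hensel A \<and> galois_independent J b E}"
 have "\<exists>M\<in>\<E>. \<forall>E\<in>\<E>. M \<subseteq> E \<longrightarrow> E = M"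
 proof (rule subset_Zorn_nonempty)
  show "\<E> \<noteq> {}" using overfield_K HH(2) ind by (auto simp: \<E>_def)
  fix \<C> assume C: "\<C> \<noteq> {}" "subset.chain \<E> \<C>"
  have CE: "overfield E" "E \<subseteq> hensel A" "galois_independent J b E" if "E \<in> \<C>" for E
   using C(2) that by (auto simp: subset_chain_def \<E>_def)
  have ch: "E \<subseteq> F \<or> F \<subseteq> E" if "E \<in> \<C>" "F \<in> \<C>" for E F
   using C(2) that by (auto simp: subset_chain_def)
  have "overfield (\<Union>\<C>)"
  proof (rule subring_overfield)
   show "K \<subseteq> \<Union>\<C>" using C(1) overfieldD(2)[OF CE(1)] by blast
   have s: "subring E R" if "E \<in> \<C>" for E using overfieldD(3)[OF CE(1)[OF that]] .
   show "subring (\<Union>\<C>) R"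
   proof (rule subringI)
    show "\<Union>\<C> \<subseteq> C" using subringE(1)[OF s] by blast
    show "\<one> \<in> \<Union>\<C>" using C(1) subringE(3)[OF s] by blast
    fix a b assume "a \<in> \<Union>\<C>" "b \<in> \<Union>\<C>"
    then obtain E F where "E \<in> \<C>" "F \<in> \<C>" "a \<in> E" "b \<in> F" by blast
    then obtain U where U: "U \<in> \<C>" "a \<in> U" "b \<in> U" using ch by blast
    show "\<ominus> a \<in> \<Union>\<C>" using subringE(5)[OF s[OF U(1)] U(2)] U(1) by blast
    show "a \<otimes> b \<in> \<Union>\<C>" using subringE(6)[OF s[OF U(1)] U(2,3)] U(1) by blast
    show "a \<oplus> b \<in> \<Union>\<C>" using subringE(7)[OF s[OF U(1)] U(2,3)] U(1) by blast
   qed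
  qed
  moreover have "\<Union>\<C> \<subseteq> hensel A" using CE(2) by auto
  moreover have "galois_independent J b (\<Union>\<C>)"
   unfolding galois_independent_def
  proof (intro allI impI)
   fix c assume c: "\<forall>j\<in>J. c j \<in> \<Union>\<C>" and rel: "\<forall>\<tau>\<in>auts K. (\<Oplus>j\<in>J. c j \<otimes> \<tau> (b j)) = \<zero>"
   have "\<exists>E\<in>\<C>. \<forall>j\<in>J. c j \<in> E"
    using J(1) c
   proof (induction rule: finite_induct)
    case (insert j J)
    then obtain E F where EF: "E \<in> \<C>" "\<forall>j\<in>J. c j \<in> E" "F \<in> \<C>" "c j \<in> F" by auto
    show ?case
    proof (cases "E \<subseteq> F")
     case True
     thus ?thesis using EF by (intro bexI[of _ F]) auto
    next
     case False
     hence "F \<subseteq> E" using ch[OF EF(1,3)] by blast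
     thus ?thesis using EF by (intro bexI[of _ E]) auto
    qed
   qed (use C(1) in auto)
   then obtain E where "E \<in> \<C>" "\<forall>j\<in>J. c j \<in> E" by blast
   thus "\<forall>j\<in>J. c j = \<zero>" using CE(3)[of E] rel unfolding galois_independent_def by blast
  qed
  ultimately show "\<Union>\<C> \<in> \<E>" by (simp add: \<E>_def)
 qed
 then obtain E where E: "overfield E" "E \<subseteq> hensel A" "galois_independent J b E"
  and max: "\<And>F. F \<in> \<E> \<Longrightarrow> E \<subseteq> F \<Longrightarrow> F = E" by (auto simp: \<E>_def)
 note EE = overfieldD[OF E(1)]
 have "\<exists>N. additive_exponent N \<and> x [^] N \<in> E" if x: "x \<in> hensel A" for x
 proof -
  have xc: "x \<in> C" using x HH(4) by blast
  obtain N p where N: "additive_exponent N" and p: "set p \<subseteq> E" "p \<noteq> []" "hd p = \<one>" "eval p (x [^] N) = \<zero>"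
   "length p = Suc (card {\<tau> (x [^] N) | \<tau>. \<tau> \<in> auts E})"
   using separable_power[OF E(1) xc] by (elim exE conjE)
  define x' where "x' = x [^] N"
  have x'c: "x' \<in> C" using xc by (simp add: x'_def)
  define F where "F = simple_extension E x'"
  have xF: "x' \<in> F" unfolding F_def by (rule simple_extension_mem[OF EE(3) x'c])
  have EF: "E \<subseteq> F" unfolding F_def by (rule simple_extension_incl[OF EE(4) x'c])
  have Fo: "overfield F"
  proof (rule subring_overfield)
   show "subring F R" unfolding F_def by (rule simple_extension_closed[OF EE(3) x'c])
   show "K \<subseteq> F" using EF EE(2) by blast
  qed
  have "F \<subseteq> hensel A" unfolding F_def
  proof (rule simple_extension_subring_incl[OF HH(3) E(2)])
   show "x' \<in> hensel A" unfolding x'_def by (rule pow_in_subring[OF HH(3) x])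
  qed
  moreover have "galois_independent J b F"
   unfolding F_def x'_def using galois_independent_simple_extension[OF E(1) J E(3) _ p] xc by simp
  ultimately have "F \<in> \<E>" using Fo by (simp add: \<E>_def)
  hence "F = E" using max EF by blast
  hence "x' \<in> E" using xF by simp
  thus ?thesis using N unfolding x'_def by blast
 qed
 hence "auts E \<subseteq> auts (hensel A)"
  using HH(4) by (intro auts_fixing_powers[OF A E(1)]) blast
 hence "hensel A \<subseteq> E" using hensel_least[OF A E(1)] hensel_henselian[OF A] by blast
 hence "hensel A = E" using E(2) by blast
 thus ?thesis using E(3) by simp
qed

end

end

section \<open>Linear algebra over a local ring\<close>

context field
begin

lemma finsum_swap:
 assumes "finite I" "finite J" "\<And>i j. i \<in> I \<Longrightarrow> j \<in> J \<Longrightarrow> f i j \<in> C"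
 shows "(\<Oplus>i\<in>I. \<Oplus>j\<in>J. f i j) = (\<Oplus>j\<in>J. \<Oplus>i\<in>I. f i j)"
 using assms(1,3)
proof (induction rule: finite_induct)
 case (insert i I)
 hence f: "\<And>i' j. i' \<in> insert i I \<Longrightarrow> j \<in> J \<Longrightarrow> f i' j \<in> C" by blast
 have "(\<Oplus>i\<in>insert i I. \<Oplus>j\<in>J. f i j) = (\<Oplus>j\<in>J. f i j) \<oplus> (\<Oplus>i\<in>I. \<Oplus>j\<in>J. f i j)"
  using insert.hyps f by (intro finsum_insert) (auto intro!: finsum_closed)
 also have "(\<Oplus>i\<in>I. \<Oplus>j\<in>J. f i j) = (\<Oplus>j\<in>J. \<Oplus>i\<in>I. f i j)" using insert f by blast
 also have "(\<Oplus>j\<in>J. f i j) \<oplus> (\<Oplus>j\<in>J. \<Oplus>i\<in>I. f i j) = (\<Oplus>j\<in>J. f i j \<oplus> (\<Oplus>i\<in>I. f i j))"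
  using f by (intro finsum_addf[symmetric]) (auto intro!: finsum_closed)
 also have "\<dots> = (\<Oplus>j\<in>J. \<Oplus>i\<in>insert i I. f i j)"
 proof (rule finsum_cong')
  show "(\<lambda>j. \<Oplus>i\<in>insert i I. f i j) \<in> J \<rightarrow> C" using f by (auto intro!: finsum_closed)
  fix j assume j: "j \<in> J"
  show "f i j \<oplus> (\<Oplus>i\<in>I. f i j) = (\<Oplus>i\<in>insert i I. f i j)"
   using insert.hyps f j by (intro finsum_insert[symmetric]) auto
 qed simp
 finally show ?case .
qed (simp add: finsum_zero)

text \<open>A local ring with its ideal of nonunits. A field with \<open>{\<zero>}\<close> is an
  instance, so one elimination lemma serves both vector spaces and computations modulo a maximal
  ideal.\<close>

definition local_pair :: "'a set \<Rightarrow> 'a set \<Rightarrow> bool"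
 where "local_pair S N \<longleftrightarrow> subring S R \<and> N \<subseteq> S \<and> \<zero> \<in> N \<and> \<one> \<notin> N \<and>
  (\<forall>x\<in>N. \<forall>y\<in>N. x \<oplus> y \<in> N) \<and> (\<forall>s\<in>S. \<forall>x\<in>N. s \<otimes> x \<in> N) \<and> (\<forall>x\<in>S - N. inv x \<in> S)"

lemma local_pairD:
 assumes "local_pair S N"
 shows "subring S R" "N \<subseteq> S" "\<zero> \<in> N" "\<one> \<notin> N" "x \<in> N \<Longrightarrow> y \<in> N \<Longrightarrow> x \<oplus> y \<in> N"
  "s \<in> S \<Longrightarrow> x \<in> N \<Longrightarrow> s \<otimes> x \<in> N" "x \<in> S \<Longrightarrow> x \<notin> N \<Longrightarrow> inv x \<in> S" "S \<subseteq> C" "N \<subseteq> C"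
proof -
 have a: "subring S R" "N \<subseteq> S" "\<zero> \<in> N" "\<one> \<notin> N" "\<forall>x\<in>N. \<forall>y\<in>N. x \<oplus> y \<in> N"
  "\<forall>s\<in>S. \<forall>x\<in>N. s \<otimes> x \<in> N" "\<forall>x\<in>S - N. inv x \<in> S"
  using assms unfolding local_pair_def by simp_all
 show "subring S R" "N \<subseteq> S" "\<zero> \<in> N" "\<one> \<notin> N" by (fact a)+
 show "x \<in> N \<Longrightarrow> y \<in> N \<Longrightarrow> x \<oplus> y \<in> N" using a(5) by simp
 show "s \<in> S \<Longrightarrow> x \<in> N \<Longrightarrow> s \<otimes> x \<in> N" using a(6) by simp
 show "x \<in> S \<Longrightarrow> x \<notin> N \<Longrightarrow> inv x \<in> S" using a(7) by simp
 show "S \<subseteq> C" by (rule subringE(1)[OF a(1)])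
 thus "N \<subseteq> C" using a(2) by (rule order_trans[rotated])
qed

lemma subfield_local_pair:
 assumes E: "subfield E R"
 shows "local_pair E {\<zero>}"
proof -
 have s: "subring E R" "E \<subseteq> C" using subfieldE(1,3)[OF E] by auto
 have "s \<otimes> \<zero> = \<zero>" if "s \<in> E" for s using that s(2) by (intro r_null) blast
 moreover have "inv x \<in> E" if "x \<in> E - {\<zero>}" for x using subfield_inv_closed[OF E] that by blast
 ultimately show ?thesis using s(1) subringE(2)[OF s(1)] by (simp add: local_pair_def)
qed

lemma finsum_in_subset:
 assumes "finite J" "\<And>j. j \<in> J \<Longrightarrow> f j \<in> N" "\<zero> \<in> N" "\<And>x y. x \<in> N \<Longrightarrow> y \<in> N \<Longrightarrow> x \<oplus> y \<in> N" "N \<subseteq> C"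
 shows "finsum R f J \<in> N"
 using assms(1,2)
proof (induction rule: finite_induct)
 case (insert j J)
 have "f \<in> J \<rightarrow> C" "f j \<in> C" using insert.prems assms(5) by auto
 thus ?case using insert assms(4) by simp
qed (simp add: assms)

text \<open>Gaussian elimination modulo the nonunits \<open>N\<close>.\<close>

lemma linear_system:
 assumes SN: "local_pair S N" and I: "finite I" and J: "finite J" "card I < card J"
  and c: "\<And>i j. i \<in> I \<Longrightarrow> j \<in> J \<Longrightarrow> c j i \<in> S"
 shows "\<exists>k. (\<forall>j\<in>J. k j \<in> S) \<and> (\<exists>j\<in>J. k j \<notin> N) \<and> (\<forall>i\<in>I. (\<Oplus>j\<in>J. k j \<otimes> c j i) \<in> N)"
 using I J c
proof (induction I arbitrary: J c rule: finite_induct)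
 case empty
 hence "J \<noteq> {}" by auto
 thus ?case using local_pairD(4)[OF SN] subringE(3)[OF local_pairD(1)[OF SN]]
  by (intro exI[of _ "\<lambda>_. \<one>"]) auto
next
 case (insert i I)
 note L = local_pairD[OF SN]
 have cS: "c j l \<in> S" if "j \<in> J" "l \<in> insert i I" for j l using insert.prems(3) that by blast
 have cc: "c j l \<in> C" if "j \<in> J" "l \<in> insert i I" for j l using cS[OF that] L(8) by blast
 show ?case
 proof (cases "\<forall>j\<in>J. c j i \<in> N")
  \<comment> \<open>With all coefficients in \<open>N\<close>, equation \<open>i\<close> holds
    modulo \<open>N\<close> whatever the unknowns are.\<close>
  case True
  obtain k where k: "\<forall>j\<in>J. k j \<in> S" "\<exists>j\<in>J. k j \<notin> N" "\<forall>l\<in>I. (\<Oplus>j\<in>J. k j \<otimes> c j l) \<in> N"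
   using insert.IH[of J c] insert.prems(1,2) insert.hyps cS by auto
  have "(\<Oplus>j\<in>J. k j \<otimes> c j i) \<in> N"
   by (rule finsum_in_subset[OF insert.prems(1) _ L(3) L(5) L(9)]) (use True k(1) L(6) in auto)
  thus ?thesis using k by (intro exI[of _ k]) auto
 next
  case False
  then obtain j0 where j0: "j0 \<in> J" "c j0 i \<notin> N" by blast
  define u where "u = inv (c j0 i)"
  have ne: "c j0 i \<noteq> \<zero>" using j0 L(3) by auto
  have uS: "u \<in> S" "u \<in> C" using L(7)[OF cS[OF j0(1)] j0(2)] L(8) by (auto simp: u_def)
  define J' where "J' = J - {j0}"
  have J': "finite J'" "j0 \<notin> J'" "J = insert j0 J'" "card I < card J'"
   using insert.prems(1,2) insert.hyps j0(1) by (auto simp: J'_def)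
  \<comment> \<open>The coefficient of the unknown \<open>j0\<close> in equation \<open>i\<close> is
    the pivot. Its elimination leaves a system without this equation and without this
    unknown.\<close>
  define c' where "c' j l = c j l \<ominus> (c j i \<otimes> u) \<otimes> c j0 l" for j l
  have c'S: "c' j l \<in> S" if "j \<in> J'" "l \<in> insert i I" for j l
   using cS[of j l] cS[of j i] cS[of j0 l] that j0(1) uS subringE(5,6,7)[OF L(1)]
   by (simp add: c'_def J'_def minus_eq)
  obtain k' where k': "\<forall>j\<in>J'. k' j \<in> S" "\<exists>j\<in>J'. k' j \<notin> N" "\<forall>l\<in>I. (\<Oplus>j\<in>J'. k' j \<otimes> c' j l) \<in> N"
   using insert.IH[of J' c'] J'(1,4) c'S by auto
  have k'c: "k' j \<in> C" if "j \<in> J'" for j using k'(1) that L(8) by blast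
  define s where "s = (\<Oplus>j\<in>J'. k' j \<otimes> (c j i \<otimes> u))"
  have sS: "s \<in> S" unfolding s_def
  proof (rule finsum_in_subset[OF J'(1)])
   show "k' j \<otimes> (c j i \<otimes> u) \<in> S" if "j \<in> J'" for j
    using k'(1) that cS[of j i] uS subringE(6)[OF L(1)] by (auto simp: J'_def)
  qed (use subringE(2,7)[OF L(1)] L(8) in auto)
  hence sc: "s \<in> C" using L(8) by blast
  \<comment> \<open>Back substitution: this choice for the pivot unknown makes equation
    \<open>i\<close> hold exactly.\<close>
  define k where "k j = (if j = j0 then \<ominus> s else k' j)" for j
  have key: "(\<Oplus>j\<in>J. k j \<otimes> c j l) = (\<Oplus>j\<in>J'. k' j \<otimes> c' j l)" if l: "l \<in> insert i I" for l
  proof -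
   have m1: "(\<lambda>j. k' j \<otimes> c j l) \<in> J' \<rightarrow> C" "(\<lambda>j. k' j \<otimes> (c j i \<otimes> u)) \<in> J' \<rightarrow> C"
    using k'c cc l uS by (auto simp: J'_def)
   have "(\<Oplus>j\<in>J. k j \<otimes> c j l) = k j0 \<otimes> c j0 l \<oplus> (\<Oplus>j\<in>J'. k j \<otimes> c j l)"
    unfolding J'(3)
    by (rule finsum_insert[OF J'(1,2)]) (use k'c cc l j0 sc in \<open>auto simp: k_def J'_def\<close>)
   also have "(\<Oplus>j\<in>J'. k j \<otimes> c j l) = (\<Oplus>j\<in>J'. k' j \<otimes> c j l)"
    by (rule finsum_cong'[OF refl m1(1)]) (auto simp: k_def J'_def)
   finally have 1: "(\<Oplus>j\<in>J. k j \<otimes> c j l) = (\<ominus> s) \<otimes> c j0 l \<oplus> (\<Oplus>j\<in>J'. k' j \<otimes> c j l)"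
    by (simp add: k_def)
   have "(\<Oplus>j\<in>J'. k' j \<otimes> c j l) = (\<Oplus>j\<in>J'. k' j \<otimes> c' j l \<oplus> (k' j \<otimes> (c j i \<otimes> u)) \<otimes> c j0 l)"
   proof (rule finsum_cong')
    fix j assume j: "j \<in> J'"
    have "k' j \<in> C" "c j l \<in> C" "c j i \<in> C" "c j0 l \<in> C"
     using k'c[OF j] cc[of j l] cc[of j i] cc[of j0 l] l j j0 by (auto simp: J'_def)
    thus "k' j \<otimes> c j l = k' j \<otimes> c' j l \<oplus> (k' j \<otimes> (c j i \<otimes> u)) \<otimes> c j0 l"
     unfolding c'_def using uS(2) by algebra
   next
    show "(\<lambda>j. k' j \<otimes> c' j l \<oplus> (k' j \<otimes> (c j i \<otimes> u)) \<otimes> c j0 l) \<in> J' \<rightarrow> C"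
     using k'c c'S[OF _ l] L(8) m1(2) cc[OF j0(1) l] by (auto simp: Pi_def subset_iff)
   qed simp
   also have "\<dots> = (\<Oplus>j\<in>J'. k' j \<otimes> c' j l) \<oplus> (\<Oplus>j\<in>J'. (k' j \<otimes> (c j i \<otimes> u)) \<otimes> c j0 l)"
    by (rule finsum_addf) (use k'c c'S[OF _ l] L(8) m1(2) cc[OF j0(1) l] in \<open>auto simp: Pi_def subset_iff\<close>)
   also have "(\<Oplus>j\<in>J'. (k' j \<otimes> (c j i \<otimes> u)) \<otimes> c j0 l) = s \<otimes> c j0 l"
    unfolding s_def by (rule finsum_ldistr[symmetric, OF J'(1) cc[OF j0(1) l] m1(2)])
   finally have 2: "(\<Oplus>j\<in>J'. k' j \<otimes> c j l) = (\<Oplus>j\<in>J'. k' j \<otimes> c' j l) \<oplus> s \<otimes> c j0 l" .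
   have fc: "(\<Oplus>j\<in>J'. k' j \<otimes> c' j l) \<in> C"
    using k'c c'S[OF _ l] L(8) by (auto intro!: finsum_closed m_closed)
   have "\<And>a b. a \<in> C \<Longrightarrow> b \<in> C \<Longrightarrow> (\<ominus> s) \<otimes> a \<oplus> (b \<oplus> s \<otimes> a) = b"
    using sc by algebra
   thus ?thesis unfolding 1 2 using fc cc[OF j0(1) l] by blast
  qed
  have "(\<Oplus>j\<in>J. k j \<otimes> c j i) = \<zero>"
  proof -
   have "k' j \<otimes> c' j i = \<zero>" if j: "j \<in> J'" for j
   proof -
    have "c j i \<in> C" using cc[of j i] j by (auto simp: J'_def)
    hence "(c j i \<otimes> u) \<otimes> c j0 i = c j i"
     unfolding u_def using mult_inv_cancel(3)[OF cc[OF j0(1)] ne] by simp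
    hence "c' j i = \<zero>" using \<open>c j i \<in> C\<close> by (simp add: c'_def minus_eq r_neg)
    thus ?thesis using k'c[OF j] by simp
   qed
   hence "(\<Oplus>j\<in>J'. k' j \<otimes> c' j i) = (\<Oplus>j\<in>J'. \<zero>)" by (intro finsum_cong') auto
   thus ?thesis using key[of i] by (simp add: finsum_zero)
  qed
  hence "\<forall>l\<in>insert i I. (\<Oplus>j\<in>J. k j \<otimes> c j l) \<in> N" using key k'(3) L(3) by auto
  moreover have "\<forall>j\<in>J. k j \<in> S" using k'(1) sS subringE(5)[OF L(1)] by (auto simp: k_def J'_def)
  moreover have "\<exists>j\<in>J. k j \<notin> N" using k'(2) J'(2,3) by (auto simp: k_def)
  ultimately show ?thesis by blast
 qed
qed

lemma double_finsum_combine: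
 assumes "finite I" "finite J" "\<And>j. j \<in> J \<Longrightarrow> k j \<in> C"
  "\<And>i j. i \<in> I \<Longrightarrow> j \<in> J \<Longrightarrow> c j i \<in> C" "\<And>i. i \<in> I \<Longrightarrow> e i \<in> C"
 shows "(\<Oplus>j\<in>J. k j \<otimes> (\<Oplus>i\<in>I. c j i \<otimes> e i)) = (\<Oplus>i\<in>I. (\<Oplus>j\<in>J. k j \<otimes> c j i) \<otimes> e i)"
proof -
 note cl = assms(3,4,5)
 have t: "k j \<otimes> c j i \<otimes> e i \<in> C" if "i \<in> I" "j \<in> J" for i j using cl that by simp
 have "(\<Oplus>j\<in>J. k j \<otimes> (\<Oplus>i\<in>I. c j i \<otimes> e i)) = (\<Oplus>j\<in>J. \<Oplus>i\<in>I. k j \<otimes> c j i \<otimes> e i)"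
 proof (rule finsum_cong')
  show "(\<lambda>j. \<Oplus>i\<in>I. k j \<otimes> c j i \<otimes> e i) \<in> J \<rightarrow> C" using t by (intro Pi_I finsum_closed) auto
  fix j assume j: "j \<in> J"
  have "k j \<otimes> (\<Oplus>i\<in>I. c j i \<otimes> e i) = (\<Oplus>i\<in>I. k j \<otimes> (c j i \<otimes> e i))"
   by (rule finsum_rdistr[OF assms(1) cl(1)[OF j]]) (use cl j in auto)
  also have "\<dots> = (\<Oplus>i\<in>I. k j \<otimes> c j i \<otimes> e i)"
  proof (rule finsum_cong')
   show "(\<lambda>i. k j \<otimes> c j i \<otimes> e i) \<in> I \<rightarrow> C" using t j by auto
   fix i assume i: "i \<in> I"
   show "k j \<otimes> (c j i \<otimes> e i) = k j \<otimes> c j i \<otimes> e i"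
    by (rule m_assoc[symmetric]) (use cl i j in auto)
  qed simp
  finally show "k j \<otimes> (\<Oplus>i\<in>I. c j i \<otimes> e i) = (\<Oplus>i\<in>I. k j \<otimes> c j i \<otimes> e i)" .
 qed simp
 also have "\<dots> = (\<Oplus>i\<in>I. \<Oplus>j\<in>J. k j \<otimes> c j i \<otimes> e i)"
  by (rule finsum_swap[OF assms(2,1)]) (rule t)
 also have "\<dots> = (\<Oplus>i\<in>I. (\<Oplus>j\<in>J. k j \<otimes> c j i) \<otimes> e i)"
 proof (rule finsum_cong')
  have kc: "(\<lambda>j. k j \<otimes> c j i) \<in> J \<rightarrow> C" if "i \<in> I" for i using cl that by auto
  show "(\<lambda>i. (\<Oplus>j\<in>J. k j \<otimes> c j i) \<otimes> e i) \<in> I \<rightarrow> C"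
   using finsum_closed[OF kc] cl(3) by auto
  fix i assume i: "i \<in> I"
  show "(\<Oplus>j\<in>J. k j \<otimes> c j i \<otimes> e i) = (\<Oplus>j\<in>J. k j \<otimes> c j i) \<otimes> e i"
   by (rule finsum_ldistr[OF assms(2) cl(3)[OF i] kc[OF i], symmetric])
 qed simp
 finally show ?thesis .
qed

section \<open>Independence, spans and dimension for indexed families\<close>

definition lin_indep :: "'a set \<Rightarrow> 'i set \<Rightarrow> ('i \<Rightarrow> 'a) \<Rightarrow> bool"
 where "lin_indep E J b \<longleftrightarrow> (\<forall>c. (\<forall>j\<in>J. c j \<in> E) \<longrightarrow> (\<Oplus>j\<in>J. c j \<otimes> b j) = \<zero> \<longrightarrow> (\<forall>j\<in>J. c j = \<zero>))"

definition lspan :: "'a set \<Rightarrow> 'i set \<Rightarrow> ('i \<Rightarrow> 'a) \<Rightarrow> 'a set"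
 where "lspan E J b = {(\<Oplus>j\<in>J. c j \<otimes> b j) | c. \<forall>j\<in>J. c j \<in> E}"

lemma lspan_obtain:
 assumes "x \<in> lspan E J b"
 obtains c where "\<And>j. j \<in> J \<Longrightarrow> c j \<in> E" "x = (\<Oplus>j\<in>J. c j \<otimes> b j)"
 using assms by (auto simp: lspan_def)

lemma lspanI: "(\<And>j. j \<in> J \<Longrightarrow> c j \<in> E) \<Longrightarrow> (\<Oplus>j\<in>J. c j \<otimes> b j) \<in> lspan E J b"
 by (auto simp: lspan_def)

lemma lin_indepD:
 assumes "lin_indep E J b" "(\<Oplus>j\<in>J. c j \<otimes> b j) = \<zero>" "\<And>j. j \<in> J \<Longrightarrow> c j \<in> E" "j \<in> J"
 shows "c j = \<zero>"
proof -
 have "(\<forall>j\<in>J. c j \<in> E) \<longrightarrow> (\<Oplus>j\<in>J. c j \<otimes> b j) = \<zero> \<longrightarrow> (\<forall>j\<in>J. c j = \<zero>)"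
  using assms(1) unfolding lin_indep_def by (rule spec)
 thus ?thesis using assms(2,3,4) by blast
qed

text \<open>Otherwise the coordinates form a homogeneous system with more unknowns than equations,
  and a nontrivial solution is a relation among the \<open>b j\<close>.\<close>

lemma card_le_of_lspan:
 assumes E: "subfield E R" and I: "finite I" "e \<in> I \<rightarrow> C" and J: "finite J" "lin_indep E J b"
  and b: "\<And>j. j \<in> J \<Longrightarrow> b j \<in> lspan E I e"
 shows "card J \<le> card I"
proof (rule ccontr)
 assume "\<not> card J \<le> card I"
 hence lt: "card I < card J" by simp
 have EC: "E \<subseteq> C" using subfieldE(3)[OF E] .
 define Q where "Q j c \<longleftrightarrow> (\<forall>i\<in>I. c i \<in> E) \<and> b j = (\<Oplus>i\<in>I. c i \<otimes> e i)" for j c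
 define c where "c j = (SOME c. Q j c)" for j
 have c: "(\<forall>i\<in>I. c j i \<in> E) \<and> b j = (\<Oplus>i\<in>I. c j i \<otimes> e i)" if j: "j \<in> J" for j
 proof -
  obtain d where "\<And>i. i \<in> I \<Longrightarrow> d i \<in> E" "b j = (\<Oplus>i\<in>I. d i \<otimes> e i)" using b[OF j] by (rule lspan_obtain) blast
  hence "Q j d" by (simp add: Q_def)
  hence "Q j (c j)" unfolding c_def by (rule someI[of "Q j"])
  thus ?thesis by (simp add: Q_def)
 qed
 have cE: "c j i \<in> E" if "i \<in> I" "j \<in> J" for i j using c[OF that(2)] that(1) by simp
 have "\<exists>k. (\<forall>j\<in>J. k j \<in> E) \<and> (\<exists>j\<in>J. k j \<notin> {\<zero>}) \<and> (\<forall>i\<in>I. (\<Oplus>j\<in>J. k j \<otimes> c j i) \<in> {\<zero>})"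
  by (rule linear_system[OF subfield_local_pair[OF E] I(1) J(1) lt cE])
 then obtain k where k: "\<forall>j\<in>J. k j \<in> E" "\<exists>j\<in>J. k j \<notin> {\<zero>}" "\<forall>i\<in>I. (\<Oplus>j\<in>J. k j \<otimes> c j i) \<in> {\<zero>}"
  by (elim exE conjE) blast
 have kc: "k j \<in> C" if "j \<in> J" for j using k(1) that EC by blast
 have cc: "c j i \<in> C" if "i \<in> I" "j \<in> J" for i j using c[OF that(2)] that(1) EC by blast
 have ec: "e i \<in> C" if "i \<in> I" for i using I(2) that by blast
 have "(\<Oplus>j\<in>J. k j \<otimes> b j) = (\<Oplus>j\<in>J. k j \<otimes> (\<Oplus>i\<in>I. c j i \<otimes> e i))"
 proof (rule finsum_cong')
  show "(\<lambda>j. k j \<otimes> (\<Oplus>i\<in>I. c j i \<otimes> e i)) \<in> J \<rightarrow> C"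
  proof
   fix j assume j: "j \<in> J"
   have "(\<lambda>i. c j i \<otimes> e i) \<in> I \<rightarrow> C" using cc[OF _ j] ec by auto
   thus "k j \<otimes> (\<Oplus>i\<in>I. c j i \<otimes> e i) \<in> C" using kc[OF j] finsum_closed by blast
  qed
  show "k j \<otimes> b j = k j \<otimes> (\<Oplus>i\<in>I. c j i \<otimes> e i)" if "j \<in> J" for j
   using c[OF that] by simp
 qed simp
 also have "\<dots> = (\<Oplus>i\<in>I. (\<Oplus>j\<in>J. k j \<otimes> c j i) \<otimes> e i)"
  by (rule double_finsum_combine[OF I(1) J(1) kc cc ec])
 also have "\<dots> = (\<Oplus>i\<in>I. \<zero>)" by (rule finsum_cong') (use k(3) ec in auto)
 finally have "(\<Oplus>j\<in>J. k j \<otimes> b j) = \<zero>" by (simp add: finsum_zero)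
 hence "k j = \<zero>" if "j \<in> J" for j by (rule lin_indepD[OF J(2) _ _ that]) (use k(1) in blast)
 thus False using k(2) by blast
qed

lemma lspan_closed:
 assumes E: "subring E R" and J: "finite J" "b \<in> J \<rightarrow> C"
 shows "lspan E J b \<subseteq> C" "\<zero> \<in> lspan E J b"
  "x \<in> lspan E J b \<Longrightarrow> y \<in> lspan E J b \<Longrightarrow> x \<oplus> y \<in> lspan E J b"
  "a \<in> E \<Longrightarrow> x \<in> lspan E J b \<Longrightarrow> a \<otimes> x \<in> lspan E J b"
  "j \<in> J \<Longrightarrow> b j \<in> lspan E J b"
proof -
 have EC: "E \<subseteq> C" using subringE(1)[OF E] .
 have m: "(\<lambda>j. c j \<otimes> b j) \<in> J \<rightarrow> C" if "\<forall>j\<in>J. c j \<in> E" for c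
  using that EC J(2) by (auto simp: Pi_def subset_iff)
 show "lspan E J b \<subseteq> C" using m by (auto simp: lspan_def intro!: finsum_closed)
 have "\<zero> \<otimes> b j = \<zero>" if "j \<in> J" for j using J(2) that by (intro l_null) blast
 hence "(\<Oplus>j\<in>J. \<zero> \<otimes> b j) = (\<Oplus>j\<in>J. \<zero>)" by (intro finsum_cong') auto
 hence "(\<Oplus>j\<in>J. \<zero> \<otimes> b j) = \<zero>" by (simp add: finsum_zero)
 thus "\<zero> \<in> lspan E J b"
  using lspanI[of J "\<lambda>_. \<zero>" E b] subringE(2)[OF E] by simp
 show "x \<oplus> y \<in> lspan E J b" if xy: "x \<in> lspan E J b" "y \<in> lspan E J b"
 proof -
  obtain c where c: "\<And>j. j \<in> J \<Longrightarrow> c j \<in> E" "x = (\<Oplus>j\<in>J. c j \<otimes> b j)" using xy(1) by (rule lspan_obtain) blast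
  obtain d where d: "\<And>j. j \<in> J \<Longrightarrow> d j \<in> E" "y = (\<Oplus>j\<in>J. d j \<otimes> b j)" using xy(2) by (rule lspan_obtain) blast
  have "x \<oplus> y = (\<Oplus>j\<in>J. c j \<otimes> b j \<oplus> d j \<otimes> b j)"
   unfolding c(2) d(2) using m c(1) d(1) by (intro finsum_addf[symmetric]) auto
  also have "\<dots> = (\<Oplus>j\<in>J. (c j \<oplus> d j) \<otimes> b j)"
   by (rule finsum_cong') (use c(1) d(1) EC J(2) in \<open>auto simp: l_distr Pi_def subset_iff\<close>)
  finally show ?thesis using lspanI[of J "\<lambda>j. c j \<oplus> d j" E b] c(1) d(1) subringE(7)[OF E] by simp
 qed
 show "a \<otimes> x \<in> lspan E J b" if a: "a \<in> E" and x: "x \<in> lspan E J b"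
 proof -
  obtain c where c: "\<And>j. j \<in> J \<Longrightarrow> c j \<in> E" "x = (\<Oplus>j\<in>J. c j \<otimes> b j)" using x by (rule lspan_obtain) blast
  have "a \<otimes> x = (\<Oplus>j\<in>J. a \<otimes> (c j \<otimes> b j))"
   unfolding c(2) using m c(1) a EC J(1) by (intro finsum_rdistr) auto
  also have "\<dots> = (\<Oplus>j\<in>J. (a \<otimes> c j) \<otimes> b j)"
   by (rule finsum_cong') (use c(1) a EC J(2) in \<open>auto simp: m_assoc Pi_def subset_iff\<close>)
  finally show ?thesis using lspanI[of J "\<lambda>j. a \<otimes> c j" E b] c(1) a subringE(6)[OF E] by simp
 qed
 show "b j \<in> lspan E J b" if j: "j \<in> J"
 proof -
  have bc: "b i \<in> C" if "i \<in> J" for i using J(2) that by blast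
  have "(\<Oplus>i\<in>J. (if i = j then \<one> else \<zero>) \<otimes> b i) = (\<Oplus>i\<in>J. if j = i then b i else \<zero>)"
   by (rule finsum_cong') (use bc in auto)
  also have "\<dots> = b j" using j J by (intro finsum_singleton) auto
  finally show ?thesis
   using lspanI[of J "\<lambda>i. if i = j then \<one> else \<zero>" E b] subringE(2,3)[OF E] by simp
 qed
qed

lemma lspan_minimal:
 assumes "finite J" "\<And>x y. x \<in> W \<Longrightarrow> y \<in> W \<Longrightarrow> x \<oplus> y \<in> W" "\<zero> \<in> W" "W \<subseteq> C"
  "\<And>j a. a \<in> E \<Longrightarrow> j \<in> J \<Longrightarrow> a \<otimes> b j \<in> W"
 shows "lspan E J b \<subseteq> W"
proof
 fix x assume "x \<in> lspan E J b"
 then obtain c where c: "\<And>j. j \<in> J \<Longrightarrow> c j \<in> E" "x = (\<Oplus>j\<in>J. c j \<otimes> b j)" by (rule lspan_obtain) blast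
 show "x \<in> W" unfolding c(2) by (rule finsum_in_subset) (use assms c in auto)
qed

text \<open>A maximal independent set of indices works: a relation with a new index \<open>j\<close>
  must have a nonzero coefficient there, so it expresses \<open>b j\<close>.\<close>

lemma independent_subfamily:
 assumes E: "subfield E R" and J: "finite J" "b \<in> J \<rightarrow> C"
 shows "\<exists>I\<subseteq>J. lin_indep E I b \<and> lspan E I b = lspan E J b"
proof -
 have Er: "subring E R" and EC: "E \<subseteq> C" using subfieldE(1,3)[OF E] by auto
 define P where "P I \<longleftrightarrow> I \<subseteq> J \<and> lin_indep E I b" for I
 have "P {}" by (simp add: P_def lin_indep_def)
 have "finite {I. P I}" using J(1) by (auto simp: P_def intro: finite_subset[of _ "Pow J"])
 then obtain I where I: "P I" "\<And>I'. P I' \<Longrightarrow> I \<subseteq> I' \<Longrightarrow> I' = I"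
  using finite_has_maximal[of "{I. P I}"] \<open>P {}\<close> by auto
 have IJ: "I \<subseteq> J" "finite I" "b \<in> I \<rightarrow> C" "lin_indep E I b"
  using I(1) J finite_subset by (auto simp: P_def)
 have bI: "b j \<in> lspan E I b" if j: "j \<in> J" for j
 proof (cases "j \<in> I")
  case True
  thus ?thesis using lspan_closed(5)[OF Er IJ(2,3)] by blast
 next
  case False
  have bc: "b j \<in> C" using J j by blast
  have "\<not> P (insert j I)" using I(2)[of "insert j I"] False by blast
  hence "\<not> lin_indep E (insert j I) b" using IJ(1) j by (simp add: P_def)
  then obtain c where c: "\<And>i. i \<in> insert j I \<Longrightarrow> c i \<in> E" "(\<Oplus>i\<in>insert j I. c i \<otimes> b i) = \<zero>"
   "\<exists>i\<in>insert j I. c i \<noteq> \<zero>" unfolding lin_indep_def by blast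
  have m: "(\<lambda>i. c i \<otimes> b i) \<in> I \<rightarrow> C" "c j \<in> C"
   using c(1) EC IJ(3) by (auto simp: Pi_def subset_iff)
  define w where "w = (\<Oplus>i\<in>I. c i \<otimes> b i)"
  have w: "w \<in> lspan E I b" "w \<in> C"
   using lspanI[of I c E b] c(1) m by (auto simp: w_def intro!: finsum_closed)
  have e: "c j \<otimes> b j \<oplus> w = \<zero>"
   using c(2) finsum_insert[OF IJ(2) False m(1)] m(2) bc by (simp add: w_def)
  have cj: "c j \<noteq> \<zero>"
  proof
   assume z: "c j = \<zero>"
   hence "w = \<zero>" using e bc w by simp
   hence "c i = \<zero>" if "i \<in> I" for i
    unfolding w_def by (rule lin_indepD[OF IJ(4) _ _ that]) (use c(1) in blast)
   thus False using c(3) z by blast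
  qed
  have "c j \<otimes> b j = \<ominus> w" using e m(2) bc w(2) by (metis m_closed minus_equality)
  hence "b j = inv (c j) \<otimes> (\<ominus> w)" using mult_inv_cancel(2)[OF m(2) cj bc] by simp
  also have "\<dots> = (\<ominus> (inv (c j))) \<otimes> w" using m(2) cj w(2) by (simp add: l_minus r_minus)
  finally have "b j = (\<ominus> (inv (c j))) \<otimes> w" .
  moreover have "\<ominus> (inv (c j)) \<in> E"
   using subfield_inv_closed[OF E _ cj] c(1) subringE(5)[OF Er] by auto
  ultimately show ?thesis using lspan_closed(4)[OF Er IJ(2,3) _ w(1)] by metis
 qed
 have "lspan E J b \<subseteq> lspan E I b"
  by (rule lspan_minimal[OF J(1)]) (use lspan_closed[OF Er IJ(2,3)] bI in blast)+
 moreover have "lspan E I b \<subseteq> lspan E J b"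
  by (rule lspan_minimal[OF IJ(2)]) (use lspan_closed[OF Er J] IJ(1) in blast)+
 ultimately show ?thesis using IJ by blast
qed

lemma combine_eq_finsum:
 assumes "length Ks = length Us" "set Ks \<subseteq> C" "set Us \<subseteq> C"
 shows "combine Ks Us = (\<Oplus>i\<in>{..<length Us}. Ks ! i \<otimes> Us ! i)"
 using assms
proof (induction Ks Us rule: list_induct2)
 case (Cons k Ks u Us)
 let ?f = "\<lambda>i. (k # Ks) ! i \<otimes> (u # Us) ! i"
 have c: "Ks ! i \<otimes> Us ! i \<in> C" if "i < length Us" for i
  using Cons.prems Cons.hyps that by (simp add: subset_iff)
 have S: "{..<Suc (length Us)} = insert 0 (Suc ` {..<length Us})" by (rule lessThan_Suc_eq_insert_0)
 have "(\<Oplus>i\<in>insert 0 (Suc ` {..<length Us}). ?f i) = ?f 0 \<oplus> (\<Oplus>i\<in>Suc ` {..<length Us}. ?f i)"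
  by (rule finsum_insert) (use c Cons.prems in auto)
 also have "(\<Oplus>i\<in>Suc ` {..<length Us}. ?f i) = (\<Oplus>i\<in>{..<length Us}. ?f (Suc i))"
  by (rule finsum_reindex) (use c in auto)
 finally show ?case using Cons by (simp add: S)
qed simp

text \<open>Translates from indexed families to the list-based \<open>combine\<close>,
  \<open>Span\<close> and \<open>dimension\<close> through an enumeration of
  \<open>I\<close>.\<close>

lemma dimension_lspan:
 assumes E: "subfield E R" and I: "finite I" "b \<in> I \<rightarrow> C" "lin_indep E I b"
 shows "dimension (card I) E (lspan E I b)"
proof -
 have EC: "E \<subseteq> C" using subfieldE(3)[OF E] .
 obtain f where f: "bij_betw f {..<card I} I" using ex_bij_betw_nat_finite[OF I(1)] by (auto simp: atLeast0LessThan)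
 define Us where "Us = map (\<lambda>i. b (f i)) [0..<card I]"
 have fI: "f i \<in> I" if "i < card I" for i using f that by (auto simp: bij_betw_def)
 have len: "length Us = card I" by (simp add: Us_def)
 have bf: "b (f i) \<in> C" if "i < card I" for i using fI[OF that] I(2) by blast
 hence UC: "set Us \<subseteq> C" by (auto simp: Us_def)
 have comb: "combine Ks Us = (\<Oplus>j\<in>I. Ks ! (inv_into {..<card I} f j) \<otimes> b j)"
  if Ks: "length Ks = length Us" "set Ks \<subseteq> E" for Ks
 proof -
  have kc: "Ks ! i \<in> C" if "i < card I" for i using Ks len that EC by (metis nth_mem subsetD)
  have g: "inv_into {..<card I} f (f i) = i" if "i < card I" for i
   using f that by (simp add: bij_betw_inv_into_left)
  have "combine Ks Us = (\<Oplus>i\<in>{..<card I}. Ks ! i \<otimes> Us ! i)"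
   using combine_eq_finsum[OF Ks(1) _ UC] Ks(2) EC len by auto
  also have "\<dots> = (\<Oplus>i\<in>{..<card I}. Ks ! (inv_into {..<card I} f (f i)) \<otimes> b (f i))"
   by (rule finsum_cong') (use g kc bf in \<open>auto simp: Us_def\<close>)
  also have "\<dots> = (\<Oplus>j\<in>f ` {..<card I}. Ks ! (inv_into {..<card I} f j) \<otimes> b j)"
  proof (rule finsum_reindex[symmetric])
   show "inj_on f {..<card I}" using f by (simp add: bij_betw_def)
   show "(\<lambda>j. Ks ! inv_into {..<card I} f j \<otimes> b j) \<in> f ` {..<card I} \<rightarrow> C"
   proof
    fix j assume "j \<in> f ` {..<card I}"
    then obtain i where "i < card I" "j = f i" by blast
    thus "Ks ! inv_into {..<card I} f j \<otimes> b j \<in> C" using g kc bf by simp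
   qed
  qed
  finally show ?thesis using f by (simp add: bij_betw_def)
 qed
 have "independent E Us"
 proof (rule trivial_combine_imp_independent[OF E UC])
  fix Ks assume Ks: "set Ks \<subseteq> E" "combine Ks Us = \<zero>"
  obtain Ks' where K': "set (take (length Us) Ks) \<subseteq> set Ks'" "set Ks' \<subseteq> set (take (length Us) Ks) \<union> {\<zero>}"
   "length Ks' = length Us" "combine Ks' Us = \<zero>"
   by (rule combine_normalize[OF subset_trans[OF Ks(1) EC] UC Ks(2)])
  have K'E: "set Ks' \<subseteq> E"
   using K'(2) Ks(1) set_take_subset[of "length Us" Ks] subringE(2)[OF subfieldE(1)[OF E]] by auto
  define c where "c j = Ks' ! (inv_into {..<card I} f j)" for j
  have inv_lt: "inv_into {..<card I} f j < card I" if "j \<in> I" for j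
   using f that inv_into_into[of j f "{..<card I}"] by (auto simp: bij_betw_def)
  have cE: "c j \<in> E" if "j \<in> I" for j
   using K'E K'(3) len inv_lt[OF that] unfolding c_def by (metis nth_mem subsetD)
  have c0: "(\<Oplus>j\<in>I. c j \<otimes> b j) = \<zero>" using comb[OF K'(3) K'E] K'(4) by (simp add: c_def)
  have z: "\<forall>j\<in>I. c j = \<zero>" using lin_indepD[OF I(3) c0] cE by blast
  have "Ks' ! i = \<zero>" if i: "i < card I" for i
  proof -
   have "inv_into {..<card I} f (f i) = i" using bij_betw_inv_into_left[OF f] i by simp
   moreover have "c (f i) = \<zero>" using z fI[OF i] by blast
   ultimately show ?thesis unfolding c_def by simp
  qed
  hence "set Ks' \<subseteq> {\<zero>}" using K'(3) len by (auto simp: in_set_conv_nth)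
  thus "set (take (length Us) Ks) \<subseteq> {\<zero>}" using K'(1) by blast
 qed
 moreover have "Span E Us = lspan E I b"
 proof
  show "Span E Us \<subseteq> lspan E I b"
  proof
   fix x assume "x \<in> Span E Us"
   then obtain Ks where Ks: "length Ks = length Us" "set Ks \<subseteq> E" "x = combine Ks Us"
    using Span_mem_iff_length_version[OF E UC, of x] by blast
   have inv_lt: "inv_into {..<card I} f j < card I" if "j \<in> I" for j
    using f that inv_into_into[of j f "{..<card I}"] by (auto simp: bij_betw_def)
   have "Ks ! (inv_into {..<card I} f j) \<in> E" if "j \<in> I" for j
    using Ks(1,2) len inv_lt[OF that] by (metis nth_mem subsetD)
   thus "x \<in> lspan E I b" unfolding Ks(3) comb[OF Ks(1,2)] by (rule lspanI)
  qed
  show "lspan E I b \<subseteq> Span E Us"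
  proof
   fix x assume "x \<in> lspan E I b"
   then obtain c where c: "\<And>j. j \<in> I \<Longrightarrow> c j \<in> E" "x = (\<Oplus>j\<in>I. c j \<otimes> b j)" by (rule lspan_obtain) blast
   define Ks where "Ks = map (\<lambda>i. c (f i)) [0..<card I]"
   have Ks: "length Ks = length Us" "set Ks \<subseteq> E" using c(1) fI by (auto simp: Ks_def Us_def)
   have "combine Ks Us = x"
    unfolding comb[OF Ks] c(2)
   proof (rule finsum_cong')
    fix j assume j: "j \<in> I"
    hence "inv_into {..<card I} f j < card I" "f (inv_into {..<card I} f j) = j"
     using f inv_into_into[of j f "{..<card I}"] f_inv_into_f[of j f "{..<card I}"] by (auto simp: bij_betw_def)
    thus "Ks ! inv_into {..<card I} f j \<otimes> b j = c j \<otimes> b j" by (simp add: Ks_def)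
   qed (use c(1) I(2) EC in \<open>auto simp: Pi_def subset_iff\<close>)
   thus "x \<in> Span E Us" using Span_mem_iff_length_version[OF E UC, of x] Ks by blast
  qed
 qed
 ultimately show ?thesis using dimensionI[OF E, of Us "lspan E I b"] len by simp
qed

lemma dimension_basis:
 assumes E: "subfield E R" and d: "dimension n E L"
 shows "\<exists>b. b \<in> {..<n} \<rightarrow> C \<and> lin_indep E {..<n} b \<and> lspan E {..<n} b = L"
proof -
 have EC: "E \<subseteq> C" using subfieldE(3)[OF E] .
 obtain Vs where V: "set Vs \<subseteq> C" "independent E Vs" "length Vs = n" "Span E Vs = L"
  using exists_base[OF E d] by blast
 have comb: "combine (map c [0..<n]) Vs = (\<Oplus>i\<in>{..<n}. c i \<otimes> Vs ! i)" if "\<forall>i\<in>{..<n}. c i \<in> E" for c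
 proof -
  have cc: "c i \<in> C" "Vs ! i \<in> C" if "i < n" for i
   using \<open>\<forall>i\<in>{..<n}. c i \<in> E\<close> EC V(1,3) that by (auto simp: subset_iff)
  have "set (map c [0..<n]) \<subseteq> C" "length (map c [0..<n]) = length Vs" using cc V(3) by auto
  hence "combine (map c [0..<n]) Vs = (\<Oplus>i\<in>{..<n}. map c [0..<n] ! i \<otimes> Vs ! i)"
   using combine_eq_finsum[of "map c [0..<n]" Vs] V(1,3) by simp
  also have "\<dots> = (\<Oplus>i\<in>{..<n}. c i \<otimes> Vs ! i)"
   by (rule finsum_cong') (use cc in auto)
  finally show ?thesis .
 qed
 have "lin_indep E {..<n} ((!) Vs)"
  unfolding lin_indep_def
 proof (intro allI impI)
  fix c assume c: "\<forall>j\<in>{..<n}. c j \<in> E" "(\<Oplus>j\<in>{..<n}. c j \<otimes> Vs ! j) = \<zero>"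
  have "set (map c [0..<n]) \<subseteq> E" "combine (map c [0..<n]) Vs = \<zero>" using c comb[OF c(1)] by auto
  hence "set (take (length Vs) (map c [0..<n])) \<subseteq> {\<zero>}"
   by (rule independent_imp_trivial_combine[OF E V(2)])
  hence sub: "c ` {0..<n} \<subseteq> {\<zero>}" using V(3) by simp
  have "c j = \<zero>" if "j < n" for j using subsetD[OF sub, of "c j"] that by simp
  thus "\<forall>j\<in>{..<n}. c j = \<zero>" by simp
 qed
 moreover have "lspan E {..<n} ((!) Vs) = L"
 proof
  show "lspan E {..<n} ((!) Vs) \<subseteq> L"
  proof
   fix x assume "x \<in> lspan E {..<n} ((!) Vs)"
   then obtain c where c: "\<And>j. j \<in> {..<n} \<Longrightarrow> c j \<in> E" "x = (\<Oplus>j\<in>{..<n}. c j \<otimes> Vs ! j)"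
    by (rule lspan_obtain) blast
   hence "x = combine (map c [0..<n]) Vs" using comb[of c] by simp
   moreover have "set (map c [0..<n]) \<subseteq> E" using c(1) by auto
   ultimately show "x \<in> L" using Span_eq_combine_set[OF E V(1)] V(4) by blast
  qed
  show "L \<subseteq> lspan E {..<n} ((!) Vs)"
  proof
   fix x assume "x \<in> L"
   then obtain Ks where Ks: "set Ks \<subseteq> E" "length Ks = length Vs" "x = combine Ks Vs"
    using Span_mem_iff_length_version[OF E V(1), of x] V(4) by blast
   hence "x = (\<Oplus>i\<in>{..<n}. Ks ! i \<otimes> Vs ! i)" using combine_eq_finsum[OF Ks(2) _ V(1)] EC V(3) by auto
   moreover have "Ks ! i \<in> E" if "i \<in> {..<n}" for i using Ks V(3) that by (metis lessThan_iff nth_mem subsetD)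
   ultimately show "x \<in> lspan E {..<n} ((!) Vs)" using lspanI[of "{..<n}" "(!) Ks" E] by simp
  qed
 qed
 moreover have "(!) Vs \<in> {..<n} \<rightarrow> C" using V by (auto simp: subset_iff)
 ultimately show ?thesis by blast
qed

end

section \<open>The local degree\<close>

locale valued_extension = algebraically_closed_over +
 fixes A L :: "'a set" and n :: nat
 assumes valring_A: "valring A" and overfield_L: "overfield L" and dim_L: "dimension n K L"
begin

text \<open>Both automorphisms pull \<open>A\<close> back to the same valuation ring of
  \<open>L\<close>; the classes correspond to the extensions to \<open>L\<close> of the valuation of
  \<open>K\<close>.\<close>

definition same_trace :: "('a \<Rightarrow> 'a) \<Rightarrow> ('a \<Rightarrow> 'a) \<Rightarrow> bool"
 where "same_trace \<tau> \<rho> \<longleftrightarrow> (\<forall>x\<in>L. \<tau> x \<in> A \<longleftrightarrow> \<rho> x \<in> A)"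

text \<open>The compositum of \<open>L\<close> with the henselization of \<open>K\<close>, later
  recognised as the henselization of \<open>L\<close>.\<close>

definition compositum :: "'a set"
 where "compositum = \<Inter> {E. overfield E \<and> L \<subseteq> E \<and> hensel A \<subseteq> E}"

lemma hensel_props:
 "overfield (hensel A)" "subfield (hensel A) R" "subring (hensel A) R" "hensel A \<subseteq> C" "K \<subseteq> hensel A"
 using hensel_overfield[OF valring_A] overfieldD by blast+

lemma L_props: "subfield L R" "subring L R" "L \<subseteq> C" "K \<subseteq> L"
 using overfield_L overfieldD by blast+

lemma K_props: "subfield K R" "subring K R" "K \<subseteq> C"
 using overfield_K overfieldD by blast+

lemma basis_exists:
 "\<exists>b. b \<in> {..<n} \<rightarrow> C \<and> lin_indep K {..<n} b \<and> lspan K {..<n} b = L"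
 by (rule dimension_basis[OF K_props(1) dim_L])

text \<open>Products of basis elements stay in \<open>L\<close>, so the span over the henselization
  is a ring; containing \<open>K\<close>, it is a field.\<close>

lemma compositum_eq_lspan:
 assumes b: "b \<in> {..<n} \<rightarrow> C" "lspan K {..<n} b = L"
 shows "compositum = lspan (hensel A) {..<n} b" "overfield compositum"
proof -
 let ?H = "hensel A" and ?F = "lspan (hensel A) {..<n} b"
 note W = lspan_closed[OF hensel_props(3) finite_lessThan b(1)]
 have LF: "L \<subseteq> ?F"
  unfolding b(2)[symmetric]
  by (rule lspan_minimal[OF finite_lessThan]) (use W hensel_props(5) in blast)+
 have one: "\<one> \<in> ?F" using LF subringE(3)[OF L_props(2)] by blast
 have HF: "?H \<subseteq> ?F"
 proof
  fix h assume h: "h \<in> ?H"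
  hence "h \<otimes> \<one> \<in> ?F" using W(4)[OF _ one] by blast
  thus "h \<in> ?F" using h hensel_props(4) by auto
 qed
 have bL: "b j \<in> L" if "j < n" for j
  using lspan_closed(5)[OF K_props(2) finite_lessThan b(1), of j] that b(2) by simp
 have bc: "b j \<in> C" if "j < n" for j using bL[OF that] L_props(3) by blast
 have mL: "x \<otimes> y \<in> ?F" if x: "x \<in> L" and y: "y \<in> ?F" for x y
 proof -
  have xc: "x \<in> C" using x L_props(3) by blast
  define U where "U = {y \<in> C. x \<otimes> y \<in> ?F}"
  have "?F \<subseteq> U"
  proof (rule lspan_minimal[OF finite_lessThan])
   show "\<zero> \<in> U" using W(2) xc by (simp add: U_def)
   show "U \<subseteq> C" by (auto simp: U_def)
   show "u \<oplus> v \<in> U" if "u \<in> U" "v \<in> U" for u v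
    using that W(3) xc by (simp add: U_def r_distr)
   fix j a assume aj: "a \<in> ?H" "j \<in> {..<n}"
   have ac: "a \<in> C" "b j \<in> C" using aj hensel_props(4) bc by auto
   have "x \<otimes> b j \<in> L" using x bL aj(2) subringE(6)[OF L_props(2)] by simp
   hence "a \<otimes> (x \<otimes> b j) \<in> ?F" using W(4) aj(1) LF by blast
   moreover have "a \<otimes> (x \<otimes> b j) = x \<otimes> (a \<otimes> b j)" using ac xc by (simp add: m_lcomm)
   ultimately show "a \<otimes> b j \<in> U" using ac by (simp add: U_def)
  qed
  thus ?thesis using y by (auto simp: U_def)
 qed
 have mult: "x \<otimes> y \<in> ?F" if x: "x \<in> ?F" and y: "y \<in> ?F" for x y
 proof -
  have yc: "y \<in> C" using y W(1) by blast
  define U where "U = {x \<in> C. x \<otimes> y \<in> ?F}"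
  have "?F \<subseteq> U"
  proof (rule lspan_minimal[OF finite_lessThan])
   show "\<zero> \<in> U" using W(2) yc by (simp add: U_def)
   show "U \<subseteq> C" by (auto simp: U_def)
   show "u \<oplus> v \<in> U" if "u \<in> U" "v \<in> U" for u v
    using that W(3) yc by (simp add: U_def l_distr)
   fix j a assume aj: "a \<in> ?H" "j \<in> {..<n}"
   have ac: "a \<in> C" "b j \<in> C" using aj hensel_props(4) bc by auto
   have "a \<otimes> (b j \<otimes> y) \<in> ?F" using W(4)[OF aj(1)] mL[OF bL y] aj(2) by simp
   thus "a \<otimes> b j \<in> U" using ac yc by (simp add: U_def m_assoc)
  qed
  thus ?thesis using x by (auto simp: U_def)
 qed
 have F: "overfield ?F"
 proof (rule subring_overfield)
  show "K \<subseteq> ?F" using HF hensel_props(5) by blast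
  show "subring ?F R"
  proof (rule subringI[OF W(1) one])
   fix x y assume xy: "x \<in> ?F" "y \<in> ?F"
   show "x \<otimes> y \<in> ?F" "x \<oplus> y \<in> ?F" using mult xy W(3) by auto
   have "(\<ominus> \<one>) \<otimes> x \<in> ?F"
    using W(4)[OF _ xy(1)] subringE(3,5)[OF hensel_props(3)] by blast
   moreover have "x \<in> C" using xy W(1) by blast
   ultimately show "\<ominus> x \<in> ?F" by (simp add: l_minus)
  qed
 qed
 have "?F \<subseteq> E" if E: "overfield E" "L \<subseteq> E" "?H \<subseteq> E" for E
 proof (rule lspan_minimal[OF finite_lessThan])
  note EE = subringE[OF overfieldD(3)[OF E(1)]]
  show "x \<oplus> y \<in> E" if "x \<in> E" "y \<in> E" for x y using EE(7) that by blast
  show "\<zero> \<in> E" "E \<subseteq> C" using EE by auto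
  show "a \<otimes> b j \<in> E" if "a \<in> ?H" "j \<in> {..<n}" for j a using EE(6) that E bL by blast
 qed
 thus eq: "compositum = ?F" unfolding compositum_def using F LF HF by blast
 show "overfield compositum" unfolding eq by (rule F)
qed

lemma compositum_props:
 "overfield compositum" "L \<subseteq> compositum" "hensel A \<subseteq> compositum"
 using compositum_eq_lspan(2) basis_exists by (auto simp: compositum_def)

text \<open>A basis is selected from a \<open>K\<close>-basis of \<open>L\<close>. That it consists
  of elements of \<open>L\<close> matters: it can be multiplied by other elements of
  \<open>L\<close> without leaving \<open>L\<close>.\<close>

lemma compositum_basis:
 "\<exists>I e. finite (I :: nat set) \<and> e \<in> I \<rightarrow> L \<and> lin_indep (hensel A) I e \<and>
   lspan (hensel A) I e = compositum \<and> dimension (card I) (hensel A) compositum"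
proof -
 obtain b where b: "b \<in> {..<n} \<rightarrow> C" "lin_indep K {..<n} b" "lspan K {..<n} b = L"
  using basis_exists by blast
 obtain I where I: "I \<subseteq> {..<n}" "lin_indep (hensel A) I b" "lspan (hensel A) I b = lspan (hensel A) {..<n} b"
  using independent_subfamily[OF hensel_props(2) finite_lessThan b(1)] by blast
 have fin: "finite I" using I(1) finite_subset by blast
 have bI: "b \<in> I \<rightarrow> C" using b(1) I(1) by blast
 have "b j \<in> L" if "j \<in> I" for j
  using lspan_closed(5)[OF K_props(2) finite_lessThan b(1), of j] that b(3) I(1) by blast
 moreover have eq: "lspan (hensel A) I b = compositum" using I(3) compositum_eq_lspan(1)[OF b(1,3)] by simp
 moreover have "dimension (card I) (hensel A) compositum"
  using dimension_lspan[OF hensel_props(2) fin bI I(2)] eq by simp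
 ultimately show ?thesis using fin I(2) by blast
qed

text \<open>An automorphism \<open>\<delta>\<close> carries one relation to the other. The
  pulled-back rings agree on \<open>L\<close>, so some \<open>\<eta>\<close> over \<open>L\<close>
  matches them on any finite set. Then \<open>\<rho> \<circ> (\<eta> \<circ> \<tau>')\<close>, with
  \<open>\<tau>'\<close> inverse to \<open>\<tau>\<close>, sends \<open>\<tau> (b j)\<close> to
  \<open>\<rho> (b j)\<close> and respects \<open>A\<close> on the finitely many elements that
  certify the \<open>k j\<close> as members of \<open>dec_fixed A\<close>; hence it fixes the
  \<open>k j\<close>.\<close>

lemma same_trace_relation:
 assumes st: "\<tau> \<in> auts K" "\<rho> \<in> auts K" "same_trace \<tau> \<rho>"
  and J: "finite J" "\<And>j. j \<in> J \<Longrightarrow> k j \<in> hensel A" "\<And>j. j \<in> J \<Longrightarrow> b j \<in> L"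
  and rel: "(\<Oplus>j\<in>J. k j \<otimes> \<tau> (b j)) = \<zero>"
 shows "(\<Oplus>j\<in>J. k j \<otimes> \<rho> (b j)) = \<zero>"
proof -
 define Q where "Q j S \<longleftrightarrow> finite S \<and> S \<subseteq> C \<and> (\<forall>\<tau>\<in>dec_on A S. \<tau> (k j) = k j)" for j S
 define S where "S j = (SOME S. Q j S)" for j
 have S: "Q j (S j)" if j: "j \<in> J" for j
 proof -
  have "k j \<in> dec_fixed A" using hensel_subset_dec_fixed[OF valring_A] J(2)[OF j] by blast
  then obtain S where "Q j S" by (auto simp: dec_fixed_def Q_def)
  thus ?thesis unfolding S_def by (rule someI[of "Q j"])
 qed
 define U where "U = (\<Union>j\<in>J. S j)"
 have U: "finite U" "U \<subseteq> C" using S J(1) by (auto simp: U_def Q_def)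
 obtain \<tau>' where t': "\<tau>' \<in> auts K" "\<And>x. x \<in> C \<Longrightarrow> \<tau>' (\<tau> x) = x" "\<And>x. x \<in> C \<Longrightarrow> \<tau> (\<tau>' x) = x"
  using auts_inverse[OF K_props(3) st(1)] by blast
 have "pullback \<tau> A \<inter> L = pullback \<rho> A \<inter> L"
  using st(3) L_props(3) by (auto simp: pullback_def same_trace_def)
 moreover have t'U: "finite (\<tau>' ` U)" "\<tau>' ` U \<subseteq> C" using U auts_closed[OF t'(1)] by auto
 ultimately obtain \<eta> where e: "\<eta> \<in> auts L" "\<forall>x\<in>\<tau>' ` U. x \<in> pullback \<tau> A \<longleftrightarrow> \<eta> x \<in> pullback \<rho> A"
  using valuation_conjugate[OF overfield_L pullback_valring[OF valring_A st(1)] pullback_valring[OF valring_A st(2)] _ t'U]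
  by blast
 have eK: "\<eta> \<in> auts K" using e(1) auts_K_mono[OF overfield_L] by blast
 define \<delta> where "\<delta> = \<rho> \<circ> (\<eta> \<circ> \<tau>')"
 have dK: "\<delta> \<in> auts K" unfolding \<delta>_def by (intro auts_comp st eK t'(1))
 have "\<delta> \<in> dec_on A U"
  unfolding dec_on_def
 proof (intro CollectI conjI ballI dK)
  fix s assume s: "s \<in> U"
  hence sc: "s \<in> C" using U by blast
  have c: "\<tau>' s \<in> C" "\<eta> (\<tau>' s) \<in> C" using auts_closed[OF t'(1) sc] auts_closed[OF eK] by auto
  have "\<tau>' s \<in> pullback \<tau> A \<longleftrightarrow> \<eta> (\<tau>' s) \<in> pullback \<rho> A" using e(2) s by blast
  thus "\<delta> s \<in> A \<longleftrightarrow> s \<in> A" using c t'(3)[OF sc] by (simp add: pullback_def \<delta>_def)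
 qed
 hence dk: "\<delta> (k j) = k j" if "j \<in> J" for j
 proof -
  have "dec_on A U \<subseteq> dec_on A (S j)" by (rule dec_on_mono) (use that in \<open>auto simp: U_def\<close>)
  thus ?thesis using S[OF that] \<open>\<delta> \<in> dec_on A U\<close> by (auto simp: Q_def)
 qed
 have bc: "b j \<in> C" "\<tau> (b j) \<in> C" "k j \<in> C" "\<rho> (b j) \<in> C" if "j \<in> J" for j
  using J(2,3)[OF that] L_props(3) hensel_props(4) auts_closed[OF st(1)] auts_closed[OF st(2)] by auto
 have db: "\<delta> (\<tau> (b j)) = \<rho> (b j)" if j: "j \<in> J" for j
  using t'(2)[OF bc(1)[OF j]] auts_fix[OF e(1) J(3)[OF j]] by (simp add: \<delta>_def)
 have "\<zero> = \<delta> (\<Oplus>j\<in>J. k j \<otimes> \<tau> (b j))" using rel auts_const[OF dK] by simp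
 also have "\<dots> = (\<Oplus>j\<in>J. \<delta> (k j \<otimes> \<tau> (b j)))"
  by (rule auts_finsum[OF dK J(1)]) (use bc in auto)
 also have "\<dots> = (\<Oplus>j\<in>J. k j \<otimes> \<rho> (b j))"
 proof (rule finsum_cong')
  show "(\<lambda>j. k j \<otimes> \<rho> (b j)) \<in> J \<rightarrow> C" using bc by auto
  show "\<delta> (k j \<otimes> \<tau> (b j)) = k j \<otimes> \<rho> (b j)" if j: "j \<in> J" for j
   using auts_binary(2)[OF dK bc(3)[OF j] bc(2)[OF j]] dk[OF j] db[OF j] by simp
 qed simp
 finally show ?thesis by simp
qed

end

text \<open>One automorphism for each extension to \<open>L\<close>, so \<open>card T\<close> is the
  number of extensions. Only the chosen representatives must map \<open>L\<close> to itself. This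
  covers a non-normal \<open>L\<close> with a unique extension, where the identity is the only
  representative.\<close>

locale trace_transversal = valued_extension +
 fixes T :: "('a \<Rightarrow> 'a) set"
 assumes finite_T: "finite T" and T_auts: "T \<subseteq> auts K"
  and T_stable: "\<tau> \<in> T \<Longrightarrow> \<tau> ` L = L"
  and T_distinct: "\<tau> \<in> T \<Longrightarrow> \<rho> \<in> T \<Longrightarrow> same_trace \<tau> \<rho> \<Longrightarrow> \<tau> = \<rho>"
  and T_cover: "\<rho> \<in> auts K \<Longrightarrow> \<exists>\<tau>\<in>T. same_trace \<rho> \<tau>"
begin

text \<open>Each conjugate of a basis element has \<open>m\<close> coordinates over the
  henselization. If \<open>n\<close> exceeded \<open>card T * m\<close>, a nontrivial combination
  over the henselization would vanish under all of \<open>T\<close>, hence by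
  \<open>same_trace_relation\<close> under all automorphisms, against Galois independence over the
  henselization.\<close>

lemma degree_le:
 assumes m: "dimension m (hensel A) compositum"
 shows "n \<le> card T * m"
proof (rule ccontr)
 assume "\<not> n \<le> card T * m"
 obtain b where b: "b \<in> {..<n} \<rightarrow> C" "lin_indep K {..<n} b" "lspan K {..<n} b = L"
  using basis_exists by blast
 have bL: "b j \<in> L" if "j < n" for j
  using lspan_closed(5)[OF K_props(2) finite_lessThan b(1), of j] that b(3) by simp
 obtain I :: "nat set" and e where I: "finite I" "e \<in> I \<rightarrow> L" "lspan (hensel A) I e = compositum"
  "dimension (card I) (hensel A) compositum" using compositum_basis by blast
 have "m = card I" using dimension_is_inj[OF hensel_props(2) m I(4)] .
 hence lt: "card (T \<times> I) < card {..<n}" using \<open>\<not> n \<le> card T * m\<close> by (simp add: card_cartesian_product)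
 have fin: "finite (T \<times> I)" using finite_T I(1) by blast
 have ec: "e i \<in> C" if "i \<in> I" for i using I(2) that L_props(3) by blast
 define Q where "Q \<tau> j c \<longleftrightarrow> (\<forall>i\<in>I. c i \<in> hensel A) \<and> \<tau> (b j) = (\<Oplus>i\<in>I. c i \<otimes> e i)" for \<tau> j c
 define c where "c j p = (SOME c. Q (fst p) j c) (snd p)" for j p
 have c: "(\<forall>i\<in>I. c j (\<tau>, i) \<in> hensel A) \<and> \<tau> (b j) = (\<Oplus>i\<in>I. c j (\<tau>, i) \<otimes> e i)"
  if t: "\<tau> \<in> T" and j: "j < n" for \<tau> j
 proof -
  have "\<tau> (b j) \<in> L" using T_stable[OF t] bL[OF j] by blast
  hence "\<tau> (b j) \<in> lspan (hensel A) I e" using compositum_props(2) I(3) by blast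
  then obtain d where "\<And>i. i \<in> I \<Longrightarrow> d i \<in> hensel A" "\<tau> (b j) = (\<Oplus>i\<in>I. d i \<otimes> e i)" by (rule lspan_obtain) blast
  hence "Q \<tau> j d" by (simp add: Q_def)
  hence "Q \<tau> j (SOME c. Q \<tau> j c)" by (rule someI[of "Q \<tau> j"])
  thus ?thesis by (simp add: Q_def c_def)
 qed
 have cH: "c j p \<in> hensel A" if "p \<in> T \<times> I" "j \<in> {..<n}" for p j
  using c[of "fst p" j] that by auto
 have "\<exists>k. (\<forall>j\<in>{..<n}. k j \<in> hensel A) \<and> (\<exists>j\<in>{..<n}. k j \<notin> {\<zero>}) \<and>
  (\<forall>p\<in>T \<times> I. (\<Oplus>j\<in>{..<n}. k j \<otimes> c j p) \<in> {\<zero>})"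
  by (rule linear_system[OF subfield_local_pair[OF hensel_props(2)] fin finite_lessThan lt cH])
 then obtain k where k: "\<And>j. j \<in> {..<n} \<Longrightarrow> k j \<in> hensel A" "\<exists>j\<in>{..<n}. k j \<noteq> \<zero>"
  "\<And>p. p \<in> T \<times> I \<Longrightarrow> (\<Oplus>j\<in>{..<n}. k j \<otimes> c j p) = \<zero>" by blast
 have kc: "k j \<in> C" if "j \<in> {..<n}" for j using k(1)[OF that] hensel_props(4) by blast
 have rel: "(\<Oplus>j\<in>{..<n}. k j \<otimes> \<tau> (b j)) = \<zero>" if t: "\<tau> \<in> T" for \<tau>
 proof -
  have cc: "c j (\<tau>, i) \<in> C" if "i \<in> I" "j \<in> {..<n}" for i j
   using cH[of "(\<tau>, i)" j] that t hensel_props(4) by auto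
  have "(\<Oplus>j\<in>{..<n}. k j \<otimes> \<tau> (b j)) = (\<Oplus>j\<in>{..<n}. k j \<otimes> (\<Oplus>i\<in>I. c j (\<tau>, i) \<otimes> e i))"
  proof (rule finsum_cong')
   show "(\<lambda>j. k j \<otimes> (\<Oplus>i\<in>I. c j (\<tau>, i) \<otimes> e i)) \<in> {..<n} \<rightarrow> C"
   proof
    fix j assume j: "j \<in> {..<n}"
    have "(\<lambda>i. c j (\<tau>, i) \<otimes> e i) \<in> I \<rightarrow> C" using cc[OF _ j] ec by auto
    thus "k j \<otimes> (\<Oplus>i\<in>I. c j (\<tau>, i) \<otimes> e i) \<in> C" using kc[OF j] finsum_closed by blast
   qed
   show "k j \<otimes> \<tau> (b j) = k j \<otimes> (\<Oplus>i\<in>I. c j (\<tau>, i) \<otimes> e i)" if "j \<in> {..<n}" for j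
    using c[OF t, of j] that by simp
  qed simp
  also have "\<dots> = (\<Oplus>i\<in>I. (\<Oplus>j\<in>{..<n}. k j \<otimes> c j (\<tau>, i)) \<otimes> e i)"
   by (rule double_finsum_combine[OF I(1) finite_lessThan kc cc ec])
  also have "\<dots> = (\<Oplus>i\<in>I. \<zero>)" by (rule finsum_cong') (use k(3) t ec in auto)
  finally show ?thesis by (simp add: finsum_zero)
 qed
 have all: "(\<Oplus>j\<in>{..<n}. k j \<otimes> \<rho> (b j)) = \<zero>" if r: "\<rho> \<in> auts K" for \<rho>
 proof -
  obtain \<tau> where t: "\<tau> \<in> T" "same_trace \<rho> \<tau>" using T_cover[OF r] by blast
  have st: "same_trace \<tau> \<rho>" using t(2) by (simp add: same_trace_def)
  show ?thesis
   by (rule same_trace_relation[OF _ r st finite_lessThan k(1) _ rel[OF t(1)]]) (use t(1) T_auts bL in auto)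
 qed
 \<comment> \<open>Over \<open>K\<close> the relation at the identity is enough.\<close>
 have "galois_independent {..<n} b K"
  unfolding galois_independent_def
 proof (intro allI impI)
  fix c assume c: "\<forall>j\<in>{..<n}. c j \<in> K" "\<forall>\<tau>\<in>auts K. (\<Oplus>j\<in>{..<n}. c j \<otimes> \<tau> (b j)) = \<zero>"
  have "(\<Oplus>j\<in>{..<n}. c j \<otimes> b j) = \<zero>" using c(2)[rule_format, OF auts_id] by simp
  thus "\<forall>j\<in>{..<n}. c j = \<zero>" using lin_indepD[OF b(2)] c(1) by blast
 qed
 hence "galois_independent {..<n} b (hensel A)"
  by (rule hensel_galois_independent[OF valring_A finite_lessThan b(1)])
 hence "\<forall>j\<in>{..<n}. k j = \<zero>"
  using k(1) all unfolding galois_independent_def by blast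
 thus False using k(2) by blast
qed

end

section \<open>Separating the conjugate valuations\<close>

context field
begin

lemma vlt_nat_pow:
 assumes A: "valring A" and v: "vlt A x y" and xy: "x \<in> C" "y \<in> C" and n: "n > 0"
 shows "vlt A (x [^] (n::nat)) (y [^] n)"
proof -
 obtain m where m: "n = Suc m" using n by (cases n) auto
 have x0: "x \<noteq> \<zero>" using v vle_zero[OF A xy(2)] by (auto simp: vlt_def)
 have "vlt A (x [^] m \<otimes> x) (x [^] m \<otimes> y)"
  using vlt_mult_iff[OF A xy, of "x [^] m"] v xy x0 by simp
 moreover have "vle A (x [^] m) (y [^] m)" using vle_nat_pow[OF A vlt_imp_vle[OF A v xy] xy] .
 hence "vle A (y \<otimes> x [^] m) (y \<otimes> y [^] m)" using vle_mult[OF A] xy by simp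
 hence "vle A (x [^] m \<otimes> y) (y [^] m \<otimes> y)" using xy by (simp add: m_comm)
 ultimately show ?thesis using vlt_vle_trans[OF A] xy by (simp add: m)
qed

lemma vle_nat_pow_cancel:
 assumes A: "valring A" and "vle A (x [^] n) (y [^] n)" "n > (0::nat)" "x \<in> C" "y \<in> C"
 shows "vle A x y"
 using vlt_nat_pow[OF A, of y x n] assms by (auto simp: vlt_def)

lemma exists_vle_minimum:
 assumes A: "valring A" and "finite I" "I \<noteq> {}" "\<And>i. i \<in> I \<Longrightarrow> f i \<in> C"
 shows "\<exists>i0\<in>I. \<forall>i\<in>I. vle A (f i0) (f i)"
 using assms(2-)
proof (induction rule: finite_ne_induct)
 case (singleton i)
 thus ?case using vle_refl[OF A] by simp
next
 case (insert i I)
 then obtain i0 where i0: "i0 \<in> I" "\<And>j. j \<in> I \<Longrightarrow> vle A (f i0) (f j)" by blast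
 have c: "f i \<in> C" "f i0 \<in> C" using insert.prems i0(1) by auto
 show ?case
 proof (cases "vle A (f i0) (f i)")
  case True
  thus ?thesis using i0 by (intro bexI[of _ i0]) auto
 next
  case False
  hence "vle A (f i) (f i0)" using vle_total[OF A c] by blast
  hence "vle A (f i) (f j)" if "j \<in> I" for j using vle_trans[OF A _ i0(2)[OF that] c(1)] by blast
  thus ?thesis using vle_refl[OF A c(1)] by (intro bexI[of _ i]) auto
 qed
qed

lemma finprod_in_subring:
 assumes S: "subring S R" and I: "finite I" "\<And>i. i \<in> I \<Longrightarrow> f i \<in> S"
 shows "finprod R f I \<in> S"
 using I
proof (induction rule: finite_induct)
 case (insert i I)
 have "f \<in> I \<rightarrow> C" "f i \<in> C" using insert.prems subringE(1)[OF S] by auto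
 thus ?case using insert subringE(6)[OF S] by simp
qed (simp add: subringE(3)[OF S])

lemma finsum_cartesian:
 assumes "finite I" "finite J" "\<And>i j. i \<in> I \<Longrightarrow> j \<in> J \<Longrightarrow> f (i, j) \<in> C"
 shows "(\<Oplus>p\<in>I \<times> J. f p) = (\<Oplus>i\<in>I. \<Oplus>j\<in>J. f (i, j))"
 using assms(1,3)
proof (induction rule: finite_induct)
 case (insert i I)
 have f: "f (i', j) \<in> C" if "i' \<in> insert i I" "j \<in> J" for i' j using insert.prems that by blast
 have "insert i I \<times> J = ({i} \<times> J) \<union> (I \<times> J)" by auto
 hence "(\<Oplus>p\<in>insert i I \<times> J. f p) = (\<Oplus>p\<in>{i} \<times> J. f p) \<oplus> (\<Oplus>p\<in>I \<times> J. f p)"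
  using insert.hyps assms(2) f by (simp only:, intro finsum_Un_disjoint) auto
 also have "(\<Oplus>p\<in>{i} \<times> J. f p) = (\<Oplus>j\<in>J. f (i, j))"
 proof -
  have "{i} \<times> J = Pair i ` J" by auto
  moreover have "f \<in> Pair i ` J \<rightarrow> C" using f by auto
  moreover have "inj_on (Pair i) J" by (simp add: inj_on_def)
  ultimately show ?thesis using finsum_reindex[of f "Pair i" J] by simp
 qed
 also have "(\<Oplus>p\<in>I \<times> J. f p) = (\<Oplus>i\<in>I. \<Oplus>j\<in>J. f (i, j))" using insert f by blast
 also have "(\<Oplus>j\<in>J. f (i, j)) \<oplus> \<dots> = (\<Oplus>i\<in>insert i I. \<Oplus>j\<in>J. f (i, j))"
  by (rule finsum_insert[symmetric, OF insert.hyps]) (use f in \<open>auto intro!: finsum_closed\<close>)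
 finally show ?case .
qed simp

lemma eval_rev_upt:
 assumes x: "x \<in> C" and a: "\<And>i. i < g \<Longrightarrow> a i \<in> C"
 shows "eval (map a (rev [0..<g])) x = (\<Oplus>i\<in>{..<g}. a i \<otimes> x [^] i)"
 using a
proof (induction g)
 case (Suc g)
 have "(\<Oplus>i\<in>insert g {..<g}. a i \<otimes> x [^] i) = a g \<otimes> x [^] g \<oplus> (\<Oplus>i\<in>{..<g}. a i \<otimes> x [^] i)"
  by (rule finsum_insert) (use Suc.prems x in auto)
 thus ?case using Suc by (simp add: lessThan_Suc)
qed simp

end

context valued_extension
begin

text \<open>Suppose \<open>\<rho> x\<close> is integral but \<open>\<tau> x\<close> is not. Some
  power of \<open>x\<close> has, for the ring pulled back by \<open>\<tau>\<close>, the value of an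
  element \<open>c\<close> of \<open>K\<close> outside \<open>A\<close>. The quotient
  \<open>u\<close> of \<open>c\<close> by that power is integral under \<open>\<tau>\<close>, hence
  under \<open>\<rho>\<close>, and multiplying back would make \<open>c\<close> integral.\<close>

lemma trace_incomparable:
 assumes st: "\<tau> \<in> auts K" "\<rho> \<in> auts K" and sub: "\<And>x. x \<in> L \<Longrightarrow> \<tau> x \<in> A \<Longrightarrow> \<rho> x \<in> A"
 shows "same_trace \<tau> \<rho>"
proof -
 have "\<tau> x \<in> A" if x: "x \<in> L" "\<rho> x \<in> A" for x
 proof (rule ccontr)
  assume xt: "\<tau> x \<notin> A"
  let ?B = "pullback \<tau> A"
  have B: "valring ?B" by (rule pullback_valring[OF valring_A st(1)])
  have xc: "x \<in> C" using x L_props by blast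
  have x0: "x \<noteq> \<zero>" using xt auts_const[OF st(1)] valring_closed(1)[OF valring_A] by auto
  obtain N c where Nc: "0 < (N::nat)" "c \<in> K" "c \<noteq> \<zero>" "veq ?B (x [^] N) c"
   using valuation_torsion[OF overfield_K B xc x0] by blast
  have cc: "c \<in> C" "c \<in> L" using subsetD[OF K_props(3) Nc(2)] subsetD[OF L_props(4) Nc(2)] by auto
  have "x \<notin> ?B" using xt by (simp add: pullback_def)
  hence "vlt ?B x \<one>" using not_in_iff[OF B xc] by simp
  hence "vlt ?B (x [^] N) \<one>" using vlt_nat_pow[OF B _ xc one_closed Nc(1)] by simp
  hence "vlt ?B c \<one>"
   using vle_vlt_trans[OF B, of c "x [^] N" \<one>] Nc(4) by (simp add: veq_def)
  hence "c \<notin> ?B" using not_in_iff[OF B cc(1)] by simp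
  hence cA: "c \<notin> A" using cc auts_fix[OF st(1) Nc(2)] by (simp add: pullback_def)
  define u where "u = inv (x [^] N) \<otimes> c"
  have "u \<in> ?B" using Nc(4) vle_iff_div[OF B, of "x [^] N" c] xc x0 cc by (simp add: u_def veq_def)
  moreover have uL: "u \<in> L"
   unfolding u_def using pow_in_subring[OF L_props(2) x(1)] subfield_inv_closed[OF L_props(1)] xc x0 cc(2)
    subringE(6)[OF L_props(2)] by simp
  ultimately have "\<rho> u \<in> A" using sub[OF uL] by (simp add: pullback_def)
  moreover have "\<rho> x [^] N \<in> A" using x(2) valring_closed[OF valring_A] by (induction N) auto
  ultimately have "\<rho> x [^] N \<otimes> \<rho> u \<in> A" using valring_closed(5)[OF valring_A] by blast
  moreover have "\<rho> x [^] N \<otimes> \<rho> u = \<rho> (x [^] N \<otimes> u)"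
   using auts_rules[OF st(2)] xc uL L_props(3) by (simp add: subset_iff)
  moreover have "x [^] N \<otimes> u = c" using xc x0 cc by (simp add: u_def)
  ultimately show False using cA auts_fix[OF st(2) Nc(2)] by simp
 qed
 thus ?thesis using sub by (auto simp: same_trace_def)
qed

lemma same_trace_id_comp:
 assumes "same_trace \<tau> id" "same_trace \<rho> id" "\<rho> ` L = L"
 shows "same_trace (\<tau> \<circ> \<rho>) id"
 using assms by (auto simp: same_trace_def)

text \<open>The automorphisms stand for the extensions: such an element is a unit at the given place
  of \<open>L\<close> and a nonunit at all the others.\<close>

definition separating :: "'a \<Rightarrow> bool"
 where "separating t \<longleftrightarrow> t \<in> L \<and> (\<forall>\<tau>\<in>auts K.
  (same_trace \<tau> id \<longrightarrow> veq A \<one> (\<tau> t)) \<and> (\<not> same_trace \<tau> id \<longrightarrow> vlt A \<one> (\<tau> t)))"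

lemma separatingD:
 assumes "separating t"
 shows "t \<in> L" "t \<in> C" "\<tau> \<in> auts K \<Longrightarrow> \<tau> t \<in> A" "\<tau> \<in> auts K \<Longrightarrow> same_trace \<tau> id \<Longrightarrow> veq A \<one> (\<tau> t)"
  "\<tau> \<in> auts K \<Longrightarrow> \<not> same_trace \<tau> id \<Longrightarrow> vlt A \<one> (\<tau> t)" "veq A \<one> t" "t \<noteq> \<zero>"
proof -
 show t: "t \<in> L" using assms by (simp add: separating_def)
 thus tc: "t \<in> C" using L_props by blast
 show v: "\<tau> \<in> auts K \<Longrightarrow> same_trace \<tau> id \<Longrightarrow> veq A \<one> (\<tau> t)"
  and w: "\<tau> \<in> auts K \<Longrightarrow> \<not> same_trace \<tau> id \<Longrightarrow> vlt A \<one> (\<tau> t)" for \<tau>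
  using assms by (simp_all add: separating_def)
 show "\<tau> t \<in> A" if "\<tau> \<in> auts K"
  using v[OF that] w[OF that] unit_in[OF valring_A] vlt_one_in[OF valring_A] auts_closed[OF that tc] by blast
 show v1: "veq A \<one> t" using v[OF auts_id] by (simp add: same_trace_def)
 show "t \<noteq> \<zero>" using unit_in[OF valring_A v1 tc] by blast
qed

end

context trace_transversal
begin

lemma T_inverse:
 assumes t: "\<tau> \<in> T"
 shows "\<exists>\<tau>'\<in>auts K. (\<forall>x\<in>C. \<tau>' (\<tau> x) = x \<and> \<tau> (\<tau>' x) = x) \<and> \<tau>' ` L = L"
proof -
 obtain \<tau>' where t': "\<tau>' \<in> auts K" "\<forall>x\<in>C. \<tau>' (\<tau> x) = x \<and> \<tau> (\<tau>' x) = x"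
  using auts_inverse[OF K_props(3)] t T_auts by blast
 have "\<tau>' ` L = \<tau>' ` \<tau> ` L" using T_stable[OF t] by simp
 also have "\<dots> = L" using t'(2) L_props(3) by (auto simp: image_image subset_iff)
 finally show ?thesis using t' by blast
qed

definition T_inv :: "('a \<Rightarrow> 'a) \<Rightarrow> 'a \<Rightarrow> 'a"
 where "T_inv \<tau> = (SOME \<tau>'. \<tau>' \<in> auts K \<and> (\<forall>x\<in>C. \<tau>' (\<tau> x) = x \<and> \<tau> (\<tau>' x) = x) \<and> \<tau>' ` L = L)"

lemma T_inv_props:
 assumes t: "\<tau> \<in> T"
 shows "T_inv \<tau> \<in> auts K" "x \<in> C \<Longrightarrow> T_inv \<tau> (\<tau> x) = x" "x \<in> C \<Longrightarrow> \<tau> (T_inv \<tau> x) = x"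
  "x \<in> L \<Longrightarrow> T_inv \<tau> x \<in> L"
proof -
 have "\<exists>\<tau>'. \<tau>' \<in> auts K \<and> (\<forall>x\<in>C. \<tau>' (\<tau> x) = x \<and> \<tau> (\<tau>' x) = x) \<and> \<tau>' ` L = L"
  using T_inverse[OF t] by blast
 hence p: "T_inv \<tau> \<in> auts K \<and> (\<forall>x\<in>C. T_inv \<tau> (\<tau> x) = x \<and> \<tau> (T_inv \<tau> x) = x) \<and> T_inv \<tau> ` L = L"
  unfolding T_inv_def by (rule someI_ex)
 thus "T_inv \<tau> \<in> auts K" "x \<in> C \<Longrightarrow> T_inv \<tau> (\<tau> x) = x" "x \<in> C \<Longrightarrow> \<tau> (T_inv \<tau> x) = x"
  "x \<in> L \<Longrightarrow> T_inv \<tau> x \<in> L" by blast+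
qed

lemma T_comp_inv_not_same:
 assumes t: "\<tau> \<in> T" "\<rho> \<in> T" "\<tau> \<noteq> \<rho>"
 shows "\<not> same_trace (\<tau> \<circ> T_inv \<rho>) id"
proof
 assume st: "same_trace (\<tau> \<circ> T_inv \<rho>) id"
 have "\<tau> x \<in> A \<longleftrightarrow> \<rho> x \<in> A" if x: "x \<in> L" for x
 proof -
  have "\<rho> x \<in> L" using T_stable[OF t(2)] x by blast
  hence "\<tau> (T_inv \<rho> (\<rho> x)) \<in> A \<longleftrightarrow> \<rho> x \<in> A" using st by (simp add: same_trace_def)
  moreover have "T_inv \<rho> (\<rho> x) = x" using T_inv_props(2)[OF t(2)] x L_props(3) by blast
  ultimately show ?thesis by simp
 qed
 thus False using T_distinct[OF t(1,2)] t(3) by (simp add: same_trace_def)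
qed

text \<open>By incomparability each other representative \<open>\<tau>\<close> has an element
  \<open>x \<tau>\<close> that is integral at the given place and not integral under
  \<open>\<tau>\<close>. In the product of the inverted geometric sums all factors are units at the
  given place; at any other place all are integral and at least one is a nonunit.\<close>

lemma separating_exists: "\<exists>t. separating t"
proof -
 define T' where "T' = {\<tau> \<in> T. \<not> same_trace \<tau> id}"
 have fin: "finite T'" using finite_T by (simp add: T'_def)
 have "\<exists>x. x \<in> L \<and> x \<in> A \<and> \<tau> x \<notin> A" if t: "\<tau> \<in> T'" for \<tau>
 proof (rule ccontr)
  assume "\<not> ?thesis"
  hence "same_trace id \<tau>" using t T_auts
   by (intro trace_incomparable auts_id) (auto simp: T'_def)
  thus False using t by (auto simp: T'_def same_trace_def)
 qed
 then obtain x where x: "\<And>\<tau>. \<tau> \<in> T' \<Longrightarrow> x \<tau> \<in> L \<and> x \<tau> \<in> A \<and> \<tau> (x \<tau>) \<notin> A" by metis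
 have xc: "x \<tau> \<in> C" if "\<tau> \<in> T'" for \<tau> using x[OF that] L_props by blast
 define P where "P = Pair A ` (\<Union>\<tau>\<in>T'. {\<rho> (x \<tau>) | \<rho>. \<rho> \<in> auts K})"
 have "finite P" unfolding P_def
  using fin finite_conjugates[OF overfield_K xc] by (intro finite_imageI finite_UN_I) auto
 moreover have "valring D \<and> y \<in> C" if Dy: "(D, y) \<in> P" for D y
 proof -
  obtain \<tau> \<rho> where "\<tau> \<in> T'" "\<rho> \<in> auts K" "D = A" "y = \<rho> (x \<tau>)" using Dy by (auto simp: P_def)
  thus ?thesis using valring_A auts_closed xc by blast
 qed
 ultimately obtain k where k: "k \<ge> 1" "\<forall>(D, y)\<in>P. y \<in> D \<longrightarrow> veq D \<one> (geo y (Suc k))"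
  using common_geo_exponent[of P 1] by blast
 have kA: "veq A \<one> (geo (\<rho> (x \<tau>)) (Suc k))" if "\<tau> \<in> T'" "\<rho> \<in> auts K" "\<rho> (x \<tau>) \<in> A" for \<tau> \<rho>
 proof -
  have "(A, \<rho> (x \<tau>)) \<in> P" using that(1,2) by (auto simp: P_def)
  thus ?thesis using k(2) that(3) by auto
 qed
 define f where "f \<tau> = inv (geo (x \<tau>) (Suc k))" for \<tau>
 have rx: "\<rho> (x \<tau>) \<in> C" if "\<tau> \<in> T'" "\<rho> \<in> auts K" for \<tau> \<rho> using auts_closed[OF that(2) xc[OF that(1)]] .
 have g0: "geo (x \<tau>) (Suc k) \<noteq> \<zero>" if t: "\<tau> \<in> T'" for \<tau>
  using geo_inverse_in(1)[OF valring_A, of "x \<tau>" k] kA[OF t auts_id] xc[OF t] by simp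
 have fL: "f \<tau> \<in> L" if t: "\<tau> \<in> T'" for \<tau>
  unfolding f_def using subfield_inv_closed[OF L_props(1) geo_in_subring[OF L_props(2)] g0[OF t]] x[OF t] by blast
 have fc: "f \<tau> \<in> C" if t: "\<tau> \<in> T'" for \<tau> using fL[OF t] L_props(3) by blast
 have rf: "\<rho> (f \<tau>) = inv (geo (\<rho> (x \<tau>)) (Suc k))" if t: "\<tau> \<in> T'" and r: "\<rho> \<in> auts K" for \<tau> \<rho>
  unfolding f_def using auts_inv[OF r _ g0[OF t]] auts_geo[OF r xc[OF t]] xc[OF t] by simp
 have rfA: "\<rho> (f \<tau>) \<in> A" if t: "\<tau> \<in> T'" and r: "\<rho> \<in> auts K" for \<tau> \<rho>
 proof -
  have "\<rho> (x \<tau>) [^] (0::nat) \<otimes> inv (geo (\<rho> (x \<tau>)) (Suc k)) \<in> A"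
   by (rule geo_inverse_in(2)[OF valring_A rx[OF t r] kA[OF t r]]) auto
  moreover have "geo (\<rho> (x \<tau>)) (Suc k) \<noteq> \<zero>"
   using geo_inverse_in(1)[OF valring_A rx[OF t r] kA[OF t r]] .
  ultimately show ?thesis using rf[OF t r] rx[OF t r] by simp
 qed
 define t where "t = finprod R f T'"
 have tL: "t \<in> L" unfolding t_def by (rule finprod_in_subring[OF L_props(2) fin fL])
 have rt: "\<rho> t = finprod R (\<lambda>\<tau>. \<rho> (f \<tau>)) T'" if r: "\<rho> \<in> auts K" for \<rho>
  unfolding t_def by (rule auts_finprod[OF r fin]) (use fc in auto)
 have 1: "veq A \<one> (\<rho> t)" if r: "\<rho> \<in> auts K" "same_trace \<rho> id" for \<rho>
 proof -
  have "\<rho> (f \<tau>) \<in> C \<and> veq A \<one> (\<rho> (f \<tau>))" if t: "\<tau> \<in> T'" for \<tau>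
  proof -
   have "\<rho> (x \<tau>) \<in> A" using r(2) x[OF t] by (simp add: same_trace_def)
   thus ?thesis
    using geo_inverse_in(3)[OF valring_A rx[OF t r(1)] kA[OF t r(1)]] rf[OF t r(1)] auts_closed[OF r(1) fc[OF t]] by simp
  qed
  thus ?thesis unfolding rt[OF r(1)] using finprod_unit[OF valring_A fin, of "\<lambda>\<tau>. \<rho> (f \<tau>)"] by blast
 qed
 have 2: "vlt A \<one> (\<rho> t)" if r: "\<rho> \<in> auts K" "\<not> same_trace \<rho> id" for \<rho>
 proof -
  obtain \<tau> where t: "\<tau> \<in> T" "same_trace \<rho> \<tau>" using T_cover[OF r(1)] by blast
  hence tT': "\<tau> \<in> T'" using r(2) by (auto simp: T'_def same_trace_def)
  have "\<rho> (x \<tau>) \<notin> A" using t(2) x[OF tT'] by (simp add: same_trace_def)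
  hence "vlt A \<one> (\<rho> (x \<tau>) [^] (0::nat) \<otimes> inv (geo (\<rho> (x \<tau>)) (Suc k)))"
   using geo_inverse_in(4)[OF valring_A rx[OF tT' r(1)] kA[OF tT' r(1)], of 0] k(1) by simp
  hence "vlt A \<one> (\<rho> (f \<tau>))"
   using rf[OF tT' r(1)] auts_closed[OF r(1) fc[OF tT']] by simp
  thus ?thesis unfolding rt[OF r(1)]
   using finprod_vlt_one[OF valring_A fin, of "\<lambda>\<tau>. \<rho> (f \<tau>)" \<tau>] rfA r(1) tT' by blast
 qed
 have "separating t" using tL 1 2 by (simp add: separating_def)
 thus ?thesis by blast
qed

text \<open>Pulling \<open>t\<close> back by the representatives gives distinct conjugates. If two
  coincided, an automorphism belonging to another place would fix \<open>t\<close>, although it must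
  turn the unit \<open>t\<close> into a nonunit.\<close>

lemma separating_conjugates:
 assumes t: "separating t"
 shows "card T \<le> card {\<tau> t | \<tau>. \<tau> \<in> auts K}"
proof -
 note S = separatingD[OF t]
 have "inj_on (\<lambda>\<tau>. T_inv \<tau> t) T"
 proof (rule inj_onI, rule ccontr)
  fix \<tau> \<rho> assume tr: "\<tau> \<in> T" "\<rho> \<in> T" "T_inv \<tau> t = T_inv \<rho> t" "\<tau> \<noteq> \<rho>"
  have "(\<tau> \<circ> T_inv \<rho>) t = t" using tr(3) T_inv_props(3)[OF tr(1) S(2)] by simp
  moreover have "\<tau> \<circ> T_inv \<rho> \<in> auts K" using auts_comp T_inv_props(1)[OF tr(2)] T_auts tr(1) by blast
  hence "vlt A \<one> ((\<tau> \<circ> T_inv \<rho>) t)" using S(5) T_comp_inv_not_same[OF tr(1,2,4)] by blast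
  ultimately show False using S(6) by (simp add: veq_def vlt_def)
 qed
 moreover have "(\<lambda>\<tau>. T_inv \<tau> t) ` T \<subseteq> {\<tau> t | \<tau>. \<tau> \<in> auts K}" using T_inv_props(1) by blast
 ultimately show ?thesis using card_inj_on_le finite_conjugates[OF overfield_K S(2)] by blast
qed

text \<open>The product of the conjugates of \<open>t\<close> under the automorphisms preserving the
  place still separates and is fixed by the decomposition group, so a power of it lies in the
  henselization. Stability of \<open>L\<close> keeps the product in \<open>L\<close>.\<close>

lemma separating_in_hensel:
 assumes stable: "\<And>\<tau>. \<tau> \<in> auts K \<Longrightarrow> \<tau> ` L = L"
 shows "\<exists>t\<in>hensel A. separating t"
proof -
 obtain t where t: "separating t" using separating_exists by blast
 note S = separatingD[OF t]
 define D where "D = {\<tau> \<in> auts K. same_trace \<tau> id}"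
 define Y where "Y = {\<tau> t | \<tau>. \<tau> \<in> D}"
 have Y: "finite Y" "Y \<subseteq> C" "Y \<subseteq> L" "t \<in> Y"
 proof -
  have "Y \<subseteq> {\<tau> t | \<tau>. \<tau> \<in> auts K}" by (auto simp: Y_def D_def)
  thus "finite Y" using finite_conjugates[OF overfield_K S(2)] finite_subset by blast
  show YL: "Y \<subseteq> L"
  proof
   fix y assume "y \<in> Y"
   then obtain \<tau> where "\<tau> \<in> auts K" "y = \<tau> t" by (auto simp: Y_def D_def)
   thus "y \<in> L" using stable[of \<tau>] S(1) by blast
  qed
  thus "Y \<subseteq> C" using L_props(3) by blast
  have "id \<in> D" by (simp add: D_def auts_id same_trace_def)
  moreover have "t = id t" by simp
  ultimately show "t \<in> Y" unfolding Y_def by blast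
 qed
 \<comment> \<open>Both directions matter: one makes \<open>D\<close> permute \<open>Y\<close>, the
   other keeps automorphisms outside \<open>D\<close> outside after composition with members of
   \<open>D\<close>.\<close>
 have comp: "\<tau> \<circ> \<rho> \<in> D \<longleftrightarrow> \<tau> \<in> D" if t: "\<tau> \<in> auts K" and r: "\<rho> \<in> D" for \<tau> \<rho>
 proof -
  have rK: "\<rho> \<in> auts K" "\<rho> ` L = L" using r stable by (auto simp: D_def)
  have "same_trace (\<tau> \<circ> \<rho>) id \<longleftrightarrow> same_trace \<tau> id"
  proof
   assume s: "same_trace (\<tau> \<circ> \<rho>) id"
   have "\<tau> x \<in> A \<longleftrightarrow> x \<in> A" if x: "x \<in> L" for x
   proof -
    obtain y where y: "y \<in> L" "x = \<rho> y" using rK(2) x by blast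
    have "\<tau> (\<rho> y) \<in> A \<longleftrightarrow> y \<in> A" using s y(1) by (simp add: same_trace_def)
    moreover have "\<rho> y \<in> A \<longleftrightarrow> y \<in> A" using r y(1) by (simp add: D_def same_trace_def)
    ultimately show ?thesis using y(2) by simp
   qed
   thus "same_trace \<tau> id" by (simp add: same_trace_def)
  next
   assume "same_trace \<tau> id"
   thus "same_trace (\<tau> \<circ> \<rho>) id" using same_trace_id_comp r rK(2) by (simp add: D_def)
  qed
  thus ?thesis using auts_comp[OF t rK(1)] t by (simp add: D_def)
 qed
 have DK: "D \<subseteq> auts K" by (auto simp: D_def)
 define t' where "t' = finprod R (\<lambda>y. y) Y"
 have t'L: "t' \<in> L" unfolding t'_def by (rule finprod_in_subring[OF L_props(2) Y(1)]) (use Y(3) in blast)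
 hence t'c: "t' \<in> C" using L_props(3) by blast
 have rt: "\<rho> t' = finprod R (\<lambda>y. \<rho> y) Y" if r: "\<rho> \<in> auts K" for \<rho>
  unfolding t'_def by (rule auts_finprod[OF r Y(1)]) (use Y(2) in auto)
 have fixed: "\<rho> t' = t'" if r: "\<rho> \<in> D" for \<rho>
 proof -
  have rK: "\<rho> \<in> auts K" using r DK by blast
  have "\<rho> ` Y \<subseteq> Y"
  proof
   fix z assume "z \<in> \<rho> ` Y"
   then obtain \<tau> where "\<tau> \<in> D" "z = (\<rho> \<circ> \<tau>) t" by (auto simp: Y_def)
   thus "z \<in> Y" using comp[OF rK] r unfolding Y_def by blast
  qed
  hence im: "\<rho> ` Y = Y" by (rule stable_set_image[OF Y(1,2) rK])
  have "inj_on \<rho> Y" using Y(1) im by (simp add: eq_card_imp_inj_on)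
  hence "finprod R (\<lambda>y. y) (\<rho> ` Y) = finprod R (\<lambda>y. \<rho> y) Y"
   using im Y(2) by (intro finprod_reindex) auto
  thus ?thesis using rt[OF rK] im by (simp add: t'_def)
 qed
 have sep1: "veq A \<one> (\<rho> t')" if r: "\<rho> \<in> auts K" "same_trace \<rho> id" for \<rho>
 proof -
  have rD: "\<rho> \<in> D" using r by (simp add: D_def)
  have "\<rho> y \<in> C \<and> veq A \<one> (\<rho> y)" if y: "y \<in> Y" for y
  proof -
   obtain \<tau> where t: "\<tau> \<in> D" "y = \<tau> t" using y by (auto simp: Y_def)
   have "\<rho> \<circ> \<tau> \<in> D" using comp[OF r(1) t(1)] rD by blast
   hence "veq A \<one> ((\<rho> \<circ> \<tau>) t)" using S(4)[of "\<rho> \<circ> \<tau>"] by (simp add: D_def)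
   thus ?thesis using t(2) auts_closed[OF r(1), of y] Y(2) y by auto
  qed
  thus ?thesis unfolding rt[OF r(1)] using finprod_unit[OF valring_A Y(1), of \<rho>] by blast
 qed
 have sep2: "vlt A \<one> (\<rho> t')" if r: "\<rho> \<in> auts K" "\<not> same_trace \<rho> id" for \<rho>
 proof -
  have rD: "\<rho> \<notin> D" using r by (simp add: D_def)
  have v: "\<rho> y \<in> C \<and> vlt A \<one> (\<rho> y)" if y: "y \<in> Y" for y
  proof -
   obtain \<tau> where t: "\<tau> \<in> D" "y = \<tau> t" using y by (auto simp: Y_def)
   have "\<rho> \<circ> \<tau> \<notin> D" using comp[OF r(1) t(1)] rD by blast
   moreover have "\<rho> \<circ> \<tau> \<in> auts K" using auts_comp[OF r(1)] t(1) DK by blast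
   ultimately have "vlt A \<one> ((\<rho> \<circ> \<tau>) t)" using S(5)[of "\<rho> \<circ> \<tau>"] by (simp add: D_def)
   thus ?thesis using t(2) auts_closed[OF r(1), of y] Y(2) y by auto
  qed
  hence "\<rho> y \<in> A" if "y \<in> Y" for y using vlt_one_in[OF valring_A] that by blast
  thus ?thesis unfolding rt[OF r(1)] using finprod_vlt_one[OF valring_A Y(1), of \<rho> t] v Y(4) by blast
 qed
 have "dec_on A C \<subseteq> D"
  using L_props(3) by (auto simp: dec_on_def D_def same_trace_def)
 hence "\<exists>N. additive_exponent N \<and> t' [^] N \<in> hensel A"
  using fixed by (intro fixed_by_dec_power[OF valring_A t'c]) blast
 then obtain N where N: "additive_exponent N" "t' [^] N \<in> hensel A" by blast
 have N0: "N > 0" using N(1) by (simp add: additive_exponent_def)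
 have "separating (t' [^] N)"
  unfolding separating_def
 proof (intro conjI ballI impI)
  show "t' [^] N \<in> L" by (rule pow_in_subring[OF L_props(2) t'L])
  fix \<rho> assume r: "\<rho> \<in> auts K"
  have e: "\<rho> (t' [^] N) = \<rho> t' [^] N" "\<rho> t' \<in> C" using auts_unary[OF r t'c] by auto
  show "veq A \<one> (\<rho> (t' [^] N))" if "same_trace \<rho> id"
   using veq_nat_pow[OF valring_A sep1[OF r that] one_closed e(2), of N] e(1) by simp
  show "vlt A \<one> (\<rho> (t' [^] N))" if "\<not> same_trace \<rho> id"
   using vlt_nat_pow[OF valring_A sep2[OF r that] one_closed e(2) N0] e(1) by simp
 qed
 thus ?thesis using N(2) by blast
qed

text \<open>The powers of \<open>t\<close> with exponent below \<open>card T\<close>, multiplied by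
  a basis of the compositum, are independent over \<open>K\<close>. In a relation the coefficient of
  each basis element is a polynomial in \<open>t\<close>, hence in the henselization and therefore
  zero; it then also vanishes at all conjugates of \<open>t\<close>, of which there are at least
  \<open>card T\<close>.\<close>

lemma degree_ge:
 assumes t: "separating t" "t \<in> hensel A" and m: "dimension m (hensel A) compositum"
 shows "card T * m \<le> n"
proof -
 note S = separatingD[OF t(1)]
 obtain b where b: "b \<in> {..<n} \<rightarrow> C" "lin_indep K {..<n} b" "lspan K {..<n} b = L"
  using basis_exists by blast
 obtain I :: "nat set" and e where I: "finite I" "e \<in> I \<rightarrow> L" "lin_indep (hensel A) I e"
  "dimension (card I) (hensel A) compositum" using compositum_basis by blast
 have mI: "m = card I" using dimension_is_inj[OF hensel_props(2) m I(4)] .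
 define g where "g = card T"
 define Cs where "Cs = {\<tau> t | \<tau>. \<tau> \<in> auts K}"
 have Cs: "finite Cs" "Cs \<subseteq> C" "g \<le> card Cs"
  using finite_conjugates[OF overfield_K S(2)] auts_closed[OF _ S(2)] separating_conjugates[OF t(1)]
  by (auto simp: Cs_def g_def)
 define u where "u p = t [^] snd p \<otimes> e (fst p)" for p :: "nat \<times> nat"
 have ec: "e l \<in> C" if "l \<in> I" for l using I(2) that L_props(3) by blast
 have "lin_indep K (I \<times> {..<g}) u"
  unfolding lin_indep_def
 proof (intro allI impI)
  fix c assume c: "\<forall>p\<in>I \<times> {..<g}. c p \<in> K" and z: "(\<Oplus>p\<in>I \<times> {..<g}. c p \<otimes> u p) = \<zero>"
  have cK: "c (l, i) \<in> K" "c (l, i) \<in> C" if "l \<in> I" "i < g" for l i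
   using c that K_props(3) by auto
  define s where "s l = (\<Oplus>i\<in>{..<g}. c (l, i) \<otimes> t [^] i)" for l
  have sH: "s l \<in> hensel A" if l: "l \<in> I" for l
   unfolding s_def
  proof (rule finsum_in_subset[OF finite_lessThan])
   fix i assume "i \<in> {..<g}"
   thus "c (l, i) \<otimes> t [^] i \<in> hensel A"
    using cK(1)[OF l] hensel_props(5) pow_in_subring[OF hensel_props(3) t(2)] subringE(6)[OF hensel_props(3)] by blast
  qed (use subringE(2,7)[OF hensel_props(3)] hensel_props(4) in auto)
  have "(\<Oplus>p\<in>I \<times> {..<g}. c p \<otimes> u p) = (\<Oplus>l\<in>I. \<Oplus>i\<in>{..<g}. c (l, i) \<otimes> u (l, i))"
   by (rule finsum_cartesian[OF I(1) finite_lessThan]) (use cK ec S(2) in \<open>auto simp: u_def\<close>)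
  also have "\<dots> = (\<Oplus>l\<in>I. s l \<otimes> e l)"
  proof (rule finsum_cong')
   show "(\<lambda>l. s l \<otimes> e l) \<in> I \<rightarrow> C" using sH hensel_props(4) ec by auto
   fix l assume l: "l \<in> I"
   have "(\<Oplus>i\<in>{..<g}. c (l, i) \<otimes> u (l, i)) = (\<Oplus>i\<in>{..<g}. (c (l, i) \<otimes> t [^] i) \<otimes> e l)"
    by (rule finsum_cong') (use cK[OF l] ec[OF l] S(2) in \<open>auto simp: u_def m_assoc\<close>)
   also have "\<dots> = s l \<otimes> e l" unfolding s_def
    by (rule finsum_ldistr[symmetric]) (use cK[OF l] ec[OF l] S(2) in auto)
   finally show "(\<Oplus>i\<in>{..<g}. c (l, i) \<otimes> u (l, i)) = s l \<otimes> e l" .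
  qed simp
  finally have "(\<Oplus>l\<in>I. s l \<otimes> e l) = \<zero>" using z by simp
  hence s0: "s l = \<zero>" if "l \<in> I" for l by (rule lin_indepD[OF I(3)]) (use sH that in auto)
  show "\<forall>p\<in>I \<times> {..<g}. c p = \<zero>"
  proof
   fix p assume "p \<in> I \<times> {..<g}"
   then obtain l i where p: "p = (l, i)" "l \<in> I" "i < g" by auto
   \<comment> \<open>Coefficient lists begin with the leading coefficient, hence the
     reversal.\<close>
   define q where "q = map (\<lambda>i. c (l, i)) (rev [0..<g])"
   have qK: "set q \<subseteq> K" using cK[OF p(2)] by (auto simp: q_def)
   have qc: "set q \<subseteq> C" using qK K_props(3) by blast
   have "eval q t = s l" unfolding q_def s_def
    by (rule eval_rev_upt[OF S(2)]) (use cK[OF p(2)] in auto)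
   hence ev: "eval q t = \<zero>" using s0[OF p(2)] by simp
   have "set q \<subseteq> {\<zero>}"
   proof (rule list_with_many_roots_zero[OF Cs(1,2) _ qc])
    show "length q \<le> card Cs" using Cs(3) by (simp add: q_def)
    fix y assume "y \<in> Cs"
    then obtain \<tau> where tau: "\<tau> \<in> auts K" "y = \<tau> t" by (auto simp: Cs_def)
    have "map \<tau> q = q" using qK auts_fix[OF tau(1)] by (intro map_idI) auto
    thus "eval q y = \<zero>" using auts_eval[OF tau(1) qc S(2)] ev auts_const[OF tau(1)] tau(2) by simp
   qed
   moreover have "c (l, i) \<in> set q" using p(3) by (auto simp: q_def)
   ultimately show "c p = \<zero>" using p(1) by blast
  qed
 qed
 moreover have "u p \<in> lspan K {..<n} b" if "p \<in> I \<times> {..<g}" for p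
 proof -
  have "e (fst p) \<in> L" using that I(2) by auto
  thus ?thesis
   unfolding b(3) u_def using pow_in_subring[OF L_props(2) S(1)] subringE(6)[OF L_props(2)] by blast
 qed
 ultimately have "card (I \<times> {..<g}) \<le> card {..<n}"
  using card_le_of_lspan[OF K_props(1) finite_lessThan b(1), of "I \<times> {..<g}" u] I(1) by blast
 thus ?thesis by (simp add: card_cartesian_product mI g_def mult.commute)
qed

end

section \<open>Values and residues of linear combinations\<close>

context valued_extension
begin

text \<open>The values lie in pairwise different cosets of the value group of
  \<open>K\<close>.\<close>

definition value_independent :: "'i set \<Rightarrow> ('i \<Rightarrow> 'a) \<Rightarrow> bool"
 where "value_independent I x \<longleftrightarrow> (\<forall>i\<in>I. x i \<in> L \<and> x i \<noteq> \<zero>) \<and>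
  (\<forall>i\<in>I. \<forall>j\<in>I. i \<noteq> j \<longrightarrow> (\<forall>c\<in>K. c \<noteq> \<zero> \<longrightarrow> \<not> veq A (c \<otimes> x i) (x j)))"

text \<open>Linear independence of the residues over the residue field of \<open>K\<close>,
  expressed by lifts so that no quotient has to be formed.\<close>

definition residue_independent :: "'i set \<Rightarrow> ('i \<Rightarrow> 'a) \<Rightarrow> bool"
 where "residue_independent J y \<longleftrightarrow> (\<forall>j\<in>J. y j \<in> L \<inter> A) \<and>
  (\<forall>c. (\<forall>j\<in>J. c j \<in> K \<inter> A) \<longrightarrow> vlt A \<one> (\<Oplus>j\<in>J. c j \<otimes> y j) \<longrightarrow> (\<forall>j\<in>J. vlt A \<one> (c j)))"

lemma value_independentD:
 assumes "value_independent I x"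
 shows "i \<in> I \<Longrightarrow> x i \<in> L" "i \<in> I \<Longrightarrow> x i \<noteq> \<zero>" "i \<in> I \<Longrightarrow> x i \<in> C"
  "i \<in> I \<Longrightarrow> j \<in> I \<Longrightarrow> i \<noteq> j \<Longrightarrow> c \<in> K \<Longrightarrow> c \<noteq> \<zero> \<Longrightarrow> \<not> veq A (c \<otimes> x i) (x j)"
 using assms L_props(3) unfolding value_independent_def by auto

lemma residue_independentD:
 assumes "residue_independent J y"
 shows "j \<in> J \<Longrightarrow> y j \<in> L" "j \<in> J \<Longrightarrow> y j \<in> A" "j \<in> J \<Longrightarrow> y j \<in> C"
  "(\<And>j. j \<in> J \<Longrightarrow> c j \<in> K) \<Longrightarrow> (\<And>j. j \<in> J \<Longrightarrow> c j \<in> A) \<Longrightarrow> vlt A \<one> (\<Oplus>j\<in>J. c j \<otimes> y j) \<Longrightarrow> j \<in> J \<Longrightarrow> vlt A \<one> (c j)"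
proof -
 have a: "\<forall>j\<in>J. y j \<in> L \<inter> A"
  "\<And>c. (\<forall>j\<in>J. c j \<in> K \<inter> A) \<longrightarrow> vlt A \<one> (\<Oplus>j\<in>J. c j \<otimes> y j) \<longrightarrow> (\<forall>j\<in>J. vlt A \<one> (c j))"
  using assms unfolding residue_independent_def by blast+
 show "j \<in> J \<Longrightarrow> y j \<in> L" "j \<in> J \<Longrightarrow> y j \<in> A" using a(1) by auto
 thus "j \<in> J \<Longrightarrow> y j \<in> C" using L_props(3) by blast
 assume "\<And>j. j \<in> J \<Longrightarrow> c j \<in> K" "\<And>j. j \<in> J \<Longrightarrow> c j \<in> A" "vlt A \<one> (\<Oplus>j\<in>J. c j \<otimes> y j)" "j \<in> J"
 thus "vlt A \<one> (c j)" using a(2)[of c] by simp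
qed

text \<open>Dividing by a coefficient of least value leaves integral coefficients, one of which is
  1. By independence of the residues the quotient is then a unit.\<close>

lemma residue_combination:
 assumes y: "residue_independent J y" and J: "finite J"
  and a: "\<And>j. j \<in> J \<Longrightarrow> a j \<in> K" "j1 \<in> J" "a j1 \<noteq> \<zero>"
 shows "\<exists>j0\<in>J. a j0 \<noteq> \<zero> \<and> (\<forall>j\<in>J. vle A (a j0) (a j)) \<and> veq A (\<Oplus>j\<in>J. a j \<otimes> y j) (a j0)"
proof -
 note Y = residue_independentD[OF y] and VA = valring_A
 have ac: "a j \<in> C" if "j \<in> J" for j using a(1)[OF that] K_props(3) by blast
 have "\<exists>j0\<in>J. \<forall>j\<in>J. vle A (a j0) (a j)"
  by (rule exists_vle_minimum[OF VA J _ ac]) (use a(2) in auto)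
 then obtain j0 where j0: "j0 \<in> J" "\<And>j. j \<in> J \<Longrightarrow> vle A (a j0) (a j)" by auto
 have nz: "a j0 \<noteq> \<zero>" using j0(2)[OF a(2)] zero_vle_iff[OF VA ac[OF a(2)]] a(3) by auto
 define c where "c j = inv (a j0) \<otimes> a j" for j
 have cK: "c j \<in> K" if "j \<in> J" for j
  unfolding c_def using subringE(6)[OF K_props(2)] subfield_inv_closed[OF K_props(1) a(1)[OF j0(1)] nz] a(1)[OF that] by blast
 have cA: "c j \<in> A" if j: "j \<in> J" for j
  unfolding c_def using vle_iff_div[OF VA ac[OF j0(1)] ac[OF j] nz] j0(2)[OF j] by blast
 have cc: "c j \<in> C" if "j \<in> J" for j using cK[OF that] K_props(3) by blast
 define s where "s = (\<Oplus>j\<in>J. c j \<otimes> y j)"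
 have sA: "s \<in> A" unfolding s_def
  by (rule finsum_in_subset[OF J])
   (use cA Y(2) valring_closed[OF VA] subringE(1)[OF valring_subring[OF VA]] in auto)
 have sc: "s \<in> C" using sA valring_carrier[OF VA] by blast
 have "\<not> vlt A \<one> s"
 proof
  assume v: "vlt A \<one> s"
  have "vlt A \<one> (c j0)" by (rule Y(4)[of c]) (use v[unfolded s_def] cK cA j0(1) in auto)
  moreover have "c j0 = \<one>" using ac[OF j0(1)] nz by (simp add: c_def)
  ultimately show False using vlt_irrefl[OF VA one_closed] by simp
 qed
 hence "veq A \<one> s" using in_cases[OF VA sA] by blast
 hence "veq A (a j0 \<otimes> s) (a j0 \<otimes> \<one>)"
  using veq_mult[OF VA veq_sym[OF VA] sc one_closed ac[OF j0(1)]] by blast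
 moreover have "a j0 \<otimes> s = (\<Oplus>j\<in>J. a j \<otimes> y j)"
 proof -
  have "a j0 \<otimes> s = (\<Oplus>j\<in>J. a j0 \<otimes> (c j \<otimes> y j))"
   unfolding s_def by (rule finsum_rdistr[OF J ac[OF j0(1)]]) (use cc Y(3) in auto)
  also have "\<dots> = (\<Oplus>j\<in>J. a j \<otimes> y j)"
  proof (rule finsum_cong')
   show "(\<lambda>j. a j \<otimes> y j) \<in> J \<rightarrow> C" using ac Y(3) by auto
   fix j assume j: "j \<in> J"
   have "a j0 \<otimes> (c j \<otimes> y j) = (a j0 \<otimes> c j) \<otimes> y j"
    using ac[OF j0(1)] cc[OF j] Y(3)[OF j] by (simp add: m_assoc)
   also have "a j0 \<otimes> c j = a j" unfolding c_def using ac[OF j0(1)] nz ac[OF j] by simp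
   finally show "a j0 \<otimes> (c j \<otimes> y j) = a j \<otimes> y j" .
  qed simp
  finally show ?thesis .
 qed
 ultimately show ?thesis using j0 nz ac[OF j0(1)] by (intro bexI[of _ j0]) auto
qed

text \<open>Each inner sum has the value of its least coefficient, a value from \<open>K\<close>. So
  the nonzero outer terms have values in different cosets, and the least of them gives the value of
  the whole sum.\<close>

lemma dominant_term:
 assumes x: "value_independent I x" and y: "residue_independent J y" and fin: "finite I" "finite J"
  and a: "\<And>i j. i \<in> I \<Longrightarrow> j \<in> J \<Longrightarrow> a i j \<in> K" "i1 \<in> I" "j1 \<in> J" "a i1 j1 \<noteq> \<zero>"
 shows "\<exists>i0\<in>I. \<exists>j0\<in>J. a i0 j0 \<noteq> \<zero> \<and> (\<forall>i\<in>I. \<forall>j\<in>J. vle A (a i0 j0 \<otimes> x i0) (a i j \<otimes> x i)) \<and>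
  veq A (\<Oplus>i\<in>I. (\<Oplus>j\<in>J. a i j \<otimes> y j) \<otimes> x i) (a i0 j0 \<otimes> x i0)"
proof -
 note X' = value_independentD[OF x] and Y = residue_independentD[OF y] and VA = valring_A
 have ac: "a i j \<in> C" if "i \<in> I" "j \<in> J" for i j using a(1)[OF that] K_props(3) by blast
 define I' where "I' = {i \<in> I. \<exists>j\<in>J. a i j \<noteq> \<zero>}"
 have I': "finite I'" "I' \<subseteq> I" "I' \<noteq> {}" using fin a(2-4) by (auto simp: I'_def)
 define s where "s i = (\<Oplus>j\<in>J. a i j \<otimes> y j)" for i
 have sc: "s i \<in> C" if "i \<in> I" for i
  unfolding s_def using ac[OF that] Y(3) by (auto intro!: finsum_closed)
 define Q where "Q i j0 \<longleftrightarrow> j0 \<in> J \<and> a i j0 \<noteq> \<zero> \<and> (\<forall>j\<in>J. vle A (a i j0) (a i j)) \<and> veq A (s i) (a i j0)" for i j0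
 define m where "m i = (SOME j0. Q i j0)" for i
 have m: "Q i (m i)" if i: "i \<in> I'" for i
 proof -
  have iI: "i \<in> I" using I' i by blast
  obtain j where "j \<in> J" "a i j \<noteq> \<zero>" using i by (auto simp: I'_def)
  hence "\<exists>j0\<in>J. a i j0 \<noteq> \<zero> \<and> (\<forall>j\<in>J. vle A (a i j0) (a i j)) \<and> veq A (\<Oplus>j\<in>J. a i j \<otimes> y j) (a i j0)"
   by (intro residue_combination[OF y fin(2) a(1)[OF iI]])
  then obtain j0 where "Q i j0" by (auto simp: Q_def s_def)
  thus ?thesis unfolding m_def by (rule someI[of "Q i"])
 qed
 define v where "v i = a i (m i) \<otimes> x i" for i
 have mJ: "m i \<in> J" "a i (m i) \<noteq> \<zero>" "a i (m i) \<in> K" "a i (m i) \<in> C" "i \<in> I" "x i \<in> C" "x i \<noteq> \<zero>"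
  if i: "i \<in> I'" for i
 proof -
  show iI: "i \<in> I" using I' i by blast
  show "m i \<in> J" "a i (m i) \<noteq> \<zero>" using m[OF i] by (simp_all add: Q_def)
  thus "a i (m i) \<in> K" "a i (m i) \<in> C" using a(1)[OF iI] ac[OF iI] by auto
  show "x i \<in> C" "x i \<noteq> \<zero>" using X'(2,3)[OF iI] by auto
 qed
 have vc: "v i \<in> C" "v i \<noteq> \<zero>" if i: "i \<in> I'" for i
  using mJ[OF i] by (auto simp: v_def integral_iff)
 have "\<exists>i0\<in>I'. \<forall>i\<in>I'. vle A (v i0) (v i)" by (rule exists_vle_minimum[OF VA I'(1,3) vc(1)])
 then obtain i0 where i0: "i0 \<in> I'" "\<And>i. i \<in> I' \<Longrightarrow> vle A (v i0) (v i)" by auto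
 have term_eq: "veq A (s i \<otimes> x i) (v i)" if i: "i \<in> I'" for i
 proof -
  have "veq A (x i \<otimes> s i) (x i \<otimes> a i (m i))"
   using veq_mult[OF VA _ sc mJ(4)[OF i] mJ(6)[OF i]] m[OF i] mJ(5)[OF i] by (auto simp: Q_def)
  thus ?thesis using mJ[OF i] sc[OF mJ(5)[OF i]] by (simp add: v_def m_comm)
 qed
 have tc: "s i \<otimes> x i \<in> C" if "i \<in> I" for i using sc[OF that] X'(3)[OF that] by simp
 have other: "vlt A (v i0) (s i \<otimes> x i)" if i: "i \<in> I - {i0}" for i
 proof (cases "i \<in> I'")
  case False
  hence "a i j = \<zero>" if "j \<in> J" for j using i that by (auto simp: I'_def)
  hence "s i = (\<Oplus>j\<in>J. \<zero>)" unfolding s_def using Y(3) by (intro finsum_cong') auto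
  hence "s i \<otimes> x i = \<zero>" using X'(3) i by (simp add: finsum_zero)
  thus ?thesis using vlt_zero[OF VA vc(1)[OF i0(1)]] vc(2)[OF i0(1)] by simp
 next
  case True
  \<comment> \<open>Equal values would put \<open>x i\<close> and \<open>x i0\<close> into one coset
    of the value group of \<open>K\<close>.\<close>
  have "\<not> veq A (v i) (v i0)"
  proof
   assume e: "veq A (v i) (v i0)"
   define d where "d = inv (a i0 (m i0))"
   have dK: "d \<in> K" "d \<in> C" "d \<noteq> \<zero>"
    using subfield_inv_closed[OF K_props(1) mJ(3,2)[OF i0(1)]] mJ[OF i0(1)] by (auto simp: d_def)
   have "veq A (d \<otimes> v i) (d \<otimes> v i0)" by (rule veq_mult[OF VA e vc(1)[OF True] vc(1)[OF i0(1)] dK(2)])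
   moreover have "d \<otimes> v i0 = x i0" unfolding d_def v_def using mJ[OF i0(1)] by simp
   moreover have "d \<otimes> v i = (d \<otimes> a i (m i)) \<otimes> x i" unfolding v_def using mJ[OF True] dK by (simp add: m_assoc)
   ultimately have "veq A ((d \<otimes> a i (m i)) \<otimes> x i) (x i0)" by simp
   moreover have "d \<otimes> a i (m i) \<in> K" using subringE(6)[OF K_props(2) dK(1) mJ(3)[OF True]] .
   moreover have "d \<otimes> a i (m i) \<noteq> \<zero>" using mJ[OF True] dK by (simp add: integral_iff)
   ultimately show False using X'(4)[OF mJ(5)[OF True] mJ(5)[OF i0(1)]] i by blast
  qed
  hence "vlt A (v i0) (v i)" using i0(2)[OF True] by (auto simp: veq_def vlt_def)
  moreover have "vle A (v i) (s i \<otimes> x i)" using term_eq[OF True] by (simp add: veq_def)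
  ultimately show ?thesis using vlt_vle_trans[OF VA] tc vc(1)[OF True] i by blast
 qed
 have i0I: "i0 \<in> I" using i0(1) I' by blast
 define r where "r = (\<Oplus>i\<in>I - {i0}. s i \<otimes> x i)"
 have rc: "r \<in> C" unfolding r_def using tc by (auto intro!: finsum_closed)
 have "vlt A (v i0) r" unfolding r_def
  by (rule vlt_finsum[OF VA]) (use fin tc vc[OF i0(1)] other in auto)
 hence "vlt A (s i0 \<otimes> x i0) r"
  using vle_vlt_trans[OF VA _ _ rc] term_eq[OF i0(1)] by (auto simp: veq_def)
 hence "veq A (s i0 \<otimes> x i0) (s i0 \<otimes> x i0 \<oplus> r)" by (rule veq_add[OF VA _ tc[OF i0I] rc])
 hence "veq A (s i0 \<otimes> x i0 \<oplus> r) (v i0)"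
  using veq_trans[OF VA veq_sym[OF VA] term_eq[OF i0(1)]] tc[OF i0I] rc vc(1)[OF i0(1)] by blast
 moreover have "(\<Oplus>i\<in>I. s i \<otimes> x i) = s i0 \<otimes> x i0 \<oplus> r"
 proof -
  have "I = insert i0 (I - {i0})" using i0I by blast
  hence "(\<Oplus>i\<in>I. s i \<otimes> x i) = (\<Oplus>i\<in>insert i0 (I - {i0}). s i \<otimes> x i)" by simp
  also have "\<dots> = s i0 \<otimes> x i0 \<oplus> r"
   unfolding r_def by (rule finsum_insert) (use fin tc i0I in auto)
  finally show ?thesis .
 qed
 ultimately have "veq A (\<Oplus>i\<in>I. s i \<otimes> x i) (v i0)" by simp
 moreover have "vle A (v i0) (a i j \<otimes> x i)" if ij: "i \<in> I" "j \<in> J" for i j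
 proof (cases "i \<in> I'")
  case True
  have "vle A (a i (m i)) (a i j)" using m[OF True] ij by (simp add: Q_def)
  hence "vle A (x i \<otimes> a i (m i)) (x i \<otimes> a i j)" using vle_mult[OF VA] mJ[OF True] by blast
  hence "vle A (v i) (a i j \<otimes> x i)" using mJ[OF True] ac[OF ij] by (simp add: v_def m_comm)
  thus ?thesis using vle_trans[OF VA i0(2)[OF True]] vc(1)[OF i0(1)] by blast
 next
  case False
  hence "a i j = \<zero>" using ij by (auto simp: I'_def)
  thus ?thesis using vle_zero[OF VA vc(1)[OF i0(1)]] X'(3)[OF ij(1)] by simp
 qed
 ultimately show ?thesis using i0I mJ(1,2)[OF i0(1)]
  unfolding s_def v_def by (intro bexI[of _ i0] bexI[of _ "m i0"]) auto
qed

section \<open>Correcting elements at the conjugate places\<close>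

lemma common_unit:
 assumes S: "finite S" "S \<subseteq> L"
 shows "\<exists>k\<ge>1. \<forall>y\<in>S. \<forall>\<tau>\<in>auts K. \<tau> y \<in> A \<longrightarrow> veq A \<one> (geo (\<tau> y) (Suc k))"
proof -
 have Sc: "S \<subseteq> C" using S(2) L_props(3) by blast
 define P where "P = Pair A ` (\<Union>y\<in>S. {\<rho> y | \<rho>. \<rho> \<in> auts K})"
 have "finite {\<rho> y | \<rho>. \<rho> \<in> auts K}" if "y \<in> S" for y
  using finite_conjugates[OF overfield_K] Sc that by blast
 hence "finite P" unfolding P_def using S(1) by blast
 moreover have "valring D \<and> y \<in> C" if Dy: "(D, y) \<in> P" for D y
 proof -
  obtain z \<rho> where "z \<in> S" "\<rho> \<in> auts K" "D = A" "y = \<rho> z" using Dy by (auto simp: P_def)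
  thus ?thesis using valring_A auts_closed Sc by blast
 qed
 ultimately obtain k where k: "k \<ge> 1" "\<forall>(D, y)\<in>P. y \<in> D \<longrightarrow> veq D \<one> (geo y (Suc k))"
  using common_geo_exponent[of P 1] by blast
 have "veq A \<one> (geo (\<tau> y) (Suc k))" if "y \<in> S" "\<tau> \<in> auts K" "\<tau> y \<in> A" for y \<tau>
 proof -
  have "(A, \<tau> y) \<in> P" using that(1,2) by (auto simp: P_def)
  thus ?thesis using k(2) that(3) by auto
 qed
 thus ?thesis using k(1) by blast
qed

lemma geo_inverse_conjugate:
 assumes y: "y \<in> L" and k': "\<forall>\<tau>\<in>auts K. \<tau> y \<in> A \<longrightarrow> veq A \<one> (geo (\<tau> y) (Suc k))"
 shows "inv (geo y (Suc k)) \<in> L"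
  and "\<tau> \<in> auts K \<Longrightarrow> j \<le> k \<Longrightarrow> \<tau> y [^] j \<otimes> \<tau> (inv (geo y (Suc k))) \<in> A"
  and "y \<in> A \<Longrightarrow> veq A \<one> (inv (geo y (Suc k)))"
proof -
 have k: "veq A \<one> (geo (\<tau> y) (Suc k))" if "\<tau> \<in> auts K" "\<tau> y \<in> A" for \<tau> using k' that by simp
 have yc: "y \<in> C" using y L_props(3) by blast
 have g0: "geo y (Suc k) \<noteq> \<zero>" using geo_inverse_in(1)[OF valring_A yc] k[OF auts_id] by simp
 show "inv (geo y (Suc k)) \<in> L"
  using subfield_inv_closed[OF L_props(1) geo_in_subring[OF L_props(2) y] g0] .
 show "y \<in> A \<Longrightarrow> veq A \<one> (inv (geo y (Suc k)))" using geo_inverse_in(3)[OF valring_A yc] k[OF auts_id] by simp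
 assume t: "\<tau> \<in> auts K" and j: "j \<le> k"
 have "\<tau> (inv (geo y (Suc k))) = inv (geo (\<tau> y) (Suc k))"
  using auts_inv[OF t _ g0] auts_geo[OF t yc] yc by simp
 thus "\<tau> y [^] j \<otimes> \<tau> (inv (geo y (Suc k))) \<in> A"
  using geo_inverse_in(2)[OF valring_A auts_closed[OF t yc] k[OF t] j] by simp
qed

text \<open>Choose \<open>c\<close> in \<open>K\<close> with the value of \<open>x [^] N\<close>, so
  that \<open>y\<close>, the quotient of \<open>x [^] N\<close> by \<open>c\<close>, is a unit, and
  multiply \<open>x\<close> by the inverted geometric sum \<open>w\<close> of \<open>y\<close>. At
  every place \<open>(x \<otimes> w) [^] N\<close> is \<open>c\<close> times
  \<open>y \<otimes> w\<close> times further factors \<open>w\<close>, and both \<open>w\<close> and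
  \<open>y \<otimes> w\<close> are integral there.\<close>

lemma adjust_value:
 assumes x: "x \<in> L" "x \<noteq> \<zero>"
 shows "\<exists>x'\<in>L. veq A x x' \<and> (\<forall>\<tau>\<in>auts K. vle A x (\<tau> x'))"
proof -
 note VA = valring_A
 have xc: "x \<in> C" using x L_props(3) by blast
 obtain N c where Nc: "0 < (N::nat)" "c \<in> K" "c \<noteq> \<zero>" "veq A (x [^] N) c"
  using valuation_torsion[OF overfield_K VA xc x(2)] by blast
 have cc: "c \<in> C" using Nc(2) K_props(3) by blast
 have xN: "x [^] N \<in> C" using xc by simp
 define y where "y = inv c \<otimes> x [^] N"
 have yL: "y \<in> L" unfolding y_def
  using subringE(6)[OF L_props(2)] subfield_inv_closed[OF K_props(1) Nc(2,3)] L_props(4) pow_in_subring[OF L_props(2) x(1)] by blast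
 have yc: "y \<in> C" using yL L_props(3) by blast
 have "y \<in> A" using vle_iff_div[OF VA cc xN Nc(3)] Nc(4) by (simp add: y_def veq_def)
 obtain k where k: "k \<ge> 1" "\<forall>z\<in>{y}. \<forall>\<tau>\<in>auts K. \<tau> z \<in> A \<longrightarrow> veq A \<one> (geo (\<tau> z) (Suc k))"
  using common_unit[of "{y}"] yL by auto
 have k': "\<forall>\<tau>\<in>auts K. \<tau> y \<in> A \<longrightarrow> veq A \<one> (geo (\<tau> y) (Suc k))" using k(2) by simp
 define w where "w = inv (geo y (Suc k))"
 note W = geo_inverse_conjugate[OF yL k', folded w_def]
 have wc: "w \<in> C" using W(1) L_props(3) by blast
 have "veq A (x \<otimes> \<one>) (x \<otimes> w)" by (rule veq_mult[OF VA W(3)[OF \<open>y \<in> A\<close>] one_closed wc xc])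
 hence 1: "veq A x (x \<otimes> w)" using xc by simp
 have 2: "vle A x (\<tau> (x \<otimes> w))" if t: "\<tau> \<in> auts K" for \<tau>
 proof (rule vle_nat_pow_cancel[OF VA _ Nc(1) xc])
  show tc: "\<tau> (x \<otimes> w) \<in> C" using auts_closed[OF t] xc wc by simp
  have c: "\<tau> x \<in> C" "\<tau> w \<in> C" "\<tau> y \<in> C" using auts_closed[OF t] xc wc yc by auto
  obtain N' where N': "N = Suc N'" using Nc(1) by (cases N) auto
  have "\<tau> w \<in> A" using W(2)[OF t, of 0] c by simp
  hence "\<tau> w [^] N' \<in> A" using valring_closed[OF VA] by (induction N') auto
  moreover have "\<tau> y \<otimes> \<tau> w \<in> A" using W(2)[OF t, of 1] k(1) c by simp
  ultimately have A1: "\<tau> w [^] N' \<otimes> (\<tau> y \<otimes> \<tau> w) \<in> A" using valring_closed(5)[OF VA] by blast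
  have "x [^] N = c \<otimes> y" unfolding y_def using cc Nc(3) xc by simp
  hence "\<tau> x [^] N = c \<otimes> \<tau> y"
   using auts_unary(3)[OF t xc, of N] auts_binary(2)[OF t cc yc] auts_fix[OF t Nc(2)] by simp
  moreover have "(\<tau> x \<otimes> \<tau> w) [^] N = \<tau> x [^] N \<otimes> \<tau> w [^] N" by (rule nat_pow_distrib[OF c(1,2)])
  moreover have "\<tau> w [^] N = \<tau> w [^] N' \<otimes> \<tau> w" by (simp add: N')
  ultimately have "(\<tau> x \<otimes> \<tau> w) [^] N = (c \<otimes> \<tau> y) \<otimes> (\<tau> w [^] N' \<otimes> \<tau> w)" by simp
  also have "\<dots> = c \<otimes> (\<tau> w [^] N' \<otimes> (\<tau> y \<otimes> \<tau> w))" using c cc by (simp add: m_ac)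
  finally have "vle A c (\<tau> (x \<otimes> w) [^] N)"
   using A1 auts_binary(2)[OF t xc wc] by (auto simp: vle_def)
  thus "vle A (x [^] N) (\<tau> (x \<otimes> w) [^] N)" using vle_trans[OF VA _ _ xN] Nc(4) by (auto simp: veq_def)
 qed
 have "x \<otimes> w \<in> L" using subringE(6)[OF L_props(2) x(1) W(1)] .
 thus ?thesis using 1 2 by blast
qed

text \<open>At every place both \<open>f j\<close> and its product with \<open>y j\<close> are
  integral, and at the given place \<open>f j\<close> is a unit. So the product of all
  \<open>f j\<close> makes every \<open>y j\<close> integral everywhere at once.\<close>

lemma adjust_integral:
 assumes J: "finite J" and y: "\<And>j. j \<in> J \<Longrightarrow> y j \<in> L \<inter> A"
 shows "\<exists>w\<in>L. veq A \<one> w \<and> (\<forall>j\<in>J. \<forall>\<tau>\<in>auts K. \<tau> (w \<otimes> y j) \<in> A)"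
proof -
 note VA = valring_A
 obtain k where k: "k \<ge> 1" "\<forall>z\<in>y ` J. \<forall>\<tau>\<in>auts K. \<tau> z \<in> A \<longrightarrow> veq A \<one> (geo (\<tau> z) (Suc k))"
  using common_unit[of "y ` J"] J y by auto
 have k': "\<forall>\<tau>\<in>auts K. \<tau> (y j) \<in> A \<longrightarrow> veq A \<one> (geo (\<tau> (y j)) (Suc k))" if "j \<in> J" for j
  using k(2) that by simp
 have yL: "y j \<in> L" if "j \<in> J" for j using y that by blast
 define f where "f j = inv (geo (y j) (Suc k))" for j
 have F: "f j \<in> L" "\<tau> \<in> auts K \<Longrightarrow> i \<le> k \<Longrightarrow> \<tau> (y j) [^] i \<otimes> \<tau> (f j) \<in> A" "veq A \<one> (f j)"
  if j: "j \<in> J" for j \<tau> i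
  using geo_inverse_conjugate[OF yL[OF j] k'[OF j]] y[OF j] by (auto simp: f_def)
 have fc: "f j \<in> C" "y j \<in> C" if "j \<in> J" for j using F(1)[OF that] yL[OF that] L_props(3) by auto
 have fA: "\<tau> (f j) \<in> A" if j: "j \<in> J" and t: "\<tau> \<in> auts K" for j \<tau>
  using F(2)[OF j t, of 0] auts_closed[OF t fc(1)[OF j]] by simp
 define w where "w = finprod R f J"
 have wL: "w \<in> L" unfolding w_def by (rule finprod_in_subring[OF L_props(2) J F(1)])
 have "veq A \<one> w" unfolding w_def using finprod_unit[OF VA J, of f] F(3) fc by blast
 moreover have "\<tau> (w \<otimes> y j) \<in> A" if j: "j \<in> J" and t: "\<tau> \<in> auts K" for j \<tau>
 proof -
  have J': "J = insert j (J - {j})" using j by blast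
  define v where "v = finprod R f (J - {j})"
  have vc: "v \<in> C" unfolding v_def using fc(1) by auto
  have "finprod R f (insert j (J - {j})) = f j \<otimes> v"
   unfolding v_def by (rule finprod_insert) (use J j fc(1) in auto)
  hence wv: "w = f j \<otimes> v" unfolding w_def using J' by simp
  have "\<tau> v = finprod R (\<lambda>i. \<tau> (f i)) (J - {j})"
   unfolding v_def by (rule auts_finprod[OF t]) (use J fc(1) in auto)
  also have "\<dots> \<in> A" by (rule finprod_in_valring[OF VA]) (use J fA t in auto)
  finally have "\<tau> v \<in> A" .
  moreover have "\<tau> (y j) \<otimes> \<tau> (f j) \<in> A"
   using F(2)[OF j t, of 1] k(1) auts_closed[OF t fc(2)[OF j]] by simp
  ultimately have "\<tau> v \<otimes> (\<tau> (y j) \<otimes> \<tau> (f j)) \<in> A" using valring_closed(5)[OF VA] by blast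
  moreover have "\<tau> (w \<otimes> y j) = \<tau> v \<otimes> (\<tau> (y j) \<otimes> \<tau> (f j))"
   unfolding wv using auts_binary(2)[OF t] fc[OF j] vc auts_closed[OF t] by (simp add: m_ac)
  ultimately show ?thesis by simp
 qed
 ultimately show ?thesis using wL by blast
qed

lemma value_independent_cong:
 assumes x: "value_independent I x" and x': "\<And>i. i \<in> I \<Longrightarrow> x' i \<in> L \<and> veq A (x i) (x' i)"
 shows "value_independent I x'"
proof -
 note D = value_independentD[OF x] and VA = valring_A
 have c: "x' i \<in> C" if "i \<in> I" for i using x'[OF that] L_props(3) by blast
 have nz: "x' i \<noteq> \<zero>" if i: "i \<in> I" for i using veq_nonzero[OF VA _ D(3)[OF i] c[OF i]] x'[OF i] D(2)[OF i] by blast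
 have "\<not> veq A (a \<otimes> x' i) (x' j)" if ij: "i \<in> I" "j \<in> I" "i \<noteq> j" and a: "a \<in> K" "a \<noteq> \<zero>" for i j a
 proof
  assume e: "veq A (a \<otimes> x' i) (x' j)"
  have ac: "a \<in> C" using a K_props(3) by blast
  have "veq A (a \<otimes> x i) (a \<otimes> x' i)" using veq_mult[OF VA _ D(3)[OF ij(1)] c[OF ij(1)] ac] x'[OF ij(1)] by blast
  hence "veq A (a \<otimes> x i) (x' j)" using veq_trans[OF VA _ e] ac D(3)[OF ij(1)] c[OF ij(2)] by simp
  moreover have "veq A (x' j) (x j)" using x'[OF ij(2)] veq_sym[OF VA] by blast
  ultimately have "veq A (a \<otimes> x i) (x j)" using veq_trans[OF VA] ac D(3)[OF ij(1)] D(3)[OF ij(2)] by simp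
  thus False using D(4)[OF ij a] by blast
 qed
 thus ?thesis using x' nz by (auto simp: value_independent_def)
qed

lemma residue_independent_scale:
 assumes y: "residue_independent J y" and J: "finite J" and w: "w \<in> L" "veq A \<one> w"
 shows "residue_independent J (\<lambda>j. w \<otimes> y j)"
proof -
 note D = residue_independentD[OF y] and VA = valring_A
 have wc: "w \<in> C" using w L_props(3) by blast
 have u: "w \<in> A" "inv w \<in> A" "w \<noteq> \<zero>" using unit_in[OF VA w(2) wc] by auto
 have "\<forall>j\<in>J. w \<otimes> y j \<in> L \<inter> A"
  using D(1,2) w(1) u(1) valring_closed(5)[OF VA] subringE(6)[OF L_props(2)] by blast
 moreover have "\<forall>j\<in>J. vlt A \<one> (c j)"
  if c: "\<forall>j\<in>J. c j \<in> K \<inter> A" and v: "vlt A \<one> (\<Oplus>j\<in>J. c j \<otimes> (w \<otimes> y j))" for c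
 proof -
  have cc: "c j \<in> C" if "j \<in> J" for j using c that K_props(3) by blast
  define s where "s = (\<Oplus>j\<in>J. c j \<otimes> y j)"
  have sc: "s \<in> C" unfolding s_def using cc D(3) by (auto intro!: finsum_closed)
  have "w \<otimes> s = (\<Oplus>j\<in>J. w \<otimes> (c j \<otimes> y j))"
   unfolding s_def by (rule finsum_rdistr[OF J wc]) (use cc D(3) in auto)
  also have "\<dots> = (\<Oplus>j\<in>J. c j \<otimes> (w \<otimes> y j))"
   by (rule finsum_cong') (use cc D(3) wc m_lcomm in auto)
  finally have "vlt A \<one> (w \<otimes> s)" using v by simp
  hence "vlt A \<one> ((w \<otimes> s) \<otimes> inv w)" using vlt_one_mult[OF VA _ u(2)] wc sc by simp
  moreover have "(w \<otimes> s) \<otimes> inv w = s" using wc sc u(3) by (simp add: m_comm[of w s])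
  ultimately have vs: "vlt A \<one> s" by simp
  have "vlt A \<one> (c j)" if "j \<in> J" for j
   by (rule D(4)[of c]) (use c that vs[unfolded s_def] in auto)
  thus ?thesis by blast
 qed
 ultimately show ?thesis unfolding residue_independent_def by blast
qed

end

context trace_transversal
begin

text \<open>
 One block of elements for each conjugate valuation: block \<open>\<tau>\<close> has the prescribed values and
 residues at \<open>\<tau>\<close> and larger values at all the other places, so the terms of a linear combination
 cannot cancel at the place where the minimum is attained.
\<close>

theorem dominating_family:
 assumes x: "value_independent I x" and y: "residue_independent J y" and fin: "finite I" "finite J"
 shows "\<exists>u. (\<forall>p\<in>T \<times> I \<times> J. u p \<in> L) \<and>
  (\<forall>p\<in>T \<times> I \<times> J. x (fst (snd p)) \<in> A \<longrightarrow> (\<forall>\<rho>\<in>auts K. \<rho> (u p) \<in> A)) \<and>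
  (\<forall>a. (\<forall>p\<in>T \<times> I \<times> J. a p \<in> K) \<longrightarrow> (\<exists>p\<in>T \<times> I \<times> J. a p \<noteq> \<zero>) \<longrightarrow>
   (\<exists>\<tau>\<in>T. \<exists>p0\<in>T \<times> I \<times> J. a p0 \<noteq> \<zero> \<and>
    (\<forall>p\<in>T \<times> I \<times> J. vle A (a p0 \<otimes> x (fst (snd p0))) (a p \<otimes> x (fst (snd p)))) \<and>
    veq A (\<tau> (\<Oplus>p\<in>T \<times> I \<times> J. a p \<otimes> u p)) (a p0 \<otimes> x (fst (snd p0)))))"
proof -
 note VA = valring_A and DX = value_independentD[OF x] and DY = residue_independentD[OF y]
 obtain z where z: "separating z" using separating_exists by blast
 note Z = separatingD[OF z]
 define Q where "Q i x' \<longleftrightarrow> x' \<in> L \<and> veq A (x i) x' \<and> (\<forall>\<tau>\<in>auts K. vle A (x i) (\<tau> x'))" for i x'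
 define x' where "x' i = (SOME v. Q i v)" for i
 have x': "x' i \<in> L" "veq A (x i) (x' i)" "\<tau> \<in> auts K \<Longrightarrow> vle A (x i) (\<tau> (x' i))" "x' i \<in> C"
  if i: "i \<in> I" for i \<tau>
 proof -
  obtain v where "Q i v" using adjust_value[OF DX(1,2)[OF i]] by (auto simp: Q_def)
  hence "Q i (x' i)" unfolding x'_def by (rule someI[of "Q i"])
  thus "x' i \<in> L" "veq A (x i) (x' i)" "\<tau> \<in> auts K \<Longrightarrow> vle A (x i) (\<tau> (x' i))" by (auto simp: Q_def)
  thus "x' i \<in> C" using L_props(3) by blast
 qed
 have vx': "value_independent I x'" by (rule value_independent_cong[OF x]) (use x'(1,2) in blast)
 obtain w where w: "w \<in> L" "veq A \<one> w" "\<And>j \<tau>. j \<in> J \<Longrightarrow> \<tau> \<in> auts K \<Longrightarrow> \<tau> (w \<otimes> y j) \<in> A"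
  using adjust_integral[OF fin(2), of y] DY(1,2) by blast
 define y' where "y' j = w \<otimes> y j" for j
 have vy': "residue_independent J y'" unfolding y'_def by (rule residue_independent_scale[OF y fin(2) w(1,2)])
 note DY' = residue_independentD[OF vy']
 \<comment> \<open>At the given place this behaves like the product of \<open>x' (fst q)\<close> and
   \<open>y' (snd q)\<close> up to a unit; the separating factor \<open>z\<close> makes its value
   strictly larger than that of \<open>x (fst q)\<close> at every other place.\<close>
 define b where "b q = z \<otimes> (x' (fst q) \<otimes> y' (snd q))" for q
 have bL: "b q \<in> L" "b q \<in> C" if "q \<in> I \<times> J" for q
 proof -
  have "x' (fst q) \<in> L" "y' (snd q) \<in> L" using that x'(1) DY'(1) by auto
  thus "b q \<in> L" unfolding b_def using Z(1) subringE(6)[OF L_props(2)] by blast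
  thus "b q \<in> C" using L_props(3) by blast
 qed
 have rb: "vle A (x (fst q)) (\<rho> (b q))" "\<not> same_trace \<rho> id \<Longrightarrow> vlt A (x (fst q)) (\<rho> (b q))"
  if q: "q \<in> I \<times> J" and r: "\<rho> \<in> auts K" for q \<rho>
 proof -
  define i j where "i = fst q" and "j = snd q"
  have ij: "i \<in> I" "j \<in> J" using q by (auto simp: i_def j_def)
  have c: "x' i \<in> C" "y' j \<in> C" "\<rho> (x' i) \<in> C" "\<rho> (y' j) \<in> C" "\<rho> z \<in> C" "x i \<in> C"
   using x'(4)[OF ij(1)] DY'(3)[OF ij(2)] auts_closed[OF r] Z(2) DX(3)[OF ij(1)] by auto
  have yA: "\<rho> (y' j) \<in> A" using w(3)[OF ij(2) r] by (simp add: y'_def)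
  have e: "\<rho> (b q) = \<rho> (x' i) \<otimes> (\<rho> (y' j) \<otimes> \<rho> z)"
   unfolding b_def i_def[symmetric] j_def[symmetric]
   using auts_binary(2)[OF r] c Z(2) by (simp add: m_ac)
  have "\<rho> (y' j) \<otimes> \<rho> z \<in> A" using yA Z(3)[OF r] valring_closed(5)[OF VA] by blast
  hence "vle A (\<rho> (x' i)) (\<rho> (b q))" unfolding e by (auto simp: vle_def)
  thus "vle A (x (fst q)) (\<rho> (b q))"
   using vle_trans[OF VA x'(3)[OF ij(1) r]] c by (simp add: i_def)
  assume ns: "\<not> same_trace \<rho> id"
  have "vlt A \<one> (\<rho> z \<otimes> \<rho> (y' j))" by (rule vlt_one_mult[OF VA Z(5)[OF r ns] yA c(5)])
  hence "vlt A \<one> (\<rho> (y' j) \<otimes> \<rho> z)" using c by (simp add: m_comm)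
  hence "vlt A (x i \<otimes> \<one>) (x i \<otimes> (\<rho> (y' j) \<otimes> \<rho> z))"
   using vlt_mult_iff[OF VA one_closed _ c(6) DX(2)[OF ij(1)]] c by simp
  moreover have "vle A (x i \<otimes> (\<rho> (y' j) \<otimes> \<rho> z)) (\<rho> (b q))"
   unfolding e using vle_mult[OF VA x'(3)[OF ij(1) r] c(6), of "\<rho> (y' j) \<otimes> \<rho> z"] c by (simp add: m_comm)
  ultimately have "vlt A (x i \<otimes> \<one>) (\<rho> (b q))"
   using vlt_vle_trans[OF VA] c auts_closed[OF r bL(2)[OF q]] by blast
  thus "vlt A (x (fst q)) (\<rho> (b q))" using c(6) by (simp add: i_def)
 qed
 \<comment> \<open>Applying \<open>\<tau>\<close> to block \<open>\<tau>\<close> gives back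
   \<open>b\<close>. Applying it to another block composes to an automorphism with a different
   trace, where \<open>b\<close> has larger value.\<close>
 define u where "u p = T_inv (fst p) (b (snd p))" for p
 have uL: "u p \<in> L" if "p \<in> T \<times> I \<times> J" for p
  unfolding u_def using that T_inv_props(4) bL(1) by auto
 have uA: "\<rho> (u p) \<in> A" if p: "p \<in> T \<times> I \<times> J" and xA: "x (fst (snd p)) \<in> A" and r: "\<rho> \<in> auts K" for p \<rho>
 proof -
  have fp: "fst p \<in> T" "snd p \<in> I \<times> J" using p by auto
  have rK: "\<rho> \<circ> T_inv (fst p) \<in> auts K" using auts_comp[OF r T_inv_props(1)[OF fp(1)]] .
  have "vle A (x (fst (snd p))) (\<rho> (u p))" using rb(1)[OF fp(2) rK] by (simp add: u_def)
  moreover have "vle A \<one> (x (fst (snd p)))" using vle_one_iff[OF VA] xA valring_carrier[OF VA] by blast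
  ultimately have "vle A \<one> (\<rho> (u p))" using vle_trans[OF VA] by blast
  moreover have "\<rho> (u p) \<in> C" using auts_closed[OF r] uL[OF p] L_props(3) by blast
  ultimately show ?thesis using vle_one_iff[OF VA] by blast
 qed
 have main: "\<exists>\<tau>\<in>T. \<exists>p0\<in>T \<times> I \<times> J. a p0 \<noteq> \<zero> \<and>
    (\<forall>p\<in>T \<times> I \<times> J. vle A (a p0 \<otimes> x (fst (snd p0))) (a p \<otimes> x (fst (snd p)))) \<and>
    veq A (\<tau> (\<Oplus>p\<in>T \<times> I \<times> J. a p \<otimes> u p)) (a p0 \<otimes> x (fst (snd p0)))"
  if a: "\<forall>p\<in>T \<times> I \<times> J. a p \<in> K" "\<exists>p\<in>T \<times> I \<times> J. a p \<noteq> \<zero>" for a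
 proof -
  let ?P = "T \<times> I \<times> J"
  have finP: "finite ?P" "finite (I \<times> J)" using finite_T fin by auto
  have aK: "a p \<in> K" "a p \<in> C" if "p \<in> ?P" for p using a(1) that K_props(3) by auto
  define v where "v p = a p \<otimes> x (fst (snd p))" for p
  have xc: "x (fst (snd p)) \<in> C" "x (fst (snd p)) \<noteq> \<zero>" if "p \<in> ?P" for p using DX(2,3) that by auto
  have vc: "v p \<in> C" if "p \<in> ?P" for p unfolding v_def using aK(2)[OF that] xc[OF that] by simp
  \<comment> \<open>A term of least value over all blocks selects the block and with it the place
    \<open>\<tau>\<close>. There all other blocks contribute strictly larger values, and
    \<open>dominant_term\<close> settles the block itself.\<close>
  have "\<exists>pm\<in>?P. \<forall>p\<in>?P. vle A (v pm) (v p)"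
   by (rule exists_vle_minimum[OF VA finP(1) _ vc]) (use a(2) in auto)
  then obtain pm where pm: "pm \<in> ?P" "\<And>p. p \<in> ?P \<Longrightarrow> vle A (v pm) (v p)" by blast
  have vnz: "v p \<noteq> \<zero> \<longleftrightarrow> a p \<noteq> \<zero>" if "p \<in> ?P" for p
   unfolding v_def using aK(2)[OF that] xc[OF that] by (simp add: integral_iff)
  have pmz: "v pm \<noteq> \<zero>"
  proof -
   obtain p where p: "p \<in> ?P" "a p \<noteq> \<zero>" using a(2) by blast
   thus ?thesis using pm(2)[OF p(1)] zero_vle_iff[OF VA vc[OF p(1)]] vnz[OF p(1)] by auto
  qed
  define \<tau> where "\<tau> = fst pm"
  have tT: "\<tau> \<in> T" using pm(1) by (auto simp: \<tau>_def)
  have tK: "\<tau> \<in> auts K" using tT T_auts by blast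
  define i1 j1 where "i1 = fst (snd pm)" and "j1 = snd (snd pm)"
  have ij1: "i1 \<in> I" "j1 \<in> J" "pm = (\<tau>, i1, j1)" using pm(1) by (auto simp: i1_def j1_def \<tau>_def)
  have a1: "a (\<tau>, i1, j1) \<noteq> \<zero>" using pmz vnz[OF pm(1)] ij1(3) by simp
  have at: "a (\<tau>, i, j) \<in> K" if "i \<in> I" "j \<in> J" for i j using aK(1) tT that by simp
  obtain i0 j0 where ij0: "i0 \<in> I" "j0 \<in> J" "a (\<tau>, i0, j0) \<noteq> \<zero>"
   "\<And>i j. i \<in> I \<Longrightarrow> j \<in> J \<Longrightarrow> vle A (a (\<tau>, i0, j0) \<otimes> x' i0) (a (\<tau>, i, j) \<otimes> x' i)"
   "veq A (\<Oplus>i\<in>I. (\<Oplus>j\<in>J. a (\<tau>, i, j) \<otimes> y' j) \<otimes> x' i) (a (\<tau>, i0, j0) \<otimes> x' i0)"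
   using dominant_term[of I x' J y' "\<lambda>i j. a (\<tau>, i, j)" i1 j1, OF vx' vy' fin at ij1(1,2) a1] by blast
  define p0 where "p0 = (\<tau>, i0, j0)"
  have p0: "p0 \<in> ?P" "a p0 \<noteq> \<zero>" using ij0 tT by (auto simp: p0_def)
  have eqx: "veq A (a (\<tau>, i, j) \<otimes> x i) (a (\<tau>, i, j) \<otimes> x' i)" if "i \<in> I" "j \<in> J" for i j
   by (rule veq_mult[OF VA x'(2)[OF that(1)] DX(3)[OF that(1)] x'(4)[OF that(1)]]) (use at[OF that] K_props(3) in blast)
  have c0: "a p0 \<otimes> x' i0 \<in> C" using aK(2)[OF p0(1)] x'(4)[OF ij0(1)] by simp
  have v0: "v p0 = a p0 \<otimes> x i0" by (simp add: v_def p0_def)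
  have e0: "veq A (v p0) (a p0 \<otimes> x' i0)" unfolding v0 using eqx[OF ij0(1,2)] by (simp add: p0_def)
  have e1: "veq A (v pm) (a pm \<otimes> x' i1)" using eqx[OF ij1(1,2)] by (simp add: v_def ij1(3))
  have "vle A (v p0) (v pm)"
  proof -
   have c1: "a pm \<otimes> x' i1 \<in> C" using aK(2)[OF pm(1)] x'(4)[OF ij1(1)] by simp
   have "vle A (v p0) (a p0 \<otimes> x' i0)" using e0 by (simp add: veq_def)
   moreover have "vle A (a p0 \<otimes> x' i0) (a pm \<otimes> x' i1)" using ij0(4)[OF ij1(1,2)] by (simp add: p0_def ij1(3))
   moreover have "vle A (a pm \<otimes> x' i1) (v pm)" using e1 by (simp add: veq_def)
   ultimately show ?thesis using vle_trans[OF VA] vc[OF p0(1)] c0 c1 by blast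
  qed
  hence min: "vle A (v p0) (v p)" if "p \<in> ?P" for p using vle_trans[OF VA _ pm(2)[OF that] vc[OF p0(1)]] by blast
  have v0nz: "v p0 \<noteq> \<zero>" using vnz[OF p0(1)] p0(2) by blast
  have uc: "u p \<in> C" if "p \<in> ?P" for p using uL[OF that] L_props(3) by blast
  define B where "B \<rho> = (\<Oplus>q\<in>I \<times> J. a (\<rho>, q) \<otimes> u (\<rho>, q))" for \<rho>
  have Bc: "B \<rho> \<in> C" if "\<rho> \<in> T" for \<rho>
   unfolding B_def using aK(2) uc that by (auto intro!: finsum_closed)
  have tB: "\<tau> (B \<rho>) = (\<Oplus>q\<in>I \<times> J. a (\<rho>, q) \<otimes> \<tau> (u (\<rho>, q)))" if r: "\<rho> \<in> T" for \<rho>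
  proof -
   have "\<tau> (B \<rho>) = (\<Oplus>q\<in>I \<times> J. \<tau> (a (\<rho>, q) \<otimes> u (\<rho>, q)))"
    unfolding B_def by (rule auts_finsum[OF tK finP(2)]) (use aK(2) uc r in auto)
   also have "\<dots> = (\<Oplus>q\<in>I \<times> J. a (\<rho>, q) \<otimes> \<tau> (u (\<rho>, q)))"
   proof (rule finsum_cong')
    fix q assume q: "q \<in> I \<times> J"
    hence p: "(\<rho>, q) \<in> ?P" using r by simp
    show "\<tau> (a (\<rho>, q) \<otimes> u (\<rho>, q)) = a (\<rho>, q) \<otimes> \<tau> (u (\<rho>, q))"
     using auts_binary(2)[OF tK aK(2)[OF p] uc[OF p]] auts_fix[OF tK aK(1)[OF p]] by simp
   next
    show "(\<lambda>q. a (\<rho>, q) \<otimes> \<tau> (u (\<rho>, q))) \<in> I \<times> J \<rightarrow> C"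
     using aK(2) auts_closed[OF tK uc] r by auto
   qed simp
   finally show ?thesis .
  qed
  have other: "vlt A (v p0) (\<tau> (B \<rho>))" if r: "\<rho> \<in> T - {\<tau>}" for \<rho>
  proof -
   have rT: "\<rho> \<in> T" "\<tau> \<noteq> \<rho>" using r by auto
   have ns: "\<not> same_trace (\<tau> \<circ> T_inv \<rho>) id" by (rule T_comp_inv_not_same[OF tT rT])
   have rK: "\<tau> \<circ> T_inv \<rho> \<in> auts K" using auts_comp[OF tK T_inv_props(1)[OF rT(1)]] .
   show ?thesis unfolding tB[OF rT(1)]
   proof (rule vlt_finsum[OF VA finP(2) _ vc[OF p0(1)] v0nz])
    show "(\<lambda>q. a (\<rho>, q) \<otimes> \<tau> (u (\<rho>, q))) \<in> I \<times> J \<rightarrow> C"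
     using aK(2) auts_closed[OF tK uc] rT(1) by auto
    fix q assume q: "q \<in> I \<times> J"
    hence p: "(\<rho>, q) \<in> ?P" using rT by simp
    have tu: "\<tau> (u (\<rho>, q)) = (\<tau> \<circ> T_inv \<rho>) (b q)" by (simp add: u_def)
    have tuc: "\<tau> (u (\<rho>, q)) \<in> C" using auts_closed[OF tK uc[OF p]] .
    show "vlt A (v p0) (a (\<rho>, q) \<otimes> \<tau> (u (\<rho>, q)))"
    proof (cases "a (\<rho>, q) = \<zero>")
     case True
     thus ?thesis using vlt_zero[OF VA vc[OF p0(1)]] v0nz tuc by simp
    next
     case False
     have "vlt A (x (fst q)) (\<tau> (u (\<rho>, q)))" unfolding tu by (rule rb(2)[OF q rK ns])
     hence "vlt A (a (\<rho>, q) \<otimes> x (fst q)) (a (\<rho>, q) \<otimes> \<tau> (u (\<rho>, q)))"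
      using vlt_mult_iff[OF VA _ tuc aK(2)[OF p] False, of "x (fst q)"] xc[OF p] by simp
     moreover have "vle A (v p0) (a (\<rho>, q) \<otimes> x (fst q))" using min[OF p] by (simp add: v_def)
     ultimately show ?thesis using vle_vlt_trans[OF VA] aK(2)[OF p] tuc by blast
    qed
   qed
  qed
  define W0 where "W0 = (\<Oplus>i\<in>I. (\<Oplus>j\<in>J. a (\<tau>, i, j) \<otimes> y' j) \<otimes> x' i)"
  have W0c: "W0 \<in> C"
  proof -
   have "(\<lambda>j. a (\<tau>, i, j) \<otimes> y' j) \<in> J \<rightarrow> C" if "i \<in> I" for i
    using at[OF that] K_props(3) DY'(3) by (auto intro!: m_closed)
   hence "(\<Oplus>j\<in>J. a (\<tau>, i, j) \<otimes> y' j) \<in> C" if "i \<in> I" for i using that by (intro finsum_closed)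
   thus ?thesis unfolding W0_def using x'(4) by (auto intro!: finsum_closed)
  qed
  have tB0: "\<tau> (B \<tau>) = z \<otimes> W0"
  proof -
   have tu: "\<tau> (u (\<tau>, q)) = b q" if "q \<in> I \<times> J" for q
    using T_inv_props(3)[OF tT bL(2)[OF that]] by (simp add: u_def)
   have ac: "a (\<tau>, q) \<in> C" if "q \<in> I \<times> J" for q using aK(2) tT that by simp
   have yc: "y' j \<in> C" if "j \<in> J" for j using DY'(3)[OF that] .
   have "\<tau> (B \<tau>) = (\<Oplus>q\<in>I \<times> J. a (\<tau>, q) \<otimes> b q)"
    unfolding tB[OF tT] by (rule finsum_cong') (use tu ac bL(2) in auto)
   also have "\<dots> = (\<Oplus>q\<in>I \<times> J. z \<otimes> (a (\<tau>, q) \<otimes> y' (snd q) \<otimes> x' (fst q)))"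
   proof (rule finsum_cong')
    show "(\<lambda>q. z \<otimes> (a (\<tau>, q) \<otimes> y' (snd q) \<otimes> x' (fst q))) \<in> I \<times> J \<rightarrow> C"
     using Z(2) ac yc x'(4) by auto
    fix q assume q: "q \<in> I \<times> J"
    hence "y' (snd q) \<in> C" "x' (fst q) \<in> C" using yc x'(4) by auto
    thus "a (\<tau>, q) \<otimes> b q = z \<otimes> (a (\<tau>, q) \<otimes> y' (snd q) \<otimes> x' (fst q))"
     unfolding b_def using ac[OF q] Z(2) by (simp add: m_ac)
   qed simp
   also have "\<dots> = z \<otimes> (\<Oplus>q\<in>I \<times> J. a (\<tau>, q) \<otimes> y' (snd q) \<otimes> x' (fst q))"
    by (rule finsum_rdistr[symmetric, OF finP(2) Z(2)]) (use ac yc x'(4) in auto)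
   also have "(\<Oplus>q\<in>I \<times> J. a (\<tau>, q) \<otimes> y' (snd q) \<otimes> x' (fst q)) = (\<Oplus>i\<in>I. \<Oplus>j\<in>J. a (\<tau>, i, j) \<otimes> y' j \<otimes> x' i)"
    using finsum_cartesian[OF fin, of "\<lambda>q. a (\<tau>, q) \<otimes> y' (snd q) \<otimes> x' (fst q)"] ac yc x'(4) by simp
   also have "\<dots> = W0"
    unfolding W0_def
   proof (rule finsum_cong')
    show "(\<lambda>i. (\<Oplus>j\<in>J. a (\<tau>, i, j) \<otimes> y' j) \<otimes> x' i) \<in> I \<rightarrow> C"
    proof
     fix i assume i: "i \<in> I"
     have "(\<lambda>j. a (\<tau>, i, j) \<otimes> y' j) \<in> J \<rightarrow> C" using ac yc i by auto
     thus "(\<Oplus>j\<in>J. a (\<tau>, i, j) \<otimes> y' j) \<otimes> x' i \<in> C" using x'(4)[OF i] finsum_closed by blast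
    qed
    fix i assume i: "i \<in> I"
    show "(\<Oplus>j\<in>J. a (\<tau>, i, j) \<otimes> y' j \<otimes> x' i) = (\<Oplus>j\<in>J. a (\<tau>, i, j) \<otimes> y' j) \<otimes> x' i"
     by (rule finsum_ldistr[symmetric, OF fin(2) x'(4)[OF i]]) (use ac yc i in auto)
   qed simp
   finally show ?thesis .
  qed
  have "veq A (\<one> \<otimes> W0) (z \<otimes> W0)"
   by (rule veq_mult2[OF VA Z(6) veq_refl[OF VA W0c]]) (use Z(2) W0c in auto)
  hence "veq A (z \<otimes> W0) W0" using W0c veq_sym[OF VA] by simp
  moreover have "veq A W0 (a p0 \<otimes> x' i0)" using ij0(5) by (simp add: W0_def p0_def)
  ultimately have "veq A (z \<otimes> W0) (a p0 \<otimes> x' i0)" using veq_trans[OF VA] Z(2) W0c c0 by blast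
  hence eB: "veq A (\<tau> (B \<tau>)) (v p0)"
   unfolding tB0 using veq_trans[OF VA _ veq_sym[OF VA e0]] Z(2) W0c vc[OF p0(1)] by simp
  define r where "r = (\<Oplus>\<rho>\<in>T - {\<tau>}. \<tau> (B \<rho>))"
  have tBc: "\<tau> (B \<rho>) \<in> C" if "\<rho> \<in> T" for \<rho> using auts_closed[OF tK Bc[OF that]] .
  have rc: "r \<in> C" unfolding r_def using tBc by (auto intro!: finsum_closed)
  have "vlt A (v p0) r" unfolding r_def
   by (rule vlt_finsum[OF VA _ _ vc[OF p0(1)] v0nz other]) (use finite_T tBc in auto)
  hence "vlt A (\<tau> (B \<tau>)) r" using vle_vlt_trans[OF VA _ _ rc] eB by (auto simp: veq_def)
  hence "veq A (\<tau> (B \<tau>)) (\<tau> (B \<tau>) \<oplus> r)" by (rule veq_add[OF VA _ tBc[OF tT] rc])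
  hence "veq A (\<tau> (B \<tau>) \<oplus> r) (v p0)"
   using veq_trans[OF VA veq_sym[OF VA] eB] tBc[OF tT] rc vc[OF p0(1)] by blast
  moreover have "\<tau> (\<Oplus>p\<in>?P. a p \<otimes> u p) = \<tau> (B \<tau>) \<oplus> r"
  proof -
   have "(\<Oplus>p\<in>?P. a p \<otimes> u p) = (\<Oplus>\<rho>\<in>T. B \<rho>)"
    unfolding B_def by (rule finsum_cartesian[OF finite_T finP(2)]) (use aK(2) uc in auto)
   hence "\<tau> (\<Oplus>p\<in>?P. a p \<otimes> u p) = (\<Oplus>\<rho>\<in>T. \<tau> (B \<rho>))"
    using auts_finsum[OF tK finite_T, of B] Bc by (simp add: Pi_def)
   also have "\<dots> = (\<Oplus>\<rho>\<in>insert \<tau> (T - {\<tau>}). \<tau> (B \<rho>))" using tT by (simp add: insert_absorb)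
   also have "\<dots> = \<tau> (B \<tau>) \<oplus> r" unfolding r_def by (rule finsum_insert) (use finite_T tBc tT in auto)
   finally show ?thesis .
  qed
  ultimately have "veq A (\<tau> (\<Oplus>p\<in>?P. a p \<otimes> u p)) (v p0)" by simp
  thus ?thesis using tT p0 min unfolding v_def by blast
 qed
 show ?thesis using uL uA main by (intro exI[of _ u] conjI) blast+
qed

end

section \<open>Finiteness of the integral closure\<close>

context valued_extension
begin

text \<open>Will be identified with the integral closure; the description by conjugates is the one
  that suits the automorphisms.\<close>

definition integral_part :: "'a set"
 where "integral_part = {x \<in> L. \<forall>\<tau>\<in>auts K. \<tau> x \<in> A}"

definition base_ring :: "'a set" where "base_ring = K \<inter> A"

definition base_ideal :: "'a set" where "base_ideal = {c \<in> K. vlt A \<one> c}"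

text \<open>Independence of the classes in D/mD over the residue field of \<open>K\<close>, where m
  is \<open>base_ideal\<close> and D is \<open>integral_part\<close>. In a valuation ring finitely
  many elements of m are multiples of one of them, so membership in mD means that a single
  \<open>d\<close> divides all conjugates.\<close>

definition integral_independent :: "'i set \<Rightarrow> ('i \<Rightarrow> 'a) \<Rightarrow> bool"
 where "integral_independent J u \<longleftrightarrow> (\<forall>j\<in>J. u j \<in> integral_part) \<and>
  (\<forall>c. (\<forall>j\<in>J. c j \<in> base_ring) \<longrightarrow>
   (\<exists>d\<in>base_ideal. \<forall>\<tau>\<in>auts K. vle A d (\<tau> (\<Oplus>j\<in>J. c j \<otimes> u j))) \<longrightarrow> (\<forall>j\<in>J. c j \<in> base_ideal))"

lemma integral_independentD:
 assumes "integral_independent J u"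
 shows "j \<in> J \<Longrightarrow> u j \<in> integral_part"
  "(\<And>j. j \<in> J \<Longrightarrow> c j \<in> base_ring) \<Longrightarrow> d \<in> base_ideal \<Longrightarrow>
   (\<And>\<tau>. \<tau> \<in> auts K \<Longrightarrow> vle A d (\<tau> (\<Oplus>j\<in>J. c j \<otimes> u j))) \<Longrightarrow> j \<in> J \<Longrightarrow> c j \<in> base_ideal"
proof -
 have a: "\<forall>j\<in>J. u j \<in> integral_part" "\<And>c. (\<forall>j\<in>J. c j \<in> base_ring) \<longrightarrow>
   (\<exists>d\<in>base_ideal. \<forall>\<tau>\<in>auts K. vle A d (\<tau> (\<Oplus>j\<in>J. c j \<otimes> u j))) \<longrightarrow> (\<forall>j\<in>J. c j \<in> base_ideal)"
  using assms unfolding integral_independent_def by blast+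
 show "j \<in> J \<Longrightarrow> u j \<in> integral_part" using a(1) by blast
 assume h: "\<And>j. j \<in> J \<Longrightarrow> c j \<in> base_ring" "d \<in> base_ideal"
  "\<And>\<tau>. \<tau> \<in> auts K \<Longrightarrow> vle A d (\<tau> (\<Oplus>j\<in>J. c j \<otimes> u j))" "j \<in> J"
 have "\<forall>j\<in>J. c j \<in> base_ring" using h(1) by blast
 moreover have "\<exists>d\<in>base_ideal. \<forall>\<tau>\<in>auts K. vle A d (\<tau> (\<Oplus>j\<in>J. c j \<otimes> u j))" using h(2,3) by blast
 ultimately show "c j \<in> base_ideal" using a(2)[of c] h(4) by blast
qed

lemma integral_partD:
 assumes "x \<in> integral_part"
 shows "x \<in> L" "x \<in> C" "\<tau> \<in> auts K \<Longrightarrow> \<tau> x \<in> A"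
 using assms L_props(3) by (auto simp: integral_part_def)

lemma base_local_pair: "local_pair base_ring base_ideal"
 unfolding local_pair_def
proof (intro conjI ballI)
 note VA = valring_A and cl = valring_closed[OF valring_A]
 note KS = subringE[OF K_props(2)]
 have Kc: "x \<in> C" if "x \<in> K" for x using that K_props(3) by blast
 show "subring base_ring R"
  by (rule subringI) (use cl KS K_props(3) in \<open>auto simp: base_ring_def\<close>)
 show "base_ideal \<subseteq> base_ring" using vlt_one_in[OF VA] Kc by (auto simp: base_ideal_def base_ring_def)
 show "\<zero> \<in> base_ideal" using KS(2) vlt_zero[OF VA] by (simp add: base_ideal_def)
 show "\<one> \<notin> base_ideal" using vlt_irrefl[OF VA] by (simp add: base_ideal_def)
 show "x \<oplus> y \<in> base_ideal" if "x \<in> base_ideal" "y \<in> base_ideal" for x y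
  using that KS(7) vlt_add[OF VA] Kc by (simp add: base_ideal_def)
 show "s \<otimes> x \<in> base_ideal" if "s \<in> base_ring" "x \<in> base_ideal" for s x
 proof -
  have "vlt A \<one> (x \<otimes> s)" using vlt_one_mult[OF VA] that Kc by (simp add: base_ideal_def base_ring_def)
  thus ?thesis using that KS(6) Kc by (simp add: base_ideal_def base_ring_def m_comm)
 qed
 show "inv x \<in> base_ring" if x: "x \<in> base_ring - base_ideal" for x
 proof -
  have xK: "x \<in> K" "x \<in> A" "\<not> vlt A \<one> x" using x by (auto simp: base_ring_def base_ideal_def)
  hence "veq A \<one> x" using in_cases[OF VA] by blast
  hence "inv x \<in> A" "x \<noteq> \<zero>" using unit_in[OF VA] Kc[OF xK(1)] by auto
  thus ?thesis using subfield_inv_closed[OF K_props(1) xK(1)] by (simp add: base_ring_def)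
 qed
qed

lemmas base_props = local_pairD[OF base_local_pair]

lemma not_base_ideal:
 assumes "c \<in> base_ring" "c \<notin> base_ideal"
 shows "veq A \<one> c"
 using assms in_cases[OF valring_A] by (auto simp: base_ring_def base_ideal_def)

lemma integral_part_closed:
 "subring integral_part R" "base_ring \<subseteq> integral_part"
proof -
 note cl = valring_closed[OF valring_A]
 note LS = subringE[OF L_props(2)]
 show "subring integral_part R"
 proof (rule subringI)
  show "integral_part \<subseteq> C" using integral_partD(2) by blast
  have "\<tau> \<one> \<in> A" if "\<tau> \<in> auts K" for \<tau> using auts_const(2)[OF that] cl(2) by simp
  thus "\<one> \<in> integral_part" using LS(3) by (simp add: integral_part_def)
  fix x y assume xy: "x \<in> integral_part" "y \<in> integral_part"
  note X = integral_partD[OF xy(1)] and Y = integral_partD[OF xy(2)]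
  have "\<tau> (\<ominus> x) \<in> A" if "\<tau> \<in> auts K" for \<tau> using auts_unary(2)[OF that X(2)] cl(3) X(3)[OF that] by simp
  thus "\<ominus> x \<in> integral_part" using LS(5)[OF X(1)] by (simp add: integral_part_def)
  have "\<tau> (x \<otimes> y) \<in> A" if "\<tau> \<in> auts K" for \<tau>
   using auts_binary(2)[OF that X(2) Y(2)] cl(5) X(3)[OF that] Y(3)[OF that] by simp
  thus "x \<otimes> y \<in> integral_part" using LS(6)[OF X(1) Y(1)] by (simp add: integral_part_def)
  have "\<tau> (x \<oplus> y) \<in> A" if "\<tau> \<in> auts K" for \<tau>
   using auts_binary(1)[OF that X(2) Y(2)] cl(4) X(3)[OF that] Y(3)[OF that] by simp
  thus "x \<oplus> y \<in> integral_part" using LS(7)[OF X(1) Y(1)] by (simp add: integral_part_def)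
 qed
 show "base_ring \<subseteq> integral_part"
 proof
  fix x assume x: "x \<in> base_ring"
  have "\<tau> x \<in> A" if "\<tau> \<in> auts K" for \<tau> using auts_fix[OF that, of x] x by (simp add: base_ring_def)
  thus "x \<in> integral_part" using x L_props(4) by (auto simp: integral_part_def base_ring_def)
 qed
qed

text \<open>Dividing a relation by a coefficient of least value makes all coefficients integral and
  one of them equal to 1, which independence modulo the ideal excludes.\<close>

lemma integral_independent_lin_indep:
 assumes u: "integral_independent J u" and J: "finite J"
 shows "lin_indep K J u"
 unfolding lin_indep_def
proof (intro allI impI, rule ccontr)
 note VA = valring_A and U = integral_independentD[OF u]
 fix a assume a: "\<forall>j\<in>J. a j \<in> K" and z: "(\<Oplus>j\<in>J. a j \<otimes> u j) = \<zero>" and "\<not> (\<forall>j\<in>J. a j = \<zero>)"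
 then obtain j1 where j1: "j1 \<in> J" "a j1 \<noteq> \<zero>" by blast
 have ac: "a j \<in> C" if "j \<in> J" for j using a that K_props(3) by blast
 have uc: "u j \<in> C" if "j \<in> J" for j using integral_partD(2)[OF U(1)[OF that]] .
 have "\<exists>j0\<in>J. \<forall>j\<in>J. vle A (a j0) (a j)"
  by (rule exists_vle_minimum[OF VA J _ ac]) (use j1 in auto)
 then obtain j0 where j0: "j0 \<in> J" "\<And>j. j \<in> J \<Longrightarrow> vle A (a j0) (a j)" by auto
 have nz: "a j0 \<noteq> \<zero>" using j0(2)[OF j1(1)] zero_vle_iff[OF VA ac[OF j1(1)]] j1(2) by auto
 define c where "c j = inv (a j0) \<otimes> a j" for j
 have iK: "inv (a j0) \<in> K" "inv (a j0) \<in> C"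
  using subfield_inv_closed[OF K_props(1) _ nz] a j0(1) ac[OF j0(1)] nz by auto
 have cB: "c j \<in> base_ring" if j: "j \<in> J" for j
  unfolding c_def base_ring_def using vle_iff_div[OF VA ac[OF j0(1)] ac[OF j] nz] j0(2)[OF j]
   subringE(6)[OF K_props(2) iK(1)] a j by blast
 have cc: "c j \<in> C" if "j \<in> J" for j using cB[OF that] base_props(8) by blast
 have "(\<Oplus>j\<in>J. c j \<otimes> u j) = (\<Oplus>j\<in>J. inv (a j0) \<otimes> (a j \<otimes> u j))"
  by (rule finsum_cong') (use ac uc iK in \<open>auto simp: c_def m_assoc\<close>)
 also have "\<dots> = inv (a j0) \<otimes> (\<Oplus>j\<in>J. a j \<otimes> u j)"
  by (rule finsum_rdistr[symmetric, OF J iK(2)]) (use ac uc in auto)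
 also have "\<dots> = \<zero>" unfolding z using iK(2) by simp
 finally have "(\<Oplus>j\<in>J. c j \<otimes> u j) = \<zero>" .
 \<comment> \<open>Zero belongs to the ideal and serves as the divisor of the zero sum.\<close>
 hence "vle A \<zero> (\<tau> (\<Oplus>j\<in>J. c j \<otimes> u j))" if "\<tau> \<in> auts K" for \<tau>
  using auts_const[OF that] vle_refl[OF VA zero_closed] by simp
 hence "c j0 \<in> base_ideal" using U(2)[of c \<zero> j0] cB base_props(3) j0(1) by blast
 moreover have "c j0 = \<one>" using ac[OF j0(1)] nz by (simp add: c_def)
 ultimately show False using base_props(4) by simp
qed

lemma full_family_spans:
 assumes J: "finite J" "card J = n" "lin_indep K J u" "\<And>j. j \<in> J \<Longrightarrow> u j \<in> L"
 shows "lspan K J u = L"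
proof -
 have uc: "u \<in> J \<rightarrow> C" using J(4) L_props(3) by auto
 have d: "dimension n K (lspan K J u)" using dimension_lspan[OF K_props(1) J(1) uc J(3)] J(2) by simp
 obtain Vs where V: "set Vs \<subseteq> C" "independent K Vs" "length Vs = n" "Span K Vs = lspan K J u"
  using exists_base[OF K_props(1) d] by blast
 have "lspan K J u \<subseteq> L"
 proof (rule lspan_minimal[OF J(1)])
  show "a \<otimes> u j \<in> L" if "a \<in> K" "j \<in> J" for a j using that J(4) L_props(4) subringE(6)[OF L_props(2)] by blast
 qed (use subringE[OF L_props(2)] in blast)+
 hence "set Vs \<subseteq> L" using Span_base_incl[OF K_props(1) V(1)] V(4) by blast
 hence "Span K Vs = L" using independent_length_eq_dimension[OF K_props(1) dim_L V(2)] V(3) by blast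
 thus ?thesis using V(4) by simp
qed

text \<open>Coefficients in \<open>K\<close> exist for reasons of dimension. If one of them were not
  integral, multiplying by the inverse \<open>d\<close> of the coefficient of least value would give
  a combination divisible by the nonunit \<open>d\<close> although one of its coefficients is
  1.\<close>

lemma integral_part_eq_lspan:
 assumes u: "integral_independent J u" and J: "finite J" "card J = n"
 shows "integral_part = lspan base_ring J u"
proof
 note VA = valring_A and U = integral_independentD[OF u]
 have uc: "u j \<in> C" if "j \<in> J" for j using integral_partD(2)[OF U(1)[OF that]] .
 show "lspan base_ring J u \<subseteq> integral_part"
 proof (rule lspan_minimal[OF J(1)])
  fix j a assume "a \<in> base_ring" "j \<in> J"
  thus "a \<otimes> u j \<in> integral_part"
   using subringE(6)[OF integral_part_closed(1)] subsetD[OF integral_part_closed(2)] U(1) by simp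
 qed (use subringE(1,2,7)[OF integral_part_closed(1)] in simp_all)
 show "integral_part \<subseteq> lspan base_ring J u"
 proof
  fix x assume x: "x \<in> integral_part"
  note X = integral_partD[OF x]
  have li: "lin_indep K J u" by (rule integral_independent_lin_indep[OF u J(1)])
  have "lspan K J u = L" by (rule full_family_spans[OF J li]) (use integral_partD(1)[OF U(1)] in blast)
  hence "x \<in> lspan K J u" using X(1) by simp
  then obtain a where a: "\<And>j. j \<in> J \<Longrightarrow> a j \<in> K" "x = (\<Oplus>j\<in>J. a j \<otimes> u j)"
   by (rule lspan_obtain) blast
  have ac: "a j \<in> C" if "j \<in> J" for j using a(1)[OF that] K_props(3) by blast
  have "a j \<in> base_ring" if j: "j \<in> J" for j
  proof (rule ccontr)
   assume "a j \<notin> base_ring"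
   hence jA: "a j \<notin> A" using a(1)[OF j] by (simp add: base_ring_def)
   have "\<exists>j0\<in>J. \<forall>j\<in>J. vle A (a j0) (a j)"
    by (rule exists_vle_minimum[OF VA J(1) _ ac]) (use j in auto)
   then obtain j0 where j0: "j0 \<in> J" "\<And>j. j \<in> J \<Longrightarrow> vle A (a j0) (a j)" by auto
   have lt: "vlt A (a j0) \<one>"
   proof -
    have "vlt A (a j) \<one>" using not_in_iff[OF VA ac[OF j]] jA by simp
    thus ?thesis using vle_vlt_trans[OF VA j0(2)[OF j]] by simp
   qed
   have nz: "a j0 \<noteq> \<zero>" using lt vle_zero[OF VA one_closed] by (auto simp: vlt_def)
   define d where "d = inv (a j0)"
   have dK: "d \<in> K" "d \<in> C" "d \<noteq> \<zero>"
    using subfield_inv_closed[OF K_props(1) a(1)[OF j0(1)] nz] ac[OF j0(1)] nz by (auto simp: d_def)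
   have "vlt A (d \<otimes> a j0) (d \<otimes> \<one>)" using vlt_mult_iff[OF VA ac[OF j0(1)] one_closed dK(2,3)] lt by simp
   hence dI: "d \<in> base_ideal" using dK ac[OF j0(1)] nz by (simp add: base_ideal_def d_def)
   define c where "c j = d \<otimes> a j" for j
   have cB: "c j \<in> base_ring" if j: "j \<in> J" for j
    unfolding c_def d_def base_ring_def using vle_iff_div[OF VA ac[OF j0(1)] ac[OF j] nz] j0(2)[OF j]
     subringE(6)[OF K_props(2) dK(1) a(1)[OF j]] by (simp add: d_def)
   have "(\<Oplus>j\<in>J. c j \<otimes> u j) = (\<Oplus>j\<in>J. d \<otimes> (a j \<otimes> u j))"
    by (rule finsum_cong') (use ac uc dK in \<open>auto simp: c_def m_assoc\<close>)
   also have "\<dots> = d \<otimes> x" unfolding a(2)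
    by (rule finsum_rdistr[symmetric, OF J(1) dK(2)]) (use ac uc in auto)
   finally have s: "(\<Oplus>j\<in>J. c j \<otimes> u j) = d \<otimes> x" .
   have "vle A d (\<tau> (\<Oplus>j\<in>J. c j \<otimes> u j))" if t: "\<tau> \<in> auts K" for \<tau>
    unfolding s using auts_binary(2)[OF t dK(2) X(2)] auts_fix[OF t dK(1)] X(3)[OF t] by (auto simp: vle_def)
   hence "c j0 \<in> base_ideal" using U(2)[of c d j0] cB dI j0(1) by blast
   moreover have "c j0 = \<one>" using ac[OF j0(1)] nz by (simp add: c_def d_def)
   ultimately show False using base_props(4) by simp
  qed
  thus "x \<in> lspan base_ring J u" unfolding a(2) by (rule lspanI)
 qed
qed

text \<open>A conjugate outside \<open>A\<close> has a power with the value of some \<open>c\<close>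
  in \<open>K\<close>, and the inverse of \<open>c\<close> makes it integral. The product of such
  elements over all conjugates works for all of them.\<close>

lemma denominator_exists:
 assumes x: "x \<in> L"
 shows "\<exists>c\<in>K. c \<noteq> \<zero> \<and> c \<otimes> x \<in> integral_part"
proof -
 note VA = valring_A
 have xc: "x \<in> C" using x L_props(3) by blast
 define Y where "Y = {\<tau> x | \<tau>. \<tau> \<in> auts K}"
 have Y: "finite Y" "Y \<subseteq> C"
  using finite_conjugates[OF overfield_K xc] auts_closed[OF _ xc] by (auto simp: Y_def)
 have ex: "\<exists>d. d \<in> base_ring \<and> d \<noteq> \<zero> \<and> d \<otimes> y \<in> A" if y: "y \<in> Y" for y
 proof (cases "y \<in> A")
  case True
  thus ?thesis using subringE(3)[OF base_props(1)] valring_carrier[OF VA True] by (intro exI[of _ \<one>]) simp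
 next
  case False
  have yc: "y \<in> C" "y \<noteq> \<zero>" using y Y(2) False valring_closed(1)[OF VA] by auto
  obtain N c where Nc: "0 < (N::nat)" "c \<in> K" "c \<noteq> \<zero>" "veq A (y [^] N) c"
   using valuation_torsion[OF overfield_K VA yc] by blast
  have cc: "c \<in> C" using Nc(2) K_props(3) by blast
  have y1: "vle A y \<one>" using vlt_imp_vle[OF VA] not_in_iff[OF VA yc(1)] False yc by simp
  obtain N' where N': "N = Suc N'" using Nc(1) by (cases N) auto
  have "vle A (y [^] N') \<one>" using vle_nat_pow[OF VA y1 yc(1) one_closed, of N'] by simp
  hence "vle A (y \<otimes> y [^] N') (y \<otimes> \<one>)" by (rule vle_mult[OF VA]) (use yc in simp_all)
  hence "vle A (y [^] N) y" using yc by (simp add: N' m_comm)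
  hence cy: "vle A c y" using vle_trans[OF VA _ _ cc] Nc(4) by (auto simp: veq_def)
  have "vle A c \<one>" using vle_trans[OF VA cy y1 cc] .
  hence "inv c \<in> A" using vle_iff_div[OF VA cc one_closed Nc(3)] cc Nc(3) by simp
  moreover have "inv c \<otimes> y \<in> A" using vle_iff_div[OF VA cc yc(1) Nc(3)] cy by simp
  moreover have "inv c \<in> K" "inv c \<noteq> \<zero>" using subfield_inv_closed[OF K_props(1) Nc(2,3)] cc Nc(3) by auto
  ultimately show ?thesis by (intro exI[of _ "inv c"]) (simp add: base_ring_def)
 qed
 define d where "d y = (SOME d. d \<in> base_ring \<and> d \<noteq> \<zero> \<and> d \<otimes> y \<in> A)" for y
 have d: "d y \<in> base_ring" "d y \<noteq> \<zero>" "d y \<otimes> y \<in> A" "d y \<in> C" if y: "y \<in> Y" for y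
  using someI_ex[OF ex[OF y]] base_props(8) unfolding d_def[symmetric] by blast+
 define c where "c = finprod R d Y"
 have c: "c \<in> base_ring" unfolding c_def by (rule finprod_in_subring[OF base_props(1) Y(1) d(1)])
 hence cK: "c \<in> K" "c \<in> C" using K_props(3) by (auto simp: base_ring_def)
 have split: "c = d y \<otimes> finprod R d (Y - {y})" "finprod R d (Y - {y}) \<in> base_ring" if y: "y \<in> Y" for y
 proof -
  have "Y = insert y (Y - {y})" using y by blast
  hence "c = finprod R d (insert y (Y - {y}))" unfolding c_def by simp
  also have "\<dots> = d y \<otimes> finprod R d (Y - {y})" by (rule finprod_insert) (use Y(1) d(4) y in auto)
  finally show "c = d y \<otimes> finprod R d (Y - {y})" .
  show "finprod R d (Y - {y}) \<in> base_ring" by (rule finprod_in_subring[OF base_props(1)]) (use Y(1) d(1) in auto)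
 qed
 have "c \<noteq> \<zero>"
 proof -
  have "finprod R d Z \<noteq> \<zero> \<and> finprod R d Z \<in> C" if "finite Z" "Z \<subseteq> Y" for Z
   using that
  proof (induction Z rule: finite_induct)
   case (insert y Z)
   hence "d \<in> Z \<rightarrow> C" "d y \<in> C" "d y \<noteq> \<zero>" using d(2,4) by auto
   thus ?case using insert by (simp add: integral_iff)
  qed simp
  thus ?thesis unfolding c_def using Y(1) by blast
 qed
 moreover have "c \<otimes> x \<in> integral_part"
  unfolding integral_part_def
 proof (intro CollectI conjI ballI)
  show "c \<otimes> x \<in> L" using subringE(6)[OF L_props(2)] cK(1) L_props(4) x by blast
  fix \<tau> assume t: "\<tau> \<in> auts K"
  hence y: "\<tau> x \<in> Y" unfolding Y_def by blast
  have yc: "\<tau> x \<in> C" using y Y(2) by blast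
  define v where "v = finprod R d (Y - {\<tau> x})"
  have v: "v \<in> A" "v \<in> C" using split(2)[OF y] valring_carrier[OF VA] by (auto simp: v_def base_ring_def)
  have cv: "c = d (\<tau> x) \<otimes> v" using split(1)[OF y] by (simp add: v_def)
  have "\<tau> (c \<otimes> x) = c \<otimes> \<tau> x" using auts_binary(2)[OF t cK(2) xc] auts_fix[OF t cK(1)] by simp
  also have "\<dots> = v \<otimes> (d (\<tau> x) \<otimes> \<tau> x)" unfolding cv using d(4)[OF y] v(2) yc by (simp add: m_ac)
  finally show "\<tau> (c \<otimes> x) \<in> A" using valring_closed(5)[OF VA v(1) d(3)[OF y]] by simp
 qed
 ultimately show ?thesis using cK(1) by blast
qed

lemma integral_independent_exists:
 assumes I: "finite I" and span: "integral_part = lspan base_ring I u" and u: "\<And>i. i \<in> I \<Longrightarrow> u i \<in> integral_part"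
 shows "\<exists>J\<subseteq>I. integral_independent J u \<and> n \<le> card J"
proof -
 note VA = valring_A
 define P where "P J \<longleftrightarrow> J \<subseteq> I \<and> lspan base_ring J u = integral_part" for J
 have "finite {J. P J}" using I by (auto simp: P_def intro: finite_subset[of _ "Pow I"])
 moreover have "I \<in> {J. P J}" using span by (simp add: P_def)
 ultimately obtain J where "J \<in> {J. P J}" "\<forall>J'\<in>{J. P J}. J' \<subseteq> J \<longrightarrow> J = J'"
  using finite_has_minimal[of "{J. P J}"] by auto
 hence J: "P J" and Jmin: "\<And>J'. P J' \<Longrightarrow> J' \<subseteq> J \<Longrightarrow> J' = J" by auto
 have JI: "J \<subseteq> I" "finite J" "lspan base_ring J u = integral_part" using J I finite_subset by (auto simp: P_def)
 have uJ: "u j \<in> integral_part" "u j \<in> C" if "j \<in> J" for j using u integral_partD(2) JI(1) that by auto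
 have uP: "u \<in> J \<rightarrow> C" using uJ(2) by auto
 have "integral_independent J u"
  unfolding integral_independent_def
 proof (intro conjI allI impI ballI, rule uJ(1))
  fix c j0 assume c: "\<forall>j\<in>J. c j \<in> base_ring" and j0: "j0 \<in> J"
   and ex: "\<exists>d\<in>base_ideal. \<forall>\<tau>\<in>auts K. vle A d (\<tau> (\<Oplus>j\<in>J. c j \<otimes> u j))"
  show "c j0 \<in> base_ideal"
  proof (rule ccontr)
   assume nI: "c j0 \<notin> base_ideal"
   obtain d where d: "d \<in> base_ideal" "\<And>\<tau>. \<tau> \<in> auts K \<Longrightarrow> vle A d (\<tau> (\<Oplus>j\<in>J. c j \<otimes> u j))" using ex by blast
   have dc: "d \<in> C" "d \<in> K" "d \<in> base_ring" using d(1) base_props(2,9) by (auto simp: base_ideal_def)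
   define W where "W = (\<Oplus>j\<in>J. c j \<otimes> u j)"
   have cc: "c j \<in> C" if "j \<in> J" for j using c that base_props(8) by blast
   have WL: "W \<in> integral_part"
    unfolding W_def JI(3)[symmetric] by (rule lspanI) (use c in blast)
   note WD = integral_partD[OF WL]
   \<comment> \<open>Divisibility of every conjugate by \<open>d\<close> is divisibility within the
     integral elements; \<open>d = \<zero>\<close> has no inverse and is treated apart.\<close>
   have "\<exists>w\<in>integral_part. W = d \<otimes> w"
   proof (cases "d = \<zero>")
    case True
    hence "W = \<zero>" using d(2)[OF auts_id] zero_vle_iff[OF VA WD(2)] by (simp add: W_def)
    thus ?thesis using True subringE(2)[OF integral_part_closed(1)] by (intro bexI[of _ \<zero>]) auto
   next
    case False
    have iK: "inv d \<in> K" using subfield_inv_closed[OF K_props(1) dc(2) False] .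
    have "inv d \<otimes> W \<in> integral_part"
     unfolding integral_part_def
    proof (intro CollectI conjI ballI)
     show "inv d \<otimes> W \<in> L" using subringE(6)[OF L_props(2)] iK L_props(4) WD(1) by blast
     fix \<tau> assume t: "\<tau> \<in> auts K"
     have "\<tau> (inv d \<otimes> W) = inv d \<otimes> \<tau> W"
      using auts_binary(2)[OF t _ WD(2), of "inv d"] auts_fix[OF t iK] dc(1) False by simp
     thus "\<tau> (inv d \<otimes> W) \<in> A"
      using vle_iff_div[OF VA dc(1) auts_closed[OF t WD(2)] False] d(2)[OF t] by (simp add: W_def)
    qed
    moreover have "W = d \<otimes> (inv d \<otimes> W)" using dc(1) False WD(2) by simp
    ultimately show ?thesis by blast
   qed
   then obtain w where w: "w \<in> integral_part" "W = d \<otimes> w" by blast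
   obtain b where b: "\<And>j. j \<in> J \<Longrightarrow> b j \<in> base_ring" "w = (\<Oplus>j\<in>J. b j \<otimes> u j)"
    using w(1) unfolding JI(3)[symmetric] by (rule lspan_obtain) blast
   have bc: "b j \<in> C" if "j \<in> J" for j using b(1)[OF that] base_props(8) by blast
   \<comment> \<open>Subtracting the representation of \<open>d \<otimes> w\<close> makes the sum
     zero and changes the coefficients only modulo the ideal, so the one at \<open>j0\<close>
     remains a unit.\<close>
   define e where "e j = c j \<oplus> (\<ominus> d) \<otimes> b j" for j
   have eB: "e j \<in> base_ring" if "j \<in> J" for j
    unfolding e_def using c b(1) that dc(3) subringE(5,6,7)[OF base_props(1)] by blast
   have ec: "e j \<in> C" if "j \<in> J" for j using eB[OF that] base_props(8) by blast
   have mdI: "(\<ominus> d) \<otimes> b j \<in> base_ideal" if j: "j \<in> J" for j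
   proof -
    have "(\<ominus> b j) \<otimes> d \<in> base_ideal"
     using base_props(6) b(1)[OF j] d(1) subringE(5)[OF base_props(1)] by blast
    moreover have "(\<ominus> b j) \<otimes> d = (\<ominus> d) \<otimes> b j" using bc[OF j] dc(1) by algebra
    ultimately show ?thesis by simp
   qed
   have eI: "e j0 \<notin> base_ideal"
   proof
    assume "e j0 \<in> base_ideal"
    moreover have "(\<ominus> \<one>) \<otimes> ((\<ominus> d) \<otimes> b j0) \<in> base_ideal"
     using base_props(6) mdI[OF j0] subringE(3,5)[OF base_props(1)] by blast
    ultimately have "e j0 \<oplus> (\<ominus> \<one>) \<otimes> ((\<ominus> d) \<otimes> b j0) \<in> base_ideal" using base_props(5) by blast
    moreover have "e j0 \<oplus> (\<ominus> \<one>) \<otimes> ((\<ominus> d) \<otimes> b j0) = c j0"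
     unfolding e_def using cc[OF j0] bc[OF j0] dc(1) by algebra
    ultimately show False using nI by simp
   qed
   have ie: "inv (e j0) \<in> base_ring" "e j0 \<noteq> \<zero>" using base_props(7)[OF eB[OF j0] eI] eI base_props(3) by auto
   have sum0: "(\<Oplus>j\<in>J. e j \<otimes> u j) = \<zero>"
   proof -
    have "(\<Oplus>j\<in>J. e j \<otimes> u j) = (\<Oplus>j\<in>J. c j \<otimes> u j \<oplus> (\<ominus> d) \<otimes> (b j \<otimes> u j))"
     by (rule finsum_cong') (use cc bc dc(1) uJ(2) in \<open>auto simp: e_def l_distr m_assoc\<close>)
    also have "\<dots> = W \<oplus> (\<Oplus>j\<in>J. (\<ominus> d) \<otimes> (b j \<otimes> u j))"
     unfolding W_def by (rule finsum_addf) (use cc bc dc(1) uJ(2) in auto)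
    also have "(\<Oplus>j\<in>J. (\<ominus> d) \<otimes> (b j \<otimes> u j)) = (\<ominus> d) \<otimes> w"
     unfolding b(2) by (rule finsum_rdistr[symmetric, OF JI(2)]) (use bc dc(1) uJ(2) in auto)
    also have "W \<oplus> (\<ominus> d) \<otimes> w = \<zero>"
     unfolding w(2) using dc(1) integral_partD(2)[OF w(1)] by (simp add: l_minus r_neg)
    finally show ?thesis .
   qed
   define J' where "J' = J - {j0}"
   have J': "finite J'" "j0 \<notin> J'" "J = insert j0 J'" "u \<in> J' \<rightarrow> C"
    using JI(2) j0 uP by (auto simp: J'_def)
   note W' = lspan_closed[OF base_props(1) J'(1,4)]
   define r where "r = (\<Oplus>j\<in>J'. e j \<otimes> u j)"
   have rc: "r \<in> C" "r \<in> lspan base_ring J' u"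
    unfolding r_def using ec uJ(2) eB by (auto simp: J'_def intro!: finsum_closed lspanI)
   have "(\<Oplus>j\<in>J. e j \<otimes> u j) = e j0 \<otimes> u j0 \<oplus> r"
    unfolding J'(3) r_def by (rule finsum_insert[OF J'(1,2)]) (use ec uJ(2) j0 in \<open>auto simp: J'_def\<close>)
   hence eq: "e j0 \<otimes> u j0 \<oplus> r = \<zero>" using sum0 by simp
   have "u j0 = (\<ominus> (inv (e j0))) \<otimes> r"
   proof -
    have "e j0 \<otimes> u j0 = \<ominus> r" using eq ec[OF j0] uJ(2)[OF j0] rc(1) by (metis m_closed minus_equality)
    hence "inv (e j0) \<otimes> (e j0 \<otimes> u j0) = inv (e j0) \<otimes> (\<ominus> r)" by simp
    thus ?thesis using mult_inv_cancel(2)[OF ec[OF j0] ie(2) uJ(2)[OF j0]] rc(1) ec[OF j0] ie(2)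
     by (simp add: l_minus r_minus)
   qed
   moreover have "\<ominus> (inv (e j0)) \<in> base_ring" using subringE(5)[OF base_props(1) ie(1)] .
   ultimately have u0: "u j0 \<in> lspan base_ring J' u" using W'(4) rc(2) by metis
   have "u j \<in> lspan base_ring J' u" if "j \<in> J" for j
    using u0 W'(5)[of j] that J'(3) by blast
   hence "lspan base_ring J u \<subseteq> lspan base_ring J' u"
    by (intro lspan_minimal[OF JI(2)]) (use W' in blast)+
   moreover have "lspan base_ring J' u \<subseteq> lspan base_ring J u"
   proof (rule lspan_minimal[OF J'(1)])
    note W1 = lspan_closed[OF base_props(1) JI(2) uP]
    show "a \<otimes> u j \<in> lspan base_ring J u" if "a \<in> base_ring" "j \<in> J'" for a j
     using W1(4,5) that J'(3) by blast
   qed (use lspan_closed[OF base_props(1) JI(2) uP] in blast)+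
   ultimately have "P J'" using JI by (auto simp: P_def J'_def)
   hence "J' = J" using Jmin by (auto simp: J'_def)
   thus False using j0 by (auto simp: J'_def)
  qed
 qed
 moreover have "n \<le> card J"
 proof -
  obtain b where b: "b \<in> {..<n} \<rightarrow> C" "lin_indep K {..<n} b" "lspan K {..<n} b = L"
   using basis_exists by blast
  note WK = lspan_closed[OF K_props(2) JI(2) uP]
  have "b j \<in> lspan K J u" if j: "j \<in> {..<n}" for j
  proof -
   have bj: "b j \<in> L" "b j \<in> C"
    using lspan_closed(5)[OF K_props(2) finite_lessThan b(1) j] b(3) L_props(3) by auto
   obtain c where c: "c \<in> K" "c \<noteq> \<zero>" "c \<otimes> b j \<in> integral_part" using denominator_exists[OF bj(1)] by blast
   have cc: "c \<in> C" using c(1) K_props(3) by blast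
   have "lspan base_ring J u \<subseteq> lspan K J u"
   proof (rule lspan_minimal[OF JI(2)])
    show "a \<otimes> u j \<in> lspan K J u" if "a \<in> base_ring" "j \<in> J" for a j
     using WK(4,5) that by (auto simp: base_ring_def)
   qed (use WK in blast)+
   hence "c \<otimes> b j \<in> lspan K J u" using c(3) JI(3) by blast
   hence "inv c \<otimes> (c \<otimes> b j) \<in> lspan K J u"
    using WK(4) subfield_inv_closed[OF K_props(1) c(1,2)] by blast
   thus ?thesis using cc c(2) bj(2) by simp
  qed
  hence "card {..<n} \<le> card J"
   by (intro card_le_of_lspan[OF K_props(1) JI(2) uP finite_lessThan b(2)])
  thus ?thesis by simp
 qed
 ultimately show ?thesis using JI(1) by blast
qed

text \<open>For integral \<open>v\<close> the value is one of those counted by the initial index. As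
  zero lies in \<open>base_ideal\<close>, a small element is nonzero.\<close>

definition small :: "'a \<Rightarrow> bool"
 where "small v \<longleftrightarrow> (\<forall>d\<in>base_ideal. vlt A v d)"

text \<open>The ideal of \<open>A\<close> generated by \<open>base_ideal\<close>; divisibility in a
  valuation ring is total, so multiples of single elements suffice.\<close>

definition extended_ideal :: "'a set"
 where "extended_ideal = {v \<in> C. \<exists>d\<in>base_ideal. vle A d v}"

lemma extended_ideal_closed:
 "\<zero> \<in> extended_ideal" "v \<in> extended_ideal \<Longrightarrow> w \<in> extended_ideal \<Longrightarrow> v \<oplus> w \<in> extended_ideal"
 "v \<in> extended_ideal \<Longrightarrow> a \<in> A \<Longrightarrow> v \<otimes> a \<in> extended_ideal"
 "c \<in> base_ideal \<Longrightarrow> c \<in> extended_ideal"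
proof -
 note VA = valring_A
 have Ic: "d \<in> C" if "d \<in> base_ideal" for d using that base_props(9) by blast
 show "\<zero> \<in> extended_ideal" using base_props(3) vle_refl[OF VA zero_closed] by (auto simp: extended_ideal_def)
 show "c \<in> extended_ideal" if "c \<in> base_ideal" using that Ic vle_refl[OF VA] by (auto simp: extended_ideal_def)
 show "v \<otimes> a \<in> extended_ideal" if v: "v \<in> extended_ideal" and a: "a \<in> A"
 proof -
  obtain d where d: "d \<in> base_ideal" "vle A d v" and vc: "v \<in> C" using v by (auto simp: extended_ideal_def)
  have "vle A v (v \<otimes> a)" using a by (auto simp: vle_def)
  hence "vle A d (v \<otimes> a)" using vle_trans[OF VA d(2) _ Ic[OF d(1)]] by blast
  thus ?thesis using d(1) vc valring_carrier[OF VA a] by (auto simp: extended_ideal_def)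
 qed
 show "v \<oplus> w \<in> extended_ideal" if v: "v \<in> extended_ideal" and w: "w \<in> extended_ideal"
 proof -
  obtain d where d: "d \<in> base_ideal" "vle A d v" and vc: "v \<in> C" using v by (auto simp: extended_ideal_def)
  obtain e where e: "e \<in> base_ideal" "vle A e w" and wc: "w \<in> C" using w by (auto simp: extended_ideal_def)
  have "\<exists>f\<in>base_ideal. vle A f v \<and> vle A f w"
  proof (cases "vle A d e")
   case True
   thus ?thesis using d vle_trans[OF VA True e(2) Ic[OF d(1)]] by blast
  next
   case False
   hence "vle A e d" using vle_total[OF VA] Ic d(1) e(1) by blast
   thus ?thesis using e vle_trans[OF VA _ d(2) Ic[OF e(1)]] by blast
  qed
  then obtain f where f: "f \<in> base_ideal" "vle A f v" "vle A f w" by blast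
  have "vle A f (v \<oplus> w)" by (rule vle_add[OF VA f(2,3)]) (use Ic[OF f(1)] vc wc in simp_all)
  thus ?thesis using f(1) vc wc by (auto simp: extended_ideal_def)
 qed
qed

text \<open>Successive approximation. An element that is not small already lies in the ideal. A
  small one has the value of some \<open>x i\<close>, and subtracting \<open>x i\<close> times a
  lift of the residue of the quotient raises the value strictly. The induction counts the
  \<open>x i\<close> whose value is at least that of the remaining element.\<close>

lemma generators_mod_extended_ideal:
 assumes fin: "finite I" "finite F"
  and x: "\<And>i. i \<in> I \<Longrightarrow> x i \<in> L \<inter> A"
  and cover: "\<And>v. v \<in> L \<Longrightarrow> v \<in> A \<Longrightarrow> small v \<Longrightarrow> \<exists>i\<in>I. veq A (x i) v"
  and y: "\<And>j. j \<in> F \<Longrightarrow> y j \<in> L \<inter> A"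
  and res: "\<And>v. v \<in> L \<Longrightarrow> v \<in> A \<Longrightarrow> \<exists>r\<in>lspan base_ring F y. vlt A \<one> (v \<ominus> r)"
  and v: "v \<in> L" "v \<in> A"
 shows "\<exists>s\<in>lspan base_ring (I \<times> F) (\<lambda>p. x (fst p) \<otimes> y (snd p)). v \<ominus> s \<in> extended_ideal"
 using v
proof (induction "card {i \<in> I. vle A v (x i)}" arbitrary: v rule: less_induct)
 case less
 note VA = valring_A
 let ?e = "\<lambda>p. x (fst p) \<otimes> y (snd p)"
 let ?W = "lspan base_ring (I \<times> F) ?e"
 have xc: "x i \<in> C" if "i \<in> I" for i using x[OF that] L_props(3) by blast
 have yc: "y j \<in> C" if "j \<in> F" for j using y[OF that] L_props(3) by blast
 have ec: "?e \<in> I \<times> F \<rightarrow> C" using xc yc by auto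
 have yP: "y \<in> F \<rightarrow> C" using yc by auto
 have finW: "finite (I \<times> F)" using fin by simp
 note W = lspan_closed[OF base_props(1) finW ec]
 have vc: "v \<in> C" using less.prems L_props(3) by blast
 show ?case
 proof (cases "small v")
  case False
  then obtain d where d: "d \<in> base_ideal" "\<not> vlt A v d" by (auto simp: small_def)
  hence "v \<in> extended_ideal" using vc by (auto simp: vlt_def extended_ideal_def)
  thus ?thesis using W(2) vc by (intro bexI[of _ \<zero>]) (auto simp: minus_eq)
 next
  case True
  then obtain i where i: "i \<in> I" "veq A (x i) v" using cover less.prems by blast
  have v0: "v \<noteq> \<zero>"
  proof
   assume "v = \<zero>"
   hence "vlt A \<zero> \<zero>" using True base_props(3) by (auto simp: small_def)
   thus False using vlt_irrefl[OF VA zero_closed] by simp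
  qed
  have x0: "x i \<noteq> \<zero>" using veq_nonzero[OF VA i(2) xc[OF i(1)] vc] v0 by simp
  define v' where "v' = inv (x i) \<otimes> v"
  have v'A: "v' \<in> A" using vle_iff_div[OF VA xc[OF i(1)] vc x0] i(2) by (simp add: v'_def veq_def)
  have v'L: "v' \<in> L" unfolding v'_def
   using subringE(6)[OF L_props(2) subfield_inv_closed[OF L_props(1) _ x0] less.prems(1)] x[OF i(1)] by blast
  have v'c: "v' \<in> C" using v'L L_props(3) by blast
  obtain r where r: "r \<in> lspan base_ring F y" "vlt A \<one> (v' \<ominus> r)" using res[OF v'L v'A] by blast
  have rc: "r \<in> C" using r(1) lspan_closed(1)[OF base_props(1) fin(2) yP] by blast
  have rLA: "r \<in> L \<inter> A"
  proof -
   have "lspan base_ring F y \<subseteq> L \<inter> A"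
   proof (rule lspan_minimal[OF fin(2)])
    show "u \<oplus> w \<in> L \<inter> A" if "u \<in> L \<inter> A" "w \<in> L \<inter> A" for u w
     using that subringE(7)[OF L_props(2)] valring_closed(4)[OF VA] by blast
    show "\<zero> \<in> L \<inter> A" using subringE(2)[OF L_props(2)] valring_closed(1)[OF VA] by blast
    show "L \<inter> A \<subseteq> C" using L_props(3) by blast
    show "a \<otimes> y j \<in> L \<inter> A" if "a \<in> base_ring" "j \<in> F" for a j
     using that y[OF that(2)] L_props(4) subringE(6)[OF L_props(2)] valring_closed(5)[OF VA] by (auto simp: base_ring_def)
   qed
   thus ?thesis using r(1) by blast
  qed
  have xrW: "x i \<otimes> r \<in> ?W"
  proof -
   define U where "U = {r \<in> C. x i \<otimes> r \<in> ?W}"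
   have "lspan base_ring F y \<subseteq> U"
   proof (rule lspan_minimal[OF fin(2)])
    show "\<zero> \<in> U" using W(2) xc[OF i(1)] by (simp add: U_def)
    show "U \<subseteq> C" by (auto simp: U_def)
    show "u \<oplus> w \<in> U" if "u \<in> U" "w \<in> U" for u w using that W(3) xc[OF i(1)] by (simp add: U_def r_distr)
    fix j a assume aj: "a \<in> base_ring" "j \<in> F"
    have ac: "a \<in> C" using aj(1) base_props(8) by blast
    have "x i \<otimes> y j \<in> ?W" using W(5)[of "(i, j)"] i(1) aj(2) by simp
    hence "a \<otimes> (x i \<otimes> y j) \<in> ?W" using W(4)[OF aj(1)] by blast
    moreover have "a \<otimes> (x i \<otimes> y j) = x i \<otimes> (a \<otimes> y j)" using ac xc[OF i(1)] yc[OF aj(2)] by (simp add: m_lcomm)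
    ultimately show "a \<otimes> y j \<in> U" using ac yc[OF aj(2)] by (simp add: U_def)
   qed
   thus ?thesis using r(1) by (auto simp: U_def)
  qed
  define v1 where "v1 = x i \<otimes> (v' \<ominus> r)"
  have dc: "v' \<ominus> r \<in> C" using v'c rc by simp
  have v1c: "v1 \<in> C" unfolding v1_def using xc[OF i(1)] dc by simp
  have v1A: "v1 \<in> A" unfolding v1_def using valring_closed(5)[OF VA] x[OF i(1)] vlt_one_in[OF VA r(2) dc] by blast
  have v1L: "v1 \<in> L" unfolding v1_def
   using subringE(5,6,7)[OF L_props(2)] x[OF i(1)] v'L rLA by (simp add: minus_eq)
  have v1e: "v1 = v \<ominus> x i \<otimes> r"
  proof -
   have "x i \<otimes> v' = v" unfolding v'_def using xc[OF i(1)] x0 vc by simp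
   thus ?thesis unfolding v1_def using xc[OF i(1)] v'c rc by (simp add: minus_eq r_distr r_minus)
  qed
  have "vlt A (x i \<otimes> \<one>) (x i \<otimes> (v' \<ominus> r))"
   using vlt_mult_iff[OF VA one_closed dc xc[OF i(1)] x0] r(2) by simp
  hence lt: "vlt A (x i) v1" unfolding v1_def using xc[OF i(1)] by simp
  have vlt': "vlt A v v1" using vle_vlt_trans[OF VA _ lt v1c] i(2) by (auto simp: veq_def)
  have "{i \<in> I. vle A v1 (x i)} \<subset> {i \<in> I. vle A v (x i)}"
  proof
   show "{i \<in> I. vle A v1 (x i)} \<subseteq> {i \<in> I. vle A v (x i)}"
    using vle_trans[OF VA vlt_imp_vle[OF VA vlt' vc v1c] _ vc] by blast
   have "i \<in> {i \<in> I. vle A v (x i)}" using i by (simp add: veq_def)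
   moreover have "i \<notin> {i \<in> I. vle A v1 (x i)}" using lt by (simp add: vlt_def)
   ultimately show "{i \<in> I. vle A v1 (x i)} \<noteq> {i \<in> I. vle A v (x i)}" by blast
  qed
  hence "card {i \<in> I. vle A v1 (x i)} < card {i \<in> I. vle A v (x i)}"
   using fin(1) by (intro psubset_card_mono) auto
  then obtain s1 where s1: "s1 \<in> ?W" "v1 \<ominus> s1 \<in> extended_ideal" using less.hyps v1L v1A by blast
  have s1c: "s1 \<in> C" using s1(1) W(1) by blast
  have "v \<ominus> (x i \<otimes> r \<oplus> s1) = v1 \<ominus> s1"
   unfolding v1e using vc xc[OF i(1)] rc s1c by (simp add: minus_eq minus_add a_ac)
  thus ?thesis using s1 W(3)[OF xrW s1(1)] by (intro bexI[of _ "x i \<otimes> r \<oplus> s1"]) auto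
 qed
qed

end

section \<open>Cardinality bounds from the transversal\<close>

context trace_transversal
begin

text \<open>The fundamental inequality: some conjugate of a nontrivial combination of the dominating
  family has the value of a nonzero element, so the combination does not vanish.\<close>

lemma value_residue_card_le:
 assumes x: "value_independent I x" and y: "residue_independent J y" and fin: "finite I" "finite J"
 shows "card T * card I * card J \<le> n"
proof -
 let ?P = "T \<times> I \<times> J"
 obtain u where u: "\<forall>p\<in>?P. u p \<in> L"
  and "\<forall>p\<in>?P. x (fst (snd p)) \<in> A \<longrightarrow> (\<forall>\<rho>\<in>auts K. \<rho> (u p) \<in> A)"
  and dom: "\<forall>a. (\<forall>p\<in>?P. a p \<in> K) \<longrightarrow> (\<exists>p\<in>?P. a p \<noteq> \<zero>) \<longrightarrow>
   (\<exists>\<tau>\<in>T. \<exists>p0\<in>?P. a p0 \<noteq> \<zero> \<and>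
    (\<forall>p\<in>?P. vle A (a p0 \<otimes> x (fst (snd p0))) (a p \<otimes> x (fst (snd p)))) \<and>
    veq A (\<tau> (\<Oplus>p\<in>?P. a p \<otimes> u p)) (a p0 \<otimes> x (fst (snd p0))))"
  using dominating_family[OF x y fin] by (elim exE conjE)
 have "lin_indep K ?P u"
  unfolding lin_indep_def
 proof (intro allI impI, rule ccontr)
  fix a assume a: "\<forall>p\<in>?P. a p \<in> K" and z: "(\<Oplus>p\<in>?P. a p \<otimes> u p) = \<zero>" and "\<not> (\<forall>p\<in>?P. a p = \<zero>)"
  then obtain \<tau> p0 where t: "\<tau> \<in> T" "p0 \<in> ?P" "a p0 \<noteq> \<zero>"
   "veq A (\<tau> (\<Oplus>p\<in>?P. a p \<otimes> u p)) (a p0 \<otimes> x (fst (snd p0)))"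
   using dom[rule_format, of a] a by blast
  have c: "a p0 \<in> C" "x (fst (snd p0)) \<in> C" "x (fst (snd p0)) \<noteq> \<zero>"
   using t(2) a K_props(3) value_independentD(2,3)[OF x] by auto
  have "\<tau> \<in> auts K" using t(1) T_auts by blast
  hence "\<tau> \<zero> = \<zero>" by (rule auts_const(1))
  hence "veq A \<zero> (a p0 \<otimes> x (fst (snd p0)))" using t(4) z by simp
  hence "a p0 \<otimes> x (fst (snd p0)) = \<zero>" using veq_nonzero[OF valring_A] c by blast
  thus False using c t(3) by (simp add: integral_iff)
 qed
 moreover obtain b where b: "b \<in> {..<n} \<rightarrow> C" "lin_indep K {..<n} b" "lspan K {..<n} b = L"
  using basis_exists by blast
 moreover have "finite ?P" using finite_T fin by simp
 ultimately have "card ?P \<le> card {..<n}"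
  using card_le_of_lspan[OF K_props(1) finite_lessThan b(1), of ?P u] u b(3) by simp
 thus ?thesis by (simp add: card_cartesian_product mult.assoc)
qed

text \<open>A unit coefficient contributes a term of small value, and the dominating term has at
  most this value. Hence at the dominating place the sum is not divisible by an element of the
  ideal.\<close>

lemma integral_independent_family:
 assumes x: "value_independent I x" and y: "residue_independent J y" and fin: "finite I" "finite J"
  and sm: "\<And>i. i \<in> I \<Longrightarrow> x i \<in> A \<and> small (x i)"
 shows "\<exists>u. integral_independent (T \<times> I \<times> J) u"
proof -
 note VA = valring_A
 let ?P = "T \<times> I \<times> J"
 obtain u where u: "\<forall>p\<in>?P. u p \<in> L"
  and uA: "\<forall>p\<in>?P. x (fst (snd p)) \<in> A \<longrightarrow> (\<forall>\<rho>\<in>auts K. \<rho> (u p) \<in> A)"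
  and dom: "\<forall>a. (\<forall>p\<in>?P. a p \<in> K) \<longrightarrow> (\<exists>p\<in>?P. a p \<noteq> \<zero>) \<longrightarrow>
   (\<exists>\<tau>\<in>T. \<exists>p0\<in>?P. a p0 \<noteq> \<zero> \<and>
    (\<forall>p\<in>?P. vle A (a p0 \<otimes> x (fst (snd p0))) (a p \<otimes> x (fst (snd p)))) \<and>
    veq A (\<tau> (\<Oplus>p\<in>?P. a p \<otimes> u p)) (a p0 \<otimes> x (fst (snd p0))))"
  using dominating_family[OF x y fin] by (elim exE conjE)
 have "integral_independent ?P u"
  unfolding integral_independent_def
 proof (intro conjI ballI allI impI)
  fix p assume p: "p \<in> ?P"
  hence "x (fst (snd p)) \<in> A" using sm by auto
  thus "u p \<in> integral_part" using p u uA by (auto simp: integral_part_def)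
 next
  fix a p1 assume a: "\<forall>p\<in>?P. a p \<in> base_ring" and p1: "p1 \<in> ?P"
   and "\<exists>d\<in>base_ideal. \<forall>\<tau>\<in>auts K. vle A d (\<tau> (\<Oplus>p\<in>?P. a p \<otimes> u p))"
  then obtain d where d: "d \<in> base_ideal" "\<And>\<tau>. \<tau> \<in> auts K \<Longrightarrow> vle A d (\<tau> (\<Oplus>p\<in>?P. a p \<otimes> u p))" by blast
  show "a p1 \<in> base_ideal"
  proof (rule ccontr)
   assume nI: "a p1 \<notin> base_ideal"
   have aK: "\<forall>p\<in>?P. a p \<in> K" using a by (auto simp: base_ring_def)
   have nz: "\<exists>p\<in>?P. a p \<noteq> \<zero>" using p1 nI base_props(3) by metis
   obtain \<tau> p0 where t: "\<tau> \<in> T" "p0 \<in> ?P" "vle A (a p0 \<otimes> x (fst (snd p0))) (a p1 \<otimes> x (fst (snd p1)))"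
    "veq A (\<tau> (\<Oplus>p\<in>?P. a p \<otimes> u p)) (a p0 \<otimes> x (fst (snd p0)))"
    using dom[rule_format, OF aK[rule_format] nz] p1 by blast
   have ac: "a p \<in> C" "x (fst (snd p)) \<in> C" if "p \<in> ?P" for p
    using that aK K_props(3) value_independentD(3)[OF x] by auto
   have dc: "d \<in> C" using d(1) base_props(9) by blast
   have unit: "veq A \<one> (a p1)" using not_base_ideal[OF _ nI] a p1 by blast
   define xp where "xp = x (fst (snd p1))"
   have xpc: "xp \<in> C" using ac(2)[OF p1] by (simp add: xp_def)
   have "veq A (xp \<otimes> \<one>) (xp \<otimes> a p1)" by (rule veq_mult[OF VA unit one_closed ac(1)[OF p1] xpc])
   hence "vle A (a p1 \<otimes> xp) xp" using xpc ac(1)[OF p1] by (simp add: veq_def m_comm)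
   hence 1: "vle A (a p0 \<otimes> x (fst (snd p0))) xp"
    using vle_trans[OF VA t(3)] ac t(2) by (simp add: xp_def)
   have tK: "\<tau> \<in> auts K" using t(1) T_auts by blast
   have "vle A d (a p0 \<otimes> x (fst (snd p0)))" using vle_trans[OF VA d(2)[OF tK] _ dc] t(4) by (auto simp: veq_def)
   hence "vle A d xp" using vle_trans[OF VA _ 1 dc] by blast
   moreover have "vlt A xp d" using sm p1 d(1) by (auto simp: small_def xp_def)
   ultimately show False by (simp add: vlt_def)
  qed
 qed
 thus ?thesis by blast
qed

text \<open>Modulo the extended ideal, each of the \<open>card T\<close> conjugates of
  \<open>u j\<close> is a combination of \<open>card I * card F\<close> generators. With more
  members \<open>u j\<close> than this, elimination over the local ring yields a combination with a
  coefficient outside the ideal, all of whose conjugates under \<open>T\<close> lie in the extended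
  ideal.\<close>

lemma integral_independent_card_le:
 assumes u: "integral_independent J u" and J: "finite J"
  and fin: "finite I" "finite F"
  and x: "\<And>i. i \<in> I \<Longrightarrow> x i \<in> L \<inter> A"
  and cover: "\<And>v. v \<in> L \<Longrightarrow> v \<in> A \<Longrightarrow> small v \<Longrightarrow> \<exists>i\<in>I. veq A (x i) v"
  and y: "\<And>j. j \<in> F \<Longrightarrow> y j \<in> L \<inter> A"
  and res: "\<And>v. v \<in> L \<Longrightarrow> v \<in> A \<Longrightarrow> \<exists>r\<in>lspan base_ring F y. vlt A \<one> (v \<ominus> r)"
 shows "card J \<le> card T * card I * card F"
proof (rule ccontr)
 assume "\<not> card J \<le> card T * card I * card F"
 hence lt: "card (T \<times> I \<times> F) < card J" by (simp add: card_cartesian_product mult.assoc)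
 note VA = valring_A and U = integral_independentD[OF u]
 let ?e = "\<lambda>p. x (fst p) \<otimes> y (snd p)"
 have finW: "finite (I \<times> F)" "finite (T \<times> I \<times> F)" using fin finite_T by auto
 have eA: "?e p \<in> A" if "p \<in> I \<times> F" for p using that x y valring_closed(5)[OF VA] by auto
 have ec: "?e p \<in> C" if "p \<in> I \<times> F" for p using eA[OF that] valring_carrier[OF VA] by blast
 have uc: "u j \<in> C" if "j \<in> J" for j using integral_partD(2)[OF U(1)[OF that]] .
 have tu: "\<tau> (u j) \<in> L" "\<tau> (u j) \<in> A" "\<tau> (u j) \<in> C" if "\<tau> \<in> T" "j \<in> J" for \<tau> j
 proof -
  have "\<tau> \<in> auts K" using that T_auts by blast
  thus "\<tau> (u j) \<in> A" using integral_partD(3)[OF U(1)[OF that(2)]] by blast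
  show "\<tau> (u j) \<in> L" using T_stable[OF that(1)] integral_partD(1)[OF U(1)[OF that(2)]] by blast
  thus "\<tau> (u j) \<in> C" using L_props(3) by blast
 qed
 define Q where "Q \<tau> j c \<longleftrightarrow> (\<forall>p\<in>I \<times> F. c p \<in> base_ring) \<and>
   \<tau> (u j) \<ominus> (\<Oplus>p\<in>I \<times> F. c p \<otimes> ?e p) \<in> extended_ideal" for \<tau> j c
 define c where "c j q = (SOME c. Q (fst q) j c) (snd q)" for j q
 have c: "(\<forall>p\<in>I \<times> F. c j (\<tau>, p) \<in> base_ring) \<and> \<tau> (u j) \<ominus> (\<Oplus>p\<in>I \<times> F. c j (\<tau>, p) \<otimes> ?e p) \<in> extended_ideal"
  if t: "\<tau> \<in> T" and j: "j \<in> J" for \<tau> j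
 proof -
  obtain s where s: "s \<in> lspan base_ring (I \<times> F) ?e" "\<tau> (u j) \<ominus> s \<in> extended_ideal"
   using generators_mod_extended_ideal[OF fin x cover y res tu(1,2)[OF t j]] by blast
  obtain d where "\<And>p. p \<in> I \<times> F \<Longrightarrow> d p \<in> base_ring" "s = (\<Oplus>p\<in>I \<times> F. d p \<otimes> ?e p)"
   using s(1) by (rule lspan_obtain) blast
  hence "Q \<tau> j d" using s(2) by (simp add: Q_def)
  hence "Q \<tau> j (SOME c. Q \<tau> j c)" by (rule someI[of "Q \<tau> j"])
  thus ?thesis by (simp add: Q_def c_def)
 qed
 have cB: "c j q \<in> base_ring" if "q \<in> T \<times> I \<times> F" "j \<in> J" for q j
  using c[of "fst q" j] that by auto
 have "\<exists>k. (\<forall>j\<in>J. k j \<in> base_ring) \<and> (\<exists>j\<in>J. k j \<notin> base_ideal) \<and>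
  (\<forall>q\<in>T \<times> I \<times> F. (\<Oplus>j\<in>J. k j \<otimes> c j q) \<in> base_ideal)"
  by (rule linear_system[OF base_local_pair finW(2) J lt cB])
 then obtain k where k: "\<And>j. j \<in> J \<Longrightarrow> k j \<in> base_ring" "\<exists>j\<in>J. k j \<notin> base_ideal"
  "\<And>q. q \<in> T \<times> I \<times> F \<Longrightarrow> (\<Oplus>j\<in>J. k j \<otimes> c j q) \<in> base_ideal" by blast
 have kc: "k j \<in> C" "k j \<in> A" "k j \<in> K" if "j \<in> J" for j
  using k(1)[OF that] base_props(8) by (auto simp: base_ring_def)
 define W where "W = (\<Oplus>j\<in>J. k j \<otimes> u j)"
 have Wc: "W \<in> C" unfolding W_def using kc uc by (auto intro!: finsum_closed)
 have WL: "W \<in> L" unfolding W_def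
 proof (rule finsum_in_subset[OF J])
  show "k j \<otimes> u j \<in> L" if "j \<in> J" for j
   using kc(3)[OF that] L_props(4) integral_partD(1)[OF U(1)[OF that]] subringE(6)[OF L_props(2)] by blast
 qed (use subringE(2,7)[OF L_props(2)] L_props(3) in auto)
 have sum_ext: "finsum R f B \<in> extended_ideal"
  if "finite B" "\<And>b. b \<in> B \<Longrightarrow> f b \<in> extended_ideal" for f and B :: "'x set"
  by (rule finsum_in_subset[OF that extended_ideal_closed(1,2)]) (auto simp: extended_ideal_def)
 have tW: "\<tau> W \<in> extended_ideal" if t: "\<tau> \<in> T" for \<tau>
 proof -
  have tK: "\<tau> \<in> auts K" using t T_auts by blast
  define s where "s j = (\<Oplus>p\<in>I \<times> F. c j (\<tau>, p) \<otimes> ?e p)" for j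
  have cc: "c j (\<tau>, p) \<in> C" if "p \<in> I \<times> F" "j \<in> J" for p j
   using cB[of "(\<tau>, p)" j] that t base_props(8) by auto
  have sc: "s j \<in> C" if j: "j \<in> J" for j
  proof -
   have "(\<lambda>p. c j (\<tau>, p) \<otimes> ?e p) \<in> I \<times> F \<rightarrow> C"
    by (rule Pi_I, rule m_closed[OF cc[OF _ j] ec])
   thus ?thesis unfolding s_def by (rule finsum_closed)
  qed
  have dE: "\<tau> (u j) \<ominus> s j \<in> extended_ideal" "\<tau> (u j) \<ominus> s j \<in> C" if j: "j \<in> J" for j
   using c[OF t j] tu(3)[OF t j] sc[OF j] by (auto simp: s_def)
  have "\<tau> W = (\<Oplus>j\<in>J. \<tau> (k j \<otimes> u j))"
   unfolding W_def by (rule auts_finsum[OF tK J]) (use kc uc in auto)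
  also have "\<dots> = (\<Oplus>j\<in>J. k j \<otimes> s j \<oplus> (\<tau> (u j) \<ominus> s j) \<otimes> k j)"
  proof (rule finsum_cong')
   show "(\<lambda>j. k j \<otimes> s j \<oplus> (\<tau> (u j) \<ominus> s j) \<otimes> k j) \<in> J \<rightarrow> C" using kc(1) sc dE(2) by auto
   fix j assume j: "j \<in> J"
   have "\<tau> (k j \<otimes> u j) = k j \<otimes> \<tau> (u j)"
    using auts_binary(2)[OF tK kc(1)[OF j] uc[OF j]] auts_fix[OF tK kc(3)[OF j]] by simp
   also have "\<dots> = k j \<otimes> s j \<oplus> (\<tau> (u j) \<ominus> s j) \<otimes> k j"
    using kc(1)[OF j] sc[OF j] tu(3)[OF t j] by algebra
   finally show "\<tau> (k j \<otimes> u j) = k j \<otimes> s j \<oplus> (\<tau> (u j) \<ominus> s j) \<otimes> k j" .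
  qed simp
  also have "\<dots> = (\<Oplus>j\<in>J. k j \<otimes> s j) \<oplus> (\<Oplus>j\<in>J. (\<tau> (u j) \<ominus> s j) \<otimes> k j)"
   by (rule finsum_addf) (use kc(1) sc dE(2) in auto)
  also have "(\<Oplus>j\<in>J. k j \<otimes> s j) = (\<Oplus>p\<in>I \<times> F. (\<Oplus>j\<in>J. k j \<otimes> c j (\<tau>, p)) \<otimes> ?e p)"
   unfolding s_def by (rule double_finsum_combine[OF finW(1) J kc(1) cc ec])
  finally have e: "\<tau> W = (\<Oplus>p\<in>I \<times> F. (\<Oplus>j\<in>J. k j \<otimes> c j (\<tau>, p)) \<otimes> ?e p) \<oplus> (\<Oplus>j\<in>J. (\<tau> (u j) \<ominus> s j) \<otimes> k j)" .
  have "(\<Oplus>p\<in>I \<times> F. (\<Oplus>j\<in>J. k j \<otimes> c j (\<tau>, p)) \<otimes> ?e p) \<in> extended_ideal"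
  proof (rule sum_ext[OF finW(1)])
   fix p assume p: "p \<in> I \<times> F"
   have "(\<Oplus>j\<in>J. k j \<otimes> c j (\<tau>, p)) \<in> base_ideal" using k(3)[of "(\<tau>, p)"] t p by simp
   thus "(\<Oplus>j\<in>J. k j \<otimes> c j (\<tau>, p)) \<otimes> ?e p \<in> extended_ideal"
    using extended_ideal_closed(3,4) eA[OF p] by blast
  qed
  moreover have "(\<Oplus>j\<in>J. (\<tau> (u j) \<ominus> s j) \<otimes> k j) \<in> extended_ideal"
   by (rule sum_ext[OF J]) (use extended_ideal_closed(3) dE(1) kc(2) in blast)
  ultimately show ?thesis unfolding e using extended_ideal_closed(2) by blast
 qed
 define Q' where "Q' \<tau> d \<longleftrightarrow> d \<in> base_ideal \<and> vle A d (\<tau> W)" for \<tau> d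
 define dd where "dd \<tau> = (SOME d. Q' \<tau> d)" for \<tau>
 have dd: "Q' \<tau> (dd \<tau>)" if t: "\<tau> \<in> T" for \<tau>
 proof -
  obtain d where "Q' \<tau> d" using tW[OF t] by (auto simp: extended_ideal_def Q'_def)
  thus ?thesis unfolding dd_def by (rule someI[of "Q' \<tau>"])
 qed
 have ddc: "dd \<tau> \<in> C" if "\<tau> \<in> T" for \<tau> using dd[OF that] base_props(9) by (auto simp: Q'_def)
 have Tne: "T \<noteq> {}" using T_cover[OF auts_id] by blast
 \<comment> \<open>Every place brings its own divisor; the one of least value divides at all places
   of \<open>T\<close>.\<close>
 have "\<exists>\<tau>0\<in>T. \<forall>\<tau>\<in>T. vle A (dd \<tau>0) (dd \<tau>)" by (rule exists_vle_minimum[OF VA finite_T Tne ddc])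
 then obtain \<tau>0 where t0: "\<tau>0 \<in> T" "\<And>\<tau>. \<tau> \<in> T \<Longrightarrow> vle A (dd \<tau>0) (dd \<tau>)" by blast
 define d where "d = dd \<tau>0"
 have d: "d \<in> base_ideal" "d \<in> C" "d \<in> K" using dd[OF t0(1)] ddc[OF t0(1)] by (auto simp: d_def Q'_def base_ideal_def)
 have dT: "vle A d (\<tau> W)" if t: "\<tau> \<in> T" for \<tau>
  using vle_trans[OF VA t0(2)[OF t] _ ddc[OF t0(1)]] dd[OF t] by (simp add: d_def Q'_def)
 \<comment> \<open>For nonzero \<open>d\<close> in \<open>K\<close>, divisibility by
   \<open>d\<close> is integrality of the quotient, an element of \<open>L\<close>. It therefore
   depends only on the trace and passes from the representatives to all automorphisms.\<close>
 have "vle A d (\<rho> W)" if r: "\<rho> \<in> auts K" for \<rho>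
 proof -
  obtain \<tau> where t: "\<tau> \<in> T" "same_trace \<rho> \<tau>" using T_cover[OF r] by blast
  have tK: "\<tau> \<in> auts K" using t(1) T_auts by blast
  show ?thesis
  proof (cases "d = \<zero>")
   case True
   hence "\<tau> W = \<zero>" using dT[OF t(1)] zero_vle_iff[OF VA auts_closed[OF tK Wc]] by simp
   hence "W = \<zero>" using auts_zero_iff[OF tK Wc] by simp
   thus ?thesis using auts_const[OF r] True vle_refl[OF VA zero_closed] by simp
  next
   case False
   have iK: "inv d \<in> K" "inv d \<in> C" using subfield_inv_closed[OF K_props(1) d(3) False] d(2) False by auto
   have e: "\<rho>' (inv d \<otimes> W) = inv d \<otimes> \<rho>' W" if "\<rho>' \<in> auts K" for \<rho>'
    using auts_binary(2)[OF that iK(2) Wc] auts_fix[OF that iK(1)] by simp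
   have wL: "inv d \<otimes> W \<in> L" using subringE(6)[OF L_props(2)] iK(1) L_props(4) WL by blast
   have "\<tau> (inv d \<otimes> W) \<in> A"
    unfolding e[OF tK] using vle_iff_div[OF VA d(2) auts_closed[OF tK Wc] False] dT[OF t(1)] by simp
   hence "\<rho> (inv d \<otimes> W) \<in> A" using t(2) wL by (simp add: same_trace_def)
   thus ?thesis unfolding e[OF r] using vle_iff_div[OF VA d(2) auts_closed[OF r Wc] False] by simp
  qed
 qed
 hence "k j \<in> base_ideal" if "j \<in> J" for j
  using U(2)[of k d j] k(1) d(1) that unfolding W_def by blast
 thus False using k(2) by blast
qed

end

section \<open>Algebraic closures and normal extensions\<close>

text \<open>Algebraicity descends from \<open>L\<close> to \<open>K\<close> by the tower formula:
  each element lies in a simple extension of \<open>L\<close>, which is finite over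
  \<open>K\<close>.\<close>

lemma algebraic_closure_over:
 fixes C (structure)
 assumes closure: "algebraic_closure C L" and K: "subfield K C" "K \<subseteq> L"
  and fin: "ring.finite_dimension C K L"
 shows "algebraically_closed_over C K"
proof -
 interpret C: algebraic_closure C L by (rule closure)
 have L: "subfield L C" by (rule C.subfield_axioms)
 obtain n where n: "C.dimension n K L" using fin by (rule C.finite_dimensionE')
 have alg: "(C.algebraic over K) x" if x: "x \<in> carrier C" for x
 proof -
  note xL = C.algebraic_extension[OF x]
  have "C.dimension (n * degree (C.Irr L x)) K (C.simple_extension L x)"
   by (rule C.telescopic_base[OF K(1) L n C.dimension_simple_extension[OF L x xL]])
  thus ?thesis
   by (intro C.finite_dimension_imp_algebraic[OF K(1) C.simple_extension_is_subring[OF subfieldE(1)[OF L] x]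
    C.finite_dimensionI C.simple_extension_mem[OF subfieldE(1)[OF L] x]])
 qed
 show ?thesis
 proof (intro algebraically_closed_over.intro algebraically_closed_over_axioms.intro)
  show "field C" by (rule C.field_axioms)
  show "subfield K C" by (rule K(1))
  fix x assume x: "x \<in> carrier C"
  note I = C.IrrE[OF K(1) x alg[OF x]]
  have "set (C.Irr K x) \<subseteq> K"
   using I(1) C.polynomial_incl by (simp add: univ_poly_carrier[symmetric])
  moreover have "C.Irr K x \<noteq> []" using C.pirreducible_degree[OF K(1) I(1,2)] by auto
  ultimately show "\<exists>p. set p \<subseteq> K \<and> p \<noteq> [] \<and> hd p = \<one>\<^bsub>C\<^esub> \<and> C.eval p x = \<zero>\<^bsub>C\<^esub>" using I(3,4) by blast
 next
  fix p assume p: "set p \<subseteq> carrier C" "2 \<le> length p" "hd p = \<one>\<^bsub>C\<^esub>"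
  have pp: "p \<in> carrier (poly_ring C)"
   using p by (simp add: univ_poly_carrier[symmetric] polynomial_def)
  have "size (C.roots p) = degree p" using C.roots_over_carrier[OF pp] by (simp add: C.splitted_def)
  hence "C.roots p \<noteq> {#}" using p(2) by auto
  then obtain x where "x \<in># C.roots p" by blast
  hence "C.is_root p x" using C.roots_mem_iff_is_root[OF pp] by blast
  thus "\<exists>x\<in>carrier C. C.eval p x = \<zero>\<^bsub>C\<^esub>" by (auto simp: C.is_root_def)
 qed
qed

context algebraically_closed_over
begin

text \<open>The image of \<open>x\<close> is a root of the irreducible polynomial of
  \<open>x\<close> over \<open>K\<close>, which splits over \<open>L\<close>. The irreducible
  polynomial of the image over \<open>L\<close> divides it, so it is linear and the image lies in
  \<open>L\<close>.\<close>

lemma normal_extension_stable: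
 assumes L: "overfield L" and normal: "normal_extension R K L" and t: "\<tau> \<in> auts K"
 shows "\<tau> ` L = L"
proof -
 note LD = overfieldD[OF L]
 interpret F: field "R\<lparr>carrier := L\<rparr>" by (rule subfield_iff(2)[OF LD(1)])
 have poly: "univ_poly (R\<lparr>carrier := L\<rparr>) = univ_poly R" by (rule univ_poly_consistent[OF LD(3)])
 have stable: "\<rho> x \<in> L" if r: "\<rho> \<in> auts K" and x: "x \<in> L" for \<rho> x
 proof -
  have xc: "x \<in> C" using x LD(4) by blast
  define p where "p = Irr K x"
  note I = IrrE[OF subfield_K xc algebraic_over[OF xc overfield_K], folded p_def]
  have pK: "set p \<subseteq> K" using I(1) polynomial_incl by (simp add: univ_poly_carrier[symmetric])
  have p0: "p \<noteq> []" using pirreducible_degree[OF subfield_K I(1,2)] by auto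
  have pL: "p \<in> carrier (L[X])"
   using pK p0 I(3) LD(2) by (auto simp: univ_poly_carrier[symmetric] polynomial_def)
  have split: "F.splitted p" using normal I(1,2,4) x unfolding normal_extension_def by blast
  define y where "y = \<rho> x"
  have yc: "y \<in> C" using auts_closed[OF r xc] by (simp add: y_def)
  have "\<rho> (eval p x) = eval (map \<rho> p) y" using auts_eval[OF r _ xc] pK LD(2,4) by (simp add: y_def subset_trans)
  moreover have "map \<rho> p = p" using pK auts_fix[OF r] by (intro map_idI) blast
  ultimately have ey: "eval p y = \<zero>" using I(4) auts_const(1)[OF r] by simp
  note J = IrrE[OF LD(1) yc algebraic_over[OF yc L]]
  have "Irr L y pdivides p" by (rule Irr_minimal[OF LD(1) yc algebraic_over[OF yc L] pL ey])
  hence "Irr L y divides\<^bsub>L[X]\<^esub> p" using pdivides_iff_shell[OF LD(1) J(1) pL] by blast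
  hence "Irr L y pdivides\<^bsub>R\<lparr>carrier := L\<rparr>\<^esub> p" by (simp add: pdivides_def poly)
  hence d: "degree (Irr L y) = 1"
   using F.splitted_imp_trivial_factors[of p "Irr L y"] pL p0 split J(1,2) by (simp add: poly)
  hence "length (Irr L y) = Suc (Suc 0)" by linarith
  then obtain a b where ab: "Irr L y = [a, b]" by (auto simp: length_Suc_conv)
  have "set [a, b] \<subseteq> L" using J(1) polynomial_incl[of L "[a, b]"] unfolding ab by (simp add: univ_poly_carrier[symmetric])
  hence b: "b \<in> L" "b \<in> C" using LD(4) by auto
  have "a = \<one>" using J(3) by (simp add: ab)
  hence "y \<oplus> b = \<zero>" using J(4) yc b(2) by (simp add: ab)
  hence "y = \<ominus> b" using yc b(2) by (metis minus_equality minus_minus)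
  thus ?thesis using subringE(5)[OF LD(3) b(1)] by (simp add: y_def)
 qed
 obtain \<rho> where r: "\<rho> \<in> auts K" "\<forall>x\<in>C. \<rho> (\<tau> x) = x \<and> \<tau> (\<rho> x) = x"
  using auts_inverse[OF subfieldE(3)[OF subfield_K] t] by blast
 show ?thesis
 proof
  show "\<tau> ` L \<subseteq> L" using stable[OF t] by blast
  show "L \<subseteq> \<tau> ` L"
  proof
   fix x assume x: "x \<in> L"
   hence "x = \<tau> (\<rho> x)" using r(2) LD(4) by auto
   thus "x \<in> \<tau> ` L" using stable[OF r(1) x] by (rule image_eqI)
  qed
 qed
qed

end

section \<open>Valuations and valuation rings\<close>

lemma (in ordered_comm_group) gle_cancel:
 assumes "a \<in> carrier G" "b \<in> carrier G" "c \<in> carrier G"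
 shows "a \<otimes> c \<preceq> b \<otimes> c \<longleftrightarrow> a \<preceq> b"
proof
 assume "a \<otimes> c \<preceq> b \<otimes> c"
 hence "a \<otimes> c \<otimes> inv c \<preceq> b \<otimes> c \<otimes> inv c" using assms gle_mult[of "a \<otimes> c" "b \<otimes> c" "inv c"] by simp
 thus "a \<preceq> b" using assms by (simp add: m_assoc)
qed (use assms gle_mult in blast)

lemma (in ordered_comm_group) ordered_subgroup:
 assumes S: "subgroup S G"
 shows "ordered_comm_group (G\<lparr>carrier := S\<rparr>)"
proof -
 have sub: "x \<in> S \<Longrightarrow> x \<in> carrier G" for x using subgroup.subset[OF S] by blast
 interpret S: group "G\<lparr>carrier := S\<rparr>" by (rule subgroup_imp_group[OF S])
 have "comm_group (G\<lparr>carrier := S\<rparr>)"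
  by (rule S.group_comm_groupI) (use sub m_comm in simp)
 moreover have "ordered_comm_group_axioms (G\<lparr>carrier := S\<rparr>)"
 proof
  fix a b c assume a: "a \<in> carrier (G\<lparr>carrier := S\<rparr>)"
  thus "a \<preceq>\<^bsub>G\<lparr>carrier := S\<rparr>\<^esub> a" using sub gle_refl by simp
  assume b: "b \<in> carrier (G\<lparr>carrier := S\<rparr>)"
  thus "a \<preceq>\<^bsub>G\<lparr>carrier := S\<rparr>\<^esub> b \<or> b \<preceq>\<^bsub>G\<lparr>carrier := S\<rparr>\<^esub> a" using a sub gle_total by simp
  show "a = b" if "a \<preceq>\<^bsub>G\<lparr>carrier := S\<rparr>\<^esub> b" "b \<preceq>\<^bsub>G\<lparr>carrier := S\<rparr>\<^esub> a"
   using a b that sub gle_antisym by simp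
  assume c: "c \<in> carrier (G\<lparr>carrier := S\<rparr>)"
  show "a \<preceq>\<^bsub>G\<lparr>carrier := S\<rparr>\<^esub> c" if "a \<preceq>\<^bsub>G\<lparr>carrier := S\<rparr>\<^esub> b" "b \<preceq>\<^bsub>G\<lparr>carrier := S\<rparr>\<^esub> c"
   using gle_trans[of a b c] a b c that sub by simp
  show "a \<otimes>\<^bsub>G\<lparr>carrier := S\<rparr>\<^esub> c \<preceq>\<^bsub>G\<lparr>carrier := S\<rparr>\<^esub> b \<otimes>\<^bsub>G\<lparr>carrier := S\<rparr>\<^esub> c" if "a \<preceq>\<^bsub>G\<lparr>carrier := S\<rparr>\<^esub> b"
   using gle_mult[of a b c] a b c that sub by simp
 qed
 ultimately show ?thesis by (simp add: ordered_comm_group_def)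
qed

lemma (in valuation) value_closed: "x \<in> carrier F \<Longrightarrow> x \<noteq> \<zero>\<^bsub>F\<^esub> \<Longrightarrow> v x \<in> carrier G"
 using v_surj by blast

lemma (in valuation) value_one: "v \<one>\<^bsub>F\<^esub> = \<one>\<^bsub>G\<^esub>"
proof -
 have "v \<one>\<^bsub>F\<^esub> \<otimes>\<^bsub>G\<^esub> v \<one>\<^bsub>F\<^esub> = v \<one>\<^bsub>F\<^esub>" using v_mult[of "\<one>\<^bsub>F\<^esub>" "\<one>\<^bsub>F\<^esub>"] by simp
 thus ?thesis using value_closed[of "\<one>\<^bsub>F\<^esub>"] by simp
qed

lemma (in valuation) value_inv:
 assumes x: "x \<in> carrier F" "x \<noteq> \<zero>\<^bsub>F\<^esub>"
 shows "v (inv\<^bsub>F\<^esub> x) = inv\<^bsub>G\<^esub> (v x)"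
proof -
 have "v (inv\<^bsub>F\<^esub> x) \<otimes>\<^bsub>G\<^esub> v x = \<one>\<^bsub>G\<^esub>"
  using v_mult[of "inv\<^bsub>F\<^esub> x" x] x F.inv_simps[OF x] value_one by simp
 thus ?thesis using x value_closed F.inv_simps[OF x] by (metis G.inv_equality)
qed

lemma (in valuation) value_subgroup:
 assumes E: "subfield E F"
 shows "subgroup (v ` (E - {\<zero>\<^bsub>F\<^esub>})) G"
proof (rule G.subgroupI)
 note ES = subringE[OF subfieldE(1)[OF E]]
 have Ec: "x \<in> carrier F" if "x \<in> E" for x using that subfieldE(3)[OF E] by blast
 show "v ` (E - {\<zero>\<^bsub>F\<^esub>}) \<subseteq> carrier G" using value_closed Ec by auto
 show "v ` (E - {\<zero>\<^bsub>F\<^esub>}) \<noteq> {}" using ES(3) by auto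
 fix a assume "a \<in> v ` (E - {\<zero>\<^bsub>F\<^esub>})"
 then obtain x where x: "x \<in> E" "x \<noteq> \<zero>\<^bsub>F\<^esub>" "a = v x" by blast
 have "inv\<^bsub>F\<^esub> x \<in> E - {\<zero>\<^bsub>F\<^esub>}" using F.subfield_inv_closed[OF E x(1,2)] F.inv_simps(4)[OF Ec[OF x(1)] x(2)] by simp
 thus "inv\<^bsub>G\<^esub> a \<in> v ` (E - {\<zero>\<^bsub>F\<^esub>})"
  unfolding x(3) using value_inv[OF Ec[OF x(1)] x(2)] by (metis imageI)
 fix b assume "b \<in> v ` (E - {\<zero>\<^bsub>F\<^esub>})"
 then obtain y where y: "y \<in> E" "y \<noteq> \<zero>\<^bsub>F\<^esub>" "b = v y" by blast
 have "x \<otimes>\<^bsub>F\<^esub> y \<in> E - {\<zero>\<^bsub>F\<^esub>}" using ES(6)[OF x(1) y(1)] x y Ec F.integral_iff by simp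
 thus "a \<otimes>\<^bsub>G\<^esub> b \<in> v ` (E - {\<zero>\<^bsub>F\<^esub>})"
  unfolding x(3) y(3) using v_mult[of x y] x y Ec by (metis imageI DiffI singletonD)
qed

lemma (in valuation) valuation_restrict:
 assumes E: "subfield E F"
 shows "valuation (F\<lparr>carrier := E\<rparr>) (G\<lparr>carrier := v ` (E - {\<zero>\<^bsub>F\<^esub>})\<rparr>) v"
proof -
 have Ec: "x \<in> carrier F" if "x \<in> E" for x using that subfieldE(3)[OF E] by blast
 have "valuation_axioms (F\<lparr>carrier := E\<rparr>) (G\<lparr>carrier := v ` (E - {\<zero>\<^bsub>F\<^esub>})\<rparr>) v"
  by unfold_locales (use v_mult v_add Ec in simp_all)
 thus ?thesis
  unfolding valuation_def using F.subfield_iff(2)[OF E] G.ordered_subgroup[OF value_subgroup[OF E]] by blast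
qed

lemma (in valuation) valuation_ring_restrict:
 assumes E: "E \<subseteq> carrier F"
 shows "valuation_ring (F\<lparr>carrier := E\<rparr>) (G\<lparr>carrier := S\<rparr>) v = E \<inter> valuation_ring F G v"
 using E by (auto simp: valuation_ring_def)

lemma (in valuation) valuation_ring_valring: "F.valring (valuation_ring F G v)"
 unfolding F.valring_def
proof (intro conjI ballI impI)
 let ?A = "valuation_ring F G v"
 \<comment> \<open>The square of this value is the unit element, and an ordered group has no other
   element of finite order.\<close>
 have m1: "v (\<ominus>\<^bsub>F\<^esub> \<one>\<^bsub>F\<^esub>) = \<one>\<^bsub>G\<^esub>"
 proof -
  let ?m = "\<ominus>\<^bsub>F\<^esub> \<one>\<^bsub>F\<^esub>"
  have nz: "?m \<noteq> \<zero>\<^bsub>F\<^esub>" by (metis F.add.inv_eq_1_iff F.one_closed F.one_not_zero)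
  have c: "v ?m \<in> carrier G" using value_closed nz by simp
  have "?m \<otimes>\<^bsub>F\<^esub> ?m = \<one>\<^bsub>F\<^esub>" by (simp add: F.l_minus)
  hence sq: "v ?m \<otimes>\<^bsub>G\<^esub> v ?m = \<one>\<^bsub>G\<^esub>" using v_mult[of ?m ?m] nz value_one by simp
  show ?thesis
   using G.gle_total[OF c G.one_closed]
  proof
   assume h: "v ?m \<preceq>\<^bsub>G\<^esub> \<one>\<^bsub>G\<^esub>"
   have "v ?m \<otimes>\<^bsub>G\<^esub> v ?m \<preceq>\<^bsub>G\<^esub> \<one>\<^bsub>G\<^esub> \<otimes>\<^bsub>G\<^esub> v ?m" by (rule G.gle_mult[OF c G.one_closed c h])
   thus ?thesis using sq c h G.gle_antisym[OF c G.one_closed] by simp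
  next
   assume h: "\<one>\<^bsub>G\<^esub> \<preceq>\<^bsub>G\<^esub> v ?m"
   have "\<one>\<^bsub>G\<^esub> \<otimes>\<^bsub>G\<^esub> v ?m \<preceq>\<^bsub>G\<^esub> v ?m \<otimes>\<^bsub>G\<^esub> v ?m" by (rule G.gle_mult[OF G.one_closed c c h])
   thus ?thesis using sq c h G.gle_antisym[OF c G.one_closed] by simp
  qed
 qed
 have mult: "x \<otimes>\<^bsub>F\<^esub> y \<in> ?A" if x: "x \<in> ?A" and y: "y \<in> ?A" for x y
 proof (cases "x = \<zero>\<^bsub>F\<^esub> \<or> y = \<zero>\<^bsub>F\<^esub>")
  case True
  thus ?thesis using x y by (auto simp: valuation_ring_def)
 next
  case False
  hence c: "x \<in> carrier F" "y \<in> carrier F" "v x \<in> carrier G" "v y \<in> carrier G"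
   "\<one>\<^bsub>G\<^esub> \<preceq>\<^bsub>G\<^esub> v x" "\<one>\<^bsub>G\<^esub> \<preceq>\<^bsub>G\<^esub> v y" using x y value_closed by (auto simp: valuation_ring_def)
  have "\<one>\<^bsub>G\<^esub> \<otimes>\<^bsub>G\<^esub> v y \<preceq>\<^bsub>G\<^esub> v x \<otimes>\<^bsub>G\<^esub> v y" by (rule G.gle_mult) (use c in auto)
  hence "\<one>\<^bsub>G\<^esub> \<preceq>\<^bsub>G\<^esub> v x \<otimes>\<^bsub>G\<^esub> v y" using G.gle_trans[of "\<one>\<^bsub>G\<^esub>" "v y" "v x \<otimes>\<^bsub>G\<^esub> v y"] c by simp
  thus ?thesis using v_mult[of x y] c False by (simp add: valuation_ring_def)
 qed
 show "subring ?A F"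
 proof (rule F.subringI)
  show "?A \<subseteq> carrier F" by (auto simp: valuation_ring_def)
  show "\<one>\<^bsub>F\<^esub> \<in> ?A" using value_one G.gle_refl by (simp add: valuation_ring_def)
  fix x y assume x: "x \<in> ?A" and y: "y \<in> ?A"
  hence c: "x \<in> carrier F" "y \<in> carrier F" by (auto simp: valuation_ring_def)
  have "\<ominus>\<^bsub>F\<^esub> \<one>\<^bsub>F\<^esub> \<in> ?A" using m1 G.gle_refl by (simp add: valuation_ring_def)
  hence "(\<ominus>\<^bsub>F\<^esub> \<one>\<^bsub>F\<^esub>) \<otimes>\<^bsub>F\<^esub> x \<in> ?A" using x by (rule mult)
  thus "\<ominus>\<^bsub>F\<^esub> x \<in> ?A" using c by (simp add: F.l_minus)
  show "x \<otimes>\<^bsub>F\<^esub> y \<in> ?A" using x y by (rule mult)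
  show "x \<oplus>\<^bsub>F\<^esub> y \<in> ?A"
  proof (cases "x = \<zero>\<^bsub>F\<^esub> \<or> y = \<zero>\<^bsub>F\<^esub> \<or> x \<oplus>\<^bsub>F\<^esub> y = \<zero>\<^bsub>F\<^esub>")
   case True
   thus ?thesis using x y c by (auto simp: valuation_ring_def)
  next
   case False
   hence g: "v x \<in> carrier G" "v y \<in> carrier G" "v (x \<oplus>\<^bsub>F\<^esub> y) \<in> carrier G"
    "\<one>\<^bsub>G\<^esub> \<preceq>\<^bsub>G\<^esub> v x" "\<one>\<^bsub>G\<^esub> \<preceq>\<^bsub>G\<^esub> v y" using x y c value_closed by (auto simp: valuation_ring_def)
   have "v x \<preceq>\<^bsub>G\<^esub> v (x \<oplus>\<^bsub>F\<^esub> y) \<or> v y \<preceq>\<^bsub>G\<^esub> v (x \<oplus>\<^bsub>F\<^esub> y)" using v_add[of x y] c False by blast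
   hence "\<one>\<^bsub>G\<^esub> \<preceq>\<^bsub>G\<^esub> v (x \<oplus>\<^bsub>F\<^esub> y)"
    using G.gle_trans[OF G.one_closed g(1,3,4)] G.gle_trans[OF G.one_closed g(2,3,5)] by blast
   thus ?thesis using c by (simp add: valuation_ring_def)
  qed
 qed
 fix x assume x: "x \<in> carrier F" "x \<noteq> \<zero>\<^bsub>F\<^esub>"
 note c = value_closed[OF x]
 show "x \<in> ?A \<or> inv\<^bsub>F\<^esub> x \<in> ?A"
  using G.gle_total[OF G.one_closed c]
 proof
  assume "v x \<preceq>\<^bsub>G\<^esub> \<one>\<^bsub>G\<^esub>"
  hence "v x \<otimes>\<^bsub>G\<^esub> inv\<^bsub>G\<^esub> (v x) \<preceq>\<^bsub>G\<^esub> \<one>\<^bsub>G\<^esub> \<otimes>\<^bsub>G\<^esub> inv\<^bsub>G\<^esub> (v x)" by (rule G.gle_mult[rotated 3]) (use c in auto)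
  thus ?thesis using c value_inv[OF x] F.inv_simps[OF x] by (simp add: valuation_ring_def)
 qed (use x in \<open>simp add: valuation_ring_def\<close>)
qed

lemma (in algebraically_closed_over) valuation_pullback:
 assumes V: "valuation R H V" and t: "\<tau> \<in> auts E"
 shows "valuation R H (V \<circ> \<tau>)" "valuation_ring R H (V \<circ> \<tau>) = pullback \<tau> (valuation_ring R H V)"
proof -
 interpret V: valuation R H V by (rule V)
 note rules = auts_binary[OF t] auts_closed[OF t] auts_zero_iff[OF t]
 have "\<tau> ` (C - {\<zero>}) = C - {\<zero>}"
 proof -
  have b: "inj_on \<tau> C" "\<tau> ` C = C" using t by (auto simp: auts_def bij_betw_def)
  have "\<tau> ` (C - {\<zero>}) = \<tau> ` C - \<tau> ` {\<zero>}"
   by (rule inj_on_image_set_diff[OF b(1)]) auto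
  thus ?thesis using b(2) auts_const(1)[OF t] by simp
 qed
 hence "(V \<circ> \<tau>) ` (C - {\<zero>}) = carrier H" by (simp only: image_comp[symmetric] V.v_surj)
 hence "valuation_axioms R H (V \<circ> \<tau>)"
 proof (rule valuation_axioms.intro)
  fix x y assume xy: "x \<in> C - {\<zero>}" "y \<in> C - {\<zero>}"
  hence c: "\<tau> x \<in> C - {\<zero>}" "\<tau> y \<in> C - {\<zero>}" "x \<in> C" "y \<in> C"
   using rules(4,5) by auto
  show "(V \<circ> \<tau>) (x \<otimes> y) = (V \<circ> \<tau>) x \<otimes>\<^bsub>H\<^esub> (V \<circ> \<tau>) y"
   using V.v_mult[OF c(1,2)] rules(2)[OF c(3,4)] by simp
  assume "x \<oplus> y \<noteq> \<zero>"
  hence "\<tau> x \<oplus> \<tau> y \<noteq> \<zero>" using rules(1)[OF c(3,4)] rules(5)[of "x \<oplus> y"] c(3,4) by simp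
  thus "(V \<circ> \<tau>) x \<preceq>\<^bsub>H\<^esub> (V \<circ> \<tau>) (x \<oplus> y) \<or> (V \<circ> \<tau>) y \<preceq>\<^bsub>H\<^esub> (V \<circ> \<tau>) (x \<oplus> y)"
   using V.v_add[OF c(1,2)] rules(1)[OF c(3,4)] by simp
 qed
 thus "valuation R H (V \<circ> \<tau>)" using V by (simp add: valuation_def)
 show "valuation_ring R H (V \<circ> \<tau>) = pullback \<tau> (valuation_ring R H V)"
  using rules(4,5) by (auto simp: valuation_ring_def pullback_def)
qed

section \<open>Unique extensions and henselizations\<close>

context algebraically_closed_over
begin

text \<open>\<open>only_extension\<close> ranges over valuations with values in one fixed type,
  \<open>henselian\<close> over all valuation rings. By \<open>henselian_iff\<close> it suffices to
  test the pullbacks under automorphisms, and these are moved to the fixed type by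
  \<open>equivalent_valuation_on_sets\<close>.\<close>

lemma only_extension_iff_henselian:
 assumes V: "valuation R H V" and E: "overfield E"
 shows "only_extension R E H V \<longleftrightarrow> henselian (valuation_ring R H V) E"
proof -
 interpret V: valuation R H V by (rule V)
 let ?A = "valuation_ring R H V"
 have tr: "valuation_ring (R\<lparr>carrier := E\<rparr>) (H\<lparr>carrier := value_subgroup R H V E\<rparr>) V = E \<inter> ?A"
  by (rule V.valuation_ring_restrict[OF overfieldD(4)[OF E]])
 show ?thesis
 proof
  assume only: "only_extension R E H V"
  show "henselian ?A E"
   unfolding henselian_iff[OF V.valuation_ring_valring E]
  proof
   fix \<tau> assume t: "\<tau> \<in> auts E"
   note P = valuation_pullback[OF V t]
   obtain G' :: "'a set ordered_group" and v' where
    v: "valuation R G' v'" "valuation_ring R G' v' = pullback \<tau> ?A"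
    using valuation.equivalent_valuation_on_sets[OF P(1)] unfolding P(2) by blast
   have "pullback \<tau> ?A \<inter> E = E \<inter> ?A"
    using auts_fix[OF t] overfieldD(4)[OF E] by (auto simp: pullback_def)
   hence "extends_valuation R G' v' (R\<lparr>carrier := E\<rparr>) (H\<lparr>carrier := value_subgroup R H V E\<rparr>) V"
    using v by (simp add: extends_valuation_def tr)
   hence "pullback \<tau> ?A = ?A" using only v(2) unfolding only_extension_def by blast
   hence "\<forall>x\<in>C. \<tau> x \<in> ?A \<longleftrightarrow> x \<in> ?A" by (auto simp: pullback_def set_eq_iff)
   moreover have "\<tau> \<in> auts K" using t auts_K_mono[OF E] by blast
   ultimately show "\<tau> \<in> dec_on ?A C" by (simp add: dec_on_def)
  qed
 next
  assume hens: "henselian ?A E"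
  show "only_extension R E H V"
   unfolding only_extension_def
  proof (intro allI impI)
   fix G' :: "'a set ordered_group" and v'
   assume e: "extends_valuation R G' v' (R\<lparr>carrier := E\<rparr>) (H\<lparr>carrier := value_subgroup R H V E\<rparr>) V"
   have "valuation R G' v'" using e by (simp add: extends_valuation_def)
   hence "valring (valuation_ring R G' v')" by (rule valuation.valuation_ring_valring)
   moreover have "valuation_ring R G' v' \<inter> E = ?A \<inter> E" using e by (auto simp: extends_valuation_def tr)
   ultimately show "valuation_ring R G' v' = ?A" using hens by (simp add: henselian_def)
  qed
 qed
qed

lemma henselization_base:
 assumes V: "valuation R H V"
 shows "henselization R H V K = hensel (valuation_ring R H V)"
proof -
 let ?A = "valuation_ring R H V"
 have A: "valring ?A" by (rule valuation.valuation_ring_valring[OF V])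
 have eq: "subfield E R \<and> K \<subseteq> E \<and> only_extension R E H V \<longleftrightarrow> henselian ?A E" for E
  using only_extension_iff_henselian[OF V, of E] by (auto simp: overfield_def henselian_def)
 show ?thesis
  unfolding henselization_def eq
 proof (rule Least_equality)
  show "henselian ?A (hensel ?A)"
   using henselian_iff[OF A hensel_overfield[OF A]] hensel_henselian[OF A] by blast
  show "hensel ?A \<subseteq> E" if "henselian ?A E" for E using that by (auto simp: hensel_def)
 qed
qed

end

context valued_extension
begin

text \<open>A field above a henselian one has fewer automorphisms and is henselian again; and every
  henselian field contains \<open>hensel A\<close>. So the least henselian field above
  \<open>L\<close> is the compositum.\<close>

lemma henselization_extension:
 assumes V: "valuation R H V" and A_eq: "valuation_ring R H V = A"
 shows "henselization R H V L = compositum"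
proof -
 have eq: "subfield E R \<and> L \<subseteq> E \<and> only_extension R E H V \<longleftrightarrow> henselian A E \<and> L \<subseteq> E" for E
  using only_extension_iff_henselian[OF V, of E] L_props(4) by (auto simp: overfield_def henselian_def A_eq)
 have "auts compositum \<subseteq> auts (hensel A)" by (rule auts_mono[OF compositum_props(3)])
 hence h: "henselian A compositum"
  using henselian_iff[OF valring_A compositum_props(1)] hensel_henselian[OF valring_A] by blast
 show ?thesis
  unfolding henselization_def eq
 proof (rule Least_equality)
  show "henselian A compositum \<and> L \<subseteq> compositum" using h compositum_props(2) by blast
  fix E assume E: "henselian A E \<and> L \<subseteq> E"
  hence "hensel A \<subseteq> E" "overfield E" by (auto simp: hensel_def henselian_def)
  thus "compositum \<subseteq> E" using E by (auto simp: compositum_def)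
 qed
qed

text \<open>Pulling the valuation of the closure back by \<open>\<tau>\<close> and restricting it to
  \<open>L\<close> gives another extension of the valuation of \<open>K\<close>, which uniqueness
  identifies with the given one.\<close>

lemma only_extension_same_trace:
 assumes V: "valuation R H V" and A_eq: "valuation_ring R H V = A"
  and W: "valuation (R\<lparr>carrier := L\<rparr>) G w" and w_eq: "valuation_ring (R\<lparr>carrier := L\<rparr>) G w = L \<inter> A"
  and only: "only_extension (R\<lparr>carrier := L\<rparr>) K G w" and t: "\<tau> \<in> auts K"
 shows "same_trace \<tau> id"
proof -
 let ?F = "R\<lparr>carrier := L\<rparr>"
 note P = valuation_pullback[OF V t]
 interpret P: valuation R H "V \<circ> \<tau>" by (rule P(1))
 obtain G' :: "'a set ordered_group" and v' where
  v: "valuation ?F G' v'" "valuation_ring ?F G' v' = L \<inter> pullback \<tau> A"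
  using valuation.equivalent_valuation_on_sets[OF P.valuation_restrict[OF L_props(1)]]
  unfolding P.valuation_ring_restrict[OF L_props(3)] P(2) A_eq by blast
 have "valuation_ring (?F\<lparr>carrier := K\<rparr>) (G\<lparr>carrier := value_subgroup ?F G w K\<rparr>) w = K \<inter> (L \<inter> A)"
  using valuation.valuation_ring_restrict[OF W, of K] L_props(4) by (simp add: w_eq)
 moreover have "L \<inter> pullback \<tau> A \<inter> K = K \<inter> (L \<inter> A)"
  using auts_fix[OF t] K_props(3) by (auto simp: pullback_def)
 ultimately have "extends_valuation ?F G' v' (?F\<lparr>carrier := K\<rparr>) (G\<lparr>carrier := value_subgroup ?F G w K\<rparr>) w"
  using v by (simp add: extends_valuation_def)
 hence "L \<inter> pullback \<tau> A = L \<inter> A" using only v(2) w_eq unfolding only_extension_def by blast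
 thus ?thesis using L_props(3) by (auto simp: same_trace_def pullback_def set_eq_iff)
qed

end

section \<open>Finitely generated modules and integral elements\<close>

context field
begin

lemma Span_map_eq_lspan:
 assumes S: "subring S R" and xs: "distinct xs" "u \<in> set xs \<rightarrow> C"
 shows "Span S (map u xs) = lspan S (set xs) u"
 using xs
proof (induction xs)
 case Nil
 thus ?case by (auto simp: lspan_def)
next
 case (Cons x xs)
 have Sc: "S \<subseteq> C" by (rule subringE(1)[OF S])
 have u: "u x \<in> C" "\<And>y. y \<in> set xs \<Longrightarrow> u y \<in> C" "x \<notin> set xs" using Cons.prems by auto
 have split: "(\<Oplus>y\<in>set (x # xs). c y \<otimes> u y) = c x \<otimes> u x \<oplus> (\<Oplus>y\<in>set xs. c y \<otimes> u y)"
  if "\<And>y. y \<in> set (x # xs) \<Longrightarrow> c y \<in> S" for c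
 proof -
  have c: "c x \<in> C" "\<And>y. y \<in> set xs \<Longrightarrow> c y \<in> C" using that Sc by auto
  have "(\<Oplus>y\<in>insert x (set xs). c y \<otimes> u y) = c x \<otimes> u x \<oplus> (\<Oplus>y\<in>set xs. c y \<otimes> u y)"
   by (rule finsum_insert) (use c u in auto)
  thus ?thesis by simp
 qed
 have IH: "Span S (map u xs) = lspan S (set xs) u" using Cons by simp
 have "Span S (map u (x # xs)) = line_extension S (u x) (lspan S (set xs) u)" using IH by simp
 also have "\<dots> = lspan S (set (x # xs)) u"
 proof (intro subset_antisym subsetI)
  fix z assume "z \<in> line_extension S (u x) (lspan S (set xs) u)"
  then obtain k v where kv: "k \<in> S" "v \<in> lspan S (set xs) u" "z = k \<otimes> u x \<oplus> v"
   unfolding line_extension_mem_iff by blast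
  obtain c where c: "\<And>y. y \<in> set xs \<Longrightarrow> c y \<in> S" "v = (\<Oplus>y\<in>set xs. c y \<otimes> u y)"
   using kv(2) by (rule lspan_obtain) blast
  have cc: "c y \<in> C" if "y \<in> set xs" for y using c(1)[OF that] Sc by blast
  define c' where "c' = c(x := k)"
  have c': "c' y \<in> S" if "y \<in> set (x # xs)" for y using that c(1) kv(1) by (auto simp: c'_def)
  have "(\<Oplus>y\<in>set xs. c' y \<otimes> u y) = v"
   unfolding c(2) by (rule finsum_cong') (use u cc in \<open>auto simp: c'_def\<close>)
  moreover have "c' x = k" by (simp add: c'_def)
  ultimately have "z = (\<Oplus>y\<in>set (x # xs). c' y \<otimes> u y)" using split[of c', OF c'] kv(3) by simp
  thus "z \<in> lspan S (set (x # xs)) u" using lspanI[of "set (x # xs)" c' S u] c' by simp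
 next
  fix z assume "z \<in> lspan S (set (x # xs)) u"
  then obtain c where c: "\<And>y. y \<in> set (x # xs) \<Longrightarrow> c y \<in> S" "z = (\<Oplus>y\<in>set (x # xs). c y \<otimes> u y)"
   by (rule lspan_obtain) blast
  have "c x \<in> S" "(\<Oplus>y\<in>set xs. c y \<otimes> u y) \<in> lspan S (set xs) u"
   using c(1) by (auto intro!: lspanI)
  thus "z \<in> line_extension S (u x) (lspan S (set xs) u)"
   unfolding line_extension_mem_iff using split[of c, OF c(1)] c(2) by metis
 qed
 finally show ?case .
qed

lemma finite_submoduleI:
 assumes S: "subring S R" and D: "D \<subseteq> C" and J: "finite J" "\<And>j. j \<in> J \<Longrightarrow> u j \<in> D" "D = lspan S J u"
 shows "finite_submodule R S D"
proof -
 obtain xs where xs: "set xs = J" "distinct xs" using finite_distinct_list[OF J(1)] by blast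
 have "Span S (map u xs) = lspan S (set xs) u"
  by (rule Span_map_eq_lspan[OF S xs(2)]) (use J(2) D xs(1) in auto)
 hence "D = Span S (map u xs)" using J(3) xs(1) by simp
 moreover have "set (map u xs) \<subseteq> D" using J(2) xs(1) by auto
 ultimately show ?thesis unfolding finite_submodule_def by blast
qed

lemma finite_submodule_iff:
 assumes S: "subring S R" and D: "D \<subseteq> C"
 shows "finite_submodule R S D \<longleftrightarrow>
  (\<exists>(J :: nat set) u. finite J \<and> (\<forall>j\<in>J. u j \<in> D) \<and> D = lspan S J u)" (is "_ \<longleftrightarrow> ?rhs")
proof
 assume "finite_submodule R S D"
 then obtain us where us: "set us \<subseteq> D" "D = Span S us" unfolding finite_submodule_def by blast
 have "Span S (map ((!) us) [0..<length us]) = lspan S (set [0..<length us]) ((!) us)"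
  by (rule Span_map_eq_lspan[OF S distinct_upt]) (use us(1) D nth_mem in fastforce)
 hence "D = lspan S {0..<length us} ((!) us)" using us(2) by (simp add: map_nth)
 moreover have "\<forall>j\<in>{0..<length us}. us ! j \<in> D" using us(1) by auto
 ultimately show ?rhs by blast
next
 assume ?rhs
 then obtain J :: "nat set" and u where u: "finite J" "\<forall>j\<in>J. u j \<in> D" "D = lspan S J u" by blast
 show "finite_submodule R S D" by (rule finite_submoduleI[OF S D u(1) _ u(3)]) (use u(2) in blast)
qed

text \<open>For \<open>y\<close> outside \<open>A\<close> the leading term of a monic equation has
  strictly smaller value than the sum of all other terms, so nothing can cancel it.\<close>

lemma valring_integrally_closed:
 assumes A: "valring A" and p: "set p \<subseteq> A" "p \<noteq> []" "hd p = \<one>" and y: "y \<in> C" "eval p y = \<zero>"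
 shows "y \<in> A"
proof (rule ccontr)
 assume "y \<notin> A"
 hence lt: "vlt A y \<one>" using not_in_iff[OF A y(1)] by simp
 hence y0: "y \<noteq> \<zero>" using vle_zero[OF A one_closed] by (auto simp: vlt_def)
 have small: "set q \<subseteq> A \<Longrightarrow> vlt A (y [^] length q) (eval q y)" for q
 proof (induction q)
  case Nil
  thus ?case using vlt_zero[OF A one_closed] by simp
 next
  case (Cons a q)
  have c: "a \<in> A" "a \<in> C" "set q \<subseteq> C" using Cons.prems valring_carrier[OF A] by auto
  have pc: "y [^] length q \<in> C" "y [^] length q \<noteq> \<zero>" using y(1) y0 by simp_all
  have ec: "eval q y \<in> C" using c(3) y(1) by (rule eval_in_carrier)
  have "vlt A (y [^] length q \<otimes> y) (y [^] length q \<otimes> \<one>)"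
   using vlt_mult_iff[OF A y(1) one_closed pc] lt by simp
  hence l: "vlt A (y [^] Suc (length q)) (y [^] length q)" using pc by simp
  have "vle A (y [^] length q) (y [^] length q \<otimes> a)" using c(1) by (auto simp: vle_def)
  hence "vle A (y [^] length q) (a \<otimes> y [^] length q)" using c(2) pc(1) by (simp add: m_comm)
  hence 1: "vlt A (y [^] Suc (length q)) (a \<otimes> y [^] length q)"
   by (rule vlt_vle_trans[OF A l]) (use c pc in auto)
  have "vlt A (y [^] length q) (eval q y)" using Cons by simp
  hence 2: "vlt A (y [^] Suc (length q)) (eval q y)"
   by (rule vlt_trans[OF A l]) (use y(1) pc ec in auto)
  have "vlt A (y [^] Suc (length q)) (a \<otimes> y [^] length q \<oplus> eval q y)"
   by (rule vlt_add[OF A 1 2]) (use y(1) c(2) pc(1) ec in auto)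
  thus ?case by (simp add: eval_Cons)
 qed
 obtain q where q: "p = \<one> # q" using p(2,3) by (cases p) auto
 have qA: "set q \<subseteq> A" "set q \<subseteq> C" using p(1) q valring_carrier[OF A] by auto
 have ec: "eval q y \<in> C" by (rule eval_in_carrier[OF qA(2) y(1)])
 have pc: "y [^] length q \<in> C" using y(1) by simp
 have "y [^] length q \<oplus> eval q y = \<zero>" using y pc unfolding q eval_Cons by simp
 hence "y [^] length q = \<ominus> (eval q y)" using ec pc by (metis minus_equality)
 hence "vlt A (y [^] length q) (y [^] length q)"
  using vlt_minus[OF A small[OF qA(1)] pc ec] by simp
 thus False using vlt_irrefl[OF A pc] by blast
qed

end

context valued_extension
begin

text \<open>Conjugates satisfy the same monic equation over \<open>K\<close>, and valuation rings
  are integrally closed. Conversely the coefficients of the minimal polynomial over \<open>K\<close>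
  are polynomial expressions in the conjugates, hence lie in \<open>A\<close>.\<close>

lemma integral_closure_eq: "integral_closure R (K \<inter> A) L = integral_part"
proof (intro subset_antisym subsetI)
 fix x assume "x \<in> integral_closure R (K \<inter> A) L"
 then obtain p where p: "x \<in> L" "set p \<subseteq> K \<inter> A" "p \<noteq> []" "hd p = \<one>" "eval p x = \<zero>"
  unfolding integral_closure_def using polynomial_incl by blast
 have xc: "x \<in> C" using p(1) L_props(3) by blast
 have pc: "set p \<subseteq> C" using p(2) K_props(3) by blast
 have "\<tau> x \<in> A" if t: "\<tau> \<in> auts K" for \<tau>
 proof -
  have "map \<tau> p = p" using p(2) auts_fix[OF t] by (intro map_idI) blast
  hence "eval p (\<tau> x) = \<zero>" using auts_eval[OF t pc xc] p(5) auts_const(1)[OF t] by simp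
  thus ?thesis
   using valring_integrally_closed[OF valring_A _ p(3,4) auts_closed[OF t xc]] p(2) by blast
 qed
 thus "x \<in> integral_part" using p(1) by (simp add: integral_part_def)
next
 fix x assume x: "x \<in> integral_part"
 note X = integral_partD[OF x]
 obtain rs where rs: "set rs = {\<tau> x | \<tau>. \<tau> \<in> auts K}" "min_poly K x (linprod rs)"
  using conjugates[OF overfield_K X(2)] by blast
 have "set rs \<subseteq> A" using X(3) rs(1) by auto
 hence "set (linprod rs) \<subseteq> A" by (rule linprod_in[OF valring_subring[OF valring_A]])
 hence p: "set (linprod rs) \<subseteq> K \<inter> A" "linprod rs \<noteq> []" "hd (linprod rs) = \<one>" "eval (linprod rs) x = \<zero>"
  using rs(2) by (auto simp: min_poly_def)
 hence "polynomial (K \<inter> A) (linprod rs)" by (simp add: polynomial_def)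
 thus "x \<in> integral_closure R (K \<inter> A) L" unfolding integral_closure_def using X(1) p by blast
qed

text \<open>The identity represents the only extension, and \<open>\<one>\<close> separates because
  there is no other place.\<close>

lemma transversal_of_trivial_traces:
 assumes same: "\<And>\<tau>. \<tau> \<in> auts K \<Longrightarrow> same_trace \<tau> id"
 shows "\<exists>T. trace_transversal R K A L n T \<and> (\<exists>t\<in>hensel A. separating t)"
proof (intro exI conjI)
 show "trace_transversal R K A L n {id}"
 proof (intro trace_transversal.intro trace_transversal_axioms.intro)
  show "valued_extension R K A L n" by (rule valued_extension_axioms)
  show "\<exists>\<tau>\<in>{id}. same_trace \<rho> \<tau>" if "\<rho> \<in> auts K" for \<rho> using same[OF that] by blast
 qed (use auts_id in auto)
 have "veq A \<one> (\<tau> \<one>)" if "\<tau> \<in> auts K" for \<tau>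
  unfolding auts_const(2)[OF that] by (rule veq_refl[OF valring_A one_closed])
 hence "separating \<one>" using same subringE(3)[OF L_props(2)] by (simp add: separating_def)
 thus "\<exists>t\<in>hensel A. separating t" using subringE(3)[OF hensel_props(3)] by blast
qed

text \<open>On \<open>L\<close> an automorphism is determined by the images of a basis, and each
  basis element has finitely many conjugates. So finitely many automorphisms represent all
  restrictions to \<open>L\<close>, and from these one is chosen per trace.\<close>

lemma transversal_of_stable:
 assumes stable: "\<And>\<tau>. \<tau> \<in> auts K \<Longrightarrow> \<tau> ` L = L"
 shows "\<exists>T. trace_transversal R K A L n T \<and> (\<exists>t\<in>hensel A. separating t)"
proof -
 obtain b where b: "b \<in> {..<n} \<rightarrow> C" "lspan K {..<n} b = L" using basis_exists by blast
 have bc: "b i \<in> C" if "i < n" for i using b(1) that by auto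
 define \<Phi> where "\<Phi> (\<tau> :: 'a \<Rightarrow> 'a) = restrict (\<lambda>i. \<tau> (b i)) {..<n}" for \<tau>
 have agree: "\<tau> x = \<rho> x" if t: "\<tau> \<in> auts K" and r: "\<rho> \<in> auts K" and eq: "\<Phi> \<tau> = \<Phi> \<rho>" and x: "x \<in> L" for \<tau> \<rho> x
 proof -
  have tb: "\<tau> (b i) = \<rho> (b i)" if "i < n" for i using fun_cong[OF eq, of i] that by (simp add: \<Phi>_def)
  have "x \<in> lspan K {..<n} b" using x b(2) by simp
  then obtain c where c: "\<And>i. i \<in> {..<n} \<Longrightarrow> c i \<in> K" "x = (\<Oplus>i\<in>{..<n}. c i \<otimes> b i)"
   by (rule lspan_obtain) blast
  have cc: "c i \<in> C" if "i \<in> {..<n}" for i using c(1)[OF that] K_props(3) by blast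
  have im: "\<rho>' x = (\<Oplus>i\<in>{..<n}. c i \<otimes> \<rho>' (b i))" if s: "\<rho>' \<in> auts K" for \<rho>'
  proof -
   have "\<rho>' x = (\<Oplus>i\<in>{..<n}. \<rho>' (c i \<otimes> b i))"
    unfolding c(2) by (rule auts_finsum[OF s]) (use cc bc in auto)
   also have "\<dots> = (\<Oplus>i\<in>{..<n}. c i \<otimes> \<rho>' (b i))"
   proof (rule finsum_cong')
    show "(\<lambda>i. c i \<otimes> \<rho>' (b i)) \<in> {..<n} \<rightarrow> C" using cc bc auts_closed[OF s] by auto
    fix i assume i: "i \<in> {..<n}"
    hence "b i \<in> C" using bc by simp
    thus "\<rho>' (c i \<otimes> b i) = c i \<otimes> \<rho>' (b i)"
     using auts_binary(2)[OF s cc[OF i]] auts_fix[OF s c(1)[OF i]] by simp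
   qed simp
   finally show ?thesis .
  qed
  have "(\<Oplus>i\<in>{..<n}. c i \<otimes> \<tau> (b i)) = (\<Oplus>i\<in>{..<n}. c i \<otimes> \<rho> (b i))"
   by (rule finsum_cong') (use cc bc auts_closed[OF r] tb in auto)
  thus ?thesis using im[OF t] im[OF r] by simp
 qed
 have "\<Phi> ` auts K \<subseteq> PiE {..<n} (\<lambda>i. {\<tau> (b i) | \<tau>. \<tau> \<in> auts K})"
  by (auto simp: \<Phi>_def split: if_splits)
 moreover have "finite (PiE {..<n} (\<lambda>i. {\<tau> (b i) | \<tau>. \<tau> \<in> auts K}))"
  by (rule finite_PiE) (use finite_conjugates[OF overfield_K] bc in auto)
 ultimately have fin: "finite (\<Phi> ` auts K)" by (rule finite_subset)
 define rep where "rep w = (SOME \<tau>. \<tau> \<in> auts K \<and> \<Phi> \<tau> = w)" for w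
 have rep: "rep (\<Phi> \<tau>) \<in> auts K \<and> \<Phi> (rep (\<Phi> \<tau>)) = \<Phi> \<tau>" if "\<tau> \<in> auts K" for \<tau>
  unfolding rep_def by (rule someI[of "\<lambda>\<rho>. \<rho> \<in> auts K \<and> \<Phi> \<rho> = \<Phi> \<tau>" \<tau>]) (use that in simp)
 define S where "S = rep ` \<Phi> ` auts K"
 have S: "finite S" "S \<subseteq> auts K" using fin rep by (auto simp: S_def)
 have same_sym: "same_trace \<tau> \<rho> \<Longrightarrow> same_trace \<rho> \<tau>"
  and same_tr: "same_trace \<tau> \<rho> \<Longrightarrow> same_trace \<rho> \<rho>' \<Longrightarrow> same_trace \<tau> \<rho>'" for \<tau> \<rho> \<rho>'
  by (auto simp: same_trace_def)
 have cover: "\<exists>\<tau>\<in>S. same_trace \<rho> \<tau>" if r: "\<rho> \<in> auts K" for \<rho>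
 proof
  show "rep (\<Phi> \<rho>) \<in> S" using r by (simp add: S_def)
  show "same_trace \<rho> (rep (\<Phi> \<rho>))"
   unfolding same_trace_def using agree[OF r _ _] rep[OF r] by metis
 qed
 \<comment> \<open>The choice depends only on the trace class, so the image of \<open>h\<close>
   meets each class exactly once.\<close>
 define h where "h \<rho> = (SOME \<tau>. \<tau> \<in> S \<and> same_trace \<rho> \<tau>)" for \<rho>
 have h: "h \<rho> \<in> S \<and> same_trace \<rho> (h \<rho>)" if r: "\<rho> \<in> auts K" for \<rho>
 proof -
  obtain \<tau> where "\<tau> \<in> S \<and> same_trace \<rho> \<tau>" using cover[OF r] by blast
  thus ?thesis unfolding h_def by (rule someI[of "\<lambda>\<tau>. \<tau> \<in> S \<and> same_trace \<rho> \<tau>"])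
 qed
 have hcong: "h \<rho> = h \<rho>'" if "same_trace \<rho> \<rho>'" for \<rho> \<rho>'
 proof -
  have "same_trace \<rho> = same_trace \<rho>'" using that same_sym same_tr by (intro ext) blast
  thus ?thesis by (simp add: h_def)
 qed
 have hS: "h \<rho> \<in> S" "same_trace \<rho> (h \<rho>)" if "\<rho> \<in> S" for \<rho> using h that S(2) by blast+
 have "trace_transversal R K A L n (h ` S)"
 proof (intro trace_transversal.intro trace_transversal_axioms.intro)
  show "valued_extension R K A L n" by (rule valued_extension_axioms)
  show "finite (h ` S)" using S(1) by simp
  show sub: "h ` S \<subseteq> auts K" using hS(1) S(2) by blast
  show "\<tau> ` L = L" if "\<tau> \<in> h ` S" for \<tau> using stable sub that by blast
  show "\<tau> = \<rho>" if tr: "\<tau> \<in> h ` S" "\<rho> \<in> h ` S" "same_trace \<tau> \<rho>" for \<tau> \<rho>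
  proof -
   obtain \<tau>' \<rho>' where e: "\<tau>' \<in> S" "\<rho>' \<in> S" "\<tau> = h \<tau>'" "\<rho> = h \<rho>'" using tr(1,2) by blast
   have "same_trace \<tau>' \<tau>" "same_trace \<rho>' \<rho>" using hS(2) e by auto
   hence "same_trace \<tau>' \<rho>'" using tr(3) same_tr same_sym by blast
   thus ?thesis using e hcong by simp
  qed
  show "\<exists>\<tau>\<in>h ` S. same_trace \<rho> \<tau>" if r: "\<rho> \<in> auts K" for \<rho>
  proof -
   obtain \<tau> where t: "\<tau> \<in> S" "same_trace \<rho> \<tau>" using cover[OF r] by blast
   hence "same_trace \<rho> (h \<tau>)" using same_tr[OF t(2) hS(2)[OF t(1)]] by simp
   thus ?thesis using t(1) by blast
  qed
 qed
 then interpret T: trace_transversal R K A L n "h ` S" .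
 show ?thesis using T.trace_transversal_axioms T.separating_in_hensel[OF stable] by blast
qed

text \<open>For \<open>v\<close> outside \<open>J\<close>, maximality gives a combination in the
  maximal ideal with a unit among its coefficients. The coefficient of \<open>v\<close> must be a
  unit, as \<open>J\<close> itself is independent; dividing by it expresses the residue of
  \<open>v\<close>.\<close>

lemma residue_generation:
 assumes J: "finite J" "residue_independent J id"
  and max: "\<And>v. v \<notin> J \<Longrightarrow> \<not> residue_independent (insert v J) id"
  and v: "v \<in> L" "v \<in> A"
 shows "\<exists>r\<in>lspan base_ring J id. vlt A \<one> (v \<ominus> r)"
proof (cases "v \<in> J")
 note VA = valring_A
 have vc: "v \<in> C" using v(1) L_props(3) by blast
 have Jc: "j \<in> C" if "j \<in> J" for j using residue_independentD(3)[OF J(2) that] by simp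
 {
  case True
  have "id v \<in> lspan base_ring J id"
   by (rule lspan_closed(5)[OF base_props(1) J(1) _ True]) (use Jc in auto)
  moreover have "vlt A \<one> (v \<ominus> v)" using vlt_zero[OF VA one_closed] vc by (simp add: r_neg minus_eq)
  ultimately show ?thesis by (intro bexI[of _ v]) auto
 next
  case False
  have "\<exists>c. (\<forall>j\<in>insert v J. c j \<in> K \<inter> A) \<and> vlt A \<one> (\<Oplus>j\<in>insert v J. c j \<otimes> id j) \<and>
   \<not> (\<forall>j\<in>insert v J. vlt A \<one> (c j))"
  proof (rule ccontr)
   assume n: "\<not> ?thesis"
   have "\<forall>j\<in>insert v J. id j \<in> L \<inter> A" using v residue_independentD(1,2)[OF J(2)] by auto
   hence "residue_independent (insert v J) id" using n unfolding residue_independent_def by blast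
   thus False using max[OF False] by blast
  qed
  then obtain c where c: "\<forall>j\<in>insert v J. c j \<in> K \<inter> A" "vlt A \<one> (\<Oplus>j\<in>insert v J. c j \<otimes> id j)"
   "\<not> (\<forall>j\<in>insert v J. vlt A \<one> (c j))" by blast
  have cB: "c j \<in> base_ring" if "j \<in> insert v J" for j using c(1) that unfolding base_ring_def by blast
  have cc: "c v \<in> C" "\<And>j. j \<in> J \<Longrightarrow> c j \<in> C" using cB base_props(8) by auto
  define s where "s = (\<Oplus>j\<in>J. c j \<otimes> id j)"
  have sc: "s \<in> C" unfolding s_def using cc Jc by (auto intro!: finsum_closed)
  have "(\<Oplus>j\<in>insert v J. c j \<otimes> id j) = c v \<otimes> id v \<oplus> s"
   unfolding s_def by (rule finsum_insert[OF J(1) False]) (use cc vc Jc in auto)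
  hence lt: "vlt A \<one> (c v \<otimes> v \<oplus> s)" using c(2) by simp
  have unit: "c v \<notin> base_ideal"
  proof
   assume "c v \<in> base_ideal"
   hence cv: "vlt A \<one> (c v)" by (simp add: base_ideal_def)
   have "vlt A \<one> (\<ominus> (c v \<otimes> v))"
    by (rule vlt_minus[OF VA vlt_one_mult[OF VA cv v(2) cc(1)]]) (use cc vc in auto)
   hence "vlt A \<one> (c v \<otimes> v \<oplus> s \<oplus> \<ominus> (c v \<otimes> v))"
    by (rule vlt_add[OF VA lt]) (use cc vc sc in auto)
   moreover have "c v \<otimes> v \<oplus> s \<oplus> \<ominus> (c v \<otimes> v) = s" using cc(1) vc sc by algebra
   ultimately have s1: "vlt A \<one> (\<Oplus>j\<in>J. c j \<otimes> id j)" by (simp add: s_def)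
   have "vlt A \<one> (c j)" if "j \<in> J" for j
    using residue_independentD(4)[OF J(2) _ _ s1 that] c(1) by blast
   thus False using c(3) cv by blast
  qed
  have ic: "inv (c v) \<in> base_ring" "c v \<noteq> \<zero>"
   using base_props(7)[OF cB unit] unit base_props(3) by auto
  have icc: "inv (c v) \<in> C" "inv (c v) \<in> A" using ic cc(1) by (auto simp: base_ring_def)
  have mc: "\<ominus> (inv (c v)) \<in> base_ring" by (rule subringE(5)[OF base_props(1) ic(1)])
  note span = lspan_closed[OF base_props(1) J(1), of id]
  have "s \<in> lspan base_ring J id" unfolding s_def by (rule lspanI) (use cB in auto)
  hence "(\<ominus> (inv (c v))) \<otimes> s \<in> lspan base_ring J id" using span(4)[OF _ mc] Jc by auto
  moreover have "v \<ominus> (\<ominus> (inv (c v))) \<otimes> s = (c v \<otimes> v \<oplus> s) \<otimes> inv (c v)"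
  proof -
   have "v \<ominus> (\<ominus> (inv (c v))) \<otimes> s = v \<oplus> inv (c v) \<otimes> s" using vc icc(1) sc by algebra
   also have "\<dots> = inv (c v) \<otimes> (c v \<otimes> v) \<oplus> inv (c v) \<otimes> s" using mult_inv_cancel(2)[OF cc(1) ic(2) vc] by simp
   also have "\<dots> = (c v \<otimes> v \<oplus> s) \<otimes> inv (c v)" using vc icc(1) sc cc(1) by algebra
   finally show ?thesis .
  qed
  moreover have "vlt A \<one> ((c v \<otimes> v \<oplus> s) \<otimes> inv (c v))"
   by (rule vlt_one_mult[OF VA lt icc(2)]) (use cc vc sc in auto)
  ultimately show ?thesis by (intro bexI[of _ "(\<ominus> (inv (c v))) \<otimes> s"]) simp_all
 }
qed

end

section \<open>The residue field extension\<close>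

context valued_extension
begin

text \<open>Passage from lifts to the quotient ring: under the quotient map \<open>\<pi>\<close>,
  independent lifts that generate modulo the maximal ideal become a basis over the image of
  \<open>K \<inter> A\<close>.\<close>

lemma residue_dimension:
 fixes S
 defines "S \<equiv> R\<lparr>carrier := L \<inter> A\<rparr>"
 defines "N \<equiv> {x \<in> L. vlt A \<one> x}"
 assumes J: "finite J" "residue_independent J id"
  and gen: "\<And>v. v \<in> L \<Longrightarrow> v \<in> A \<Longrightarrow> \<exists>r\<in>lspan base_ring J id. vlt A \<one> (v \<ominus> r)"
 shows "ring.dim (S Quot N) ((+>\<^bsub>S\<^esub>) N ` (K \<inter> A)) (carrier (S Quot N)) = card J"
proof -
 note VA = valring_A and cl = valring_closed[OF valring_A] and LS = subringE[OF L_props(2)]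
 have S_simps: "carrier S = L \<inter> A" "(\<otimes>\<^bsub>S\<^esub>) = (\<otimes>)" "(\<oplus>\<^bsub>S\<^esub>) = (\<oplus>)" "\<one>\<^bsub>S\<^esub> = \<one>" "\<zero>\<^bsub>S\<^esub> = \<zero>"
  by (simp_all add: S_def)
 have "subring (L \<inter> A) R"
  by (rule subringI) (use cl LS L_props(3) in auto)
 then interpret S: domain S unfolding S_def by (rule subring_is_domain)
 have Lc: "x \<in> C" if "x \<in> L" for x using that L_props(3) by blast
 have NS: "x \<in> carrier S" if "x \<in> N" for x
  using that vlt_one_in[OF VA _ Lc] by (simp add: N_def S_simps)
 have Nmem: "x \<in> N \<longleftrightarrow> vlt A \<one> x" if "x \<in> carrier S" for x using that by (simp add: N_def S_simps)
 have S_minus: "\<ominus>\<^bsub>S\<^esub> x = \<ominus> x" if x: "x \<in> carrier S" for x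
 proof (rule S.minus_equality)
  have "x \<in> C" using x Lc by (simp add: S_simps)
  thus "\<ominus> x \<oplus>\<^bsub>S\<^esub> x = \<zero>\<^bsub>S\<^esub>" by (simp add: S_simps l_neg)
  show "\<ominus> x \<in> carrier S" using x LS(5) cl(3) by (simp add: S_simps)
 qed (rule x)
 have N_mult: "x \<otimes> a \<in> N" if "x \<in> N" "a \<in> carrier S" for x a
  using that LS(6) vlt_one_mult[OF VA] Lc by (simp add: N_def S_simps)
 have ideal: "ideal N S"
 proof (rule idealI[OF S.ring_axioms])
  show "subgroup N (add_monoid S)"
  proof (rule S.add.subgroupI)
   show "N \<subseteq> carrier S" using NS by blast
   show "N \<noteq> {}" using vlt_zero[OF VA one_closed] LS(2) by (auto simp: N_def)
   show "\<ominus>\<^bsub>S\<^esub> a \<in> N" if "a \<in> N" for a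
    using S_minus[OF NS[OF that]] that vlt_minus[OF VA _ one_closed Lc] LS(5) by (simp add: N_def)
   show "a \<oplus>\<^bsub>S\<^esub> b \<in> N" if "a \<in> N" "b \<in> N" for a b
    using that vlt_add[OF VA _ _ one_closed Lc Lc] LS(7) by (simp add: N_def S_simps)
  qed
  show "x \<otimes>\<^bsub>S\<^esub> a \<in> N" "a \<otimes>\<^bsub>S\<^esub> x \<in> N" if "a \<in> N" "x \<in> carrier S" for a x
   using N_mult[OF that] S.m_comm[OF that(2) NS[OF that(1)]] by (simp_all add: S_simps)
 qed
 interpret N: ideal N S by (rule ideal)
 define Q where "Q = S Quot N"
 define \<pi> where "\<pi> = (+>\<^bsub>S\<^esub>) N"
 have "cring Q" unfolding Q_def by (rule N.quotient_is_cring[OF S.cring_axioms])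
 then interpret Q: cring Q .
 interpret h: ring_hom_cring S Q \<pi>
  unfolding Q_def \<pi>_def by (rule N.rcos_ring_hom_cring[OF S.cring_axioms])
 have zero: "\<zero>\<^bsub>Q\<^esub> = N" by (simp add: Q_def FactRing_def)
 have ker: "\<pi> x = \<zero>\<^bsub>Q\<^esub> \<longleftrightarrow> x \<in> N" if x: "x \<in> carrier S" for x
  using S.a_rcos_zero[OF ideal, of x] N.a_rcos_self[OF x] unfolding zero \<pi>_def by blast
 have Qcar: "carrier Q = \<pi> ` carrier S" by (auto simp: Q_def \<pi>_def FactRing_def A_RCOSETS_def')
 have inverse: "inv x \<in> A \<and> x \<noteq> \<zero> \<and> x \<otimes> inv x = \<one>" if x: "x \<in> carrier S" "\<pi> x \<noteq> \<zero>\<^bsub>Q\<^esub>" for x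
 proof -
  have xc: "x \<in> C" "x \<in> A" using x Lc by (auto simp: S_simps)
  have "\<not> vlt A \<one> x" using ker[OF x(1)] x(2) Nmem[OF x(1)] by blast
  hence "veq A \<one> x" using in_cases[OF VA xc(2)] by blast
  thus ?thesis using unit_in[OF VA] xc by simp
 qed
 have inverse_pi: "\<pi> x \<otimes>\<^bsub>Q\<^esub> \<pi> (inv x) = \<one>\<^bsub>Q\<^esub>" "inv x \<in> carrier S" if x: "x \<in> carrier S" "\<pi> x \<noteq> \<zero>\<^bsub>Q\<^esub>" for x
 proof -
  note i = inverse[OF x]
  show ic: "inv x \<in> carrier S"
   using i subfield_inv_closed[OF L_props(1)] x(1) by (simp add: S_simps)
  have "\<pi> x \<otimes>\<^bsub>Q\<^esub> \<pi> (inv x) = \<pi> (x \<otimes>\<^bsub>S\<^esub> inv x)" by (rule h.hom_mult[symmetric, OF x(1) ic])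
  also have "\<dots> = \<pi> \<one>\<^bsub>S\<^esub>" using i by (simp add: S_simps)
  finally show "\<pi> x \<otimes>\<^bsub>Q\<^esub> \<pi> (inv x) = \<one>\<^bsub>Q\<^esub>" by simp
 qed
 have "field Q"
 proof (rule Q.cring_fieldI2)
  have "\<pi> \<one>\<^bsub>S\<^esub> \<noteq> \<zero>\<^bsub>Q\<^esub>"
   using ker[OF S.one_closed] Nmem[OF S.one_closed] vlt_irrefl[OF VA one_closed] by (simp add: S_simps)
  thus "\<zero>\<^bsub>Q\<^esub> \<noteq> \<one>\<^bsub>Q\<^esub>" by auto
  fix a assume a: "a \<in> carrier Q" "a \<noteq> \<zero>\<^bsub>Q\<^esub>"
  then obtain x where x: "x \<in> carrier S" "a = \<pi> x" by (auto simp: Qcar)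
  thus "\<exists>b\<in>carrier Q. a \<otimes>\<^bsub>Q\<^esub> b = \<one>\<^bsub>Q\<^esub>"
   using inverse_pi[of x] a(2) by (intro bexI[of _ "\<pi> (inv x)"]) auto
 qed
 then interpret Q: field Q .
 let ?k = "\<pi> ` (K \<inter> A)"
 have KS: "x \<in> carrier S" if "x \<in> K \<inter> A" for x using that L_props(4) by (auto simp: S_simps)
 have k: "subfield ?k Q"
 proof (rule Q.subfieldI')
  note BS = subringE[OF base_props(1), unfolded base_ring_def]
  show "subring ?k Q"
  proof (rule Q.subringI)
   show "?k \<subseteq> carrier Q" using KS by auto
   show "\<one>\<^bsub>Q\<^esub> \<in> ?k" using BS(3) by (intro image_eqI[of _ _ "\<one>"]) (auto simp: S_simps(4)[symmetric])
   fix a b assume "a \<in> ?k" "b \<in> ?k"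
   then obtain x y where xy: "x \<in> K \<inter> A" "a = \<pi> x" "y \<in> K \<inter> A" "b = \<pi> y" by blast
   have "\<ominus>\<^bsub>Q\<^esub> a = \<pi> (\<ominus> x)" unfolding xy(2) using h.hom_a_inv[OF KS[OF xy(1)]] S_minus[OF KS[OF xy(1)]] by simp
   thus "\<ominus>\<^bsub>Q\<^esub> a \<in> ?k" using BS(5)[OF xy(1)] by blast
   have "a \<otimes>\<^bsub>Q\<^esub> b = \<pi> (x \<otimes> y)"
    unfolding xy(2,4) using h.hom_mult[OF KS[OF xy(1)] KS[OF xy(3)]] by (simp add: S_simps)
   thus "a \<otimes>\<^bsub>Q\<^esub> b \<in> ?k" using BS(6)[OF xy(1,3)] by blast
   have "a \<oplus>\<^bsub>Q\<^esub> b = \<pi> (x \<oplus> y)"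
    unfolding xy(2,4) using h.hom_add[OF KS[OF xy(1)] KS[OF xy(3)]] by (simp add: S_simps)
   thus "a \<oplus>\<^bsub>Q\<^esub> b \<in> ?k" using BS(7)[OF xy(1,3)] by blast
  qed
  fix a assume "a \<in> ?k - {\<zero>\<^bsub>Q\<^esub>}"
  then obtain x where x: "x \<in> K \<inter> A" "a = \<pi> x" "\<pi> x \<noteq> \<zero>\<^bsub>Q\<^esub>" by blast
  note i = inverse[OF KS[OF x(1)] x(3)] inverse_pi[OF KS[OF x(1)] x(3)]
  have "inv\<^bsub>Q\<^esub> a = \<pi> (inv x)"
   unfolding x(2) by (rule Q.comm_inv_char) (use i KS[OF x(1)] in auto)
  moreover have "inv x \<in> K \<inter> A" using subfield_inv_closed[OF K_props(1)] x(1) i(1) by blast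
  ultimately show "inv\<^bsub>Q\<^esub> a \<in> ?k" by blast
 qed
 have JS: "j \<in> carrier S" if "j \<in> J" for j using residue_independentD(1,2)[OF J(2) that] by (simp add: S_simps)
 have finsum_S: "finsum S f I = finsum R f I" if "finite I" "f \<in> I \<rightarrow> carrier S" for f I
  using that
 proof (induction I rule: finite_induct)
  case (insert i I)
  hence f: "f \<in> I \<rightarrow> carrier S" "f i \<in> carrier S" "f \<in> I \<rightarrow> C" "f i \<in> C"
   using Lc by (auto simp: S_simps)
  thus ?case using insert by (simp add: S_simps)
 qed (simp add: S_simps)
 have sum_pi: "(\<Oplus>\<^bsub>Q\<^esub>j\<in>J. \<pi> (c j) \<otimes>\<^bsub>Q\<^esub> \<pi> j) = \<pi> (\<Oplus>j\<in>J. c j \<otimes> id j)" "(\<Oplus>j\<in>J. c j \<otimes> id j) \<in> carrier S"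
  if c: "\<And>j. j \<in> J \<Longrightarrow> c j \<in> K \<inter> A" for c
 proof -
  have cS: "(\<lambda>j. c j \<otimes>\<^bsub>S\<^esub> j) \<in> J \<rightarrow> carrier S" using KS[OF c] JS by auto
  have e: "finsum S (\<lambda>j. c j \<otimes>\<^bsub>S\<^esub> j) J = (\<Oplus>j\<in>J. c j \<otimes> id j)"
   using finsum_S[OF J(1) cS] by (simp add: S_simps)
  show "(\<Oplus>j\<in>J. c j \<otimes> id j) \<in> carrier S" unfolding e[symmetric] by (rule S.finsum_closed[OF cS])
  have "(\<Oplus>\<^bsub>Q\<^esub>j\<in>J. \<pi> (c j) \<otimes>\<^bsub>Q\<^esub> \<pi> j) = finsum Q (\<pi> \<circ> (\<lambda>j. c j \<otimes>\<^bsub>S\<^esub> j)) J"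
   by (rule Q.finsum_cong') (use KS[OF c] JS in auto)
  also have "\<dots> = \<pi> (finsum S (\<lambda>j. c j \<otimes>\<^bsub>S\<^esub> j) J)" by (rule h.hom_finsum[symmetric, OF cS])
  finally show "(\<Oplus>\<^bsub>Q\<^esub>j\<in>J. \<pi> (c j) \<otimes>\<^bsub>Q\<^esub> \<pi> j) = \<pi> (\<Oplus>j\<in>J. c j \<otimes> id j)" unfolding e .
 qed
 have lin: "Q.lin_indep ?k J \<pi>"
  unfolding Q.lin_indep_def
 proof (intro allI impI ballI)
  fix a j0 assume a: "\<forall>j\<in>J. a j \<in> ?k" and z: "(\<Oplus>\<^bsub>Q\<^esub>j\<in>J. a j \<otimes>\<^bsub>Q\<^esub> \<pi> j) = \<zero>\<^bsub>Q\<^esub>" and j0: "j0 \<in> J"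
  have "\<forall>j\<in>J. \<exists>c. c \<in> K \<inter> A \<and> a j = \<pi> c" using a by blast
  then obtain c where "\<forall>j\<in>J. c j \<in> K \<inter> A \<and> a j = \<pi> (c j)" by (rule bchoice[elim_format]) blast
  hence c: "\<And>j. j \<in> J \<Longrightarrow> c j \<in> K \<inter> A" "\<And>j. j \<in> J \<Longrightarrow> a j = \<pi> (c j)" by auto
  have "(\<Oplus>\<^bsub>Q\<^esub>j\<in>J. a j \<otimes>\<^bsub>Q\<^esub> \<pi> j) = (\<Oplus>\<^bsub>Q\<^esub>j\<in>J. \<pi> (c j) \<otimes>\<^bsub>Q\<^esub> \<pi> j)"
   by (rule Q.finsum_cong') (use KS[OF c(1)] JS c(2) in auto)
  hence "\<pi> (\<Oplus>j\<in>J. c j \<otimes> id j) = \<zero>\<^bsub>Q\<^esub>" using z sum_pi(1)[of c, OF c(1)] by simp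
  hence lt: "vlt A \<one> (\<Oplus>j\<in>J. c j \<otimes> id j)"
   using ker[OF sum_pi(2)[of c, OF c(1)]] Nmem[OF sum_pi(2)[of c, OF c(1)]] by blast
  have "vlt A \<one> (c j0)"
   by (rule residue_independentD(4)[OF J(2) _ _ lt j0]) (use c(1) in auto)
  thus "a j0 = \<zero>\<^bsub>Q\<^esub>" using c(2)[OF j0] ker[OF KS[OF c(1)[OF j0]]] Nmem[OF KS[OF c(1)[OF j0]]] by simp
 qed
 have piJ: "\<pi> \<in> J \<rightarrow> carrier Q" using JS by auto
 have "Q.lspan ?k J \<pi> = carrier Q"
 proof
  show "Q.lspan ?k J \<pi> \<subseteq> carrier Q" by (rule Q.lspan_closed(1)[OF subfieldE(1)[OF k] J(1) piJ])
  show "carrier Q \<subseteq> Q.lspan ?k J \<pi>"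
  proof
   fix q assume "q \<in> carrier Q"
   then obtain v where v: "v \<in> carrier S" "q = \<pi> v" by (auto simp: Qcar)
   then obtain r where r: "r \<in> lspan base_ring J id" "vlt A \<one> (v \<ominus> r)" using gen by (auto simp: S_simps)
   obtain c where c: "\<And>j. j \<in> J \<Longrightarrow> c j \<in> base_ring" "r = (\<Oplus>j\<in>J. c j \<otimes> id j)"
    using r(1) by (rule lspan_obtain) blast
   have cK: "c j \<in> K \<inter> A" if "j \<in> J" for j using c(1)[OF that] by (simp add: base_ring_def)
   have rS: "r \<in> carrier S" unfolding c(2) by (rule sum_pi(2)[of c, OF cK])
   have "v \<ominus>\<^bsub>S\<^esub> r = v \<ominus> r" unfolding a_minus_def S_minus[OF rS] by (simp add: S_simps)
   hence "v \<ominus>\<^bsub>S\<^esub> r \<in> N" using Nmem[OF S.minus_closed[OF v(1) rS]] r(2) by simp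
   hence "\<pi> v = \<pi> r" using S.quotient_eq_iff_same_a_r_cos[OF ideal v(1) rS] by (simp add: \<pi>_def)
   hence "q = (\<Oplus>\<^bsub>Q\<^esub>j\<in>J. \<pi> (c j) \<otimes>\<^bsub>Q\<^esub> \<pi> j)" using v(2) sum_pi(1)[of c, OF cK] c(2) by simp
   thus "q \<in> Q.lspan ?k J \<pi>" using Q.lspanI[of J "\<lambda>j. \<pi> (c j)" ?k \<pi>] cK by simp
  qed
 qed
 hence "Q.dimension (card J) ?k (carrier Q)" using Q.dimension_lspan[OF k J(1) piJ lin] by simp
 hence "Q.dim ?k (carrier Q) = card J" using Q.dimI[OF k] by (simp add: over_def)
 thus ?thesis by (simp add: Q_def \<pi>_def)
qed

end

context trace_transversal
begin

lemma T_nonempty: "T \<noteq> {}" using T_cover[OF auts_id] by blast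

text \<open>The fundamental inequality with the single residue 1; it bounds families before the
  ramification index is known to be finite.\<close>

lemma value_independent_card_le:
 assumes x: "value_independent I x" and I: "finite I"
 shows "card I \<le> n"
proof -
 have "residue_independent {()} (\<lambda>_. \<one>)"
  unfolding residue_independent_def
 proof (intro conjI ballI allI impI)
  show "\<one> \<in> L \<inter> A" using subringE(3)[OF L_props(2)] valring_closed(2)[OF valring_A] by simp
  fix c :: "unit \<Rightarrow> 'a" and j
  assume c: "\<forall>j\<in>{()}. c j \<in> K \<inter> A" and "vlt A \<one> (\<Oplus>j\<in>{()}. c j \<otimes> \<one>)"
  moreover have "c () \<in> C" using c K_props(3) by auto
  ultimately show "vlt A \<one> (c j)" by simp
 qed
 hence "card T * card I * card {()} \<le> n" by (intro value_residue_card_le[OF x _ I]) simp_all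
 hence "card T * card I \<le> n" by simp
 moreover have "card T \<ge> 1" using T_nonempty finite_T by (simp add: Suc_le_eq card_gt_0_iff)
 ultimately show ?thesis using mult_le_mono1[of 1 "card T" "card I"] by linarith
qed

lemma residue_independent_card_le:
 assumes y: "residue_independent J y" and J: "finite J"
 shows "card J \<le> n"
proof -
 have "value_independent {()} (\<lambda>_. \<one>)"
  using subringE(3)[OF L_props(2)] by (simp add: value_independent_def)
 hence "card T * card {()} * card J \<le> n" by (intro value_residue_card_le[OF _ y _ J]) simp_all
 hence "card T * card J \<le> n" by simp
 moreover have "card T \<ge> 1" using T_nonempty finite_T by (simp add: Suc_le_eq card_gt_0_iff)
 ultimately show ?thesis using mult_le_mono1[of 1 "card T" "card J"] by linarith
qed

text \<open>Independent sets have at most \<open>n\<close> elements, so a largest one exists. It is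
  nonempty because the residue of 1 is not zero, which makes the residue degree positive.\<close>

lemma maximal_residue_family:
 "\<exists>J. finite J \<and> J \<noteq> {} \<and> residue_independent J id \<and>
  (\<forall>v. v \<in> L \<longrightarrow> v \<in> A \<longrightarrow> (\<exists>r\<in>lspan base_ring J id. vlt A \<one> (v \<ominus> r)))"
proof -
 define P where "P J \<longleftrightarrow> finite J \<and> residue_independent J id" for J :: "'a set"
 have "P {}" by (simp add: P_def residue_independent_def)
 moreover have "\<forall>J. P J \<longrightarrow> card J < Suc n" using residue_independent_card_le by (auto simp: P_def less_Suc_eq_le)
 ultimately have "\<exists>J. P J \<and> (\<forall>J'. P J' \<longrightarrow> card J' \<le> card J)" by (rule ex_has_greatest_nat)
 then obtain J where J: "P J" "\<And>J'. P J' \<Longrightarrow> card J' \<le> card J" by blast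
 have fin: "finite J" "residue_independent J id" using J(1) by (auto simp: P_def)
 have "\<not> residue_independent (insert v J) id" if "v \<notin> J" for v
 proof
  assume "residue_independent (insert v J) id"
  hence "P (insert v J)" using fin(1) by (simp add: P_def)
  thus False using J(2)[of "insert v J"] fin(1) that by simp
 qed
 hence gen: "\<exists>r\<in>lspan base_ring J id. vlt A \<one> (v \<ominus> r)" if "v \<in> L" "v \<in> A" for v
  using residue_generation[OF fin _ that] by blast
 have "J \<noteq> {}"
 proof
  assume "J = {}"
  then obtain r where r: "r \<in> lspan base_ring {} id" "vlt A \<one> (\<one> \<ominus> r)"
   using gen[of \<one>] subringE(3)[OF L_props(2)] valring_closed(2)[OF valring_A] by auto
  have "r = \<zero>" using r(1) by (auto simp: lspan_def)
  thus False using r(2) vlt_irrefl[OF valring_A one_closed] by (simp add: minus_eq)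
 qed
 thus ?thesis using fin gen by blast
qed

end

section \<open>Value groups and the final count\<close>

context trace_transversal
begin

context
 fixes G :: "('g, 'm) ordered_group_scheme" and w
 assumes W: "valuation (R\<lparr>carrier := L\<rparr>) G w"
  and w_ring: "valuation_ring (R\<lparr>carrier := L\<rparr>) G w = L \<inter> A"
begin

interpretation W: valuation "R\<lparr>carrier := L\<rparr>" G w by (rule W)

lemma value_mult: "x \<in> L \<Longrightarrow> y \<in> L \<Longrightarrow> x \<noteq> \<zero> \<Longrightarrow> y \<noteq> \<zero> \<Longrightarrow> w (x \<otimes> y) = w x \<otimes>\<^bsub>G\<^esub> w y"
 using W.v_mult[of x y] by simp

lemma value_carrier: "x \<in> L \<Longrightarrow> x \<noteq> \<zero> \<Longrightarrow> w x \<in> carrier G"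
 using W.value_closed[of x] by simp

lemma value_surj: "g \<in> carrier G \<Longrightarrow> \<exists>x. x \<in> L \<and> x \<noteq> \<zero> \<and> w x = g"
proof -
 assume "g \<in> carrier G"
 hence "g \<in> w ` (L - {\<zero>})" using W.v_surj by simp
 thus ?thesis by blast
qed

lemma in_ring_iff: "x \<in> L \<Longrightarrow> x \<noteq> \<zero> \<Longrightarrow> x \<in> A \<longleftrightarrow> \<one>\<^bsub>G\<^esub> \<preceq>\<^bsub>G\<^esub> w x"
 using w_ring by (auto simp: valuation_ring_def set_eq_iff)

lemma vle_value:
 assumes x: "x \<in> L" "x \<noteq> \<zero>" and y: "y \<in> L" "y \<noteq> \<zero>"
 shows "vle A x y \<longleftrightarrow> w x \<preceq>\<^bsub>G\<^esub> w y"
proof -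
 have c: "x \<in> C" "y \<in> C" using x y L_props(3) by auto
 define q where "q = inv x \<otimes> y"
 have q: "q \<in> L" "q \<noteq> \<zero>" "q \<otimes> x = y"
  using subringE(6)[OF L_props(2) subfield_inv_closed[OF L_props(1) x] y(1)] c x y
  by (auto simp: q_def integral_iff m_assoc m_comm[of y])
 have "w y = w q \<otimes>\<^bsub>G\<^esub> w x" using value_mult[OF q(1) x(1) q(2) x(2)] q(3) by simp
 hence "w x \<preceq>\<^bsub>G\<^esub> w y \<longleftrightarrow> \<one>\<^bsub>G\<^esub> \<otimes>\<^bsub>G\<^esub> w x \<preceq>\<^bsub>G\<^esub> w q \<otimes>\<^bsub>G\<^esub> w x" using value_carrier[OF x] by simp
 also have "\<dots> \<longleftrightarrow> \<one>\<^bsub>G\<^esub> \<preceq>\<^bsub>G\<^esub> w q" by (rule W.G.gle_cancel) (use value_carrier q x in auto)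
 also have "\<dots> \<longleftrightarrow> q \<in> A" using in_ring_iff[OF q(1,2)] by simp
 finally show ?thesis using vle_iff_div[OF valring_A c x(2)] by (simp add: q_def)
qed

lemma veq_value:
 assumes x: "x \<in> L" "x \<noteq> \<zero>" and y: "y \<in> L" "y \<noteq> \<zero>"
 shows "veq A x y \<longleftrightarrow> w x = w y"
 unfolding veq_def vle_value[OF x y] vle_value[OF y x]
 using W.G.gle_refl W.G.gle_antisym value_carrier[OF x] value_carrier[OF y] by auto

lemma vlt_value:
 assumes x: "x \<in> L" "x \<noteq> \<zero>" and y: "y \<in> L" "y \<noteq> \<zero>"
 shows "vlt A x y \<longleftrightarrow> w x \<prec>\<^bsub>G\<^esub> w y"
 unfolding vlt_def vle_value[OF y x] gless_def
 using W.G.gle_refl W.G.gle_antisym W.G.gle_total value_carrier[OF x] value_carrier[OF y] by metis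

lemma value_of_one: "w \<one> = \<one>\<^bsub>G\<^esub>" using W.value_one by simp

abbreviation (input) base_values where "base_values \<equiv> value_subgroup (R\<lparr>carrier := L\<rparr>) G w K"

lemma base_values_eq: "base_values = w ` (K - {\<zero>})"
 by (simp add: value_subgroup_def)

lemma base_values_subgroup: "subgroup base_values G"
proof -
 have "subfield K (R\<lparr>carrier := L\<rparr>)"
  by (rule W.F.subfield_iff(1)) (use subfield_iff(2)[OF K_props(1)] L_props(4) in simp_all)
 thus ?thesis using W.value_subgroup by (simp add: value_subgroup_def)
qed

lemma value_independent_cosets:
 assumes z: "\<And>i. i \<in> I \<Longrightarrow> z i \<in> L \<and> z i \<noteq> \<zero>"
  and inj: "\<And>i j. i \<in> I \<Longrightarrow> j \<in> I \<Longrightarrow> base_values #>\<^bsub>G\<^esub> w (z i) = base_values #>\<^bsub>G\<^esub> w (z j) \<Longrightarrow> i = j"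
 shows "value_independent I z"
 unfolding value_independent_def
proof (intro conjI ballI impI notI)
 fix i j c assume ij: "i \<in> I" "j \<in> I" "i \<noteq> j" and c: "c \<in> K" "c \<noteq> \<zero>" and eq: "veq A (c \<otimes> z i) (z j)"
 have cL: "c \<in> L" "c \<in> C" using c(1) L_props(3,4) by auto
 have zi: "z i \<in> L" "z i \<noteq> \<zero>" "z i \<in> C" and zj: "z j \<in> L" "z j \<noteq> \<zero>" using z ij L_props(3) by auto
 have p: "c \<otimes> z i \<in> L" "c \<otimes> z i \<noteq> \<zero>"
  using subringE(6)[OF L_props(2) cL(1) zi(1)] cL(2) zi c(2) by (auto simp: integral_iff)
 have "w (z j) = w c \<otimes>\<^bsub>G\<^esub> w (z i)"
  using eq veq_value[OF p zj] value_mult[OF cL(1) zi(1) c(2) zi(2)] by simp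
 moreover have "w c \<in> base_values" using c by (simp add: base_values_eq)
 ultimately have "w (z j) \<in> base_values #>\<^bsub>G\<^esub> w (z i)" by (auto simp: r_coset_def)
 hence "base_values #>\<^bsub>G\<^esub> w (z i) = base_values #>\<^bsub>G\<^esub> w (z j)"
  using W.G.repr_independence value_carrier[OF zi(1,2)] base_values_subgroup by blast
 thus False using inj ij by blast
qed (use z in auto)

lemma value_independent_subset: "value_independent I z \<Longrightarrow> I' \<subseteq> I \<Longrightarrow> value_independent I' z"
 unfolding value_independent_def by blast

lemma value_independent_finite:
 assumes z: "value_independent I z"
 shows "finite I"
proof (rule ccontr)
 assume "infinite I"
 then obtain I' where I': "finite I'" "card I' = Suc n" "I' \<subseteq> I" using infinite_arbitrarily_large by blast
 have "card I' \<le> n" by (rule value_independent_card_le[OF value_independent_subset[OF z I'(3)] I'(1)])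
 thus False using I'(2) by simp
qed

text \<open>Indexing by the cosets themselves lets the bound on independent families show that there
  are finitely many cosets; only then does \<open>card\<close> give the true index rather than its
  default 0.\<close>

lemma ramification_family:
 "\<exists>z. value_independent (rcosets\<^bsub>G\<^esub> base_values) z"
proof -
 let ?Q = "rcosets\<^bsub>G\<^esub> base_values"
 have "\<forall>q\<in>?Q. \<exists>x. x \<in> L \<and> x \<noteq> \<zero> \<and> base_values #>\<^bsub>G\<^esub> w x = q"
 proof
  fix q assume "q \<in> ?Q"
  then obtain g where g: "g \<in> carrier G" "q = base_values #>\<^bsub>G\<^esub> g" by (auto simp: RCOSETS_def)
  then obtain x where "x \<in> L" "x \<noteq> \<zero>" "w x = g" using value_surj[OF g(1)] by blast
  thus "\<exists>x. x \<in> L \<and> x \<noteq> \<zero> \<and> base_values #>\<^bsub>G\<^esub> w x = q" using g(2) by blast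
 qed
 then obtain z where z: "\<forall>q\<in>?Q. z q \<in> L \<and> z q \<noteq> \<zero> \<and> base_values #>\<^bsub>G\<^esub> w (z q) = q"
  by (rule bchoice[elim_format]) blast
 have "value_independent ?Q z"
  by (rule value_independent_cosets) (use z in auto)
 thus ?thesis by blast
qed

lemma rcosets_nonempty: "rcosets\<^bsub>G\<^esub> base_values \<noteq> {}"
 by (auto simp: RCOSETS_def)

definition initial_values where
 "initial_values = {g \<in> carrier G. \<one>\<^bsub>G\<^esub> \<preceq>\<^bsub>G\<^esub> g \<and> (\<forall>d\<in>base_values. \<one>\<^bsub>G\<^esub> \<prec>\<^bsub>G\<^esub> d \<longrightarrow> g \<prec>\<^bsub>G\<^esub> d)}"

text \<open>A positive \<open>d\<close> would lie strictly above \<open>h\<close>; but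
  \<open>h\<close> is composed of \<open>d\<close> and the nonnegative \<open>g\<close>, so it is
  not below \<open>d\<close>.\<close>

lemma initial_values_eq_one_sided:
 assumes g: "g \<in> initial_values" and h: "h \<in> initial_values"
  and d: "d \<in> base_values" "h = d \<otimes>\<^bsub>G\<^esub> g" "\<one>\<^bsub>G\<^esub> \<preceq>\<^bsub>G\<^esub> d"
 shows "d = \<one>\<^bsub>G\<^esub>"
proof (rule ccontr)
 assume "d \<noteq> \<one>\<^bsub>G\<^esub>"
 hence "\<one>\<^bsub>G\<^esub> \<prec>\<^bsub>G\<^esub> d" using d(3) by (auto simp: gless_def)
 hence lt: "h \<prec>\<^bsub>G\<^esub> d" using h d(1) by (simp add: initial_values_def)
 have c: "g \<in> carrier G" "h \<in> carrier G" "\<one>\<^bsub>G\<^esub> \<preceq>\<^bsub>G\<^esub> g" "d \<in> carrier G"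
  using g h d(1) subgroup.subset[OF base_values_subgroup] by (auto simp: initial_values_def)
 have "\<one>\<^bsub>G\<^esub> \<otimes>\<^bsub>G\<^esub> d \<preceq>\<^bsub>G\<^esub> g \<otimes>\<^bsub>G\<^esub> d" by (rule W.G.gle_mult) (use c in auto)
 hence "d \<preceq>\<^bsub>G\<^esub> h" using c d(2) by (simp add: W.G.m_comm)
 thus False using lt W.G.gle_antisym[OF c(2,4)] by (auto simp: gless_def)
qed

text \<open>Two initial values in one coset differ by a value \<open>d\<close> of \<open>K\<close>,
  and either \<open>d\<close> or its inverse is nonnegative, so the one-sided statement applies in
  one of the two directions. This is why the initial index is at most the ramification
  index.\<close>

lemma initial_values_coset_inj:
 assumes g: "g \<in> initial_values" and h: "h \<in> initial_values"
  and eq: "base_values #>\<^bsub>G\<^esub> g = base_values #>\<^bsub>G\<^esub> h"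
 shows "g = h"
proof -
 have c: "g \<in> carrier G" "h \<in> carrier G" using g h by (auto simp: initial_values_def)
 have "h \<in> base_values #>\<^bsub>G\<^esub> g" by (rule W.G.repr_independenceD[OF base_values_subgroup c(2) eq])
 then obtain d where d: "d \<in> base_values" "h = d \<otimes>\<^bsub>G\<^esub> g" by (auto simp: r_coset_def)
 have dc: "d \<in> carrier G" using d(1) subgroup.subset[OF base_values_subgroup] by blast
 have id: "inv\<^bsub>G\<^esub> d \<in> base_values" by (rule subgroup.m_inv_closed[OF base_values_subgroup d(1)])
 have g': "g = inv\<^bsub>G\<^esub> d \<otimes>\<^bsub>G\<^esub> h" using c dc d(2) by (simp add: W.G.m_assoc[symmetric])
 have "d = \<one>\<^bsub>G\<^esub>"
  using W.G.gle_total[OF W.G.one_closed dc]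
 proof
  assume "d \<preceq>\<^bsub>G\<^esub> \<one>\<^bsub>G\<^esub>"
  hence "d \<otimes>\<^bsub>G\<^esub> inv\<^bsub>G\<^esub> d \<preceq>\<^bsub>G\<^esub> \<one>\<^bsub>G\<^esub> \<otimes>\<^bsub>G\<^esub> inv\<^bsub>G\<^esub> d"
   using W.G.gle_mult[of d "\<one>\<^bsub>G\<^esub>" "inv\<^bsub>G\<^esub> d"] dc by simp
  hence "\<one>\<^bsub>G\<^esub> \<preceq>\<^bsub>G\<^esub> inv\<^bsub>G\<^esub> d" using dc by simp
  hence "inv\<^bsub>G\<^esub> d = \<one>\<^bsub>G\<^esub>" by (rule initial_values_eq_one_sided[OF h g id g'])
  thus ?thesis using dc by (metis W.G.inv_inv W.G.inv_one)
 qed (rule initial_values_eq_one_sided[OF g h d])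
 thus ?thesis using d(2) c(1) by simp
qed

lemma initial_values_card:
 assumes fin: "finite (rcosets\<^bsub>G\<^esub> base_values)"
 shows "finite initial_values" "card initial_values \<le> card (rcosets\<^bsub>G\<^esub> base_values)"
proof -
 have inj: "inj_on (\<lambda>g. base_values #>\<^bsub>G\<^esub> g) initial_values"
  by (rule inj_onI) (rule initial_values_coset_inj)
 have im: "(\<lambda>g. base_values #>\<^bsub>G\<^esub> g) ` initial_values \<subseteq> rcosets\<^bsub>G\<^esub> base_values"
  by (auto simp: initial_values_def RCOSETS_def)
 show "finite initial_values" by (rule inj_on_finite[OF inj im fin])
 show "card initial_values \<le> card (rcosets\<^bsub>G\<^esub> base_values)" by (rule card_inj_on_le[OF inj im fin])
qed

text \<open>The initial values are exactly the values of small integral elements of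
  \<open>L\<close>. The family is thus fit for building integral elements and at the same time
  complete for the approximation modulo the extended ideal.\<close>

lemma initial_family:
 "\<exists>z. value_independent initial_values z \<and> (\<forall>g\<in>initial_values. z g \<in> L \<inter> A \<and> small (z g)) \<and>
  (\<forall>v. v \<in> L \<longrightarrow> v \<in> A \<longrightarrow> small v \<longrightarrow> (\<exists>g\<in>initial_values. veq A (z g) v))"
proof -
 have "\<forall>g\<in>initial_values. \<exists>x. x \<in> L \<and> x \<noteq> \<zero> \<and> w x = g" using value_surj by (simp add: initial_values_def)
 then obtain z where "\<forall>g\<in>initial_values. z g \<in> L \<and> z g \<noteq> \<zero> \<and> w (z g) = g"
  by (rule bchoice[elim_format]) blast
 hence z: "\<And>g. g \<in> initial_values \<Longrightarrow> z g \<in> L" "\<And>g. g \<in> initial_values \<Longrightarrow> z g \<noteq> \<zero>"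
  "\<And>g. g \<in> initial_values \<Longrightarrow> w (z g) = g" by auto
 have small_iff: "small v \<longleftrightarrow> (\<forall>d\<in>base_values. \<one>\<^bsub>G\<^esub> \<prec>\<^bsub>G\<^esub> d \<longrightarrow> w v \<prec>\<^bsub>G\<^esub> d)" if v: "v \<in> L" "v \<noteq> \<zero>" for v
 proof -
  have vc: "v \<in> C" using v(1) L_props(3) by blast
  have one: "\<one> \<in> L" using subringE(3)[OF L_props(2)] .
  have KL: "d \<in> L" if "d \<in> K" for d using that L_props(4) by blast
  have "small v \<longleftrightarrow> (\<forall>d\<in>K - {\<zero>}. vlt A \<one> d \<longrightarrow> vlt A v d)"
   using vlt_zero[OF valring_A vc] v(2) by (auto simp: small_def base_ideal_def)
  also have "\<dots> \<longleftrightarrow> (\<forall>d\<in>K - {\<zero>}. \<one>\<^bsub>G\<^esub> \<prec>\<^bsub>G\<^esub> w d \<longrightarrow> w v \<prec>\<^bsub>G\<^esub> w d)"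
   using vlt_value[OF one one_not_zero KL] vlt_value[OF v KL] value_of_one by auto
  finally show ?thesis by (simp add: base_values_eq)
 qed
 have "value_independent initial_values z"
  by (rule value_independent_cosets) (use z initial_values_coset_inj in auto)
 moreover have "z g \<in> L \<inter> A \<and> small (z g)" if g: "g \<in> initial_values" for g
  using z[OF g] g in_ring_iff[OF z(1)[OF g] z(2)[OF g]] small_iff[OF z(1)[OF g] z(2)[OF g]] by (simp add: initial_values_def)
 moreover have "\<exists>g\<in>initial_values. veq A (z g) v" if v: "v \<in> L" "v \<in> A" "small v" for v
 proof -
  have "\<zero> \<in> base_ideal" by (rule base_props(3))
  hence v0: "v \<noteq> \<zero>" using v(3) vlt_irrefl[OF valring_A zero_closed] by (auto simp: small_def)
  have g: "w v \<in> initial_values"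
   using small_iff[OF v(1) v0] v in_ring_iff[OF v(1) v0] value_carrier[OF v(1) v0] by (simp add: initial_values_def)
  thus ?thesis using veq_value[OF z(1)[OF g] z(2)[OF g] v(1) v0] z(3)[OF g] by blast
 qed
 ultimately show ?thesis by blast
qed

lemma residue_degree_eq:
 assumes J: "finite J" "residue_independent J id"
  and gen: "\<And>v. v \<in> L \<Longrightarrow> v \<in> A \<Longrightarrow> \<exists>r\<in>lspan base_ring J id. vlt A \<one> (v \<ominus> r)"
 shows "residue_degree (R\<lparr>carrier := L\<rparr>) G w K = card J"
proof -
 have one: "\<one> \<in> L" using subringE(3)[OF L_props(2)] .
 have "x \<in> L \<and> (x = \<zero> \<or> \<one>\<^bsub>G\<^esub> \<prec>\<^bsub>G\<^esub> w x) \<longleftrightarrow> x \<in> L \<and> vlt A \<one> x" for x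
  using vlt_value[OF one one_not_zero, of x] value_of_one vlt_zero[OF valring_A one_closed]
  by (cases "x = \<zero>") auto
 hence ideal: "valuation_ideal (R\<lparr>carrier := L\<rparr>) G w = {x \<in> L. vlt A \<one> x}"
  by (simp add: valuation_ideal_def)
 have "restricted_ring (R\<lparr>carrier := L\<rparr>) G w K = K \<inter> (L \<inter> A)"
  using W.valuation_ring_restrict[of K] L_props(4) by (simp add: w_ring)
 hence base: "restricted_ring (R\<lparr>carrier := L\<rparr>) G w K = K \<inter> A" using L_props(4) by blast
 show ?thesis
  using residue_dimension[OF J gen]
  unfolding residue_degree_def residue_field_def residue_subfield_def ideal base w_ring by simp
qed

text \<open>\<open>degree_le\<close> and \<open>degree_ge\<close> give \<open>g * m = n\<close>,
  which converts bounds on \<open>n\<close> into statements on the local degree \<open>m\<close>;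
  \<open>g\<close> and \<open>f\<close> are positive and can be cancelled. Positivity of
  \<open>e * f\<close> is exported because the defect is a quotient.\<close>

lemma finite_iff_invariants:
 assumes t: "separating t" "t \<in> hensel A" and m: "dimension m (hensel A) compositum"
 defines "e \<equiv> ramification_index (R\<lparr>carrier := L\<rparr>) G w K"
  and "f \<equiv> residue_degree (R\<lparr>carrier := L\<rparr>) G w K"
 shows "finite_submodule R base_ring integral_part \<longleftrightarrow> m = e * f \<and> initial_index G base_values = e"
  and "e * f > 0"
proof -
 define \<epsilon> where "\<epsilon> = initial_index G base_values"
 define g where "g = card T"
 have degree: "g * m = n" using degree_le[OF m] degree_ge[OF t m] by (simp add: g_def)
 have g1: "g > 0" using T_nonempty finite_T by (simp add: g_def card_gt_0_iff)
 obtain y where y: "value_independent (rcosets\<^bsub>G\<^esub> base_values) y" using ramification_family by blast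
 have finQ: "finite (rcosets\<^bsub>G\<^esub> base_values)" by (rule value_independent_finite[OF y])
 have e: "e = card (rcosets\<^bsub>G\<^esub> base_values)" by (simp add: e_def ramification_index_def)
 have e1: "e > 0" using finQ rcosets_nonempty by (simp add: e card_gt_0_iff)
 obtain z where z: "value_independent initial_values z" "\<forall>h\<in>initial_values. z h \<in> L \<inter> A \<and> small (z h)"
  "\<forall>v. v \<in> L \<longrightarrow> v \<in> A \<longrightarrow> small v \<longrightarrow> (\<exists>h\<in>initial_values. veq A (z h) v)"
  using initial_family by blast
 have eps: "\<epsilon> = card initial_values" by (simp add: \<epsilon>_def initial_index_def initial_values_def)
 note finI = initial_values_card(1)[OF finQ]
 have epse: "\<epsilon> \<le> e" using initial_values_card(2)[OF finQ] by (simp add: eps e)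
 obtain J where J: "finite J" "J \<noteq> {}" "residue_independent J id"
  "\<forall>v. v \<in> L \<longrightarrow> v \<in> A \<longrightarrow> (\<exists>r\<in>lspan base_ring J id. vlt A \<one> (v \<ominus> r))"
  using maximal_residue_family by blast
 have f: "f = card J" unfolding f_def by (rule residue_degree_eq[OF J(1,3)]) (use J(4) in blast)
 have f1: "f > 0" using J(1,2) by (simp add: f card_gt_0_iff)
 show "e * f > 0" using e1 f1 by simp
 have gef: "g * e * f \<le> n"
  using value_residue_card_le[OF y J(3) finQ J(1)] by (simp add: g_def e f)
 have S: "subring base_ring R" by (rule base_props(1))
 have D: "integral_part \<subseteq> C" by (rule subringE(1)[OF integral_part_closed(1)])
 show "finite_submodule R base_ring integral_part \<longleftrightarrow> m = e * f \<and> initial_index G base_values = e"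
  unfolding \<epsilon>_def[symmetric]
 proof
  assume "finite_submodule R base_ring integral_part"
  then obtain I :: "nat set" and u where u: "finite I" "\<And>i. i \<in> I \<Longrightarrow> u i \<in> integral_part"
   "integral_part = lspan base_ring I u"
   unfolding finite_submodule_iff[OF S D] by blast
  obtain I' where I': "I' \<subseteq> I" "integral_independent I' u" "n \<le> card I'"
   using integral_independent_exists[OF u(1,3,2)] by blast
  have "card I' \<le> card T * card initial_values * card J"
  proof (rule integral_independent_card_le[OF I'(2) finite_subset[OF I'(1) u(1)] finI J(1)])
   show "z h \<in> L \<inter> A" if "h \<in> initial_values" for h using z(2) that by blast
   show "\<exists>h\<in>initial_values. veq A (z h) v" if "v \<in> L" "v \<in> A" "small v" for v using z(3) that by blast
   show "id j \<in> L \<inter> A" if "j \<in> J" for j using residue_independentD(1,2)[OF J(3) that] by blast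
   show "\<exists>r\<in>lspan base_ring J id. vlt A \<one> (v \<ominus> r)" if "v \<in> L" "v \<in> A" for v using J(4) that by blast
  qed
  hence n: "n \<le> g * \<epsilon> * f" using I'(3) by (simp add: g_def eps f)
  have "g * e * f \<le> g * \<epsilon> * f" using gef n by (rule le_trans)
  hence "e \<le> \<epsilon>" using g1 f1 by simp
  hence "e = \<epsilon>" using epse by simp
  hence "g * m = g * (e * f)" using n gef degree by (simp add: mult.assoc)
  thus "m = e * f \<and> \<epsilon> = e" using g1 \<open>e = \<epsilon>\<close> by simp
 next
  assume eq: "m = e * f \<and> \<epsilon> = e"
  have "\<exists>u. integral_independent (T \<times> initial_values \<times> J) u"
   by (rule integral_independent_family[OF z(1) J(3) finI J(1)]) (use z(2) in blast)
  then obtain u where u: "integral_independent (T \<times> initial_values \<times> J) u" by blast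
  have fin: "finite (T \<times> initial_values \<times> J)" using finite_T finI J(1) by simp
  have "card (T \<times> initial_values \<times> J) = n"
   using degree eq by (simp add: card_cartesian_product g_def eps f)
  hence "integral_part = lspan base_ring (T \<times> initial_values \<times> J) u"
   by (rule integral_part_eq_lspan[OF u fin])
  thus "finite_submodule R base_ring integral_part"
   using integral_independentD(1)[OF u] by (intro finite_submoduleI[OF S D fin, of u]) auto
 qed
qed

end

end

theorem corollary2p2:
  fixes C :: "('a, 'b) ring_scheme"
    and K L :: "'a set"
    and \<Gamma> :: "('g, 'm) ordered_group_scheme" and \<omega> :: "'a \<Rightarrow> 'g"
    and H :: "('h, 'n) ordered_group_scheme" and V :: "'a \<Rightarrow> 'h"
  assumes closure: "algebraic_closure C L"
    and K: "subfield K C" "K \<subseteq> L"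
    and finite_ext: "ring.finite_dimension C K L"
    and omega: "valuation (C\<lparr>carrier := L\<rparr>) \<Gamma> \<omega>"
    and V: "extends_valuation C H V (C\<lparr>carrier := L\<rparr>) \<Gamma> \<omega>"
    and cases: "only_extension (C\<lparr>carrier := L\<rparr>) K \<Gamma> \<omega> \<or> normal_extension C K L"
  shows "finite_submodule C (restricted_ring (C\<lparr>carrier := L\<rparr>) \<Gamma> \<omega> K)
           (integral_closure C (restricted_ring (C\<lparr>carrier := L\<rparr>) \<Gamma> \<omega> K) L)
         \<longleftrightarrow> defect C H V L \<Gamma> \<omega> K = 1 \<and>
             initial_index \<Gamma> (value_subgroup (C\<lparr>carrier := L\<rparr>) \<Gamma> \<omega> K)
               = ramification_index (C\<lparr>carrier := L\<rparr>) \<Gamma> \<omega> K"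
proof -
 interpret C: algebraically_closed_over C K
  by (rule algebraic_closure_over[OF closure K finite_ext])
 have L: "C.overfield L" using closure K(2) by (simp add: C.overfield_def algebraic_closure_def)
 define A where "A = valuation_ring C H V"
 have VC: "valuation C H V" and VA: "A \<inter> L = valuation_ring (C\<lparr>carrier := L\<rparr>) \<Gamma> \<omega>"
  using V by (simp_all add: extends_valuation_def A_def)
 have w_ring: "valuation_ring (C\<lparr>carrier := L\<rparr>) \<Gamma> \<omega> = L \<inter> A" using VA by blast
 obtain n where n: "C.dimension n K L" using finite_ext by (rule C.finite_dimensionE')
 interpret C: valued_extension C K A L n
 proof (intro valued_extension.intro valued_extension_axioms.intro)
  show "C.valring A" unfolding A_def by (rule valuation.valuation_ring_valring[OF VC])
 qed (use L n C.algebraically_closed_over_axioms in auto)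
 \<comment> \<open>The two cases are distinguished only here; afterwards only the transversal and
   the separating element in the henselization are used.\<close>
 have "\<exists>T. trace_transversal C K A L n T \<and> (\<exists>t\<in>C.hensel A. C.separating t)"
  using cases
 proof
  assume only: "only_extension (C\<lparr>carrier := L\<rparr>) K \<Gamma> \<omega>"
  show ?thesis
   by (rule C.transversal_of_trivial_traces)
    (rule C.only_extension_same_trace[OF VC A_def[symmetric] omega w_ring only])
 next
  assume "normal_extension C K L"
  thus ?thesis by (intro C.transversal_of_stable C.normal_extension_stable[OF L])
 qed
 then obtain T t where T: "trace_transversal C K A L n T" and t: "C.separating t" "t \<in> C.hensel A" by blast
 interpret C: trace_transversal C K A L n T by (rule T)
 obtain m where m: "C.dimension m (C.hensel A) C.compositum" using C.compositum_basis by blast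
 let ?F = "C\<lparr>carrier := L\<rparr>"
 have "restricted_ring ?F \<Gamma> \<omega> K = K \<inter> (L \<inter> A)"
  using valuation.valuation_ring_restrict[OF omega, of K] K(2) by (simp add: w_ring)
 hence base: "restricted_ring ?F \<Gamma> \<omega> K = K \<inter> A" using K(2) by blast
 note inv = C.finite_iff_invariants[OF omega w_ring t m]
 have "C.dim (C.hensel A) C.compositum = m"
  using C.dimI[OF C.hensel_props(2) m] by (simp add: over_def)
 hence "defect C H V L \<Gamma> \<omega> K = of_nat m / of_nat (ramification_index ?F \<Gamma> \<omega> K * residue_degree ?F \<Gamma> \<omega> K)"
  using C.henselization_base[OF VC] C.henselization_extension[OF VC A_def[symmetric]]
  by (simp add: defect_def A_def)
 \<comment> \<open>As the denominator is positive, the quotient is 1 exactly when numerator and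
   denominator agree.\<close>
 hence "defect C H V L \<Gamma> \<omega> K = 1 \<longleftrightarrow> m = ramification_index ?F \<Gamma> \<omega> K * residue_degree ?F \<Gamma> \<omega> K"
  using inv(2) by (simp del: of_nat_mult add: divide_eq_1_iff) (rule eq_commute)
 thus ?thesis
  using inv(1) unfolding base C.integral_closure_eq C.base_ring_def by blast
qed

end
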